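(* Let $k$ be an uncountable algebraically closed field of characteristic $0$. The smooth locus of a complete toric variety over $k$ is strongly rationally connected.
   Context: A toric variety is the variety associated to a fan (a finite collection of convex cones) in $N_{\mathbb{R}}=N\otimes_{\mathbb{Z}}\mathbb{R}$ for a lattice $N\cong\mathbb{Z}^n$. Points are closed points. A rational curve on a variety $Y$ is a nonconstant morphism $f:\mathbb{P}^1\to Y$. A variety $Y$ over a field of characteristic $0$ is rationally connected if any two general points of $Y$ can be connected by a rational curve of $Y$ of a bounded family. For $Y$ smooth, a rational curve $f:\mathbb{P}^1\to Y$ is free if $f^*T_Y$ is globally generated, and very free if $f^*T_Y$ is ample. A smooth rationally connected variety $Y$ is strongly rationally connected if any of the following conditions (Hassett–Tschinkel) hold: (1) for each point $y\in Y$, there exists a rational curve $f:\mathbb{P}^1\to Y$ joining $y$ and a generic point in $Y$; (2) for each point $y\in Y$, there exists a free rational curve containing $y$; (3) for any finite collection of points $y_1,\ldots,y_m\in Y$, there exists a very free rational curve containing the $y_j$ as smooth points; (4) for any finite collection of jets $\operatorname{Spec} k[\epsilon]/\langle\epsilon^{N+1}\rangle\subset Y$, $i=1,\ldots,m$, supported at distinct points $y_1,\ldots,y_m$, there exists a very free rational curve smooth at $y_1,\ldots,y_m$ and containing the prescribed jets. *)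

theory Defs
  imports "HOL-Analysis.Analysis" "HOL-Computational_Algebra.Computational_Algebra"
begin

section \<open>Spaces with functions\<close>

text \<open>
  Varieties over an algebraically closed field are treated classically, as sets of closed points
  with a Zariski topology and a sheaf of field-valued functions. Functions are
  total in HOL; membership in \<open>reg X U\<close> only depends on the values on \<open>U\<close> in all constructions
  below (and for every \<open>prevariety\<close>, by the sheaf condition).
\<close>

record ('a, 'k) fspace =
  zar :: "'a topology"
  reg :: "'a set \<Rightarrow> ('a \<Rightarrow> 'k) set"

abbreviation pts :: "('a, 'k) fspace \<Rightarrow> 'a set"
  where "pts X \<equiv> topspace (zar X)"

definition morphism :: "('a, 'k) fspace \<Rightarrow> ('b, 'k) fspace \<Rightarrow> ('a \<Rightarrow> 'b) \<Rightarrow> bool"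
  where "morphism X Y f \<longleftrightarrow>
    continuous_map (zar X) (zar Y) f \<and>
    (\<forall>V g. openin (zar Y) V \<longrightarrow> g \<in> reg Y V \<longrightarrow> g \<circ> f \<in> reg X {x \<in> pts X. f x \<in> V})"

definition isomorphic :: "('a, 'k) fspace \<Rightarrow> ('b, 'k) fspace \<Rightarrow> bool"
  where "isomorphic X Y \<longleftrightarrow>
    (\<exists>f g. morphism X Y f \<and> morphism Y X g \<and>
      (\<forall>x\<in>pts X. g (f x) = x) \<and> (\<forall>y\<in>pts Y. f (g y) = y))"

definition induced :: "('a, 'k) fspace \<Rightarrow> 'a set \<Rightarrow> ('a, 'k) fspace"
  where "induced X S =
    \<lparr>zar = subtopology (zar X) S,
     reg = (\<lambda>U. {f. \<forall>p\<in>U. \<exists>V. openin (zar X) V \<and> p \<in> V \<and>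
                     (\<exists>g\<in>reg X V. \<forall>q\<in>V \<inter> U. f q = g q)})\<rparr>"

text \<open>The following says that \<open>reg X\<close> is closed under restriction and gluing.\<close>

definition sheaf_of_functions :: "('a, 'k) fspace \<Rightarrow> bool"
  where "sheaf_of_functions X \<longleftrightarrow>
    (\<forall>U. openin (zar X) U \<longrightarrow> reg X U = reg (induced X (pts X)) U)"

text \<open>
  The maximal spectrum of an algebra \<open>A\<close> of functions on the point set \<open>V\<close>: the non-vanishing loci
  of elements of \<open>A\<close> are a basis of the topology, regular functions are locally fractions.
\<close>

definition mspec :: "'a set \<Rightarrow> ('a \<Rightarrow> 'k::field) set \<Rightarrow> ('a, 'k) fspace"
  where "mspec V A =
    (let T = topology_generated_by ((\<lambda>h. {x \<in> V. h x \<noteq> 0}) ` A) in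
    \<lparr>zar = T,
     reg = (\<lambda>U. {f. \<forall>x\<in>U. \<exists>W. openin T W \<and> x \<in> W \<and>
                     (\<exists>g\<in>A. \<exists>h\<in>A. \<forall>y\<in>W \<inter> U. h y \<noteq> 0 \<and> f y = g y / h y)})\<rparr>)"

text \<open>Affine \<open>m\<close>-space is the set of sequences vanishing from index \<open>m\<close> on.\<close>

definition affine_pts :: "nat \<Rightarrow> (nat \<Rightarrow> 'k::field) set"
  where "affine_pts m = {x. \<forall>i\<ge>m. x i = 0}"

inductive_set polyfun :: "nat \<Rightarrow> ((nat \<Rightarrow> 'k::field) \<Rightarrow> 'k) set" for m :: nat
  where
    const: "(\<lambda>x. c) \<in> polyfun m"
  | coord: "i < m \<Longrightarrow> (\<lambda>x. x i) \<in> polyfun m"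
  | add: "f \<in> polyfun m \<Longrightarrow> g \<in> polyfun m \<Longrightarrow> (\<lambda>x. f x + g x) \<in> polyfun m"
  | mult: "f \<in> polyfun m \<Longrightarrow> g \<in> polyfun m \<Longrightarrow> (\<lambda>x. f x * g x) \<in> polyfun m"

definition algebraic_set :: "nat \<Rightarrow> ((nat \<Rightarrow> 'k::field) \<Rightarrow> 'k) set \<Rightarrow> (nat \<Rightarrow> 'k) set"
  where "algebraic_set m P = {x \<in> affine_pts m. \<forall>p\<in>P. p x = 0}"

definition is_affine :: "('a, 'k::field) fspace \<Rightarrow> bool"
  where "is_affine X \<longleftrightarrow>
    (\<exists>m P. P \<subseteq> polyfun m \<and> isomorphic X (mspec (algebraic_set m P) (polyfun m)))"

definition prevariety :: "('a, 'k::field) fspace \<Rightarrow> bool"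
  where "prevariety X \<longleftrightarrow>
    sheaf_of_functions X \<and>
    (\<exists>\<U>. finite \<U> \<and> \<Union>\<U> = pts X \<and>
      (\<forall>U\<in>\<U>. openin (zar X) U \<and> is_affine (induced X U)))"

text \<open>
  Products of prevarieties: on \<open>U \<times> V\<close> one has the functions
  \<open>\<Sum>i. a\<^sub>i(x) b\<^sub>i(y)\<close> with \<open>a\<^sub>i\<close> and \<open>b\<^sub>i\<close> regular on \<open>U\<close> and \<open>V\<close>. Their non-vanishing loci form a
  basis of the Zariski topology of the product, and regular functions are locally fractions of them.
\<close>

definition tensor_fun ::
  "('a, 'k::field) fspace \<Rightarrow> ('b, 'k) fspace \<Rightarrow> 'a set \<Rightarrow> 'b set \<Rightarrow> ('a \<times> 'b \<Rightarrow> 'k) set"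
  where "tensor_fun X Y U V =
    {h. \<exists>r a b. (\<forall>i<r. a i \<in> reg X U \<and> b i \<in> reg Y V) \<and>
                h = (\<lambda>(x, y). \<Sum>i<(r::nat). a i x * b i y)}"

definition fprod :: "('a, 'k::field) fspace \<Rightarrow> ('b, 'k) fspace \<Rightarrow> ('a \<times> 'b, 'k) fspace"
  where "fprod X Y =
    \<lparr>zar = topology_generated_by
       {{p \<in> U \<times> V. h p \<noteq> 0} |U V h.
          openin (zar X) U \<and> openin (zar Y) V \<and> h \<in> tensor_fun X Y U V},
     reg = (\<lambda>W. {f. \<forall>p\<in>W. \<exists>U V. openin (zar X) U \<and> openin (zar Y) V \<and> p \<in> U \<times> V \<and>
              (\<exists>g\<in>tensor_fun X Y U V. \<exists>h\<in>tensor_fun X Y U V. h p \<noteq> 0 \<and>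
                (\<forall>q\<in>W \<inter> U \<times> V. h q \<noteq> 0 \<longrightarrow> f q = g q / h q))})\<rparr>"

definition irreducible_in :: "'a topology \<Rightarrow> 'a set \<Rightarrow> bool"
  where "irreducible_in T C \<longleftrightarrow>
    C \<noteq> {} \<and> C \<subseteq> topspace T \<and>
    (\<forall>A B. closedin T A \<longrightarrow> closedin T B \<longrightarrow> C \<subseteq> A \<union> B \<longrightarrow> C \<subseteq> A \<or> C \<subseteq> B)"

definition separated :: "('a, 'k::field) fspace \<Rightarrow> bool"
  where "separated X \<longleftrightarrow> closedin (zar (fprod X X)) ((\<lambda>x. (x, x)) ` pts X)"

definition variety :: "('a, 'k::field) fspace \<Rightarrow> bool"
  where "variety X \<longleftrightarrow> prevariety X \<and> irreducible_in (zar X) (pts X) \<and> separated X"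

text \<open>
  Universal closedness over the field. The points of every prevariety over \<open>'k\<close>
  can be encoded in the type \<open>nat \<Rightarrow> 'k\<close>, so that type is no restriction on \<open>Z\<close>.
\<close>

definition is_complete :: "('a, 'k::field) fspace \<Rightarrow> bool"
  where "is_complete X \<longleftrightarrow>
    (\<forall>Z :: (nat \<Rightarrow> 'k, 'k) fspace. prevariety Z \<longrightarrow>
      (\<forall>C. closedin (zar (fprod X Z)) C \<longrightarrow> closedin (zar Z) (snd ` C)))"


section \<open>The smooth locus\<close>

text \<open>
  Irreducible closed subsets through \<open>x\<close> correspond to the prime ideals of the local
  ring at \<open>x\<close>, so \<open>krull_dim_at X x d\<close> says that this local ring has Krull dimension \<open>d\<close>.
\<close>

definition irreducible_chain_at :: "('a, 'k) fspace \<Rightarrow> 'a \<Rightarrow> nat \<Rightarrow> bool"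
  where "irreducible_chain_at X x d \<longleftrightarrow>
    (\<exists>Z :: nat \<Rightarrow> 'a set.
      (\<forall>i\<le>d. closedin (zar X) (Z i) \<and> irreducible_in (zar X) (Z i) \<and> x \<in> Z i) \<and>
      (\<forall>i<d. Z i \<subset> Z (Suc i)))"

definition krull_dim_at :: "('a, 'k) fspace \<Rightarrow> 'a \<Rightarrow> nat \<Rightarrow> bool"
  where "krull_dim_at X x d \<longleftrightarrow>
    irreducible_chain_at X x d \<and> \<not> irreducible_chain_at X x (Suc d)"

text \<open>The germs at \<open>x\<close> of \<open>d\<close> functions vanishing at \<open>x\<close> generate the maximal ideal of the
  local ring at \<open>x\<close>.\<close>

definition max_ideal_generated_by :: "('a, 'k::field) fspace \<Rightarrow> 'a \<Rightarrow> nat \<Rightarrow> bool"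
  where "max_ideal_generated_by X x d \<longleftrightarrow>
    (\<exists>U t. openin (zar X) U \<and> x \<in> U \<and> (\<forall>i<d. t i \<in> reg X U \<and> t i x = 0) \<and>
      (\<forall>V g. openin (zar X) V \<and> x \<in> V \<and> g \<in> reg X V \<and> g x = 0 \<longrightarrow>
        (\<exists>W h. openin (zar X) W \<and> x \<in> W \<and> W \<subseteq> U \<inter> V \<and> (\<forall>i<d. h i \<in> reg X W) \<and>
          (\<forall>y\<in>W. g y = (\<Sum>i<d. h i y * t i y)))))"

text \<open>The local ring at \<open>x\<close> is regular; over an algebraically closed field this is smoothness.\<close>

definition smooth_at :: "('a, 'k::field) fspace \<Rightarrow> 'a \<Rightarrow> bool"
  where "smooth_at X x \<longleftrightarrow> (\<exists>d. krull_dim_at X x d \<and> max_ideal_generated_by X x d)"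

definition smooth :: "('a, 'k::field) fspace \<Rightarrow> bool"
  where "smooth X \<longleftrightarrow> (\<forall>x\<in>pts X. smooth_at X x)"

definition smooth_locus :: "('a, 'k::field) fspace \<Rightarrow> ('a, 'k) fspace"
  where "smooth_locus X = induced X {x \<in> pts X. smooth_at X x}"


section \<open>Gluing and the projective line\<close>

text \<open>
  The space obtained from the spaces \<open>C i\<close> along the chart maps \<open>\<phi> i\<close>: a set is open, and a function
  is regular, iff its pullback to every chart is.
\<close>

definition glue :: "'i set \<Rightarrow> ('i \<Rightarrow> ('b, 'k) fspace) \<Rightarrow> ('i \<Rightarrow> 'b \<Rightarrow> 'a) \<Rightarrow> ('a, 'k) fspace"
  where "glue I C \<phi> =
    \<lparr>zar = topology (\<lambda>U. U \<subseteq> (\<Union>i\<in>I. \<phi> i ` pts (C i)) \<and>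
              (\<forall>i\<in>I. openin (zar (C i)) {y \<in> pts (C i). \<phi> i y \<in> U})),
     reg = (\<lambda>U. {f. \<forall>i\<in>I. f \<circ> \<phi> i \<in> reg (C i) {y \<in> pts (C i). \<phi> i y \<in> U}})\<rparr>"

lemma openin_glue:
  "openin (zar (glue I C \<phi>)) U \<longleftrightarrow>
    U \<subseteq> (\<Union>i\<in>I. \<phi> i ` pts (C i)) \<and>
    (\<forall>i\<in>I. openin (zar (C i)) {y \<in> pts (C i). \<phi> i y \<in> U})"
proof -
  define P where "P = (\<lambda>U. U \<subseteq> (\<Union>i\<in>I. \<phi> i ` pts (C i)) \<and>
    (\<forall>i\<in>I. openin (zar (C i)) {y \<in> pts (C i). \<phi> i y \<in> U}))"
  have inter: "P (S \<inter> T)" if "P S" "P T" for S T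
  proof -
    have eq: "{y \<in> pts (C i). \<phi> i y \<in> S \<inter> T} =
        {y \<in> pts (C i). \<phi> i y \<in> S} \<inter> {y \<in> pts (C i). \<phi> i y \<in> T}" for i
      by blast
    have "S \<inter> T \<subseteq> (\<Union>i\<in>I. \<phi> i ` pts (C i))"
      using that(1) unfolding P_def by blast
    then show ?thesis
      using that unfolding P_def eq by (simp add: openin_Int)
  qed
  have union: "P (\<Union>\<K>)" if "\<forall>K\<in>\<K>. P K" for \<K>
  proof -
    have eq: "{y \<in> pts (C i). \<phi> i y \<in> \<Union>\<K>} = (\<Union>K\<in>\<K>. {y \<in> pts (C i). \<phi> i y \<in> K})" for i
      by blast
    have "\<Union>\<K> \<subseteq> (\<Union>i\<in>I. \<phi> i ` pts (C i))"
      using that unfolding P_def by blast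
    moreover have "openin (zar (C i)) {y \<in> pts (C i). \<phi> i y \<in> \<Union>\<K>}" if i: "i \<in> I" for i
      unfolding eq using \<open>\<forall>K\<in>\<K>. P K\<close> i by (intro openin_Union) (auto simp: P_def)
    ultimately show ?thesis
      by (simp add: P_def)
  qed
  have "istopology P"
    unfolding istopology_def using inter union by blast
  then show ?thesis
    by (simp add: glue_def P_def)
qed

text \<open>The projective line is glued from two affine lines, with coordinates \<open>t\<close> and \<open>1/t\<close>;
  \<open>None\<close> is the point at infinity.\<close>

definition affine_line :: "('k::field, 'k) fspace"
  where "affine_line = mspec UNIV (range poly)"

definition P1 :: "('k::field option, 'k) fspace"
  where "P1 = glue (UNIV :: bool set) (\<lambda>_. affine_line)
    (\<lambda>i s. if i then Some s else if s = 0 then None else Some (1 / s))"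


section \<open>Toric varieties\<close>

text \<open>
  Both the lattice and its dual are \<open>int ^ 'n\<close>, paired by the inner product of
  \<open>real ^ 'n\<close>. The dimension \<open>CARD('n)\<close> is positive: a point contains no rational curves.
\<close>

definition lattice_vec :: "int ^ 'n \<Rightarrow> real ^ 'n"
  where "lattice_vec m = (\<chi> i. of_int (m $ i))"

definition rational_polyhedral_cone :: "(real ^ 'n::finite) set \<Rightarrow> bool"
  where "rational_polyhedral_cone \<sigma> \<longleftrightarrow>
    (\<exists>G. finite G \<and> \<sigma> = convex_cone hull (lattice_vec ` G))"

definition fan :: "(real ^ 'n::finite) set set \<Rightarrow> bool"
  where "fan \<Sigma> \<longleftrightarrow>
    finite \<Sigma> \<and> \<Sigma> \<noteq> {} \<and>
    (\<forall>\<sigma>\<in>\<Sigma>. rational_polyhedral_cone \<sigma> \<and> \<sigma> \<inter> uminus ` \<sigma> = {0}) \<and>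
    (\<forall>\<sigma>\<in>\<Sigma>. \<forall>\<tau>. \<tau> face_of \<sigma> \<and> \<tau> \<noteq> {} \<longrightarrow> \<tau> \<in> \<Sigma>) \<and>
    (\<forall>\<sigma>\<in>\<Sigma>. \<forall>\<sigma>'\<in>\<Sigma>. (\<sigma> \<inter> \<sigma>') face_of \<sigma> \<and> (\<sigma> \<inter> \<sigma>') face_of \<sigma>')"

definition dual_semigroup :: "(real ^ 'n::finite) set \<Rightarrow> (int ^ 'n) set"
  where "dual_semigroup \<sigma> = {m. \<forall>v\<in>\<sigma>. 0 \<le> lattice_vec m \<bullet> v}"

text \<open>
  Closed points of the affine toric variety of \<open>\<sigma>\<close>, i.e. algebra homomorphisms from the
  semigroup algebra of \<open>dual_semigroup \<sigma>\<close> to the field, are the same as monoid homomorphisms from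
  \<open>dual_semigroup \<sigma>\<close> to the multiplicative monoid of the field. These are
  extended by 0 to the whole dual lattice. An element \<open>\<Sum>m. c\<^sub>m \<chi>\<^sup>m\<close> of the semigroup algebra
  has the value \<open>\<Sum>m. c\<^sub>m x(m)\<close> at \<open>x\<close>.
\<close>

definition affine_toric_pts :: "(real ^ 'n::finite) set \<Rightarrow> (int ^ 'n \<Rightarrow> 'k::field) set"
  where "affine_toric_pts \<sigma> =
    {x. x 0 = 1 \<and>
        (\<forall>m\<in>dual_semigroup \<sigma>. \<forall>m'\<in>dual_semigroup \<sigma>. x (m + m') = x m * x m') \<and>
        (\<forall>m. m \<notin> dual_semigroup \<sigma> \<longrightarrow> x m = 0)}"

definition semigroup_algebra :: "(real ^ 'n::finite) set \<Rightarrow> ((int ^ 'n \<Rightarrow> 'k::field) \<Rightarrow> 'k) set"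
  where "semigroup_algebra \<sigma> =
    {\<lambda>x. \<Sum>m\<in>F. c m * x m |F c. finite F \<and> F \<subseteq> dual_semigroup \<sigma>}"

definition affine_toric :: "(real ^ 'n::finite) set \<Rightarrow> (int ^ 'n \<Rightarrow> 'k::field, 'k) fspace"
  where "affine_toric \<sigma> = mspec (affine_toric_pts \<sigma>) (semigroup_algebra \<sigma>)"

text \<open>The map from the affine toric variety of a face of \<open>\<sigma>\<close> to that of \<open>\<sigma>\<close>.\<close>

definition restrict_hom ::
  "(real ^ 'n::finite) set \<Rightarrow> (int ^ 'n \<Rightarrow> 'k::field) \<Rightarrow> (int ^ 'n \<Rightarrow> 'k)"
  where "restrict_hom \<sigma> x = (\<lambda>m. if m \<in> dual_semigroup \<sigma> then x m else 0)"

text \<open>The affine pieces of \<open>\<sigma>\<close> and \<open>\<sigma>'\<close> are glued along the affine piece of \<open>\<sigma> \<inter> \<sigma>'\<close>.\<close>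

definition gluing_rel :: "(real ^ 'n::finite) set set \<Rightarrow>
    (((real ^ 'n) set \<times> (int ^ 'n \<Rightarrow> 'k::field)) \<times> ((real ^ 'n) set \<times> (int ^ 'n \<Rightarrow> 'k))) set"
  where "gluing_rel \<Sigma> =
    {((\<sigma>, restrict_hom \<sigma> y), (\<sigma>', restrict_hom \<sigma>' y)) |\<sigma> \<sigma>' y.
       \<sigma> \<in> \<Sigma> \<and> \<sigma>' \<in> \<Sigma> \<and> y \<in> affine_toric_pts (\<sigma> \<inter> \<sigma>')}"

type_synonym ('n, 'k) toric_pt = "((real ^ 'n) set \<times> (int ^ 'n \<Rightarrow> 'k)) set"

definition toric_variety ::
  "(real ^ 'n::finite) set set \<Rightarrow> (('n, 'k::field) toric_pt, 'k) fspace"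
  where "toric_variety \<Sigma> = glue \<Sigma> affine_toric (\<lambda>\<sigma> x. gluing_rel \<Sigma> `` {(\<sigma>, x)})"


section \<open>Rational curves\<close>

definition rational_curve :: "('a, 'k::field) fspace \<Rightarrow> ('k option \<Rightarrow> 'a) \<Rightarrow> bool"
  where "rational_curve Y f \<longleftrightarrow> morphism P1 Y f \<and> (\<exists>p q. f p \<noteq> f q)"

text \<open>
  A bounded family of rational curves is one parametrized by a prevariety \<open>T\<close> (a reduced scheme of
  finite type); again the type \<open>nat \<Rightarrow> 'k\<close> is large enough for the points of any \<open>T\<close>. A pair of
  general points is one in some non-empty open subset of \<open>Y \<times> Y\<close>.
\<close>

definition family_of_rational_curves ::
  "('t, 'k::field) fspace \<Rightarrow> ('a, 'k) fspace \<Rightarrow> ('t \<times> 'k option \<Rightarrow> 'a) \<Rightarrow> bool"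
  where "family_of_rational_curves T Y F \<longleftrightarrow>
    prevariety T \<and> morphism (fprod T P1) Y F \<and>
    (\<forall>t\<in>pts T. rational_curve Y (\<lambda>p. F (t, p)))"

definition rationally_connected :: "('a, 'k::field) fspace \<Rightarrow> bool"
  where "rationally_connected Y \<longleftrightarrow>
    (\<exists>(T :: (nat \<Rightarrow> 'k, 'k) fspace) F. family_of_rational_curves T Y F \<and>
      (\<exists>W. openin (zar (fprod Y Y)) W \<and> W \<noteq> {} \<and>
        (\<forall>(y, z)\<in>W. \<exists>t\<in>pts T. \<exists>p q. F (t, p) = y \<and> F (t, q) = z)))"

text \<open>
  Of the four equivalent conditions of Hassett and Tschinkel the following uses the first one: every
  point is joined to a generic point, i.e. to all points of some non-empty open subset.
\<close>

definition strongly_rationally_connected :: "('a, 'k::field) fspace \<Rightarrow> bool"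
  where "strongly_rationally_connected Y \<longleftrightarrow>
    variety Y \<and> smooth Y \<and> rationally_connected Y \<and>
    (\<forall>y\<in>pts Y. \<exists>U. openin (zar Y) U \<and> U \<noteq> {} \<and>
      (\<forall>z\<in>U. \<exists>f. rational_curve Y f \<and> y \<in> range f \<and> z \<in> range f))"

end

theory Submission
  imports Defs "HOL-Analysis.Kronecker_Approximation_Theorem"
begin

text \<open>
  The smooth locus of a toric variety is the union of the charts of some of the cones: the character
  semigroup of the smallest cone \<open>K\<close> at a smooth point must, up to units, be generated by few elements,
  since otherwise there are more than \<open>n\<close> independent derivations at the point
  (\<open>smooth_orbit_few_generators\<close>, with \<open>krull_dim_at_iff\<close>), and conversely a semigroup with few
  generators makes the whole chart smooth (\<open>few_generators_smooth\<close>). In particular the smooth locus is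
  a toric variety, and it contains the charts of all rays (\<open>ray_smooth\<close>).

  Completeness enters through the limits of one-parameter subgroups: every lattice vector lies in a
  cone (\<open>complete_covers_lattice\<close>), so lattice vectors along the rays span the lattice
  positively, up to finite index (\<open>complete_rays\<close>).

  Given lattice vectors \<open>v\<^sub>1, \<dots>, v\<^sub>q\<close> in cones of the smooth locus with sum zero, and linear forms
  \<open>l\<^sub>1, \<dots>, l\<^sub>q\<close> on the projective line no two of which have a common zero, the map whose value at a character \<open>m\<close> is
  \<open>\<Prod>i. l\<^sub>i\<^bsup>\<langle>m, v\<^sub>i\<rangle>\<^esup>\<close> is homogeneous of degree 0. It sends points at which no \<open>l\<^sub>i\<close> vanishes to the torus,
  and the zero of \<open>l\<^sub>i\<close> to the chart of the cone of \<open>v\<^sub>i\<close>. So it is a rational curve in the smooth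
  locus, and letting the coefficients of the \<open>l\<^sub>i\<close> vary gives a family over an affine variety
  (\<open>family_of_curves\<close>). At 0 and at infinity the linear forms \<open>a\<^sub>i t + b\<^sub>i\<close> take the values \<open>b\<^sub>i\<close> and
  \<open>a\<^sub>i\<close>. If every ray occurs at least twice among the \<open>v\<^sub>i\<close>, then, as the field has all roots, both of
  these points of the torus can be prescribed while all \<open>b\<^sub>i / a\<^sub>i\<close> are kept distinct
  (\<open>realized_all\<close>, \<open>torus_pts_joined\<close>). This is rational connectedness. An arbitrary smooth point is a
  limit along some \<open>v\<close> of a point of the torus. Adding a positive multiple of \<open>v\<close> to the \<open>v\<^sub>i\<close>, with
  the linear form \<open>t\<close>, makes the curve pass through the limit at \<open>t = 0\<close> (\<open>limit_joined\<close>).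

  The points of a chart are described by limits, too: every point of an affine toric variety is the
  limit of a point of the torus along a lattice vector of the cone (\<open>limit_pt_form\<close>). Since such limits are
  attained along affine lines, irreducibility and dimension can be treated with curves instead of
  commutative algebra.
\<close>

abbreviation zopen :: "('a, 'k) fspace => 'a set => bool"
  where "zopen X \<equiv> openin (zar X)"

no_notation fps_nth (infixl "$" 75)

section \<open>Lattice points of rational cones\<close>

definition pairing :: "int ^ 'n::finite => int ^ 'n => int"
  where "pairing m u = (\<Sum>i\<in>UNIV. m $ i * u $ i)"

lemma pairing_add_left [simp]: "pairing (a + b) u = pairing a u + pairing b u"
  by (simp add: pairing_def algebra_simps sum.distrib)

lemma pairing_add_right [simp]: "pairing m (a + b) = pairing m a + pairing m b"
  by (simp add: pairing_def algebra_simps sum.distrib)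

lemma pairing_minus_left [simp]: "pairing (- a) u = - pairing a u"
  by (simp add: pairing_def sum_negf)

lemma pairing_minus_right [simp]: "pairing m (- a) = - pairing m a"
  by (simp add: pairing_def sum_negf)

lemma pairing_diff_left [simp]: "pairing (a - b) u = pairing a u - pairing b u"
  by (simp add: pairing_def algebra_simps sum_subtractf)

lemma pairing_diff_right [simp]: "pairing m (a - b) = pairing m a - pairing m b"
  by (simp add: pairing_def algebra_simps sum_subtractf)

lemma pairing_0 [simp]: "pairing 0 u = 0" "pairing m 0 = 0"
  by (simp_all add: pairing_def)

lemma of_int_vec_index: "(of_int z :: int ^ 'n::finite) $ i = z"
  by (cases z) (simp_all add: of_nat_index)

lemma pairing_mult [simp]:
  "pairing (of_nat N * m) u = int N * pairing m u" "pairing m (of_nat N * u) = int N * pairing m u"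
  "pairing (of_int z * m) u = z * pairing m u" "pairing m (of_int z * u) = z * pairing m u"
  by (simp_all add: pairing_def sum_distrib_left of_nat_index of_int_vec_index mult_ac)

lemma pairing_sum_right: "pairing m (\<Sum>x\<in>A. f x) = (\<Sum>x\<in>A. pairing m (f x))"
  by (induction A rule: infinite_finite_induct) auto

lemma pairing_commute: "pairing m u = pairing u m"
  by (simp add: pairing_def mult.commute)

lemma pairing_axis [simp]: "pairing (axis i 1) u = u $ i" "pairing m (axis i 1) = m $ i"
  by (simp_all add: pairing_def axis_def if_distrib if_distribR cong: if_cong)

lemma lattice_vec_simps [simp]:
  "lattice_vec 0 = 0" "lattice_vec (a + b) = lattice_vec a + lattice_vec b"
  "lattice_vec (- a) = - lattice_vec a" "lattice_vec (a - b) = lattice_vec a - lattice_vec b"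
  "lattice_vec (of_nat N * a) = real N *\<^sub>R lattice_vec a"
  by (simp_all add: lattice_vec_def vec_eq_iff of_nat_index)

lemma inner_lattice_vec: "lattice_vec m \<bullet> lattice_vec u = of_int (pairing m u)"
  by (simp add: lattice_vec_def inner_vec_def pairing_def)

lemma lattice_vec_eq_0_iff [simp]: "lattice_vec m = 0 \<longleftrightarrow> m = 0"
  by (simp add: lattice_vec_def vec_eq_iff)

text \<open>By Dirichlet's theorem on simultaneous approximation, a large multiple of a real vector is very
  close to an integral one. An integral linear form that vanishes on the real vector takes a small
  integral value on the approximation, hence vanishes there too; nonzero signs are preserved as the
  error stays below the value. This is how all rational solutions below are extracted from
  real ones.\<close>

lemma integer_vector_same_signs:
  fixes A :: "'r => 'j => int" and w :: "'j => real"
  assumes J: "finite J" and R: "finite R"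
  shows "\<exists>p :: 'j => int. \<forall>r\<in>R.
    sgn (\<Sum>j\<in>J. real_of_int (A r j) * of_int (p j)) = sgn (\<Sum>j\<in>J. of_int (A r j) * w j)"
proof -
  define K where "K r = (\<Sum>j\<in>J. \<bar>real_of_int (A r j)\<bar>)" for r
  define a where "a r = (\<Sum>j\<in>J. of_int (A r j) * w j)" for r
  define B where "B r = K r + K r / \<bar>a r\<bar>" for r
  have K0: "K r \<ge> 0" for r
    by (auto simp: K_def intro: sum_nonneg)
  have B0: "B r \<ge> 0" for r
    using K0[of r] by (simp add: B_def)
  obtain N :: nat where N: "real N > (\<Sum>r\<in>R. B r)"
    using reals_Archimedean2 by blast
  have NB: "real N > B r" if "r \<in> R" for r
    using member_le_sum[of r R B] R B0 that N by force
  have N0: "N > 0"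
    using N sum_nonneg[of R B] B0 by (cases N) force+
  from ex_bij_betw_nat_finite[OF J] obtain f where f: "bij_betw f {0..<card J} J"
    by blast
  obtain q p where q: "0 < q" and p: "\<And>i. i < card J ==>
      \<bar>of_int q * w (f i) - of_int (p i)\<bar> < 1 / N"
    using Dirichlet_approx_simult[OF N0, of "card J" "\<lambda>i. w (f i)"] by blast
  define g where "g = inv_into {0..<card J} f"
  define P where "P j = p (g j)" for j
  have P: "\<bar>of_int (P j) - of_int q * w j\<bar> \<le> 1 / N" if "j \<in> J" for j
  proof -
    have "g j < card J" "f (g j) = j"
      using f that unfolding g_def bij_betw_def
      by (auto simp: f_inv_into_f intro: inv_into_into[of j f "{0..<card J}", simplified])
    then show ?thesis
      using p[of "g j"] by (simp add: P_def)
  qed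
  have "sgn (\<Sum>j\<in>J. real_of_int (A r j) * of_int (P j)) = sgn (a r)" if r: "r \<in> R" for r
  proof -
    define s where "s = (\<Sum>j\<in>J. A r j * P j)"
    have s: "of_int s = (\<Sum>j\<in>J. real_of_int (A r j) * of_int (P j))"
      by (simp add: s_def)
    have "\<bar>of_int s - of_int q * a r\<bar> = \<bar>\<Sum>j\<in>J. of_int (A r j) * (of_int (P j) - of_int q * w j)\<bar>"
      by (simp add: s a_def sum_distrib_left sum_subtractf algebra_simps)
    also have "\<dots> \<le> (\<Sum>j\<in>J. \<bar>real_of_int (A r j)\<bar> * (1 / N))"
      by (rule order_trans[OF sum_abs], rule sum_mono) (use P in \<open>auto simp only: abs_mult intro!: mult_left_mono\<close>)
    also have "\<dots> = K r / N"
      by (simp add: K_def sum_divide_distrib)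
    finally have err: "\<bar>of_int s - of_int q * a r\<bar> \<le> K r / N" .
    have NK: "K r < N" "K r / \<bar>a r\<bar> < N"
      using NB[OF r] K0[of r] by (auto simp: B_def) (smt (verit) divide_nonneg_nonneg)
    have e1: "K r / N < 1"
      using NK(1) N0 by simp
    show ?thesis
    proof (cases "a r = 0")
      case True
      then have "\<bar>real_of_int s\<bar> < 1"
        using err e1 by simp
      then have "s = 0" by linarith
      then show ?thesis using s True by (metis of_int_0)
    next
      case False
      then have e2: "K r / N < \<bar>a r\<bar>"
        using NK(2) N0 by (simp add: field_simps)
      have "\<bar>a r\<bar> \<le> \<bar>of_int q * a r\<bar>"
        using q False by (simp add: abs_mult)
      then have "a r > 0 ==> a r \<le> of_int q * a r" "a r < 0 ==> of_int q * a r \<le> a r"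
        using q by (auto simp: abs_mult)
      then have "(0 < a r \<and> 0 < real_of_int s) \<or> (a r < 0 \<and> real_of_int s < 0)"
        using err e2 False by (cases "a r > 0") linarith+
      then show ?thesis
        unfolding s[symmetric] by (auto simp: sgn_if)
    qed
  qed
  then show ?thesis
    unfolding a_def by blast
qed

lemma lattice_point_same_signs:
  fixes w :: "real ^ 'n::finite"
  assumes "finite G"
  shows "\<exists>p :: int ^ 'n. \<forall>g\<in>G. sgn (real_of_int (pairing g p)) = sgn (lattice_vec g \<bullet> w)"
proof -
  obtain p :: "'n => int" where p: "\<forall>g\<in>G. sgn (\<Sum>j\<in>UNIV. real_of_int (g $ j) * of_int (p j)) =
      sgn (\<Sum>j\<in>UNIV. of_int (g $ j) * w $ j)"
    using integer_vector_same_signs[of UNIV G vec_nth "vec_nth w"] assms by auto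
  then have "\<forall>g\<in>G. sgn (real_of_int (pairing g (\<chi> j. p j))) = sgn (lattice_vec g \<bullet> w)"
    by (simp add: pairing_def lattice_vec_def inner_vec_def)
  then show ?thesis by blast
qed

lemma convex_cone_hull_finite:
  fixes S :: "'a::real_vector set"
  assumes "finite S"
  shows "convex_cone hull S = {\<Sum>x\<in>S. c x *\<^sub>R x |c. \<forall>x\<in>S. (0::real) \<le> c x}" (is "_ = ?R")
proof
  have "convex_cone ?R"
    unfolding convex_cone_iff
  proof (intro conjI ballI allI impI)
    show "0 \<in> ?R"
      by (rule CollectI, rule exI[of _ "\<lambda>_. 0"]) simp
    fix x assume "x \<in> ?R"
    then obtain c where c: "x = (\<Sum>x\<in>S. c x *\<^sub>R x)" "\<forall>x\<in>S. 0 \<le> c x" by blast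
    { fix y assume "y \<in> ?R"
      then obtain d where d: "y = (\<Sum>x\<in>S. d x *\<^sub>R x)" "\<forall>x\<in>S. 0 \<le> d x" by blast
      show "x + y \<in> ?R"
        by (rule CollectI, rule exI[of _ "\<lambda>x. c x + d x"])
          (use c d in \<open>auto simp: sum.distrib scaleR_add_left\<close>) }
    fix a :: real assume "a \<ge> 0"
    then show "a *\<^sub>R x \<in> ?R"
      by (intro CollectI exI[of _ "\<lambda>x. a * c x"]) (use c in \<open>auto simp: scaleR_sum_right\<close>)
  qed
  moreover have "S \<subseteq> ?R"
  proof
    fix x assume x: "x \<in> S"
    show "x \<in> ?R"
      by (rule CollectI, rule exI[of _ "\<lambda>y. if y = x then 1 else 0"])
        (use x assms in \<open>auto simp: if_distrib[of "\<lambda>c. c *\<^sub>R _"] cong: if_cong\<close>)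
  qed
  ultimately show "convex_cone hull S \<subseteq> ?R"
    by (simp add: hull_minimal)
  show "?R \<subseteq> convex_cone hull S"
  proof clarify
    fix c :: "'a => real" assume c: "\<forall>x\<in>S. 0 \<le> c x"
    have "(\<Sum>x\<in>T. c x *\<^sub>R x) \<in> convex_cone hull S" if "finite T" "T \<subseteq> S" for T
      using that by (induction T rule: finite_induct)
        (auto intro!: convex_cone_hull_add convex_cone_hull_mul simp: convex_cone_hull_contains_0 c hull_inc)
    with assms show "(\<Sum>x\<in>S. c x *\<^sub>R x) \<in> convex_cone hull S" by blast
  qed
qed

lemma lattice_vec_inj: "inj lattice_vec"
  by (auto simp: inj_def lattice_vec_def vec_eq_iff)

lemma sum_list_replicate_of_nat: "sum_list (replicate N x) = of_nat N * (x :: int ^ 'n::finite)"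
  by (induction N) (auto simp: algebra_simps)

lemma sum_of_nat_mult_eq_sum_list:
  fixes G :: "(int ^ 'n::finite) set"
  assumes "finite G"
  shows "\<exists>ls. set ls \<subseteq> G \<and> sum_list ls = (\<Sum>g\<in>G. of_nat (c g) * g)"
  using assms
proof (induction G rule: finite_induct)
  case (insert x F)
  then obtain ls where ls: "set ls \<subseteq> F" "sum_list ls = (\<Sum>g\<in>F. of_nat (c g) * g)"
    by blast
  then show ?case
    using insert.hyps
    by (intro exI[of _ "replicate (c x) x @ ls"]) (auto simp: sum_list_replicate_of_nat)
qed (auto intro: exI[of _ "[]"])

text \<open>Lattice points of a cone are rational non-negative combinations of the generators; sums of
  lists of generators stand for non-negative integral combinations.\<close>

lemma lattice_point_of_hull:
  fixes G :: "(int ^ 'n::finite) set"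
  assumes G: "finite G" and w: "lattice_vec w \<in> convex_cone hull (lattice_vec ` G)"
  shows "\<exists>q>0. \<exists>ls. set ls \<subseteq> G \<and> sum_list ls = of_nat q * w"
proof -
  obtain c0 where c0: "lattice_vec w = (\<Sum>x\<in>lattice_vec ` G. c0 x *\<^sub>R x)" "\<forall>x\<in>lattice_vec ` G. 0 \<le> c0 x"
    using w convex_cone_hull_finite[of "lattice_vec ` G"] G by auto
  define c where "c = c0 \<circ> lattice_vec"
  have c: "lattice_vec w = (\<Sum>g\<in>G. c g *\<^sub>R lattice_vec g)" "\<forall>g\<in>G. 0 \<le> c g"
    using c0 by (auto simp: c_def sum.reindex inj_on_subset[OF lattice_vec_inj])
  have ci: "(\<Sum>g\<in>G. c g * of_int (g $ i)) = of_int (w $ i)" for i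
    using arg_cong[OF c(1), of "\<lambda>v. v $ i"] by (simp add: lattice_vec_def)
  define J where "J = insert None (Some ` G)"
  define wt where "wt j = (case j of None => 1 | Some g => c g)" for j
  define A :: "'n + (int ^ 'n) option => (int ^ 'n) option => int" where
    "A r j = (case r of Inl i => (case j of None => - (w $ i) | Some g => g $ i)
             | Inr j' => if j = j' then 1 else 0)" for r j
  have fJ: "finite J" using G by (simp add: J_def)
  have sumJ: "(\<Sum>j\<in>J. f j) = f None + (\<Sum>g\<in>G. f (Some g))" for f :: "_ => real"
    unfolding J_def by (subst sum.insert) (use G in \<open>auto simp: sum.reindex\<close>)
  obtain p where p: "\<forall>r\<in>range Inl \<union> Inr ` J.
    sgn (\<Sum>j\<in>J. real_of_int (A r j) * of_int (p j)) = sgn (\<Sum>j\<in>J. of_int (A r j) * wt j)"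
    using integer_vector_same_signs[OF fJ, of "range Inl \<union> Inr ` J" A wt] fJ by auto
  have *: "sgn (real_of_int (p j)) = sgn (wt j)" if "j \<in> J" for j
    using p[rule_format, of "Inr j"] that fJ by (simp add: A_def if_distrib if_distribR cong: if_cong)
  have eq: "(\<Sum>g\<in>G. p (Some g) * g $ i) = p None * w $ i" for i
  proof -
    have "(\<Sum>j\<in>J. of_int (A (Inl i) j) * wt j) = 0"
      unfolding sumJ using ci[of i] by (simp add: A_def wt_def mult.commute)
    then have "(\<Sum>j\<in>J. real_of_int (A (Inl i) j) * of_int (p j)) = 0"
      using p[rule_format, of "Inl i"] by (simp add: sgn_zero_iff)
    then have "real_of_int (\<Sum>g\<in>G. p (Some g) * g $ i) = of_int (p None * w $ i)"
      unfolding sumJ by (simp add: A_def mult.commute)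
    then show ?thesis by linarith
  qed
  have p0: "p None > 0"
    using *[of None] by (auto simp: J_def wt_def sgn_if split: if_splits)
  have pg: "p (Some g) \<ge> 0" if "g \<in> G" for g
    using *[of "Some g"] c(2) that by (auto simp: J_def wt_def sgn_if split: if_splits)
  obtain ls where ls: "set ls \<subseteq> G" "sum_list ls = (\<Sum>g\<in>G. of_nat (nat (p (Some g))) * g)"
    using sum_of_nat_mult_eq_sum_list[OF G, of "\<lambda>g. nat (p (Some g))"] by blast
  have "sum_list ls = of_nat (nat (p None)) * w"
    unfolding ls(2) vec_eq_iff using eq pg p0 by (simp add: of_nat_index of_int_vec_index)
  then show ?thesis
    using p0 ls(1) by (intro exI[of _ "nat (p None)"]) auto
qed

text \<open>Farkas' lemma: a hyperplane that separates the point from the cone may be moved to the origin, since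
  a functional that is bounded below on a cone is non-negative on it.\<close>

lemma closed_convex_cone_separation:
  fixes x :: "'a::euclidean_space"
  assumes "finite S" "x \<notin> convex_cone hull S"
  shows "\<exists>m. (\<forall>y\<in>S. 0 \<le> m \<bullet> y) \<and> m \<bullet> x < 0"
proof -
  define K where "K = convex_cone hull S"
  have "closed K" "convex K" "0 \<in> K"
    using assms by (simp_all add: K_def closed_convex_cone_hull convex_convex_cone_hull convex_cone_hull_contains_0)
  then obtain m b where mb: "m \<bullet> x < b" "\<forall>y\<in>K. b < m \<bullet> y"
    using separating_hyperplane_closed_point[of K x] assms(2) by (auto simp: K_def)
  have "0 \<le> m \<bullet> y" if "y \<in> S" for y
  proof (rule ccontr)
    assume neg: "\<not> 0 \<le> m \<bullet> y"
    define t where "t = \<bar>b\<bar> / - (m \<bullet> y)"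
    have "t \<ge> 0" using neg unfolding t_def by (intro divide_nonneg_nonneg) auto
    then have "t *\<^sub>R y \<in> K"
      using that by (simp add: K_def convex_cone_hull_mul hull_inc)
    then have "b < t * (m \<bullet> y)" using mb(2) by fastforce
    moreover have "t * (m \<bullet> y) = - \<bar>b\<bar>" using neg by (simp add: t_def)
    ultimately show False by linarith
  qed
  moreover have "m \<bullet> x < 0"
    using mb \<open>0 \<in> K\<close> by force
  ultimately show ?thesis by blast
qed

lemma inner_hull_nonneg:
  assumes "\<forall>y\<in>S. 0 \<le> m \<bullet> y" "x \<in> convex_cone hull S"
  shows "0 \<le> m \<bullet> x"
proof -
  have "convex_cone hull S \<subseteq> {x. m \<bullet> x \<ge> 0}"
    by (rule hull_minimal) (use assms(1) convex_cone_halfspace_ge in auto)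
  then show ?thesis using assms(2) by blast
qed

lemma dual_semigroup_hull:
  "dual_semigroup (convex_cone hull (lattice_vec ` G)) = {m. \<forall>g\<in>G. 0 \<le> pairing m g}"
  unfolding dual_semigroup_def
proof (intro Collect_cong iffI ballI)
  fix m g assume "\<forall>v\<in>convex_cone hull lattice_vec ` G. 0 \<le> lattice_vec m \<bullet> v" "g \<in> G"
  then have "0 \<le> lattice_vec m \<bullet> lattice_vec g" by (simp add: hull_inc)
  then show "0 \<le> pairing m g" by (simp add: inner_lattice_vec)
next
  fix m v assume "\<forall>g\<in>G. 0 \<le> pairing m g" "v \<in> convex_cone hull lattice_vec ` G"
  then show "0 \<le> lattice_vec m \<bullet> v"
    by (intro inner_hull_nonneg[of "lattice_vec ` G"]) (auto simp: inner_lattice_vec)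
qed

lemma dual_semigroup_0 [simp]: "0 \<in> dual_semigroup K"
  by (simp add: dual_semigroup_def)

lemma dual_semigroup_add: "a \<in> dual_semigroup K ==> b \<in> dual_semigroup K ==> a + b \<in> dual_semigroup K"
  by (simp add: dual_semigroup_def inner_add_left)

lemma dual_semigroup_mult: "a \<in> dual_semigroup K ==> of_nat N * a \<in> dual_semigroup K"
  by (simp add: dual_semigroup_def)

lemma dual_semigroup_sum_list: "set ls \<subseteq> dual_semigroup K ==> sum_list ls \<in> dual_semigroup K"
  by (induction ls) (auto intro: dual_semigroup_add)

lemma dual_semigroup_mono: "K \<subseteq> \<tau> ==> dual_semigroup \<tau> \<subseteq> dual_semigroup K"
  by (auto simp: dual_semigroup_def)

lemma dual_semigroup_pairing: "m \<in> dual_semigroup K ==> lattice_vec u \<in> K ==> 0 \<le> pairing m u"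
  by (force simp: dual_semigroup_def inner_lattice_vec)

lemma dual_semigroup_zero_cone [simp]: "dual_semigroup {0} = UNIV"
  by (simp add: dual_semigroup_def)

lemma lattice_point_of_bidual:
  assumes "rational_polyhedral_cone K" and u: "\<And>m. m \<in> dual_semigroup K ==> 0 \<le> pairing m u"
  shows "lattice_vec u \<in> K"
proof (rule ccontr)
  assume no: "lattice_vec u \<notin> K"
  obtain G where G: "finite G" "K = convex_cone hull (lattice_vec ` G)"
    using assms by (auto simp: rational_polyhedral_cone_def)
  obtain m where m: "\<forall>y\<in>lattice_vec ` G. 0 \<le> m \<bullet> y" "m \<bullet> lattice_vec u < 0"
    using closed_convex_cone_separation[of "lattice_vec ` G" "lattice_vec u"] no G by auto
  obtain p where p: "\<forall>g\<in>insert u G. sgn (real_of_int (pairing g p)) = sgn (lattice_vec g \<bullet> m)"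
    using lattice_point_same_signs[of "insert u G" m] G by auto
  have "0 \<le> pairing p g" if "g \<in> G" for g
  proof -
    have "sgn (real_of_int (pairing g p)) = sgn (m \<bullet> lattice_vec g)" "0 \<le> m \<bullet> lattice_vec g"
      using p m(1) that by (simp_all add: inner_commute)
    then have "sgn (real_of_int (pairing g p)) \<ge> 0" by simp
    then show ?thesis by (simp add: pairing_commute[of p])
  qed
  then have "p \<in> dual_semigroup K"
    by (simp add: G dual_semigroup_hull)
  moreover have "pairing p u < 0"
  proof -
    have "sgn (real_of_int (pairing u p)) = sgn (m \<bullet> lattice_vec u)"
      using p by (simp add: inner_commute)
    then have "sgn (real_of_int (pairing u p)) < 0" using m(2) by simp
    then show ?thesis by (simp add: pairing_commute[of p])
  qed
  ultimately show False using u by force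
qed

subsection \<open>Finite generation\<close>

lemma nat_seq_nondecreasing_subseq:
  fixes f :: "nat => nat"
  shows "\<exists>r :: nat => nat. strict_mono r \<and> (\<forall>i j. i \<le> j --> f (r i) \<le> f (r j))"
proof -
  obtain r where r: "strict_mono r" "monoseq (\<lambda>n. f (r n))"
    using seq_monosub[of f] by blast
  show ?thesis
  proof (cases "incseq (\<lambda>n. f (r n))")
    case True
    then show ?thesis using r(1) unfolding incseq_def by blast
  next
    case False
    then have dec: "decseq (\<lambda>n. f (r n))"
      using r(2) by (simp add: monoseq_iff)
    define k where "k = (LEAST v. \<exists>n. f (r n) = v)"
    have "\<exists>n. f (r n) = k"
      unfolding k_def by (rule LeastI_ex) blast
    then obtain n where n: "f (r n) = k" by blast
    have ge: "k \<le> f (r j)" for j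
      unfolding k_def by (rule Least_le) blast
    have "f (r j) = k" if "j \<ge> n" for j
      using dec that n ge[of j] by (fastforce simp: decseq_def)
    then show ?thesis
      using r(1) by (intro exI[of _ "\<lambda>i. r (i + n)"]) (auto simp: strict_mono_def)
  qed
qed

text \<open>Dickson's lemma. Coordinate by coordinate, a sequence is thinned out until it is monotone in each.\<close>

lemma Dickson:
  fixes J :: "('a => nat) set"
  assumes "finite J" "infinite A"
  shows "\<exists>a\<in>A. \<exists>b\<in>A. a \<noteq> b \<and> (\<forall>f\<in>J. f a \<le> f b)"
proof -
  obtain s :: "nat => 'a" where s: "inj s" "range s \<subseteq> A"
    using assms(2) infinite_countable_subset by blast
  have "\<exists>r :: nat => nat. strict_mono r \<and> (\<forall>f\<in>J. \<forall>i j. i \<le> j --> f (s (r i)) \<le> f (s (r j)))"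
    using assms(1)
  proof (induction J rule: finite_induct)
    case empty
    show ?case by (intro exI[of _ "\<lambda>n. n"]) (simp add: strict_mono_def)
  next
    case (insert f J)
    then obtain r :: "nat => nat" where r: "strict_mono r" "\<forall>f\<in>J. \<forall>i j. i \<le> j --> f (s (r i)) \<le> f (s (r j))"
      by blast
    obtain r' :: "nat => nat" where r': "strict_mono r'" "\<forall>i j. i \<le> j --> f (s (r (r' i))) \<le> f (s (r (r' j)))"
      using nat_seq_nondecreasing_subseq[of "\<lambda>i. f (s (r i))"] by blast
    have "strict_mono (r \<circ> r')" using r r' by (simp add: strict_mono_def)
    moreover have "r' i \<le> r' j" if "i \<le> j" for i j
      using r'(1) that by (simp add: strict_mono_less_eq)
    ultimately have "strict_mono (r \<circ> r') \<and> (\<forall>g\<in>insert f J. \<forall>i j. i \<le> j -->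
        g (s ((r \<circ> r') i)) \<le> g (s ((r \<circ> r') j)))"
      using r(2) r'(2) by (metis (no_types, lifting) comp_apply insert_iff)
    then show ?case by blast
  qed
  then obtain r :: "nat => nat" where r: "strict_mono r" "\<forall>f\<in>J. \<forall>i j. i \<le> j --> f (s (r i)) \<le> f (s (r j))"
    by blast
  have "s (r 0) \<noteq> s (r 1)"
    using s(1) r(1) by (simp add: inj_eq strict_mono_eq)
  then show ?thesis
    using s(2) r(2) by (intro bexI[of _ "s (r 0)"] bexI[of _ "s (r 1)"]) auto
qed

text \<open>Gordan's lemma. Lattice points are compared via the positive and negative parts of their
  coordinates and their values on the generators of the cone; differences of comparable elements
  stay in the semigroup, so the minimal nonzero elements generate, and there are finitely many
  by Dickson's lemma.\<close>

lemma dual_semigroup_finitely_generated: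
  fixes K :: "(real ^ 'n::finite) set"
  assumes "rational_polyhedral_cone K"
  shows "\<exists>H. finite H \<and> H \<subseteq> dual_semigroup K \<and>
    (\<forall>m\<in>dual_semigroup K. \<exists>ls. set ls \<subseteq> H \<and> sum_list ls = m)"
proof -
  obtain G where G: "finite G" "K = convex_cone hull (lattice_vec ` G)"
    using assms by (auto simp: rational_polyhedral_cone_def)
  define S where "S = dual_semigroup K"
  have S: "m \<in> S \<longleftrightarrow> (\<forall>g\<in>G. 0 \<le> pairing m g)" for m
    by (simp add: S_def G dual_semigroup_hull)
  define J :: "(int ^ 'n => nat) set" where
    "J = range (\<lambda>i m. nat (m $ i)) \<union> range (\<lambda>i m. nat (- m $ i)) \<union> (\<lambda>g m. nat (pairing m g)) ` G"
  have fJ: "finite J" by (simp add: J_def G)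
  define le where "le a b \<longleftrightarrow> (\<forall>f\<in>J. f a \<le> f b)" for a b
  define ht where "ht a = (\<Sum>f\<in>J. f a)" for a
  have le_diff: "b - a \<in> S" "f (b - a) = f b - f a" if "le a b" "a \<in> S" "b \<in> S" "f \<in> J" for a b f
  proof -
    have c: "nat (a $ i) \<le> nat (b $ i)" "nat (- a $ i) \<le> nat (- b $ i)" for i
      using that(1) by (auto simp: le_def J_def)
    have g: "nat (pairing a g) \<le> nat (pairing b g)" if "g \<in> G" for g
      using \<open>le a b\<close> that by (auto simp: le_def J_def)
    have g': "pairing a g \<le> pairing b g" if "g \<in> G" for g
      using g[OF that] \<open>a \<in> S\<close> \<open>b \<in> S\<close> that by (auto simp: S)
    then show "b - a \<in> S" using that by (auto simp: S)
    have "nat (b $ i - a $ i) = nat (b $ i) - nat (a $ i)"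
      "nat (a $ i - b $ i) = nat (- b $ i) - nat (- a $ i)" for i
      using c[of i] by linarith+
    moreover have "nat (pairing b g - pairing a g) = nat (pairing b g) - nat (pairing a g)" if "g \<in> G" for g
      using \<open>a \<in> S\<close> that by (auto simp: S nat_diff_distrib')
    ultimately show "f (b - a) = f b - f a"
      using \<open>f \<in> J\<close> by (auto simp: J_def)
  qed
  have eqI: "a = b" if "le a b" "le b a" for a b
  proof -
    have "nat (a $ i) = nat (b $ i)" "nat (- a $ i) = nat (- b $ i)" for i
      using that unfolding le_def J_def by (simp_all add: ball_Un order_antisym)
    then have "a $ i = b $ i" for i
    proof -
      have "x = y" if "nat x = nat y" "nat (- x) = nat (- y)" for x y :: int
        using that by linarith
      with \<open>nat (a $ i) = nat (b $ i)\<close> \<open>nat (- a $ i) = nat (- b $ i)\<close> show ?thesis by simp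
    qed
    then show ?thesis by (simp add: vec_eq_iff)
  qed
  define H where "H = {m \<in> S. m \<noteq> 0 \<and> (\<forall>a\<in>S. a \<noteq> 0 --> le a m --> a = m)}"
  have "finite H"
  proof (rule ccontr)
    assume "infinite H"
    then obtain a b where "a \<in> H" "b \<in> H" "a \<noteq> b" "le a b"
      using Dickson[OF fJ, of H] unfolding le_def by auto
    then show False by (auto simp: H_def)
  qed
  have ht_diff: "ht (b - a) < ht b" if "le a b" "a \<in> S" "b \<in> S" "a \<noteq> 0" for a b
  proof -
    have "\<exists>f\<in>J. f a > 0"
    proof (rule ccontr)
      assume "\<not> (\<exists>f\<in>J. f a > 0)"
      then have "le a 0" by (auto simp: le_def)
      moreover have "le 0 a" by (auto simp: le_def J_def)
      ultimately show False using eqI that by blast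
    qed
    then obtain f where f: "f \<in> J" "f a > 0" by blast
    have "f a \<le> f b" using that f by (auto simp: le_def)
    have le': "f' (b - a) \<le> f' b" if "f' \<in> J" for f'
      using le_diff(2)[OF \<open>le a b\<close> \<open>a \<in> S\<close> \<open>b \<in> S\<close> that] by simp
    have lt: "f (b - a) < f b"
      using le_diff(2)[OF \<open>le a b\<close> \<open>a \<in> S\<close> \<open>b \<in> S\<close> f(1)] f(2) \<open>f a \<le> f b\<close> by simp
    show ?thesis
      unfolding ht_def by (rule sum_strict_mono_ex1[OF fJ]) (use le' lt f(1) in auto)
  qed
  have ht_lt: "ht a < ht b" if ab: "le a b" "a \<noteq> b" for a b
  proof -
    obtain f where f: "f \<in> J" "\<not> f b \<le> f a"
      using ab eqI[of a b] by (auto simp: le_def)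
    show ?thesis
      unfolding ht_def by (rule sum_strict_mono_ex1[OF fJ]) (use ab f in \<open>auto simp: le_def not_le intro!: bexI[of _ f]\<close>)
  qed
  have min: "\<exists>a\<in>H. le a m" if "m \<in> S" "m \<noteq> 0" for m
    using that
  proof (induction "ht m" arbitrary: m rule: less_induct)
    case less
    show ?case
    proof (cases "m \<in> H")
      case True
      then show ?thesis by (auto simp: le_def)
    next
      case False
      then obtain a where a: "a \<in> S" "a \<noteq> 0" "le a m" "a \<noteq> m"
        using less.prems by (auto simp: H_def)
      then obtain b where "b \<in> H" "le b a"
        using less.hyps[OF ht_lt[OF a(3,4)]] by blast
      then show ?thesis using a(3) by (auto simp: le_def intro: order_trans)
    qed
  qed
  have "\<exists>ls. set ls \<subseteq> H \<and> sum_list ls = m" if "m \<in> S" for m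
    using that
  proof (induction "ht m" arbitrary: m rule: less_induct)
    case less
    show ?case
    proof (cases "m = 0")
      case True
      then show ?thesis by (intro exI[of _ "[]"]) auto
    next
      case False
      obtain a where a: "a \<in> H" "le a m" using min less.prems False by blast
      then have a': "a \<in> S" "a \<noteq> 0" by (auto simp: H_def)
      have J0: "J \<noteq> {}" by (simp add: J_def)
      then have "m - a \<in> S"
        using le_diff(1)[OF a(2) a'(1) less.prems] by blast
      then obtain ls where "set ls \<subseteq> H" "sum_list ls = m - a"
        using less.hyps[OF ht_diff[OF a(2) a'(1) less.prems a'(2)]] by blast
      then show ?thesis using a(1) by (intro exI[of _ "a # ls"]) auto
    qed
  qed
  moreover have "H \<subseteq> S" by (auto simp: H_def)
  ultimately show ?thesis using \<open>finite H\<close> unfolding S_def by blast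
qed


text \<open>Faces of the dual semigroup are cut out by lattice points of the cone: a generator outside
  the face that were non-positive wherever the face vanishes would, by Farkas, have a multiple
  completed inside the semigroup to an element of the face.\<close>

lemma dual_semigroup_face:
  fixes K :: "(real ^ 'n::finite) set"
  assumes K: "rational_polyhedral_cone K"
    and F: "F \<subseteq> dual_semigroup K" "0 \<in> F"
    and face: "\<And>a b. a \<in> dual_semigroup K ==> b \<in> dual_semigroup K ==> a + b \<in> F \<longleftrightarrow> a \<in> F \<and> b \<in> F"
  shows "\<exists>u. lattice_vec u \<in> K \<and> F = {m \<in> dual_semigroup K. pairing m u = 0}"
proof -
  define S where "S = dual_semigroup K"
  obtain H where H: "finite H" "H \<subseteq> S" "\<And>m. m \<in> S ==> \<exists>ls. set ls \<subseteq> H \<and> sum_list ls = m"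
    using dual_semigroup_finitely_generated[OF K] unfolding S_def by blast
  have sumF: "sum_list ls \<in> F \<longleftrightarrow> set ls \<subseteq> F" if "set ls \<subseteq> S" for ls
    using that
  proof (induction ls)
    case (Cons a ls)
    then show ?case
      using face[of a "sum_list ls"] by (auto simp: S_def dual_semigroup_sum_list)
  qed (use F in auto)
  have *: "\<exists>w. (\<forall>h\<in>H. 0 \<le> w \<bullet> lattice_vec h) \<and> (\<forall>h\<in>H \<inter> F. w \<bullet> lattice_vec h = 0) \<and> w \<bullet> lattice_vec h0 > 0"
    if h0: "h0 \<in> H" "h0 \<notin> F" for h0
  proof -
    define E where "E = H \<union> uminus ` (H \<inter> F)"
    have fE: "finite E" using H by (simp add: E_def)
    have "lattice_vec (- h0) \<notin> convex_cone hull (lattice_vec ` E)"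
    proof
      assume "lattice_vec (- h0) \<in> convex_cone hull (lattice_vec ` E)"
      then obtain q ls where q: "q > 0" "set ls \<subseteq> E" "sum_list ls = of_nat q * (- h0)"
        using lattice_point_of_hull[OF fE] by blast
      have "\<exists>as bs. set as \<subseteq> H \<and> set bs \<subseteq> H \<inter> F \<and> sum_list ls + sum_list bs = sum_list as"
        using q(2)
      proof (induction ls)
        case Nil
        show ?case by (intro exI[of _ "[]"]) auto
      next
        case (Cons x ls)
        then obtain as bs where ab: "set as \<subseteq> H" "set bs \<subseteq> H \<inter> F" "sum_list ls + sum_list bs = sum_list as"
          by auto
        show ?case
        proof (cases "x \<in> H")
          case True
          then show ?thesis using ab by (intro exI[of _ "x # as"] exI[of _ bs]) (auto simp: add.assoc)
        next
          case False
          then have "- x \<in> H \<inter> F" using Cons.prems by (auto simp: E_def)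
          then show ?thesis using ab by (intro exI[of _ as] exI[of _ "(- x) # bs"]) auto
        qed
      qed
      then obtain as bs where ab: "set as \<subseteq> H" "set bs \<subseteq> H \<inter> F" "sum_list ls + sum_list bs = sum_list as"
        by blast
      have "sum_list (replicate q h0 @ as) = sum_list bs"
        using ab(3) q(3) by (simp add: sum_list_replicate_of_nat algebra_simps)
      moreover have "sum_list bs \<in> F" using sumF[of bs] ab(2) H(2) by auto
      ultimately have "set (replicate q h0 @ as) \<subseteq> F"
        using sumF[of "replicate q h0 @ as"] ab(1) h0(1) H(2) by (metis (no_types, lifting)
          Un_subset_iff empty_subsetI insert_subset set_append set_replicate_conv_if subset_iff)
      then show False using h0 q(1) by (cases q) auto
    qed
    then obtain w where w: "\<forall>y\<in>lattice_vec ` E. 0 \<le> w \<bullet> y" "w \<bullet> lattice_vec (- h0) < 0"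
      using closed_convex_cone_separation[of "lattice_vec ` E" "lattice_vec (- h0)"] fE by blast
    have "0 \<le> w \<bullet> lattice_vec h" if "h \<in> H" for h
      using w(1) that by (auto simp: E_def)
    moreover have "w \<bullet> lattice_vec h = 0" if "h \<in> H \<inter> F" for h
    proof -
      have "0 \<le> w \<bullet> lattice_vec h" "0 \<le> w \<bullet> lattice_vec (- h)"
        using w(1) that unfolding E_def by blast+
      then show ?thesis by simp
    qed
    ultimately show ?thesis using w(2) by (intro exI[of _ w]) auto
  qed
  then obtain W where W: "\<And>h0 h. h0 \<in> H - F ==> h \<in> H ==> 0 \<le> W h0 \<bullet> lattice_vec h"
    "\<And>h0 h. h0 \<in> H - F ==> h \<in> H \<inter> F ==> W h0 \<bullet> lattice_vec h = 0"
    "\<And>h0. h0 \<in> H - F ==> W h0 \<bullet> lattice_vec h0 > 0"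
    by (metis DiffE)
  define w where "w = (\<Sum>h0\<in>H - F. W h0)"
  have w0: "w \<bullet> lattice_vec h = 0" if "h \<in> H \<inter> F" for h
    unfolding w_def inner_sum_left using W(2)[OF _ that] by simp
  have wpos: "w \<bullet> lattice_vec h > 0" if "h \<in> H - F" for h
    unfolding w_def inner_sum_left
    by (rule sum_pos2[of _ h]) (use that H W in auto)
  obtain u where u: "\<forall>h\<in>H. sgn (real_of_int (pairing h u)) = sgn (lattice_vec h \<bullet> w)"
    using lattice_point_same_signs[OF H(1)] by blast
  have u0: "pairing h u = 0" if "h \<in> H \<inter> F" for h
  proof -
    have "sgn (real_of_int (pairing h u)) = 0"
      using u w0[OF that] that by (simp add: inner_commute)
    then show ?thesis by (simp add: sgn_zero_iff)
  qed
  have upos: "pairing h u > 0" if "h \<in> H - F" for h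
  proof -
    have "sgn (real_of_int (pairing h u)) = 1"
      using u wpos[OF that] that by (simp add: inner_commute)
    then show ?thesis by (simp add: sgn_if split: if_splits)
  qed
  have unn: "pairing h u \<ge> 0" if "h \<in> H" for h
    using u0[of h] upos[of h] that by (cases "h \<in> F") auto
  have sum_nn: "pairing (sum_list ls) u \<ge> 0" if "set ls \<subseteq> H" for ls
    using that by (induction ls) (auto intro: add_nonneg_nonneg unn)
  have sum_0: "pairing (sum_list ls) u = 0 \<longleftrightarrow> set ls \<subseteq> F" if "set ls \<subseteq> H" for ls
    using that
  proof (induction ls)
    case (Cons a ls)
    then show ?case
      using sum_nn[of ls] unn[of a] u0[of a] upos[of a] by (cases "a \<in> F") auto
  qed auto
  have "lattice_vec u \<in> K"
    using lattice_point_of_bidual[OF K, of u] sum_nn H(3) unfolding S_def by blast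
  moreover have "m \<in> F \<longleftrightarrow> pairing m u = 0" if "m \<in> S" for m
  proof -
    obtain ls where ls: "set ls \<subseteq> H" "sum_list ls = m" using H(3) \<open>m \<in> S\<close> by blast
    then show ?thesis using sum_0[of ls] sumF[of ls] H(2) by auto
  qed
  ultimately show ?thesis using F(1) unfolding S_def by blast
qed

subsection \<open>Faces\<close>

lemma face_of_add:
  assumes T: "T face_of C" "conic T" and C: "convex_cone C" and ab: "a \<in> C" "b \<in> C" "a + b \<in> T"
  shows "a \<in> T"
proof (cases "a = b")
  case True
  then have "(1/2) *\<^sub>R (a + a) \<in> T" using ab T(2) by (intro conicD) auto
  then show ?thesis by (simp add: scaleR_2[symmetric])
next
  case False
  have "a + b \<in> open_segment (2 *\<^sub>R a) (2 *\<^sub>R b)"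
    unfolding in_segment using False by (auto intro!: exI[of _ "1/2"])
  moreover have "2 *\<^sub>R a \<in> C" "2 *\<^sub>R b \<in> C" using C ab by (auto intro: convex_cone_scaleR)
  ultimately have "2 *\<^sub>R a \<in> T" using T(1) ab(3) unfolding face_of_def by blast
  then have "(1/2) *\<^sub>R (2 *\<^sub>R a) \<in> T" using conicD[OF T(2), of "2 *\<^sub>R a" "1/2"] by simp
  then show ?thesis by simp
qed

lemma rational_polyhedral_cone_convex_cone: "rational_polyhedral_cone K ==> convex_cone K"
  by (auto simp: rational_polyhedral_cone_def convex_cone_convex_cone_hull)

text \<open>The separation lemma for two cones that meet in a common face. Its last clause says that the
  affine chart of the intersection is a principal open subset of the chart of the second cone. A
  real separating functional is a sum of one functional for each generator outside the face.\<close>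

lemma separating_lattice_vector:
  fixes K K' :: "(real ^ 'n::finite) set"
  assumes rpc: "rational_polyhedral_cone K" "rational_polyhedral_cone K'"
    and face: "(K \<inter> K') face_of K'"
  shows "\<exists>m\<in>dual_semigroup K'. - m \<in> dual_semigroup K \<and>
    (\<forall>p\<in>dual_semigroup (K \<inter> K'). \<exists>N. p + of_nat N * m \<in> dual_semigroup K')"
proof -
  obtain G where G: "finite G" "K = convex_cone hull (lattice_vec ` G)"
    using rpc(1) by (auto simp: rational_polyhedral_cone_def)
  obtain G' where G': "finite G'" "K' = convex_cone hull (lattice_vec ` G')"
    using rpc(2) by (auto simp: rational_polyhedral_cone_def)
  define \<tau> where "\<tau> = K \<inter> K'"
  note cc = rpc[THEN rational_polyhedral_cone_convex_cone]
  have con: "conic \<tau>"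
    using cc unfolding \<tau>_def convex_cone_def conic_def by blast
  define E where "E = lattice_vec ` G' \<union> uminus ` lattice_vec ` G"
  have fE: "finite E" using G G' by (simp add: E_def)
  have neg_hull: "convex_cone hull (uminus ` lattice_vec ` G) = uminus ` K"
    unfolding G(2) by (rule convex_cone_hull_linear_image) (simp add: linear_iff)
  have *: "\<exists>m. (\<forall>y\<in>E. 0 \<le> m \<bullet> y) \<and> m \<bullet> lattice_vec g > 0" if g: "g \<in> G'" "lattice_vec g \<notin> \<tau>" for g
  proof -
    have "- lattice_vec g \<notin> convex_cone hull E"
    proof
      assume "- lattice_vec g \<in> convex_cone hull E"
      then obtain s' s where s: "s' \<in> K'" "s \<in> K" "- lattice_vec g = s' - s"
        unfolding E_def convex_cone_hull_Un neg_hull G'(2)[symmetric] by auto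
      have gs: "lattice_vec g \<in> K'" using g by (simp add: G' hull_inc)
      have "lattice_vec g + s' = s" using s(3) by (simp add: algebra_simps)
      moreover have "lattice_vec g + s' \<in> K'"
        using gs s cc by (auto intro: convex_cone_add)
      ultimately have "lattice_vec g + s' \<in> \<tau>" using s by (simp add: \<tau>_def)
      then show False
        using face_of_add[OF face[folded \<tau>_def] con cc(2) gs s(1)] g by blast
    qed
    then obtain m where "\<forall>y\<in>E. 0 \<le> m \<bullet> y" "m \<bullet> (- lattice_vec g) < 0"
      using closed_convex_cone_separation[OF fE] by blast
    then show ?thesis by (intro exI[of _ m]) auto
  qed
  then obtain M where M: "\<And>g y. g \<in> G' ==> lattice_vec g \<notin> \<tau> ==> y \<in> E ==> 0 \<le> M g \<bullet> y"
    "\<And>g. g \<in> G' ==> lattice_vec g \<notin> \<tau> ==> M g \<bullet> lattice_vec g > 0"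
    by metis
  define G1 where "G1 = {g \<in> G'. lattice_vec g \<notin> \<tau>}"
  define m where "m = (\<Sum>g\<in>G1. M g)"
  have m1: "0 \<le> m \<bullet> y" if "y \<in> E" for y
    unfolding m_def inner_sum_left by (rule sum_nonneg) (use M that in \<open>auto simp: G1_def\<close>)
  have m2: "0 < m \<bullet> lattice_vec g" if "g \<in> G1" for g
    unfolding m_def inner_sum_left
    by (rule sum_pos2[of _ g]) (use that G' M in \<open>auto simp: G1_def E_def\<close>)
  obtain p where p: "\<forall>g\<in>G \<union> G'. sgn (real_of_int (pairing g p)) = sgn (lattice_vec g \<bullet> m)"
    using lattice_point_same_signs[of "G \<union> G'" m] G G' by auto
  have pG': "0 \<le> pairing p g" if "g \<in> G'" for g
  proof -
    have "sgn (real_of_int (pairing g p)) = sgn (m \<bullet> lattice_vec g)" "0 \<le> m \<bullet> lattice_vec g"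
      using p m1[of "lattice_vec g"] that by (auto simp: inner_commute E_def)
    then have "sgn (real_of_int (pairing g p)) \<ge> 0" by simp
    then show ?thesis by (simp add: pairing_commute[of p])
  qed
  have pG1: "1 \<le> pairing p g" if "g \<in> G1" for g
  proof -
    have "sgn (real_of_int (pairing g p)) = 1"
      using p m2[OF that] that by (simp add: inner_commute G1_def)
    then show ?thesis by (simp add: pairing_commute[of p] sgn_if split: if_splits)
  qed
  have pG: "pairing p g \<le> 0" if "g \<in> G" for g
  proof -
    have "sgn (real_of_int (pairing g p)) = sgn (m \<bullet> lattice_vec g)" "0 \<le> m \<bullet> (- lattice_vec g)"
      using p m1[of "- lattice_vec g"] that by (auto simp: inner_commute E_def)
    then have "sgn (real_of_int (pairing g p)) \<le> 0" by (simp add: sgn_if)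
    then show ?thesis by (simp add: pairing_commute[of p])
  qed
  have "\<exists>N. q + of_nat N * p \<in> dual_semigroup K'" if q: "q \<in> dual_semigroup \<tau>" for q
  proof -
    define N where "N = nat (\<Sum>g\<in>G'. \<bar>pairing q g\<bar>)"
    have "0 \<le> pairing q g + int N * pairing p g" if g: "g \<in> G'" for g
    proof (cases "g \<in> G1")
      case True
      have "- pairing q g \<le> (\<Sum>g\<in>G'. \<bar>pairing q g\<bar>)"
        by (rule order_trans[OF _ member_le_sum[of g]]) (use g G' in auto)
      also have "\<dots> \<le> int N" by (simp add: N_def)
      also have "\<dots> \<le> int N * pairing p g" using pG1[OF True] by (simp add: mult_le_cancel_left1)
      finally show ?thesis by linarith
    next
      case False
      then have "lattice_vec g \<in> \<tau>" using g by (auto simp: G1_def)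
      then have "0 \<le> pairing q g" using q dual_semigroup_pairing by blast
      then show ?thesis using pG'[OF g] by simp
    qed
    then show ?thesis by (intro exI[of _ N]) (simp add: G' dual_semigroup_hull)
  qed
  moreover have "p \<in> dual_semigroup K'" "- p \<in> dual_semigroup K"
    using pG pG' by (auto simp: G G' dual_semigroup_hull)
  ultimately show ?thesis unfolding \<tau>_def by blast
qed

text \<open>In a generating set of minimal size no generator lies in the cone of the others; as the cone is
  pointed, this makes every generator span an extreme ray.\<close>

lemma pointed_cone_rays:
  fixes K :: "(real ^ 'n::finite) set"
  assumes "rational_polyhedral_cone K" and pointed: "K \<inter> uminus ` K = {0}"
  shows "\<exists>G. finite G \<and> K = convex_cone hull (lattice_vec ` G) \<and>
    (\<forall>g\<in>G. g \<noteq> 0 \<and> (convex_cone hull {lattice_vec g}) face_of K)"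
proof -
  define P where "P G \<longleftrightarrow> finite G \<and> K = convex_cone hull (lattice_vec ` G)" for G
  have "\<exists>G. P G" using assms by (auto simp: rational_polyhedral_cone_def P_def)
  then have "P (arg_min card P)" "\<And>G'. P G' ==> card (arg_min card P) \<le> card G'"
    by (auto intro: arg_min_natI arg_min_nat_le)
  then obtain G where G: "P G" and min: "\<And>G'. P G' ==> card G \<le> card G'"
    by blast
  have fin: "finite G" and hull: "K = convex_cone hull (lattice_vec ` G)" using G by (auto simp: P_def)
  have cc: "convex_cone K" using hull convex_cone_convex_cone_hull by metis
  have pt: "x = 0" if "x \<in> K" "- x \<in> K" for x
    using pointed that by (metis IntI image_eqI minus_minus singletonD)
  have "g \<noteq> 0 \<and> (convex_cone hull {lattice_vec g}) face_of K" if g: "g \<in> G" for g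
  proof -
    define L where "L = convex_cone hull (lattice_vec ` (G - {g}))"
    define v where "v = lattice_vec g"
    have ins: "lattice_vec ` G = insert v (lattice_vec ` (G - {g}))"
      using g by (auto simp: v_def)
    have vL: "v \<notin> L"
    proof
      assume "v \<in> L"
      then have "P (G - {g})"
        using fin unfolding P_def hull ins L_def by (simp add: hull_redundant)
      from min[OF this] show False using card_Diff1_less[OF fin g] by linarith
    qed
    have "0 \<in> L" by (simp add: L_def convex_cone_hull_contains_0)
    then have v0: "v \<noteq> 0" using vL by auto
    have ray: "convex_cone hull {v} = {c *\<^sub>R v |c. 0 \<le> c}"
      by (subst convex_cone_hull_finite) auto
    have dec: "\<exists>\<alpha> a'. 0 \<le> \<alpha> \<and> a' \<in> L \<and> a = \<alpha> *\<^sub>R v + a'" if "a \<in> K" for a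
    proof -
      have "K = convex_cone hull ({v} \<union> lattice_vec ` (G - {g}))"
        by (simp add: hull ins)
      then have "a \<in> (\<Union>x\<in>convex_cone hull {v}. \<Union>y\<in>L. {x + y})"
        using that unfolding convex_cone_hull_Un L_def by simp
      then show ?thesis unfolding ray by blast
    qed
    have vs: "v \<in> K" using g by (simp add: hull v_def hull_inc)
    have Ls: "L \<subseteq> K" unfolding L_def hull by (rule hull_mono) auto
    have "(convex_cone hull {v}) face_of K"
      unfolding face_of_def
    proof (intro conjI ballI impI)
      show "convex_cone hull {v} \<subseteq> K"
        using vs cc by (simp add: hull_minimal)
      show "convex (convex_cone hull {v})" by (rule convex_convex_cone_hull)
      have aux: "a \<in> convex_cone hull {v}"
        if "a \<in> K" "b \<in> K" "x \<in> convex_cone hull {v}" "x \<in> open_segment a b" for a b x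
      proof -
        obtain u where u: "0 < u" "u < 1" "x = (1 - u) *\<^sub>R a + u *\<^sub>R b"
          using \<open>x \<in> open_segment a b\<close> by (auto simp: in_segment)
        obtain l where l: "x = l *\<^sub>R v" "0 \<le> l" using \<open>x \<in> convex_cone hull {v}\<close> ray by auto
        obtain \<alpha> a' where a: "0 \<le> \<alpha>" "a' \<in> L" "a = \<alpha> *\<^sub>R v + a'" using dec \<open>a \<in> K\<close> by blast
        obtain \<beta> b' where b: "0 \<le> \<beta>" "b' \<in> L" "b = \<beta> *\<^sub>R v + b'" using dec \<open>b \<in> K\<close> by blast
        define \<mu> where "\<mu> = l - (1 - u) * \<alpha> - u * \<beta>"
        define c where "c = (1 - u) *\<^sub>R a' + u *\<^sub>R b'"
        have c: "c = \<mu> *\<^sub>R v"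
          using u(3) l(1) a(3) b(3) unfolding c_def \<mu>_def
          by (simp add: algebra_simps)
        have cL: "c \<in> L"
          unfolding c_def L_def using u a(2) b(2)
          by (auto simp: L_def intro!: convex_cone_hull_add convex_cone_hull_mul)
        have mu: "\<mu> \<le> 0"
        proof (rule ccontr)
          assume "\<not> \<mu> \<le> 0"
          then have "v = (1 / \<mu>) *\<^sub>R c" "1 / \<mu> \<ge> 0" using c by auto
          then have "v \<in> L" using cL unfolding L_def by (metis convex_cone_hull_mul)
          then show False using vL by simp
        qed
        have "- c \<in> K"
          using convex_cone_scaleR[OF cc _ vs, of "- \<mu>"] mu c by simp
        then have "c = 0" using pt cL Ls by blast
        moreover have "(1 - u) *\<^sub>R a' \<in> K" "u *\<^sub>R b' \<in> K"
          using a b u Ls cc by (auto intro!: convex_cone_scaleR)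
        ultimately have "(1 - u) *\<^sub>R a' = 0"
          using pt[of "(1 - u) *\<^sub>R a'"] by (simp add: c_def add_eq_0_iff)
        then have "a' = 0" using u by simp
        then show ?thesis using a ray by auto
      qed
      fix a b x assume *: "a \<in> K" "b \<in> K" "x \<in> convex_cone hull {v}" "x \<in> open_segment a b"
      show "a \<in> convex_cone hull {v}" using aux * by blast
      show "b \<in> convex_cone hull {v}" using aux[of b a x] * by (simp add: open_segment_commute)
    qed
    then show ?thesis using v0 by (auto simp: v_def)
  qed
  then show ?thesis using fin hull by blast
qed

section \<open>Spaces with well-behaved functions\<close>

text \<open>What is used of a prevariety: a sheaf of algebras of functions in which non-vanishing functions
  are invertible and their non-vanishing loci are open. The constructions below preserve this, so
  affineness is needed only where a prevariety is asked for.\<close>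

definition nice :: "('a, 'k::field) fspace => bool"
  where "nice X \<longleftrightarrow> sheaf_of_functions X \<and> (\<forall>U. zopen X U -->
    (\<forall>c. (\<lambda>x. c) \<in> reg X U) \<and>
    (\<forall>f\<in>reg X U. \<forall>g\<in>reg X U. (\<lambda>x. f x + g x) \<in> reg X U \<and> (\<lambda>x. f x * g x) \<in> reg X U) \<and>
    (\<forall>f\<in>reg X U. zopen X {x \<in> U. f x \<noteq> 0} \<and>
      (\<lambda>x. inverse (f x)) \<in> reg X {x \<in> U. f x \<noteq> 0}))"

lemma sheaf_iff:
  assumes "sheaf_of_functions X" "zopen X U"
  shows "f \<in> reg X U \<longleftrightarrow> (\<forall>p\<in>U. \<exists>V. zopen X V \<and> p \<in> V \<and> (\<exists>g\<in>reg X V. \<forall>q\<in>V \<inter> U. f q = g q))"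
proof -
  have "reg X U = reg (induced X (pts X)) U"
    using assms by (auto simp: sheaf_of_functions_def)
  then show ?thesis by (simp add: induced_def)
qed

lemma sheafI:
  assumes "\<And>U f. zopen X U ==>
    (\<And>p. p \<in> U ==> \<exists>V. zopen X V \<and> p \<in> V \<and> (\<exists>g\<in>reg X V. \<forall>q\<in>V \<inter> U. f q = g q)) ==> f \<in> reg X U"
  shows "sheaf_of_functions X"
  unfolding sheaf_of_functions_def
proof (intro allI impI)
  fix U assume U: "zopen X U"
  have "reg (induced X (pts X)) U \<subseteq> reg X U"
    using assms[OF U] by (auto simp: induced_def)
  moreover have "reg X U \<subseteq> reg (induced X (pts X)) U"
    using U by (auto simp: induced_def)
  ultimately show "reg X U = reg (induced X (pts X)) U" by blast
qed

lemma niceI: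
  assumes "\<And>U f. zopen X U ==>
    (\<And>p. p \<in> U ==> \<exists>V. zopen X V \<and> p \<in> V \<and> (\<exists>g\<in>reg X V. \<forall>q\<in>V \<inter> U. f q = g q)) ==> f \<in> reg X U"
    and "\<And>U c. zopen X U ==> (\<lambda>x. c) \<in> reg X U"
    and "\<And>U f g. zopen X U ==> f \<in> reg X U ==> g \<in> reg X U ==> (\<lambda>x. f x + g x) \<in> reg X U"
    and "\<And>U f g. zopen X U ==> f \<in> reg X U ==> g \<in> reg X U ==> (\<lambda>x. f x * g x) \<in> reg X U"
    and "\<And>U f. zopen X U ==> f \<in> reg X U ==> zopen X {x \<in> U. f x \<noteq> 0}"
    and "\<And>U f. zopen X U ==> f \<in> reg X U ==> (\<lambda>x. inverse (f x)) \<in> reg X {x \<in> U. f x \<noteq> 0}"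
  shows "nice X"
  unfolding nice_def
proof (intro conjI allI impI ballI)
  show "sheaf_of_functions X" by (rule sheafI) (rule assms(1))
qed (rule assms; assumption)+

lemma nice_sheaf: "nice X ==> sheaf_of_functions X"
  by (simp add: nice_def)

context
  fixes X :: "('a, 'k::field) fspace" and U :: "'a set"
  assumes X: "nice X" and U: "zopen X U"
begin

lemma reg_local:
  assumes "\<And>p. p \<in> U ==> \<exists>V g. zopen X V \<and> p \<in> V \<and> g \<in> reg X V \<and> (\<forall>q\<in>V \<inter> U. f q = g q)"
  shows "f \<in> reg X U"
proof (rule sheaf_iff[OF nice_sheaf[OF X] U, THEN iffD2], rule ballI)
  fix p assume "p \<in> U"
  from assms[OF this] obtain V g where "zopen X V" "p \<in> V" "g \<in> reg X V" "\<forall>q\<in>V \<inter> U. f q = g q"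
    by blast
  then show "\<exists>V. zopen X V \<and> p \<in> V \<and> (\<exists>g\<in>reg X V. \<forall>q\<in>V \<inter> U. f q = g q)" by blast
qed

lemma reg_restrict:
  assumes "zopen X V" "f \<in> reg X V" "U \<subseteq> V"
  shows "f \<in> reg X U"
  by (rule reg_local, rule exI[of _ V], rule exI[of _ f]) (use assms in auto)

lemma reg_cong:
  assumes "f \<in> reg X U" "\<And>x. x \<in> U ==> f x = g x"
  shows "g \<in> reg X U"
  by (rule reg_local, rule exI[of _ U], rule exI[of _ f]) (use assms U in auto)

lemma reg_const: "(\<lambda>x. c) \<in> reg X U"
  and reg_add: "f \<in> reg X U ==> g \<in> reg X U ==> (\<lambda>x. f x + g x) \<in> reg X U"
  and reg_mult: "f \<in> reg X U ==> g \<in> reg X U ==> (\<lambda>x. f x * g x) \<in> reg X U"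
  and reg_open: "f \<in> reg X U ==> zopen X {x \<in> U. f x \<noteq> 0}"
  and reg_inverse': "f \<in> reg X U ==> (\<lambda>x. inverse (f x)) \<in> reg X {x \<in> U. f x \<noteq> 0}"
  using X U unfolding nice_def by blast+

lemma reg_inverse:
  assumes "f \<in> reg X U" "\<And>x. x \<in> U ==> f x \<noteq> 0"
  shows "(\<lambda>x. inverse (f x)) \<in> reg X U"
proof -
  have "{x \<in> U. f x \<noteq> 0} = U" using assms by auto
  then show ?thesis using reg_inverse'[OF assms(1)] by simp
qed

lemma reg_uminus: "f \<in> reg X U ==> (\<lambda>x. - f x) \<in> reg X U"
  using reg_mult[OF reg_const[of "-1"]] by simp

lemma reg_diff: "f \<in> reg X U ==> g \<in> reg X U ==> (\<lambda>x. f x - g x) \<in> reg X U"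
  using reg_add[OF _ reg_uminus] by simp

lemma reg_sum: "(\<And>i. i \<in> I ==> f i \<in> reg X U) ==> (\<lambda>x. \<Sum>i\<in>I. f i x) \<in> reg X U"
  by (induction I rule: infinite_finite_induct) (auto intro: reg_const reg_add)

lemma reg_prod: "(\<And>i. i \<in> I ==> f i \<in> reg X U) ==> (\<lambda>x. \<Prod>i\<in>I. f i x) \<in> reg X U"
  by (induction I rule: infinite_finite_induct) (auto intro: reg_const reg_mult)

lemma reg_power: "f \<in> reg X U ==> (\<lambda>x. f x ^ n) \<in> reg X U"
  by (induction n) (auto intro: reg_const reg_mult)

lemma reg_power_int:
  assumes "f \<in> reg X U" "k \<ge> 0 \<or> (\<forall>x\<in>U. f x \<noteq> 0)"
  shows "(\<lambda>x. f x powi k) \<in> reg X U"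
proof (cases "k \<ge> 0")
  case True
  then show ?thesis using reg_power[OF assms(1), of "nat k"] by (simp add: power_int_def)
next
  case False
  then have "\<And>x. x \<in> U ==> f x \<noteq> 0" using assms(2) by blast
  from reg_power[OF reg_inverse[OF assms(1) this], of "nat (- k)"] False
  show ?thesis by (simp add: power_int_def)
qed

lemma reg_divide:
  assumes "f \<in> reg X U" "g \<in> reg X U" "\<And>x. x \<in> U ==> g x \<noteq> 0"
  shows "(\<lambda>x. f x / g x) \<in> reg X U"
  using reg_mult[OF assms(1) reg_inverse[OF assms(2,3)]] by (simp add: divide_inverse)

end

subsection \<open>Spaces of local fractions\<close>

definition function_algebra :: "('a => 'k::field) set => bool"
  where "function_algebra A \<longleftrightarrow> (\<forall>c. (\<lambda>x. c) \<in> A) \<and>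
    (\<forall>f\<in>A. \<forall>g\<in>A. (\<lambda>x. f x + g x) \<in> A \<and> (\<lambda>x. f x * g x) \<in> A)"

text \<open>The common shape of maximal spectra and of products: a family of pairs of a point set and an
  algebra of functions on it, compatible with intersections.\<close>

definition fraction_space :: "('a, 'k::field) fspace => ('a set \<times> ('a => 'k) set) set => bool"
  where "fraction_space X B \<longleftrightarrow>
    (\<forall>(D, A)\<in>B. function_algebra A) \<and>
    (\<forall>(D, A)\<in>B. \<forall>(D', A')\<in>B. \<exists>A''. (D \<inter> D', A'') \<in> B \<and> A \<subseteq> A'' \<and> A' \<subseteq> A'') \<and>
    (\<forall>W. zopen X W \<longleftrightarrow>
      (\<forall>p\<in>W. \<exists>D A h. (D, A) \<in> B \<and> h \<in> A \<and> p \<in> D \<and> h p \<noteq> 0 \<and> (\<forall>q\<in>D. h q \<noteq> 0 --> q \<in> W))) \<and>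
    (\<forall>W f. zopen X W --> (f \<in> reg X W \<longleftrightarrow>
      (\<forall>p\<in>W. \<exists>D A g h. (D, A) \<in> B \<and> g \<in> A \<and> h \<in> A \<and> p \<in> D \<and> h p \<noteq> 0 \<and>
        (\<forall>q\<in>D. h q \<noteq> 0 --> q \<in> W \<and> f q = g q / h q))))"

lemma fraction_space_nice:
  assumes "fraction_space X B"
  shows "nice X"
proof -
  note fs = assms[unfolded fraction_space_def]
  have A: "function_algebra A" if "(D, A) \<in> B" for D A
    using fs[THEN conjunct1] that by auto
  have alg: "(\<lambda>x. c) \<in> A" "f \<in> A ==> g \<in> A ==> (\<lambda>x. f x + g x) \<in> A"
     "f \<in> A ==> g \<in> A ==> (\<lambda>x. f x * g x) \<in> A" if "(D, A) \<in> B" for D A f g c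
    using A[OF that] by (simp_all add: function_algebra_def)
  have int: "\<exists>A''. (D \<inter> D', A'') \<in> B \<and> A \<subseteq> A'' \<and> A' \<subseteq> A''" if "(D, A) \<in> B" "(D', A') \<in> B" for D A D' A'
    using fs[THEN conjunct2, THEN conjunct1] that by (auto 0 3)
  note op = fs[THEN conjunct2, THEN conjunct2, THEN conjunct1, rule_format]
  note rg = fs[THEN conjunct2, THEN conjunct2, THEN conjunct2, rule_format]
  have neigh: "\<exists>D A g h. (D, A) \<in> B \<and> g \<in> A \<and> h \<in> A \<and> p \<in> D \<and> h p \<noteq> 0 \<and>
        (\<forall>q\<in>D. h q \<noteq> 0 --> q \<in> W \<and> f q = g q / h q)" if "zopen X W" "f \<in> reg X W" "p \<in> W" for W f p
    using rg[OF that(1), of f] that(2,3) by simp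
  have nb: "\<exists>D A h. (D, A) \<in> B \<and> h \<in> A \<and> p \<in> D \<and> h p \<noteq> 0 \<and> (\<forall>q\<in>D. h q \<noteq> 0 --> q \<in> W)"
    if "zopen X W" "p \<in> W" for W p
    using op[of W] that by simp
  have common: "\<exists>D A f1 f2 h. (D, A) \<in> B \<and> f1 \<in> A \<and> f2 \<in> A \<and> h \<in> A \<and> p \<in> D \<and> h p \<noteq> 0 \<and>
        (\<forall>q\<in>D. h q \<noteq> 0 --> q \<in> W \<inter> W' \<and> f q = f1 q / h q \<and> g q = f2 q / h q)"
    if W: "zopen X W" "f \<in> reg X W" "p \<in> W" "zopen X W'" "g \<in> reg X W'" "p \<in> W'" for W W' f g p
  proof -
    obtain D A g1 h1 where 1: "(D, A) \<in> B" "g1 \<in> A" "h1 \<in> A" "p \<in> D" "h1 p \<noteq> 0"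
      "\<And>q. q \<in> D ==> h1 q \<noteq> 0 ==> q \<in> W \<and> f q = g1 q / h1 q"
      using neigh[OF W(1-3)] by blast
    obtain D' A' g2 h2 where 2: "(D', A') \<in> B" "g2 \<in> A'" "h2 \<in> A'" "p \<in> D'" "h2 p \<noteq> 0"
      "\<And>q. q \<in> D' ==> h2 q \<noteq> 0 ==> q \<in> W' \<and> g q = g2 q / h2 q"
      using neigh[OF W(4-6)] by blast
    obtain A'' where A'': "(D \<inter> D', A'') \<in> B" "A \<subseteq> A''" "A' \<subseteq> A''" using int 1(1) 2(1) by blast
    have "(\<lambda>x. g1 x * h2 x) \<in> A''" "(\<lambda>x. g2 x * h1 x) \<in> A''" "(\<lambda>x. h1 x * h2 x) \<in> A''"
      using 1 2 A'' alg(3)[OF A''(1)] by blast+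
    moreover have "q \<in> W \<inter> W' \<and> f q = (g1 q * h2 q) / (h1 q * h2 q) \<and> g q = (g2 q * h1 q) / (h1 q * h2 q)"
      if "q \<in> D \<inter> D'" "h1 q * h2 q \<noteq> 0" for q
      using 1(6)[of q] 2(6)[of q] that by (auto simp: field_simps)
    ultimately show ?thesis
      using 1 2 A''(1)
      by (intro exI[of _ "D \<inter> D'"] exI[of _ A''] exI[of _ "\<lambda>x. g1 x * h2 x"] exI[of _ "\<lambda>x. g2 x * h1 x"]
          exI[of _ "\<lambda>x. h1 x * h2 x"]) auto
  qed
  have cst: "(\<lambda>x. c) \<in> reg X W" if W: "zopen X W" for W c
  proof (rule rg[OF W, THEN iffD2], rule ballI)
    fix p assume "p \<in> W"
    then obtain D A h where h: "(D, A) \<in> B" "h \<in> A" "p \<in> D" "h p \<noteq> 0" "\<And>q. q \<in> D ==> h q \<noteq> 0 ==> q \<in> W"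
      using nb[OF W \<open>p \<in> W\<close>] by blast
    have "(\<lambda>x. c * h x) \<in> A" using alg[OF h(1)] h(2) by blast
    then show "\<exists>D A g h. (D, A) \<in> B \<and> g \<in> A \<and> h \<in> A \<and> p \<in> D \<and> h p \<noteq> 0 \<and>
        (\<forall>q\<in>D. h q \<noteq> 0 --> q \<in> W \<and> c = g q / h q)"
      using h by (intro exI[of _ D] exI[of _ A] exI[of _ "\<lambda>x. c * h x"] exI[of _ h]) auto
  qed
  show ?thesis
  proof (rule niceI)
    fix U c assume U: "zopen X U"
    show "(\<lambda>x. c) \<in> reg X U" using cst U by blast
    { fix f assume loc: "\<And>p. p \<in> U ==> \<exists>V. zopen X V \<and> p \<in> V \<and> (\<exists>g\<in>reg X V. \<forall>q\<in>V \<inter> U. f q = g q)"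
      show "f \<in> reg X U"
      proof (rule rg[OF U, THEN iffD2], rule ballI)
        fix p assume p: "p \<in> U"
        from loc[OF p] obtain V g where V: "zopen X V" "p \<in> V" "g \<in> reg X V" "\<forall>q\<in>V \<inter> U. f q = g q"
          by blast
        obtain D A f1 f2 h where "(D, A) \<in> B" "f1 \<in> A" "f2 \<in> A" "h \<in> A" "p \<in> D" "h p \<noteq> 0"
          "\<forall>q\<in>D. h q \<noteq> 0 --> q \<in> V \<inter> U \<and> g q = f1 q / h q \<and> 0 = f2 q / h q"
          using common[OF V(1,3,2) U cst[OF U, of 0] p]
          by (elim exE conjE) (rule that)
        then show "\<exists>D A g h. (D, A) \<in> B \<and> g \<in> A \<and> h \<in> A \<and> p \<in> D \<and> h p \<noteq> 0 \<and>
          (\<forall>q\<in>D. h q \<noteq> 0 --> q \<in> U \<and> f q = g q / h q)"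
          using V(4) by (intro exI[of _ D] exI[of _ A] exI[of _ f1] exI[of _ h]) auto
      qed }
    { fix f g assume fg: "f \<in> reg X U" "g \<in> reg X U"
      have "(\<lambda>x. f x + g x) \<in> reg X U \<and> (\<lambda>x. f x * g x) \<in> reg X U"
        unfolding rg[OF U]
      proof (intro conjI ballI)
        fix p assume p: "p \<in> U"
        obtain D A f1 f2 h where *: "(D, A) \<in> B" "f1 \<in> A" "f2 \<in> A" "h \<in> A" "p \<in> D" "h p \<noteq> 0"
          "\<forall>q\<in>D. h q \<noteq> 0 --> q \<in> U \<inter> U \<and> f q = f1 q / h q \<and> g q = f2 q / h q"
          using common[OF U fg(1) p U fg(2) p]
          by (elim exE conjE) (rule that)
        show "\<exists>D A k h. (D, A) \<in> B \<and> k \<in> A \<and> h \<in> A \<and> p \<in> D \<and> h p \<noteq> 0 \<and>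
          (\<forall>q\<in>D. h q \<noteq> 0 --> q \<in> U \<and> f q + g q = k q / h q)"
          using * alg(2)[OF *(1,2,3)]
          by (intro exI[of _ D] exI[of _ A] exI[of _ "\<lambda>x. f1 x + f2 x"] exI[of _ h])
            (auto simp: add_divide_distrib)
        show "\<exists>D A k h. (D, A) \<in> B \<and> k \<in> A \<and> h \<in> A \<and> p \<in> D \<and> h p \<noteq> 0 \<and>
          (\<forall>q\<in>D. h q \<noteq> 0 --> q \<in> U \<and> f q * g q = k q / h q)"
          using * alg(3)[OF *(1,2,3)] alg(3)[OF *(1,4,4)]
          by (intro exI[of _ D] exI[of _ A] exI[of _ "\<lambda>x. f1 x * f2 x"] exI[of _ "\<lambda>x. h x * h x"]) auto
      qed
      then show "(\<lambda>x. f x + g x) \<in> reg X U" "(\<lambda>x. f x * g x) \<in> reg X U" by blast+ }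
    { fix f assume f: "f \<in> reg X U"
      have *: "\<exists>D A k h. (D, A) \<in> B \<and> k \<in> A \<and> h \<in> A \<and> p \<in> D \<and> h p \<noteq> 0 \<and>
          (\<forall>q\<in>D. h q \<noteq> 0 --> q \<in> {x \<in> U. f x \<noteq> 0} \<and> inverse (f q) = k q / h q)"
        if p: "p \<in> {x \<in> U. f x \<noteq> 0}" for p
      proof -
        obtain D A g h where h: "(D, A) \<in> B" "g \<in> A" "h \<in> A" "p \<in> D" "h p \<noteq> 0"
           "\<forall>q\<in>D. h q \<noteq> 0 --> q \<in> U \<and> f q = g q / h q"
          using neigh[OF U f, of p] p by blast
        have "g p * h p \<noteq> 0" using h p by auto
        moreover have "q \<in> {x \<in> U. f x \<noteq> 0} \<and> inverse (f q) = (h q * h q) / (g q * h q)"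
          if "q \<in> D" "g q * h q \<noteq> 0" for q
          using h(6) that by auto
        ultimately show ?thesis
          using h alg(3)[OF h(1,2,3)] alg(3)[OF h(1,3,3)]
          by (intro exI[of _ D] exI[of _ A] exI[of _ "\<lambda>x. h x * h x"] exI[of _ "\<lambda>x. g x * h x"]) auto
      qed
      show op': "zopen X {x \<in> U. f x \<noteq> 0}"
      proof (rule op[THEN iffD2], rule ballI)
        fix p assume "p \<in> {x \<in> U. f x \<noteq> 0}"
        from *[OF this] show "\<exists>D A h. (D, A) \<in> B \<and> h \<in> A \<and> p \<in> D \<and> h p \<noteq> 0 \<and>
          (\<forall>q\<in>D. h q \<noteq> 0 --> q \<in> {x \<in> U. f x \<noteq> 0})"
          by meson
      qed
      show "(\<lambda>x. inverse (f x)) \<in> reg X {x \<in> U. f x \<noteq> 0}"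
        by (rule rg[OF op', THEN iffD2], rule ballI, rule *) }
  qed
qed

lemma openin_generated_by_basis:
  assumes "\<And>a b. a \<in> S ==> b \<in> S ==> a \<inter> b \<in> S"
  shows "openin (topology_generated_by S) W \<longleftrightarrow> (\<forall>p\<in>W. \<exists>b\<in>S. p \<in> b \<and> b \<subseteq> W)"
  unfolding openin_topology_generated_by_iff
proof
  assume "generate_topology_on S W"
  then show "\<forall>p\<in>W. \<exists>b\<in>S. p \<in> b \<and> b \<subseteq> W"
  proof induction
    case (Int a b)
    show ?case
    proof
      fix p assume "p \<in> a \<inter> b"
      then obtain c d where "c \<in> S" "p \<in> c" "c \<subseteq> a" "d \<in> S" "p \<in> d" "d \<subseteq> b" using Int by blast
      then show "\<exists>e\<in>S. p \<in> e \<and> e \<subseteq> a \<inter> b" using assms[of c d] by blast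
    qed
  next
    case (UN K)
    then show ?case by (meson UnionE Union_upper order_trans)
  qed auto
next
  assume *: "\<forall>p\<in>W. \<exists>b\<in>S. p \<in> b \<and> b \<subseteq> W"
  have "W = \<Union>{b\<in>S. b \<subseteq> W}" using * by blast
  moreover have "generate_topology_on S (\<Union>{b\<in>S. b \<subseteq> W})"
    by (rule generate_topology_on.UN) (auto intro: generate_topology_on.Basis)
  ultimately show "generate_topology_on S W" by simp
qed

lemma mspec_openin:
  assumes "function_algebra A"
  shows "zopen (mspec V A) W \<longleftrightarrow> (\<forall>p\<in>W. \<exists>h\<in>A. p \<in> V \<and> h p \<noteq> 0 \<and> (\<forall>q\<in>V. h q \<noteq> 0 --> q \<in> W))"
proof -
  have "\<exists>h\<in>A. {x \<in> V. f x \<noteq> 0} \<inter> {x \<in> V. g x \<noteq> 0} = {x \<in> V. h x \<noteq> 0}" if "f \<in> A" "g \<in> A" for f g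
    using assms that unfolding function_algebra_def by (intro bexI[of _ "\<lambda>x. f x * g x"]) auto
  then have "zopen (mspec V A) W \<longleftrightarrow> (\<forall>p\<in>W. \<exists>b\<in>((\<lambda>h. {x \<in> V. h x \<noteq> 0}) ` A). p \<in> b \<and> b \<subseteq> W)"
    unfolding mspec_def Let_def fspace.select_convs
    by (subst openin_generated_by_basis) (auto simp: image_iff)
  also have "\<dots> \<longleftrightarrow> (\<forall>p\<in>W. \<exists>h\<in>A. p \<in> V \<and> h p \<noteq> 0 \<and> (\<forall>q\<in>V. h q \<noteq> 0 --> q \<in> W))"
    by (intro ball_cong refl) auto
  finally show ?thesis .
qed

lemma mspec_pts:
  assumes "function_algebra A"
  shows "pts (mspec V A) = V"
proof -
  have "(\<lambda>x. 1) \<in> A" using assms by (simp add: function_algebra_def)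
  then show ?thesis unfolding mspec_def Let_def by auto
qed

lemma mspec_reg:
  assumes A: "function_algebra A" and U: "zopen (mspec V A) U"
  shows "f \<in> reg (mspec V A) U \<longleftrightarrow>
    (\<forall>p\<in>U. \<exists>g\<in>A. \<exists>h\<in>A. p \<in> V \<and> h p \<noteq> 0 \<and> (\<forall>q\<in>V. h q \<noteq> 0 --> q \<in> U \<and> f q = g q / h q))" (is "_ \<longleftrightarrow> ?R")
proof
  let ?T = "zar (mspec V A)"
  have rg: "f \<in> reg (mspec V A) U \<longleftrightarrow> (\<forall>x\<in>U. \<exists>W. openin ?T W \<and> x \<in> W \<and>
                     (\<exists>g\<in>A. \<exists>h\<in>A. \<forall>y\<in>W \<inter> U. h y \<noteq> 0 \<and> f y = g y / h y))"
    by (simp add: mspec_def Let_def)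
  { assume "f \<in> reg (mspec V A) U"
    show ?R
    proof
      fix p assume p: "p \<in> U"
      then obtain W g h where W: "openin ?T W" "p \<in> W" "g \<in> A" "h \<in> A" "\<forall>y\<in>W \<inter> U. h y \<noteq> 0 \<and> f y = g y / h y"
        using rg \<open>f \<in> reg (mspec V A) U\<close> by blast
      have "openin ?T (W \<inter> U)" using W U by blast
      then obtain k where k: "k \<in> A" "p \<in> V" "k p \<noteq> 0" "\<forall>q\<in>V. k q \<noteq> 0 --> q \<in> W \<inter> U"
        using p W(2) unfolding mspec_openin[OF A] by blast
      have "(\<lambda>x. g x * k x) \<in> A" "(\<lambda>x. h x * k x) \<in> A"
        using A W k by (auto simp: function_algebra_def)
      then show "\<exists>g\<in>A. \<exists>h\<in>A. p \<in> V \<and> h p \<noteq> 0 \<and> (\<forall>q\<in>V. h q \<noteq> 0 --> q \<in> U \<and> f q = g q / h q)"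
        using W k p by (intro bexI[of _ "\<lambda>x. g x * k x"] bexI[of _ "\<lambda>x. h x * k x"]) auto
    qed }
  assume R: ?R
  show "f \<in> reg (mspec V A) U"
    unfolding rg
  proof
    fix p assume "p \<in> U"
    then obtain g h where h: "g \<in> A" "h \<in> A" "p \<in> V" "h p \<noteq> 0" "\<forall>q\<in>V. h q \<noteq> 0 --> q \<in> U \<and> f q = g q / h q"
      using R by blast
    then show "\<exists>W. openin ?T W \<and> p \<in> W \<and> (\<exists>g\<in>A. \<exists>h\<in>A. \<forall>y\<in>W \<inter> U. h y \<noteq> 0 \<and> f y = g y / h y)"
      by (intro exI[of _ "{q \<in> V. h q \<noteq> 0}"]) (auto simp: mspec_openin[OF A])
  qed
qed

lemma mspec_nice:
  assumes "function_algebra A"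
  shows "nice (mspec V A)"
proof (rule fraction_space_nice)
  show "fraction_space (mspec V A) {(V, A)}"
    unfolding fraction_space_def
  proof (intro conjI)
    show "\<forall>W. zopen (mspec V A) W \<longleftrightarrow>
      (\<forall>p\<in>W. \<exists>D A' h. (D, A') \<in> {(V, A)} \<and> h \<in> A' \<and> p \<in> D \<and> h p \<noteq> 0 \<and> (\<forall>q\<in>D. h q \<noteq> 0 --> q \<in> W))"
      unfolding mspec_openin[OF assms] by (intro allI ball_cong refl) auto
    show "\<forall>W f. zopen (mspec V A) W --> (f \<in> reg (mspec V A) W \<longleftrightarrow>
      (\<forall>p\<in>W. \<exists>D A' g h. (D, A') \<in> {(V, A)} \<and> g \<in> A' \<and> h \<in> A' \<and> p \<in> D \<and> h p \<noteq> 0 \<and>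
        (\<forall>q\<in>D. h q \<noteq> 0 --> q \<in> W \<and> f q = g q / h q)))"
      by (intro allI impI, subst mspec_reg[OF assms], assumption, intro ball_cong refl) auto
  qed (use assms in auto)
qed

lemma mspec_algebra_reg:
  assumes "function_algebra A" "g \<in> A" "zopen (mspec V A) U"
  shows "g \<in> reg (mspec V A) U"
proof -
  have "(\<lambda>x. 1) \<in> A" using assms by (simp add: function_algebra_def)
  have op: "zopen (mspec V A) V"
    using openin_topspace[of "zar (mspec V A)"] mspec_pts[OF assms(1), of V] by simp
  have "g \<in> reg (mspec V A) V"
    by (rule mspec_reg[OF assms(1) op, THEN iffD2], rule ballI, rule bexI[of _ g], rule bexI[of _ "\<lambda>x. 1"])
      (use assms(2) \<open>(\<lambda>x. 1) \<in> A\<close> in auto)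
  then show ?thesis
    by (rule reg_restrict[OF mspec_nice[OF assms(1)] assms(3) op])
      (use openin_subset[OF assms(3)] mspec_pts[OF assms(1), of V] in simp)
qed

subsection \<open>Products\<close>

lemma tensor_fun_single:
  "a \<in> reg X U ==> b \<in> reg Y V ==> (\<lambda>(x, y). a x * b y) \<in> tensor_fun X Y U V"
  unfolding tensor_fun_def
  by (rule CollectI, rule exI[of _ 1], rule exI[of _ "\<lambda>_. a"], rule exI[of _ "\<lambda>_. b"]) auto

lemma tensor_fun_add:
  assumes "f \<in> tensor_fun X Y U V" "g \<in> tensor_fun X Y U V"
  shows "(\<lambda>p. f p + g p) \<in> tensor_fun X Y U V"
proof -
  obtain r a b where f: "\<forall>i<r. a i \<in> reg X U \<and> b i \<in> reg Y V" "f = (\<lambda>(x, y). \<Sum>i<(r::nat). a i x * b i y)"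
    using assms(1) unfolding tensor_fun_def by blast
  obtain r' a' b' where g: "\<forall>i<r'. a' i \<in> reg X U \<and> b' i \<in> reg Y V" "g = (\<lambda>(x, y). \<Sum>i<(r'::nat). a' i x * b' i y)"
    using assms(2) unfolding tensor_fun_def by blast
  define a'' where "a'' i = (if i < r then a i else a' (i - r))" for i
  define b'' where "b'' i = (if i < r then b i else b' (i - r))" for i
  have split: "(\<Sum>i<r + r'. F i) = (\<Sum>i<r. F i) + (\<Sum>i<r'. F (r + i))" for F :: "nat => 'c"
    using sum.atLeastLessThan_concat[of 0 r "r + r'" F] sum.shift_bounds_nat_ivl[of F 0 r r']
    by (simp add: lessThan_atLeast0 add.commute)
  have "\<forall>i<r + r'. a'' i \<in> reg X U \<and> b'' i \<in> reg Y V"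
    using f(1) g(1) by (auto simp: a''_def b''_def)
  moreover have "(\<lambda>p. f p + g p) = (\<lambda>(x, y). \<Sum>i<r + r'. a'' i x * b'' i y)"
    unfolding f(2) g(2) split by (auto simp: a''_def b''_def fun_eq_iff)
  ultimately show ?thesis unfolding tensor_fun_def by blast
qed

lemma tensor_fun_induct [consumes 1, case_names zero single add]:
  assumes "f \<in> tensor_fun X Y U V"
    and z: "P (\<lambda>p. 0)"
    and single: "\<And>a b. a \<in> reg X U ==> b \<in> reg Y V ==> P (\<lambda>(x, y). a x * b y)"
    and add: "\<And>f g. P f ==> P g ==> P (\<lambda>p. f p + g p)"
  shows "P f"
proof -
  obtain r a b where f: "\<forall>i<r. a i \<in> reg X U \<and> b i \<in> reg Y V" "f = (\<lambda>(x, y). \<Sum>i<(r::nat). a i x * b i y)"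
    using assms(1) unfolding tensor_fun_def by blast
  have "P (\<lambda>(x, y). \<Sum>i<s. a i x * b i y)" if "s \<le> r" for s
    using that
  proof (induction s)
    case 0
    then show ?case using z by (simp add: case_prod_beta')
  next
    case (Suc s)
    then have "P (\<lambda>(x, y). \<Sum>i<s. a i x * b i y)" "P (\<lambda>(x, y). a s x * b s y)"
      using f(1) single by auto
    from add[OF this] show ?case by (simp add: case_prod_beta')
  qed
  then show ?thesis using f(2) by blast
qed

lemma tensor_fun_zero: "(\<lambda>p. 0) \<in> tensor_fun X Y U V"
  unfolding tensor_fun_def by (rule CollectI, rule exI[of _ 0]) auto

lemma tensor_fun_mult:
  assumes X: "nice X" "zopen X U" and Y: "nice Y" "zopen Y V"
    and f: "f \<in> tensor_fun X Y U V" and g: "g \<in> tensor_fun X Y U V"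
  shows "(\<lambda>p. f p * g p) \<in> tensor_fun X Y U V"
  using f
proof (induction rule: tensor_fun_induct)
  case zero
  show ?case using tensor_fun_zero by simp
next
  case (single a b)
  show ?case using g
  proof (induction rule: tensor_fun_induct)
    case zero
    show ?case using tensor_fun_zero by simp
  next
    case (single a' b')
    from tensor_fun_single[OF reg_mult[OF X \<open>a \<in> _\<close> single(1)] reg_mult[OF Y \<open>b \<in> _\<close> single(2)]]
    show ?case by (simp add: case_prod_beta' mult_ac)
  next
    case (add f g)
    from tensor_fun_add[OF this] show ?case by (simp add: case_prod_beta' algebra_simps)
  qed
next
  case (add f g)
  from tensor_fun_add[OF this] show ?case by (simp add: algebra_simps)
qed

lemma tensor_fun_algebra:
  assumes X: "nice X" "zopen X U" and Y: "nice Y" "zopen Y V"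
  shows "function_algebra (tensor_fun X Y U V)"
proof -
  have "(\<lambda>p. c) \<in> tensor_fun X Y U V" for c
    using tensor_fun_single[OF reg_const[OF X, of c] reg_const[OF Y, of 1]] by (simp add: case_prod_beta')
  then show ?thesis
    unfolding function_algebra_def using tensor_fun_add tensor_fun_mult[OF X Y] by blast
qed

lemma tensor_fun_restrict:
  assumes X: "nice X" "zopen X U" "zopen X U'" "U' \<subseteq> U"
    and Y: "nice Y" "zopen Y V" "zopen Y V'" "V' \<subseteq> V"
  shows "tensor_fun X Y U V \<subseteq> tensor_fun X Y U' V'"
proof
  fix f assume "f \<in> tensor_fun X Y U V"
  then show "f \<in> tensor_fun X Y U' V'"
    by (induction rule: tensor_fun_induct)
      (auto intro!: tensor_fun_zero tensor_fun_add tensor_fun_single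
        reg_restrict[OF X(1,3,2) _ X(4)] reg_restrict[OF Y(1,3,2) _ Y(4)])
qed

context
  fixes X :: "('a, 'k::field) fspace" and Y :: "('b, 'k) fspace"
  assumes X: "nice X" and Y: "nice Y"
begin

lemma fprod_openin:
  "zopen (fprod X Y) W \<longleftrightarrow> (\<forall>p\<in>W. \<exists>U V. zopen X U \<and> zopen Y V \<and>
    (\<exists>h\<in>tensor_fun X Y U V. p \<in> U \<times> V \<and> h p \<noteq> 0 \<and> (\<forall>q\<in>U \<times> V. h q \<noteq> 0 --> q \<in> W)))"
proof -
  let ?S = "{{p \<in> U \<times> V. h p \<noteq> 0} |U V h.
          zopen X U \<and> zopen Y V \<and> h \<in> tensor_fun X Y U V}"
  have "a \<inter> b \<in> ?S" if ab: "a \<in> ?S" "b \<in> ?S" for a b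
  proof -
    obtain U V h where a: "a = {p \<in> U \<times> V. h p \<noteq> 0}" "zopen X U" "zopen Y V" "h \<in> tensor_fun X Y U V"
      using ab(1) by blast
    obtain U' V' h' where b: "b = {p \<in> U' \<times> V'. h' p \<noteq> 0}" "zopen X U'" "zopen Y V'" "h' \<in> tensor_fun X Y U' V'"
      using ab(2) by blast
    have op: "zopen X (U \<inter> U')" "zopen Y (V \<inter> V')" using a b by auto
    have "h \<in> tensor_fun X Y (U \<inter> U') (V \<inter> V')" "h' \<in> tensor_fun X Y (U \<inter> U') (V \<inter> V')"
      using tensor_fun_restrict[OF X a(2) op(1) _ Y a(3) op(2)] tensor_fun_restrict[OF X b(2) op(1) _ Y b(3) op(2)]
        a(4) b(4) by blast+
    then have M: "(\<lambda>p. h p * h' p) \<in> tensor_fun X Y (U \<inter> U') (V \<inter> V')"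
      using tensor_fun_mult[OF X op(1) Y op(2)] by blast
    have E: "a \<inter> b = {p \<in> (U \<inter> U') \<times> (V \<inter> V'). h p * h' p \<noteq> 0}"
      unfolding a(1) b(1) by auto
    show ?thesis
      by (rule CollectI, rule exI[of _ "U \<inter> U'"], rule exI[of _ "V \<inter> V'"], rule exI[of _ "\<lambda>p. h p * h' p"])
        (intro conjI E op M)
  qed
  then have "zopen (fprod X Y) W \<longleftrightarrow> (\<forall>p\<in>W. \<exists>b\<in>?S. p \<in> b \<and> b \<subseteq> W)"
    unfolding fprod_def fspace.select_convs by (rule openin_generated_by_basis)
  also have "\<dots> \<longleftrightarrow> (\<forall>p\<in>W. \<exists>U V. zopen X U \<and> zopen Y V \<and>
    (\<exists>h\<in>tensor_fun X Y U V. p \<in> U \<times> V \<and> h p \<noteq> 0 \<and> (\<forall>q\<in>U \<times> V. h q \<noteq> 0 --> q \<in> W)))"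
  proof (intro ball_cong refl iffI)
    fix p assume "\<exists>b\<in>?S. p \<in> b \<and> b \<subseteq> W"
    then obtain U V h where "zopen X U" "zopen Y V" "h \<in> tensor_fun X Y U V"
      "p \<in> {p \<in> U \<times> V. h p \<noteq> 0}" "{p \<in> U \<times> V. h p \<noteq> 0} \<subseteq> W" by blast
    then show "\<exists>U V. zopen X U \<and> zopen Y V \<and>
      (\<exists>h\<in>tensor_fun X Y U V. p \<in> U \<times> V \<and> h p \<noteq> 0 \<and> (\<forall>q\<in>U \<times> V. h q \<noteq> 0 --> q \<in> W))"
      by blast
  next
    fix p assume "\<exists>U V. zopen X U \<and> zopen Y V \<and>
      (\<exists>h\<in>tensor_fun X Y U V. p \<in> U \<times> V \<and> h p \<noteq> 0 \<and> (\<forall>q\<in>U \<times> V. h q \<noteq> 0 --> q \<in> W))"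
    then obtain U V h where *: "zopen X U" "zopen Y V" "h \<in> tensor_fun X Y U V"
      "p \<in> {p \<in> U \<times> V. h p \<noteq> 0}" "{p \<in> U \<times> V. h p \<noteq> 0} \<subseteq> W" by blast
    then have "{p \<in> U \<times> V. h p \<noteq> 0} \<in> ?S" by blast
    then show "\<exists>b\<in>?S. p \<in> b \<and> b \<subseteq> W" using * by blast
  qed
  finally show ?thesis .
qed

lemma fprod_times_openin:
  assumes "zopen X U" "zopen Y V"
  shows "zopen (fprod X Y) (U \<times> V)"
  unfolding fprod_openin
proof
  fix p assume "p \<in> U \<times> V"
  then show "\<exists>U' V'. zopen X U' \<and> zopen Y V' \<and>
    (\<exists>h\<in>tensor_fun X Y U' V'. p \<in> U' \<times> V' \<and> h p \<noteq> 0 \<and> (\<forall>q\<in>U' \<times> V'. h q \<noteq> 0 --> q \<in> U \<times> V))"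
    using assms tensor_fun_algebra[OF X assms(1) Y assms(2)]
    by (intro exI[of _ U] exI[of _ V] conjI bexI[of _ "\<lambda>p. 1"]) (auto simp: function_algebra_def)
qed

lemma fprod_pts: "pts (fprod X Y) = pts X \<times> pts Y"
proof
  show "pts X \<times> pts Y \<subseteq> pts (fprod X Y)"
    using fprod_times_openin[OF openin_topspace openin_topspace] openin_subset by blast
  have "zopen (fprod X Y) (pts (fprod X Y))" by simp
  then show "pts (fprod X Y) \<subseteq> pts X \<times> pts Y"
    unfolding fprod_openin using openin_subset[of "zar X"] openin_subset[of "zar Y"] by fast
qed

lemma fprod_reg:
  assumes W: "zopen (fprod X Y) W"
  shows "f \<in> reg (fprod X Y) W \<longleftrightarrow> (\<forall>p\<in>W. \<exists>U V. zopen X U \<and> zopen Y V \<and>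
    (\<exists>g\<in>tensor_fun X Y U V. \<exists>h\<in>tensor_fun X Y U V. p \<in> U \<times> V \<and> h p \<noteq> 0 \<and>
      (\<forall>q\<in>U \<times> V. h q \<noteq> 0 --> q \<in> W \<and> f q = g q / h q)))" (is "_ \<longleftrightarrow> ?R")
proof
  have rg: "f \<in> reg (fprod X Y) W \<longleftrightarrow> (\<forall>p\<in>W. \<exists>U V. zopen X U \<and> zopen Y V \<and> p \<in> U \<times> V \<and>
              (\<exists>g\<in>tensor_fun X Y U V. \<exists>h\<in>tensor_fun X Y U V. h p \<noteq> 0 \<and>
                (\<forall>q\<in>W \<inter> U \<times> V. h q \<noteq> 0 --> f q = g q / h q)))"
    by (simp add: fprod_def)
  { assume ?R
    then show "f \<in> reg (fprod X Y) W" unfolding rg by fast }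
  assume f: "f \<in> reg (fprod X Y) W"
  show ?R
  proof
    fix p assume p: "p \<in> W"
    then obtain U V g h where 1: "zopen X U" "zopen Y V" "p \<in> U \<times> V" "g \<in> tensor_fun X Y U V"
      "h \<in> tensor_fun X Y U V" "h p \<noteq> 0" "\<forall>q\<in>W \<inter> U \<times> V. h q \<noteq> 0 --> f q = g q / h q"
      using bspec[OF f[unfolded rg] p] by (elim exE conjE bexE) (rule that)
    obtain U' V' k where 2: "zopen X U'" "zopen Y V'" "k \<in> tensor_fun X Y U' V'" "p \<in> U' \<times> V'"
      "k p \<noteq> 0" "\<forall>q\<in>U' \<times> V'. k q \<noteq> 0 --> q \<in> W"
      using bspec[OF W[unfolded fprod_openin] p] by (elim exE conjE bexE) (rule that)
    have op: "zopen X (U \<inter> U')" "zopen Y (V \<inter> V')" using 1 2 by auto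
    have "g \<in> tensor_fun X Y (U \<inter> U') (V \<inter> V')" "h \<in> tensor_fun X Y (U \<inter> U') (V \<inter> V')"
       "k \<in> tensor_fun X Y (U \<inter> U') (V \<inter> V')"
      using tensor_fun_restrict[OF X 1(1) op(1) _ Y 1(2) op(2)] tensor_fun_restrict[OF X 2(1) op(1) _ Y 2(2) op(2)]
        1(4,5) 2(3) by blast+
    then have "(\<lambda>p. g p * k p) \<in> tensor_fun X Y (U \<inter> U') (V \<inter> V')" "(\<lambda>p. h p * k p) \<in> tensor_fun X Y (U \<inter> U') (V \<inter> V')"
      using tensor_fun_mult[OF X op(1) Y op(2)] by blast+
    moreover have "q \<in> W \<and> f q = (g q * k q) / (h q * k q)" if "q \<in> (U \<inter> U') \<times> (V \<inter> V')" "h q * k q \<noteq> 0" for q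
      using that 1(7)[rule_format, of q] 2(6)[rule_format, of q] by auto
    moreover have "p \<in> (U \<inter> U') \<times> (V \<inter> V')" "h p * k p \<noteq> 0" using 1 2 by auto
    ultimately show "\<exists>U V. zopen X U \<and> zopen Y V \<and>
      (\<exists>g\<in>tensor_fun X Y U V. \<exists>h\<in>tensor_fun X Y U V. p \<in> U \<times> V \<and> h p \<noteq> 0 \<and>
      (\<forall>q\<in>U \<times> V. h q \<noteq> 0 --> q \<in> W \<and> f q = g q / h q))"
      using op by (intro exI[of _ "U \<inter> U'"] exI[of _ "V \<inter> V'"] conjI
        bexI[of _ "\<lambda>p. g p * k p"] bexI[of _ "\<lambda>p. h p * k p"]) auto
  qed
qed

lemma fprod_nice: "nice (fprod X Y)"
proof (rule fraction_space_nice)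
  let ?B = "{(U \<times> V, tensor_fun X Y U V) |U V. zopen X U \<and> zopen Y V}"
  show "fraction_space (fprod X Y) ?B"
    unfolding fraction_space_def
  proof (intro conjI)
    show "\<forall>(D, A)\<in>?B. function_algebra A" using tensor_fun_algebra[OF X _ Y] by auto
    show "\<forall>(D, A)\<in>?B. \<forall>(D', A')\<in>?B. \<exists>A''. (D \<inter> D', A'') \<in> ?B \<and> A \<subseteq> A'' \<and> A' \<subseteq> A''"
    proof clarify
      fix U V U' V'
      assume o: "zopen X U" "zopen Y V" "zopen X U'" "zopen Y V'"
      have op: "zopen X (U \<inter> U')" "zopen Y (V \<inter> V')" using o by auto
      show "\<exists>A''. (U \<times> V \<inter> U' \<times> V', A'') \<in> ?B \<and> tensor_fun X Y U V \<subseteq> A'' \<and> tensor_fun X Y U' V' \<subseteq> A''"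
        using op tensor_fun_restrict[OF X o(1) op(1) _ Y o(2) op(2)] tensor_fun_restrict[OF X o(3) op(1) _ Y o(4) op(2)]
        by (intro exI[of _ "tensor_fun X Y (U \<inter> U') (V \<inter> V')"]) (auto simp: Times_Int_Times)
    qed
    show "\<forall>W. zopen (fprod X Y) W \<longleftrightarrow>
      (\<forall>p\<in>W. \<exists>D A h. (D, A) \<in> ?B \<and> h \<in> A \<and> p \<in> D \<and> h p \<noteq> 0 \<and> (\<forall>q\<in>D. h q \<noteq> 0 --> q \<in> W))"
      unfolding fprod_openin by (intro allI ball_cong refl) (simp, blast)
    show "\<forall>W f. zopen (fprod X Y) W --> (f \<in> reg (fprod X Y) W \<longleftrightarrow>
      (\<forall>p\<in>W. \<exists>D A g h. (D, A) \<in> ?B \<and> g \<in> A \<and> h \<in> A \<and> p \<in> D \<and> h p \<noteq> 0 \<and>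
        (\<forall>q\<in>D. h q \<noteq> 0 --> q \<in> W \<and> f q = g q / h q)))"
      by (intro allI impI, subst fprod_reg, assumption, intro ball_cong refl) (simp, blast)
  qed
qed

lemma fprod_tensor_reg:
  assumes "zopen X U" "zopen Y V" "h \<in> tensor_fun X Y U V"
  shows "h \<in> reg (fprod X Y) (U \<times> V)"
proof -
  have one: "(\<lambda>p. 1) \<in> tensor_fun X Y U V"
    using tensor_fun_algebra[OF X assms(1) Y assms(2)] by (auto simp: function_algebra_def)
  have *: "\<exists>g\<in>tensor_fun X Y U V. \<exists>k\<in>tensor_fun X Y U V. p \<in> U \<times> V \<and> k p \<noteq> 0 \<and>
      (\<forall>q\<in>U \<times> V. k q \<noteq> 0 --> q \<in> U \<times> V \<and> h q = g q / k q)" if "p \<in> U \<times> V" for p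
    by (rule bexI[of _ h], rule bexI[of _ "\<lambda>p. 1"]) (use that one assms(3) in auto)
  show ?thesis
    using assms(1,2) * by (intro fprod_reg[OF fprod_times_openin[OF assms(1,2)], THEN iffD2] ballI exI[of _ U] exI[of _ V] conjI)
qed

lemma fprod_fst_reg:
  assumes "zopen X U" "zopen Y V" "a \<in> reg X U"
  shows "(\<lambda>p. a (fst p)) \<in> reg (fprod X Y) (U \<times> V)"
  using fprod_tensor_reg[OF assms(1,2) tensor_fun_single[OF assms(3) reg_const[OF Y assms(2), of 1]]]
  by (simp add: case_prod_beta')

lemma fprod_snd_reg:
  assumes "zopen X U" "zopen Y V" "b \<in> reg Y V"
  shows "(\<lambda>p. b (snd p)) \<in> reg (fprod X Y) (U \<times> V)"
  using fprod_tensor_reg[OF assms(1,2) tensor_fun_single[OF reg_const[OF X assms(1), of 1] assms(3)]]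
  by (simp add: case_prod_beta')

lemma tensor_fun_slice:
  assumes "zopen Y V" "h \<in> tensor_fun X Y U V"
  shows "(\<lambda>y. h (x, y)) \<in> reg Y V"
  using assms(2)
  by (induction rule: tensor_fun_induct)
    (auto intro: reg_add[OF Y assms(1)] reg_mult[OF Y assms(1)] reg_const[OF Y assms(1)])

end


subsection \<open>Open subspaces and gluing\<close>

lemma induced_openin: "zopen X S ==> zopen (induced X S) U \<longleftrightarrow> zopen X U \<and> U \<subseteq> S"
  by (simp add: induced_def openin_open_subtopology)

lemma induced_pts: "zopen X S ==> pts (induced X S) = S"
  by (auto simp: induced_def dest: openin_subset)

lemma induced_reg:
  assumes "sheaf_of_functions X" "zopen X U"
  shows "reg (induced X S) U = reg X U"
  using sheaf_iff[OF assms] by (auto simp: induced_def)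

lemma induced_nice:
  assumes X: "nice X" and S: "zopen X S"
  shows "nice (induced X S)"
proof (rule niceI)
  fix U assume "zopen (induced X S) U"
  then have U: "zopen X U" and US: "U \<subseteq> S" using induced_openin[OF S] by auto
  note r = induced_reg[OF nice_sheaf[OF X] U, of S]
  show "(\<lambda>x. c) \<in> reg (induced X S) U" for c unfolding r by (rule reg_const[OF X U])
  show "(\<lambda>x. f x + g x) \<in> reg (induced X S) U" "(\<lambda>x. f x * g x) \<in> reg (induced X S) U"
    if "f \<in> reg (induced X S) U" "g \<in> reg (induced X S) U" for f g
    using that unfolding r by (auto intro: reg_add[OF X U] reg_mult[OF X U])
  show "f \<in> reg (induced X S) U"
    if loc: "\<And>p. p \<in> U ==> \<exists>V. zopen (induced X S) V \<and> p \<in> V \<and> (\<exists>g\<in>reg (induced X S) V. \<forall>q\<in>V \<inter> U. f q = g q)" for f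
    unfolding r
  proof (rule reg_local[OF X U])
    fix p assume "p \<in> U"
    from loc[OF this] obtain V g where V: "zopen (induced X S) V" "p \<in> V" "g \<in> reg (induced X S) V" "\<forall>q\<in>V \<inter> U. f q = g q"
      by blast
    have V': "zopen X V" using V(1) induced_openin[OF S] by auto
    show "\<exists>V g. zopen X V \<and> p \<in> V \<and> g \<in> reg X V \<and> (\<forall>q\<in>V \<inter> U. f q = g q)"
      using V V' induced_reg[OF nice_sheaf[OF X] V', of S] by (intro exI[of _ V] exI[of _ g]) simp
  qed
  show "zopen (induced X S) {x \<in> U. f x \<noteq> 0}"
    "(\<lambda>x. inverse (f x)) \<in> reg (induced X S) {x \<in> U. f x \<noteq> 0}" if "f \<in> reg (induced X S) U" for f
  proof -
    have f: "f \<in> reg X U" using that r by simp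
    show "zopen (induced X S) {x \<in> U. f x \<noteq> 0}"
      using reg_open[OF X U f] US by (auto simp: induced_openin[OF S])
    show "(\<lambda>x. inverse (f x)) \<in> reg (induced X S) {x \<in> U. f x \<noteq> 0}"
      using reg_inverse'[OF X U f] by (simp add: induced_reg[OF nice_sheaf[OF X] reg_open[OF X U f]])
  qed
qed

lemma glue_pts: "pts (glue I C \<phi>) = (\<Union>i\<in>I. \<phi> i ` pts (C i))"
proof -
  have "{y \<in> pts (C i). \<phi> i y \<in> (\<Union>i\<in>I. \<phi> i ` pts (C i))} = pts (C i)" if "i \<in> I" for i
    using that by auto
  then have "zopen (glue I C \<phi>) (\<Union>i\<in>I. \<phi> i ` pts (C i))"
    by (simp add: openin_glue)
  moreover have "pts (glue I C \<phi>) \<subseteq> (\<Union>i\<in>I. \<phi> i ` pts (C i))"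
    using openin_glue[of I C \<phi> "pts (glue I C \<phi>)"] by simp
  ultimately show ?thesis using openin_subset by blast
qed

lemma glue_reg:
  "f \<in> reg (glue I C \<phi>) U \<longleftrightarrow> (\<forall>i\<in>I. f \<circ> \<phi> i \<in> reg (C i) {y \<in> pts (C i). \<phi> i y \<in> U})"
  by (simp add: glue_def)

lemma glue_nice:
  assumes C: "\<And>i. i \<in> I ==> nice (C i)"
  shows "nice (glue I C \<phi>)"
proof (rule niceI)
  let ?X = "glue I C \<phi>"
  define pre where "pre i U = {y \<in> pts (C i). \<phi> i y \<in> U}" for i U
  note rg = glue_reg[of _ I C \<phi>, folded pre_def]
  fix U assume U: "zopen ?X U"
  have pre: "zopen (C i) (pre i V)" if "i \<in> I" "zopen ?X V" for i V
    using that by (simp add: openin_glue pre_def)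
  show "(\<lambda>x. c) \<in> reg ?X U" for c
    unfolding rg o_def using reg_const[OF C pre] U by blast
  show "(\<lambda>x. f x + g x) \<in> reg ?X U" "(\<lambda>x. f x * g x) \<in> reg ?X U"
    if "f \<in> reg ?X U" "g \<in> reg ?X U" for f g
    using that unfolding rg o_def using reg_add[OF C pre] reg_mult[OF C pre] U by blast+
  show "f \<in> reg ?X U"
    if loc: "\<And>p. p \<in> U ==> \<exists>V. zopen ?X V \<and> p \<in> V \<and> (\<exists>g\<in>reg ?X V. \<forall>q\<in>V \<inter> U. f q = g q)" for f
    unfolding rg
  proof
    fix i assume i: "i \<in> I"
    show "f \<circ> \<phi> i \<in> reg (C i) (pre i U)"
    proof (rule reg_local[OF C[OF i] pre[OF i U]])
      fix y assume y: "y \<in> pre i U"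
      then have "\<phi> i y \<in> U" by (simp add: pre_def)
      from loc[OF this] obtain V g where V: "zopen ?X V" "\<phi> i y \<in> V" "g \<in> reg ?X V" "\<forall>q\<in>V \<inter> U. f q = g q"
        by blast
      have "g \<circ> \<phi> i \<in> reg (C i) (pre i V)" using V(3) i by (simp add: rg)
      then show "\<exists>V g. zopen (C i) V \<and> y \<in> V \<and> g \<in> reg (C i) V \<and> (\<forall>q\<in>V \<inter> pre i U. (f \<circ> \<phi> i) q = g q)"
        using pre[OF i V(1)] V(2,4) y by (intro exI[of _ "pre i V"] exI[of _ "g \<circ> \<phi> i"]) (auto simp: pre_def)
    qed
  qed
  show "zopen ?X {x \<in> U. f x \<noteq> 0}"
    "(\<lambda>x. inverse (f x)) \<in> reg ?X {x \<in> U. f x \<noteq> 0}" if "f \<in> reg ?X U" for f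
  proof -
    have eq: "pre i {x \<in> U. f x \<noteq> 0} = {y \<in> pre i U. (f \<circ> \<phi> i) y \<noteq> 0}" for i
      by (auto simp: pre_def)
    have f: "f \<circ> \<phi> i \<in> reg (C i) (pre i U)" if "i \<in> I" for i
      using \<open>f \<in> reg ?X U\<close> that by (simp add: rg)
    have "{x \<in> U. f x \<noteq> 0} \<subseteq> (\<Union>i\<in>I. \<phi> i ` pts (C i))"
      using U by (auto simp: openin_glue)
    moreover have "zopen (C i) (pre i {x \<in> U. f x \<noteq> 0})" if "i \<in> I" for i
      unfolding eq by (rule reg_open[OF C[OF that] pre[OF that U] f[OF that]])
    ultimately show "zopen ?X {x \<in> U. f x \<noteq> 0}"
      unfolding openin_glue pre_def by blast
    have "(\<lambda>x. inverse (f x)) \<circ> \<phi> i \<in> reg (C i) (pre i {x \<in> U. f x \<noteq> 0})" if "i \<in> I" for i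
      unfolding eq using reg_inverse'[OF C[OF that] pre[OF that U] f[OF that]] by (simp add: o_def)
    then show "(\<lambda>x. inverse (f x)) \<in> reg ?X {x \<in> U. f x \<noteq> 0}"
      unfolding rg by blast
  qed
qed

subsection \<open>Morphisms\<close>

lemma morphism_reg:
  "morphism X Y f ==> zopen Y V ==> g \<in> reg Y V ==> g \<circ> f \<in> reg X {x \<in> pts X. f x \<in> V}"
  by (simp add: morphism_def)

lemma morphism_continuous: "morphism X Y f ==> continuous_map (zar X) (zar Y) f"
  by (simp add: morphism_def)

lemma morphism_preimage_open:
  "morphism X Y f ==> zopen Y V ==> zopen X {x \<in> pts X. f x \<in> V}"
  by (blast intro: openin_continuous_map_preimage morphism_continuous)

lemma morphism_pts: "morphism X Y f ==> x \<in> pts X ==> f x \<in> pts Y"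
  by (auto dest: morphism_continuous continuous_map_image_subset_topspace)

lemma morphism_id: "morphism X X (\<lambda>x. x)"
  unfolding morphism_def
proof (intro conjI allI impI)
  show "continuous_map (zar X) (zar X) (\<lambda>x. x)" by simp
  fix V g assume V: "zopen X V" "g \<in> reg X V"
  then have "{x \<in> pts X. x \<in> V} = V" by (auto dest: openin_subset)
  then show "g \<circ> (\<lambda>x. x) \<in> reg X {x \<in> pts X. x \<in> V}" using V by (simp add: o_def)
qed

lemma morphism_compose:
  assumes f: "morphism X Y f" and g: "morphism Y Z g"
  shows "morphism X Z (g \<circ> f)"
  unfolding morphism_def
proof (intro conjI allI impI)
  have cf: "continuous_map (zar X) (zar Y) f" and cg: "continuous_map (zar Y) (zar Z) g"
    using f g by (auto simp: morphism_def)
  then show "continuous_map (zar X) (zar Z) (g \<circ> f)" by (rule continuous_map_compose)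
  fix V h assume V: "zopen Z V" "h \<in> reg Z V"
  have op: "zopen Y {y \<in> pts Y. g y \<in> V}"
    using cg V(1) by (rule openin_continuous_map_preimage)
  have "h \<circ> g \<in> reg Y {y \<in> pts Y. g y \<in> V}" using g V by (simp add: morphism_def)
  then have "h \<circ> g \<circ> f \<in> reg X {x \<in> pts X. f x \<in> {y \<in> pts Y. g y \<in> V}}"
    by (rule morphism_reg[OF f op])
  moreover have "{x \<in> pts X. f x \<in> {y \<in> pts Y. g y \<in> V}} = {x \<in> pts X. (g \<circ> f) x \<in> V}"
    using continuous_map_image_subset_topspace[OF cf] by auto
  ultimately show "h \<circ> (g \<circ> f) \<in> reg X {x \<in> pts X. (g \<circ> f) x \<in> V}" by (simp add: o_assoc)
qed

lemma isomorphic_trans: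
  assumes "isomorphic X Y" "isomorphic Y Z"
  shows "isomorphic X Z"
proof -
  obtain f g where f: "morphism X Y f" "morphism Y X g" "\<forall>x\<in>pts X. g (f x) = x" "\<forall>y\<in>pts Y. f (g y) = y"
    using assms(1) by (auto simp: isomorphic_def)
  obtain f' g' where f': "morphism Y Z f'" "morphism Z Y g'" "\<forall>x\<in>pts Y. g' (f' x) = x" "\<forall>y\<in>pts Z. f' (g' y) = y"
    using assms(2) by (auto simp: isomorphic_def)
  have "f x \<in> pts Y" if "x \<in> pts X" for x
    using f(1) that by (auto simp: morphism_def dest: continuous_map_image_subset_topspace)
  moreover have "g' x \<in> pts Y" if "x \<in> pts Z" for x
    using f'(2) that by (auto simp: morphism_def dest: continuous_map_image_subset_topspace)
  ultimately show ?thesis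
    unfolding isomorphic_def using f f'
    by (intro exI[of _ "f' \<circ> f"] exI[of _ "g \<circ> g'"]) (auto intro: morphism_compose)
qed

lemma morphism_local:
  assumes X: "nice X"
    and loc: "\<And>x. x \<in> pts X ==> \<exists>N. zopen X N \<and> x \<in> N \<and> morphism (induced X N) Y f"
  shows "morphism X Y f"
proof -
  have *: "zopen X {x \<in> pts X. f x \<in> V} \<and> (\<forall>g\<in>reg Y V. g \<circ> f \<in> reg X {x \<in> pts X. f x \<in> V})"
    if V: "zopen Y V" for V
  proof
    let ?P = "{x \<in> pts X. f x \<in> V}"
    have nbh: "\<exists>M. zopen X M \<and> x \<in> M \<and> M \<subseteq> ?P \<and> (\<forall>g\<in>reg Y V. g \<circ> f \<in> reg X M)" if "x \<in> ?P" for x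
    proof -
      from that loc obtain N where N: "zopen X N" "x \<in> N" "morphism (induced X N) Y f" by auto
      define M where "M = {y \<in> pts (induced X N). f y \<in> V}"
      have "zopen (induced X N) M"
        using N(3) V unfolding M_def morphism_def by (blast intro: openin_continuous_map_preimage)
      then have M: "zopen X M" using induced_openin[OF N(1)] by auto
      have "g \<circ> f \<in> reg X M" if "g \<in> reg Y V" for g
        using N(3) V that induced_reg[OF nice_sheaf[OF X] M, of N] unfolding M_def morphism_def by blast
      moreover have "x \<in> M" "M \<subseteq> ?P"
        using that N openin_subset[OF N(1)] by (auto simp: M_def induced_pts)
      ultimately show ?thesis using M by blast
    qed
    show op: "zopen X ?P"
      by (subst openin_subopen) (use nbh in blast)
    show "\<forall>g\<in>reg Y V. g \<circ> f \<in> reg X ?P"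
    proof
      fix g assume g: "g \<in> reg Y V"
      show "g \<circ> f \<in> reg X ?P"
      proof (rule reg_local[OF X op])
        fix p assume "p \<in> ?P"
        from nbh[OF this] g show "\<exists>V h. zopen X V \<and> p \<in> V \<and> h \<in> reg X V \<and> (\<forall>q\<in>V \<inter> ?P. (g \<circ> f) q = h q)"
          by blast
      qed
    qed
  qed
  have "f x \<in> pts Y" if "x \<in> pts X" for x
  proof -
    from loc[OF that] obtain N where N: "zopen X N" "x \<in> N" "morphism (induced X N) Y f" by auto
    then show ?thesis
      by (auto simp: morphism_def induced_pts dest!: continuous_map_image_subset_topspace)
  qed
  then show ?thesis using * by (auto simp: morphism_def continuous_map_def)
qed

lemma morphism_cong:
  assumes X: "nice X" and f: "morphism X Y f" and eq: "\<And>x. x \<in> pts X ==> f x = g x"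
  shows "morphism X Y g"
  unfolding morphism_def
proof (intro conjI allI impI)
  show "continuous_map (zar X) (zar Y) g"
    using f eq by (auto simp: morphism_def intro: continuous_map_eq)
  fix V h assume V: "zopen Y V" "h \<in> reg Y V"
  have e: "{x \<in> pts X. g x \<in> V} = {x \<in> pts X. f x \<in> V}" using eq by auto
  have "zopen X {x \<in> pts X. f x \<in> V}" "h \<circ> f \<in> reg X {x \<in> pts X. f x \<in> V}"
    using f V by (auto simp: morphism_def intro: openin_continuous_map_preimage)
  then show "h \<circ> g \<in> reg X {x \<in> pts X. g x \<in> V}"
    unfolding e by (rule reg_cong[OF X]) (use eq in auto)
qed

lemma morphism_glue_chart:
  assumes "i \<in> I"
  shows "morphism (C i) (glue I C \<phi>) (\<phi> i)"
  unfolding morphism_def continuous_map_def using assms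
  by (auto simp: glue_pts openin_glue glue_reg)

lemma morphism_into_induced:
  assumes X: "nice X" and Y: "nice Y" and S: "zopen Y S"
    and f: "morphism X Y f" and im: "f ` pts X \<subseteq> S"
  shows "morphism X (induced Y S) f"
  unfolding morphism_def
proof (intro conjI allI impI)
  have c: "continuous_map (zar X) (zar Y) f" using f by (simp add: morphism_def)
  then show "continuous_map (zar X) (zar (induced Y S)) f"
    using im by (auto simp: induced_def intro: continuous_map_into_subtopology)
  fix V h assume V: "zopen (induced Y S) V" "h \<in> reg (induced Y S) V"
  have V': "zopen Y V" using V(1) induced_openin[OF S] by auto
  then show "h \<circ> f \<in> reg X {x \<in> pts X. f x \<in> V}"
    using f V(2) induced_reg[OF nice_sheaf[OF Y] V', of S] by (simp add: morphism_def)
qed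

lemma morphism_from_induced:
  assumes X: "nice X" and S: "zopen X S" and f: "morphism X Y f"
  shows "morphism (induced X S) Y f"
  unfolding morphism_def
proof (intro conjI allI impI)
  have c: "continuous_map (zar X) (zar Y) f" using f by (simp add: morphism_def)
  then show "continuous_map (zar (induced X S)) (zar Y) f"
    by (auto simp: induced_def intro: continuous_map_from_subtopology)
  fix V h assume V: "zopen Y V" "h \<in> reg Y V"
  have e: "{x \<in> pts (induced X S). f x \<in> V} = {x \<in> pts X. f x \<in> V} \<inter> S"
    using induced_pts[OF S] openin_subset[OF S] by auto
  have o: "zopen X {x \<in> pts X. f x \<in> V}" using c V by (blast intro: openin_continuous_map_preimage)
  have o': "zopen X ({x \<in> pts X. f x \<in> V} \<inter> S)" using o S by blast
  have "h \<circ> f \<in> reg X {x \<in> pts X. f x \<in> V}" using f V by (simp add: morphism_def)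
  then have "h \<circ> f \<in> reg X ({x \<in> pts X. f x \<in> V} \<inter> S)"
    by (rule reg_restrict[OF X o' o]) blast
  then show "h \<circ> f \<in> reg (induced X S) {x \<in> pts (induced X S). f x \<in> V}"
    unfolding e induced_reg[OF nice_sheaf[OF X] o'] .
qed

lemma morphism_into_mspec:
  assumes X: "nice X" and A: "function_algebra A"
    and im: "\<And>x. x \<in> pts X ==> f x \<in> V" and reg: "\<And>h. h \<in> A ==> (\<lambda>x. h (f x)) \<in> reg X (pts X)"
  shows "morphism X (mspec V A) f"
proof -
  have D: "zopen X {x \<in> pts X. h (f x) \<noteq> 0}" if "h \<in> A" for h
    by (rule reg_open[OF X openin_topspace reg[OF that]])
  have op: "zopen X {x \<in> pts X. f x \<in> W}" if W: "zopen (mspec V A) W" for W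
  proof (subst openin_subopen, rule ballI)
    fix x assume x: "x \<in> {x \<in> pts X. f x \<in> W}"
    then have "f x \<in> W" by simp
    from bspec[OF W[unfolded mspec_openin[OF A]] this]
    obtain h where "h \<in> A" "h (f x) \<noteq> 0" "\<forall>q\<in>V. h q \<noteq> 0 --> q \<in> W" by blast
    then show "\<exists>T. zopen X T \<and> x \<in> T \<and> T \<subseteq> {x \<in> pts X. f x \<in> W}"
      using D[of h] im x by (intro exI[of _ "{x \<in> pts X. h (f x) \<noteq> 0}"]) auto
  qed
  have rg: "k \<circ> f \<in> reg X {x \<in> pts X. f x \<in> W}"
    if W: "zopen (mspec V A) W" and k: "k \<in> reg (mspec V A) W" for W k
  proof (rule reg_local[OF X op[OF W]])
    fix x assume x: "x \<in> {x \<in> pts X. f x \<in> W}"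
    then have fx: "f x \<in> W" by simp
    from bspec[OF k[unfolded mspec_reg[OF A W]] this]
    obtain g h where gh: "g \<in> A" "h \<in> A" "h (f x) \<noteq> 0" "\<forall>q\<in>V. h q \<noteq> 0 --> q \<in> W \<and> k q = g q / h q" by blast
    let ?D = "{x \<in> pts X. h (f x) \<noteq> 0}"
    have "(\<lambda>x. g (f x) / h (f x)) \<in> reg X ?D"
      by (rule reg_divide[OF X D[OF gh(2)]])
        (use reg_restrict[OF X D[OF gh(2)] openin_topspace] reg gh in auto)
    then show "\<exists>V h. zopen X V \<and> x \<in> V \<and> h \<in> reg X V \<and> (\<forall>q\<in>V \<inter> {x \<in> pts X. f x \<in> W}. (k \<circ> f) q = h q)"
      using D[OF gh(2)] x gh(3,4) im
      by (intro exI[of _ ?D] exI[of _ "\<lambda>x. g (f x) / h (f x)"]) auto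
  qed
  show ?thesis
    unfolding morphism_def continuous_map_def using op rg im by (auto simp: mspec_pts[OF A])
qed

subsection \<open>Irreducibility via curves\<close>

lemma range_poly_algebra: "function_algebra (range (poly :: 'k::field poly => _))"
  unfolding function_algebra_def
proof (intro conjI allI ballI)
  show "(\<lambda>x. c) \<in> range poly" for c :: 'k by (rule image_eqI[of _ _ "[:c:]"]) auto
  fix f g :: "'k => 'k" assume "f \<in> range poly" "g \<in> range poly"
  then obtain p q where "f = poly p" "g = poly q" by blast
  then have "(\<lambda>x. f x + g x) = poly (p + q)" "(\<lambda>x. f x * g x) = poly (p * q)" by auto
  then show "(\<lambda>x. f x + g x) \<in> range poly" "(\<lambda>x. f x * g x) \<in> range poly" by simp_all
qed

lemma affine_line_nice: "nice affine_line"
  unfolding affine_line_def by (rule mspec_nice[OF range_poly_algebra])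

lemma affine_line_pts [simp]: "pts affine_line = UNIV"
  unfolding affine_line_def by (rule mspec_pts[OF range_poly_algebra])

lemma affine_line_openin:
  "zopen (affine_line :: ('k::field, 'k) fspace) U \<longleftrightarrow> U = {} \<or> finite (- U)"
proof
  assume U: "zopen (affine_line :: ('k, 'k) fspace) U"
  show "U = {} \<or> finite (- U)"
  proof (cases "U = {}")
    case False
    then obtain x where "x \<in> U" by blast
    from bspec[OF U[unfolded affine_line_def mspec_openin[OF range_poly_algebra]] this]
    obtain p :: "'k poly" where p: "poly p x \<noteq> 0" "\<forall>q. poly p q \<noteq> 0 --> q \<in> U" by auto
    then have "- U \<subseteq> {z. poly p z = 0}" by auto
    moreover have "p \<noteq> 0" using p by auto
    ultimately show ?thesis using poly_roots_finite finite_subset by blast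
  qed simp
next
  assume U: "U = {} \<or> finite (- U)"
  show "zopen (affine_line :: ('k, 'k) fspace) U"
  proof (cases "U = {}")
    case False
    then have fin: "finite (- U)" using U by simp
    show ?thesis
      unfolding affine_line_def mspec_openin[OF range_poly_algebra]
    proof
      fix x assume "x \<in> U"
      then show "\<exists>h\<in>range poly. x \<in> UNIV \<and> h x \<noteq> 0 \<and> (\<forall>q\<in>UNIV. h q \<noteq> 0 --> q \<in> U)"
        using fin by (intro bexI[of _ "poly (\<Prod>a\<in>- U. [:- a, 1:])"]) (auto simp: poly_prod)
    qed
  qed auto
qed

lemma affine_line_poly_reg: "zopen affine_line U ==> poly p \<in> reg affine_line U"
  unfolding affine_line_def by (rule mspec_algebra_reg[OF range_poly_algebra]) auto

lemma affine_line_id_reg: "zopen affine_line U ==> (\<lambda>x. x) \<in> reg affine_line (U :: 'k::field set)"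
proof -
  have "poly [:0, 1 :: 'k:] = (\<lambda>x. x)" by (simp add: fun_eq_iff)
  then show "zopen affine_line U ==> (\<lambda>x. x) \<in> reg affine_line U"
    using affine_line_poly_reg[of U "[:0, 1:]"] by simp
qed

text \<open>Two proper closed subsets of a curve \<open>E\<close>, an open part of the affine line, are finite, so they cannot
  cover it. This replaces dimension theory and coordinate rings in all irreducibility proofs.\<close>

lemma irreducible_if_joined_by_curves:
  fixes X :: "('a, 'k::field_char_0) fspace"
  assumes "C \<noteq> {}" "C \<subseteq> pts X"
    and curves: "\<And>x y. x \<in> C ==> y \<in> C ==> \<exists>E g a b. zopen (affine_line :: ('k, 'k) fspace) E \<and>
      continuous_map (zar (induced affine_line E)) (zar X) g \<and> g ` E \<subseteq> C \<and> a \<in> E \<and> b \<in> E \<and> g a = x \<and> g b = y"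
  shows "irreducible_in (zar X) C"
  unfolding irreducible_in_def
proof (intro conjI allI impI assms(1,2))
  fix A B assume A: "closedin (zar X) A" and B: "closedin (zar X) B" and AB: "C \<subseteq> A \<union> B"
  show "C \<subseteq> A \<or> C \<subseteq> B"
  proof (rule ccontr)
    assume "\<not> ?thesis"
    then obtain x y where xy: "x \<in> C" "x \<notin> A" "y \<in> C" "y \<notin> B" by blast
    obtain E g a b where E: "zopen (affine_line :: ('k, 'k) fspace) E"
      and g: "continuous_map (zar (induced affine_line E)) (zar X) g" "g ` E \<subseteq> C" "a \<in> E" "b \<in> E" "g a = x" "g b = y"
      using curves[OF xy(1,3)] by (elim exE conjE) (rule that)
    have fin: "finite (- {s \<in> E. g s \<in> pts X - A'})" if A': "closedin (zar X) A'" "\<exists>s\<in>E. g s \<notin> A'" for A'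
    proof -
      have "zopen (induced affine_line E) {s \<in> pts (induced affine_line E). g s \<in> pts X - A'}"
        using g(1) A'(1) by (blast intro: openin_continuous_map_preimage)
      then have "zopen (affine_line :: ('k, 'k) fspace) {s \<in> E. g s \<in> pts X - A'}"
        by (simp add: induced_openin[OF E] induced_pts[OF E])
      moreover have "{s \<in> E. g s \<in> pts X - A'} \<noteq> {}"
        using A'(2) g(2) assms(2) by blast
      ultimately show ?thesis by (simp only: affine_line_openin) blast
    qed
    have "finite (- {s \<in> E. g s \<in> pts X - A} \<union> - {s \<in> E. g s \<in> pts X - B})"
      using fin[OF A] fin[OF B] g xy by blast
    then obtain s where "s \<notin> - {s \<in> E. g s \<in> pts X - A} \<union> - {s \<in> E. g s \<in> pts X - B}"
      using ex_new_if_finite[OF infinite_UNIV_char_0] by blast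
    then show False using AB g(2) by blast
  qed
qed

subsection \<open>The projective line\<close>

lemma P1_nice: "nice P1"
  unfolding P1_def by (rule glue_nice) (rule affine_line_nice)

lemma P1_pts [simp]: "pts (P1 :: ('k::field option, 'k) fspace) = UNIV"
proof -
  have "p \<in> (\<Union>i\<in>UNIV. (\<lambda>s. if i then Some s else if s = 0 then None else Some (1 / s)) ` UNIV)" for p :: "'k option"
  proof (cases p)
    case None
    then show ?thesis by (intro UN_I[of False] image_eqI[of _ _ 0]) auto
  next
    case (Some t)
    then show ?thesis by (intro UN_I[of True] image_eqI[of _ _ t]) auto
  qed
  then show ?thesis unfolding P1_def glue_pts affine_line_pts by blast
qed

lemma P1_openin:
  "zopen (P1 :: ('k::field option, 'k) fspace) U \<longleftrightarrow>
    zopen affine_line {s. Some s \<in> U} \<and>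
    zopen affine_line {s. (if s = 0 then None else Some (1 / s)) \<in> U}"
proof -
  have "U \<subseteq> pts P1" by simp
  then show ?thesis unfolding P1_def openin_glue glue_pts by (simp add: UNIV_bool conj_commute ex_bool_eq all_bool_eq)
qed

lemma P1_reg:
  "f \<in> reg (P1 :: ('k::field option, 'k) fspace) U \<longleftrightarrow>
    (\<lambda>s. f (Some s)) \<in> reg affine_line {s. Some s \<in> U} \<and>
    (\<lambda>s. f (if s = 0 then None else Some (1 / s))) \<in> reg affine_line {s. (if s = 0 then None else Some (1 / s)) \<in> U}"
  unfolding P1_def glue_reg by (simp add: UNIV_bool o_def conj_commute ex_bool_eq all_bool_eq)

lemma P1_finite_chart:
  "zopen (P1 :: ('k::field option, 'k) fspace) (range Some)"
  "(\<lambda>p. case p of None => 0 | Some t => t) \<in> reg (P1 :: ('k option, 'k) fspace) (range Some)"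
proof -
  let ?E = "- {0 :: 'k}"
  have E: "zopen (affine_line :: ('k, 'k) fspace) ?E" by (simp add: affine_line_openin)
  have e: "{s. (if s = 0 then None else Some (1 / s)) \<in> range Some} = ?E" by auto
  show "zopen (P1 :: ('k option, 'k) fspace) (range Some)"
    unfolding P1_openin e using E by (simp add: affine_line_openin)
  have "(\<lambda>s. inverse s) \<in> reg affine_line ?E"
    by (rule reg_inverse[OF affine_line_nice E affine_line_id_reg[OF E]]) auto
  then have "(\<lambda>s. case if s = 0 then None else Some (1 / s) of None => 0 | Some t => t) \<in> reg affine_line ?E"
    by (rule reg_cong[OF affine_line_nice E]) (auto simp: inverse_eq_divide)
  then show "(\<lambda>p. case p of None => 0 | Some t => t) \<in> reg (P1 :: ('k option, 'k) fspace) (range Some)"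
    unfolding P1_reg e using affine_line_id_reg[of UNIV] by (simp add: affine_line_openin)
qed

lemma P1_infinite_chart:
  "zopen (P1 :: ('k::field option, 'k) fspace) (- {Some 0})"
  "(\<lambda>p. case p of None => 0 | Some t => inverse t) \<in> reg (P1 :: ('k option, 'k) fspace) (- {Some 0})"
proof -
  let ?E = "- {0 :: 'k}"
  have E: "zopen (affine_line :: ('k, 'k) fspace) ?E" by (simp add: affine_line_openin)
  have U: "zopen (affine_line :: ('k, 'k) fspace) UNIV" by (simp add: affine_line_openin)
  have e: "{s. (if s = 0 then None else Some (1 / s)) \<in> - {Some 0}} = (UNIV :: 'k set)" "{s :: 'k. Some s \<in> - {Some 0}} = ?E"
    by auto
  show "zopen (P1 :: ('k option, 'k) fspace) (- {Some 0})"
    unfolding P1_openin e using E U by simp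
  have "(\<lambda>s. inverse s) \<in> reg affine_line ?E"
    by (rule reg_inverse[OF affine_line_nice E affine_line_id_reg[OF E]]) auto
  moreover have "(\<lambda>s. case if s = 0 then None else Some (1 / s) of None => 0 | Some t => inverse t) = (\<lambda>s :: 'k. s)"
    by (auto simp: fun_eq_iff)
  ultimately show "(\<lambda>p. case p of None => 0 | Some t => inverse t) \<in> reg (P1 :: ('k option, 'k) fspace) (- {Some 0})"
    unfolding P1_reg e using affine_line_id_reg[OF U] by simp
qed

lemma morphism_slice:
  assumes T: "nice T" and Z: "nice Z" and t: "t \<in> pts T"
  shows "morphism Z (fprod T Z) (\<lambda>p. (t, p))"
proof -
  have op: "zopen Z {p \<in> pts Z. (t, p) \<in> W}" if W: "zopen (fprod T Z) W" for W
  proof (subst openin_subopen, rule ballI)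
    fix p assume p: "p \<in> {p \<in> pts Z. (t, p) \<in> W}"
    then have "(t, p) \<in> W" by simp
    from bspec[OF W[unfolded fprod_openin[OF T Z]] this]
    obtain U V h where h: "zopen T U" "zopen Z V" "h \<in> tensor_fun T Z U V" "(t, p) \<in> U \<times> V" "h (t, p) \<noteq> 0"
      "\<forall>q\<in>U \<times> V. h q \<noteq> 0 --> q \<in> W"
      by (elim exE conjE bexE) (rule that)
    have "zopen Z {q \<in> V. h (t, q) \<noteq> 0}"
      by (rule reg_open[OF Z h(2) tensor_fun_slice[OF T Z h(2,3)]])
    then show "\<exists>T. zopen Z T \<and> p \<in> T \<and> T \<subseteq> {p \<in> pts Z. (t, p) \<in> W}"
      using h openin_subset[OF h(2)] by (intro exI[of _ "{q \<in> V. h (t, q) \<noteq> 0}"]) auto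
  qed
  have rg: "k \<circ> (\<lambda>p. (t, p)) \<in> reg Z {p \<in> pts Z. (t, p) \<in> W}"
    if W: "zopen (fprod T Z) W" and k: "k \<in> reg (fprod T Z) W" for W k
  proof (rule reg_local[OF Z op[OF W]])
    fix p assume p: "p \<in> {p \<in> pts Z. (t, p) \<in> W}"
    then have tp: "(t, p) \<in> W" by simp
    from bspec[OF k[unfolded fprod_reg[OF T Z W]] this]
    obtain U V g h where h: "zopen T U" "zopen Z V" "g \<in> tensor_fun T Z U V" "h \<in> tensor_fun T Z U V"
      "(t, p) \<in> U \<times> V" "h (t, p) \<noteq> 0" "\<forall>q\<in>U \<times> V. h q \<noteq> 0 --> q \<in> W \<and> k q = g q / h q"
      by (elim exE conjE bexE) (rule that)
    let ?D = "{q \<in> V. h (t, q) \<noteq> 0}"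
    have D: "zopen Z ?D"
      by (rule reg_open[OF Z h(2) tensor_fun_slice[OF T Z h(2,4)]])
    have "(\<lambda>q. g (t, q) / h (t, q)) \<in> reg Z ?D"
      by (rule reg_divide[OF Z D])
        (use reg_restrict[OF Z D h(2)] tensor_fun_slice[OF T Z h(2)] h(3,4) in auto)
    then show "\<exists>V h. zopen Z V \<and> p \<in> V \<and> h \<in> reg Z V \<and> (\<forall>q\<in>V \<inter> {p \<in> pts Z. (t, p) \<in> W}. (k \<circ> (\<lambda>p. (t, p))) q = h q)"
      using D h by (intro exI[of _ ?D] exI[of _ "\<lambda>q. g (t, q) / h (t, q)"]) auto
  qed
  show ?thesis
    unfolding morphism_def continuous_map_def using op rg t by (auto simp: fprod_pts[OF T Z])
qed

subsection \<open>Affine varieties\<close>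

lemma polyfun_algebra: "function_algebra (polyfun m)"
  by (auto simp: function_algebra_def intro: polyfun.intros)

lemma mspec_polyfun_prevariety:
  assumes "P \<subseteq> polyfun m"
  shows "prevariety (mspec (algebraic_set m P) (polyfun m))" (is "prevariety ?X")
proof -
  have X: "nice ?X" by (rule mspec_nice[OF polyfun_algebra])
  have o: "zopen ?X (pts ?X)" by simp
  have "isomorphic (induced ?X (pts ?X)) ?X"
    unfolding isomorphic_def
    using morphism_from_induced[OF X o morphism_id] morphism_into_induced[OF X X o morphism_id]
    by (intro exI[of _ "\<lambda>x. x"]) auto
  then have "is_affine (induced ?X (pts ?X))"
    unfolding is_affine_def using assms by blast
  then show ?thesis
    unfolding prevariety_def using nice_sheaf[OF X] by (intro conjI exI[of _ "{pts ?X}"]) auto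
qed

section \<open>Points of toric varieties\<close>

subsection \<open>Characters\<close>

definition torus :: "(int ^ 'n::finite => 'k::field) set"
  where "torus = {\<phi>. \<phi> 0 = 1 \<and> (\<forall>a b. \<phi> (a + b) = \<phi> a * \<phi> b)}"

lemma torus_0: "\<phi> \<in> torus ==> \<phi> 0 = 1"
  and torus_add: "\<phi> \<in> torus ==> \<phi> (a + b) = \<phi> a * \<phi> b"
  by (auto simp: torus_def)

lemma torus_minus_mult: "\<phi> \<in> torus ==> \<phi> (- a) * \<phi> a = 1"
  using torus_add[of \<phi> "- a" a] torus_0[of \<phi>] by simp

lemma torus_nonzero [simp]: "\<phi> \<in> torus ==> \<phi> a \<noteq> 0"
  using torus_minus_mult[of \<phi> a] by auto

lemma torus_minus: "\<phi> \<in> torus ==> \<phi> (- a) = inverse (\<phi> a)"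
  using torus_minus_mult[of \<phi> a] by (simp add: field_simps)

lemma torus_of_nat: "\<phi> \<in> torus ==> \<phi> (of_nat N * a) = \<phi> a ^ N"
  by (induction N) (simp_all add: torus_0 torus_add distrib_right)

lemma torus_of_int: "\<phi> \<in> torus ==> \<phi> (of_int z * a) = \<phi> a powi z"
proof (cases "z \<ge> 0")
  case True
  then show "\<phi> \<in> torus ==> ?thesis"
    using torus_of_nat[of \<phi> "nat z" a] by (simp add: power_int_def)
next
  case False
  assume \<phi>: "\<phi> \<in> torus"
  have "of_int z * a = - (of_nat (nat (- z)) * a)" using False by simp
  then show ?thesis
    using torus_of_nat[OF \<phi>, of "nat (- z)" a] torus_minus[OF \<phi>, of "of_nat (nat (- z)) * a"] False
    by (simp only: power_int_def power_inverse if_False)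
qed

lemma torus_sum: "\<phi> \<in> torus ==> \<phi> (\<Sum>i\<in>I. f i) = (\<Prod>i\<in>I. \<phi> (f i))"
  by (induction I rule: infinite_finite_induct) (auto simp: torus_0 torus_add)

lemma torus_mult: "\<phi> \<in> torus ==> \<psi> \<in> torus ==> (\<lambda>m. \<phi> m * \<psi> m) \<in> torus"
  by (auto simp: torus_def)

lemma torus_inverse: "\<phi> \<in> torus ==> (\<lambda>m. inverse (\<phi> m)) \<in> torus"
  by (auto simp: torus_def)

lemma torus_prod: "(\<And>i. i \<in> I ==> f i \<in> torus) ==> (\<lambda>m. \<Prod>i\<in>I. f i m) \<in> torus"
  by (induction I rule: infinite_finite_induct) (auto simp: torus_def)

lemma one_parameter_torus: "s \<noteq> 0 ==> (\<lambda>m. s powi pairing m u) \<in> torus"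
  by (auto simp: torus_def power_int_add)

lemma vec_eq_sum_axis: "m = (\<Sum>i\<in>UNIV. of_int (m $ i) * axis i 1)" for m :: "int ^ 'n::finite"
  by (simp add: vec_eq_iff of_int_vec_index axis_def if_distrib cong: if_cong)

lemma torus_eq_prod:
  assumes "\<phi> \<in> torus"
  shows "\<phi> m = (\<Prod>i\<in>UNIV. \<phi> (axis i 1) powi (m $ i))"
  by (subst vec_eq_sum_axis[of m]) (simp only: torus_sum[OF assms] torus_of_int[OF assms])

text \<open>Over an algebraically closed field the multiplicative group is divisible, so characters extend
  from subgroups; adjoining a vector \<open>e\<close> amounts to extracting a root of the value at the smallest
  multiple of \<open>e\<close> in the subgroup.\<close>

lemma nth_root_exists:
  fixes a :: "'k::alg_closed_field"
  assumes "n > 0"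
  shows "\<exists>r. r ^ n = a"
proof -
  define f where "f i = (if i = n then 1 else if i = 0 then - a else 0)" for i
  obtain x where x: "(\<Sum>k\<le>n. f k * x ^ k) = 0"
    using alg_closed[of n f] assms by (auto simp: f_def)
  have "(\<Sum>k\<le>n. f k * x ^ k) = (\<Sum>k\<in>{0, n}. f k * x ^ k)"
    by (rule sum.mono_neutral_right) (auto simp: f_def)
  also have "\<dots> = x ^ n - a" using assms by (simp add: f_def)
  finally show ?thesis using x by (intro exI[of _ x]) simp
qed

lemma int_subgroup_generator:
  fixes Z :: "int set"
  assumes "0 \<in> Z" "\<And>a b. a \<in> Z ==> b \<in> Z ==> a - b \<in> Z"
  shows "\<exists>q\<ge>0. Z = range (\<lambda>k. q * k)"
proof (cases "Z = {0}")
  case True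
  then show ?thesis by (intro exI[of _ 0]) auto
next
  case False
  then obtain z where "z \<in> Z" "z \<noteq> 0" using assms(1) by auto
  then have "\<exists>n::nat. n > 0 \<and> int n \<in> Z"
    using assms(2)[OF assms(1), of z] by (intro exI[of _ "nat \<bar>z\<bar>"]) (auto simp: abs_if)
  define n where "n = (LEAST n::nat. n > 0 \<and> int n \<in> Z)"
  have n: "n > 0" "int n \<in> Z" using LeastI_ex[OF \<open>\<exists>n::nat. n > 0 \<and> int n \<in> Z\<close>] by (auto simp: n_def)
  have neg: "- a \<in> Z" if "a \<in> Z" for a using assms(2)[OF assms(1) that] by simp
  have add: "a + b \<in> Z" if "a \<in> Z" "b \<in> Z" for a b using assms(2)[OF that(1) neg[OF that(2)]] by simp
  have mult': "int n * int k \<in> Z" for k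
    by (induction k) (use assms(1) add n in \<open>auto simp: algebra_simps\<close>)
  have mult: "int n * k \<in> Z" for k
    using mult'[of "nat k"] neg[OF mult'[of "nat (- k)"]] by (cases "k \<ge> 0") auto
  have "z \<in> range (\<lambda>k. int n * k)" if "z \<in> Z" for z
  proof -
    have "z mod int n \<in> Z"
      using assms(2)[OF that mult, of "z div int n"] by (simp only: minus_mult_div_eq_mod)
    then have "int (nat (z mod int n)) \<in> Z" using n(1) by simp
    moreover have "nat (z mod int n) < n" using n(1) by (simp add: nat_less_iff)
    ultimately have "nat (z mod int n) = 0"
      using not_less_Least[of "nat (z mod int n)" "\<lambda>n. n > 0 \<and> int n \<in> Z"] unfolding n_def[symmetric] by auto
    then have "z = int n * (z div int n)" using n(1) by (metis (no_types) mult_div_mod_eq nat_eq_iff2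
      add.right_neutral of_nat_0 pos_mod_sign of_nat_0_less_iff)
    then show ?thesis by blast
  qed
  then show ?thesis using mult by (intro exI[of _ "int n"]) auto
qed

lemma extend_character_by_one:
  fixes G :: "(int ^ 'n::finite) set" and \<phi> :: "int ^ 'n => 'k::alg_closed_field" and e :: "int ^ 'n"
  assumes G: "0 \<in> G" "\<And>a b. a \<in> G ==> b \<in> G ==> a - b \<in> G"
    and \<phi>: "\<phi> 0 = 1" "\<And>a b. a \<in> G ==> b \<in> G ==> \<phi> (a + b) = \<phi> a * \<phi> b"
  defines "G' \<equiv> {g + of_int z * e |g z. g \<in> G}"
  shows "\<exists>\<psi>. (\<forall>a\<in>G. \<psi> a = \<phi> a) \<and> (\<forall>a\<in>G'. \<forall>b\<in>G'. \<psi> (a + b) = \<psi> a * \<psi> b)"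
proof -
  have neg: "- a \<in> G" if "a \<in> G" for a using G(2)[OF G(1) that] by simp
  have add: "a + b \<in> G" if "a \<in> G" "b \<in> G" for a b using G(2)[OF that(1) neg[OF that(2)]] by simp
  have nz: "\<phi> a \<noteq> 0" if "a \<in> G" for a using \<phi>(2)[OF that neg[OF that]] \<phi>(1) by auto
  define Z where "Z = {z. of_int z * e \<in> G}"
  have "0 \<in> Z" using G by (simp add: Z_def)
  moreover have "a - b \<in> Z" if "a \<in> Z" "b \<in> Z" for a b
    using G(2)[of "of_int a * e" "of_int b * e"] that by (simp add: Z_def algebra_simps)
  ultimately obtain q where q: "q \<ge> 0" "Z = range (\<lambda>k. q * k)"
    using int_subgroup_generator[of Z] by blast
  have qZ: "of_int q * e \<in> G"
  proof -
    have "q * 1 \<in> Z" unfolding q(2) by blast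
    then show ?thesis by (simp add: Z_def)
  qed
  obtain r :: 'k where r: "r \<noteq> 0" "q > 0 ==> r ^ nat q = \<phi> (of_int q * e)"
  proof (cases "q > 0")
    case True
    then obtain r where r: "r ^ nat q = \<phi> (of_int q * e)" using nth_root_exists[of "nat q"] by auto
    have "r \<noteq> 0"
    proof
      assume "r = 0"
      then have "\<phi> (of_int q * e) = 0" using r True by (simp add: zero_power)
      then show False using nz[OF qZ] by simp
    qed
    then show ?thesis using r that by blast
  qed (use that[of 1] in auto)
  have mulk': "of_nat k * a \<in> G \<and> \<phi> (of_nat k * a) = \<phi> a ^ k" if "a \<in> G" for a k
    by (induction k) (use that G(1) \<phi> add in \<open>auto simp: distrib_right\<close>)
  have mulk: "\<phi> (of_int k * a) = \<phi> a powi k" if "a \<in> G" for a k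
  proof (cases "k \<ge> 0")
    case True
    then show ?thesis using mulk'[OF that, of "nat k"] by (simp add: power_int_def)
  next
    case False
    have "\<phi> (- a) * \<phi> a = 1" using \<phi>(2)[OF neg[OF that] that] \<phi>(1) by simp
    then have "\<phi> (- a) = inverse (\<phi> a)" using nz[OF that] by (simp add: field_simps)
    moreover have "of_int k * a = of_nat (nat (- k)) * (- a)" using False by simp
    ultimately show ?thesis using mulk'[OF neg[OF that], of "nat (- k)"] False by (simp add: power_int_def)
  qed
  have rZ: "\<phi> (of_int z * e) = r powi z" if "of_int z * e \<in> G" for z
  proof -
    have "z \<in> Z" using that by (simp add: Z_def)
    then obtain k where k: "z = q * k" unfolding q(2) by blast
    have "\<phi> (of_int z * e) = \<phi> (of_int k * (of_int q * e))" by (simp add: k mult_ac)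
    also have "\<dots> = \<phi> (of_int q * e) powi k" by (rule mulk[OF qZ])
    also have "\<dots> = r powi z"
    proof (cases "q > 0")
      case True
      then have "\<phi> (of_int q * e) = r powi q" using r(2) by (simp add: power_int_def)
      then show ?thesis using r(1) by (simp add: k power_int_mult)
    next
      case False
      then have "q = 0" using q(1) by simp
      then show ?thesis using \<phi>(1) by (simp add: k)
    qed
    finally show ?thesis .
  qed
  have wd: "\<phi> g * r powi z = \<phi> g' * r powi z'" if "g \<in> G" "g' \<in> G" "g + of_int z * e = g' + of_int z' * e" for g g' z z'
  proof -
    have e: "of_int (z - z') * e = g' - g" using that(3) by (simp add: algebra_simps)
    then have "of_int (z - z') * e \<in> G" using G(2)[OF that(2,1)] by simp
    then have "\<phi> (g' - g) = r powi (z - z')" using rZ e by metis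
    moreover have "\<phi> g' = \<phi> g * \<phi> (g' - g)" using \<phi>(2)[OF that(1) G(2)[OF that(2,1)]] by simp
    ultimately show ?thesis using r(1) by (simp add: power_int_diff)
  qed
  define \<psi> where "\<psi> x = (SOME v. \<exists>g z. g \<in> G \<and> x = g + of_int z * e \<and> v = \<phi> g * r powi z)" for x
  have \<psi>: "\<psi> (g + of_int z * e) = \<phi> g * r powi z" if "g \<in> G" for g z
  proof -
    have "\<exists>g' z'. g' \<in> G \<and> g + of_int z * e = g' + of_int z' * e \<and> \<psi> (g + of_int z * e) = \<phi> g' * r powi z'"
      unfolding \<psi>_def by (rule someI_ex) (use that in blast)
    then show ?thesis using wd[OF that] by metis
  qed
  have "\<psi> a = \<phi> a" if "a \<in> G" for a using \<psi>[OF that, of 0] by simp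
  moreover have "\<psi> (a + b) = \<psi> a * \<psi> b" if ab: "a \<in> G'" "b \<in> G'" for a b
  proof -
    obtain g z g' z' where g: "g \<in> G" "a = g + of_int z * e" "g' \<in> G" "b = g' + of_int z' * e"
      using ab by (auto simp: G'_def)
    have "a + b = (g + g') + of_int (z + z') * e" by (simp add: g algebra_simps)
    then have "\<psi> (a + b) = \<phi> (g + g') * r powi (z + z')"
      using \<psi>[OF add[OF g(1,3)], of "z + z'"] by (simp only:)
    then show ?thesis using \<psi>[OF g(1)] \<psi>[OF g(3)] g r(1) \<phi>(2) by (simp add: power_int_add)
  qed
  ultimately show ?thesis by blast
qed

text \<open>Adjoin the coordinate vectors one after the other.\<close>

lemma extend_character:
  fixes G :: "(int ^ 'n::finite) set" and \<phi> :: "int ^ 'n => 'k::alg_closed_field"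
  assumes G: "0 \<in> G" "\<And>a b. a \<in> G ==> b \<in> G ==> a - b \<in> G"
    and \<phi>: "\<phi> 0 = 1" "\<And>a b. a \<in> G ==> b \<in> G ==> \<phi> (a + b) = \<phi> a * \<phi> b"
  shows "\<exists>\<psi>\<in>torus. \<forall>a\<in>G. \<psi> a = \<phi> a"
proof -
  have "\<exists>G' \<psi>. G \<subseteq> G' \<and> (\<forall>a\<in>G'. \<forall>b\<in>G'. a - b \<in> G') \<and> (\<forall>i\<in>I. axis i 1 \<in> G') \<and>
      (\<forall>a\<in>G. \<psi> a = \<phi> a) \<and> (\<forall>a\<in>G'. \<forall>b\<in>G'. \<psi> (a + b) = \<psi> a * \<psi> b)" if "finite I" for I :: "'n set"
    using that
  proof (induction I rule: finite_induct)
    case empty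
    then show ?case using G \<phi> by (intro exI[of _ G] exI[of _ \<phi>]) auto
  next
    case (insert i I)
    then obtain G1 \<psi>1 where G1: "G \<subseteq> G1" "\<And>a b. a \<in> G1 ==> b \<in> G1 ==> a - b \<in> G1" "\<forall>i\<in>I. axis i 1 \<in> G1"
      "\<forall>a\<in>G. \<psi>1 a = \<phi> a" "\<And>a b. a \<in> G1 ==> b \<in> G1 ==> \<psi>1 (a + b) = \<psi>1 a * \<psi>1 b"
      by (elim exE conjE) (rule that, auto)
    have 0: "0 \<in> G1" "\<psi>1 0 = 1" using G1 G(1) \<phi>(1) by auto
    define G' where "G' = {g + of_int z * axis i 1 |g z. g \<in> G1}"
    obtain \<psi> where \<psi>: "\<forall>a\<in>G1. \<psi> a = \<psi>1 a" "\<forall>a\<in>G'. \<forall>b\<in>G'. \<psi> (a + b) = \<psi> a * \<psi> b"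
      using extend_character_by_one[of G1 \<psi>1 "axis i 1", OF 0(1) G1(2) 0(2) G1(5)] unfolding G'_def by blast
    have sub: "G1 \<subseteq> G'"
    proof
      fix g assume "g \<in> G1"
      then show "g \<in> G'" unfolding G'_def by (intro CollectI exI[of _ g] exI[of _ 0]) simp
    qed
    have diff: "a - b \<in> G'" if ab: "a \<in> G'" "b \<in> G'" for a b
    proof -
      obtain g z g' z' where g: "g \<in> G1" "a = g + of_int z * axis i 1" "g' \<in> G1" "b = g' + of_int z' * axis i 1"
        using ab unfolding G'_def by blast
      have "a - b = (g - g') + of_int (z - z') * axis i 1" by (simp add: g algebra_simps)
      then show ?thesis using G1(2)[OF g(1,3)] unfolding G'_def by blast
    qed
    have ax: "axis i 1 \<in> G'"
      unfolding G'_def by (intro CollectI exI[of _ 0] exI[of _ 1]) (simp add: 0)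
    show ?case
      using \<psi> sub diff ax G1(1,3,4) by (intro exI[of _ G'] exI[of _ \<psi>]) auto
  qed
  from this[OF finite_class.finite_UNIV] obtain G' \<psi> where G': "G \<subseteq> G'" "\<And>a b. a \<in> G' ==> b \<in> G' ==> a - b \<in> G'" "\<And>i. axis i 1 \<in> G'"
      "\<forall>a\<in>G. \<psi> a = \<phi> a" "\<And>a b. a \<in> G' ==> b \<in> G' ==> \<psi> (a + b) = \<psi> a * \<psi> b"
    by (elim exE conjE) (rule that, auto)
  have 0: "0 \<in> G'" using G G' by blast
  have neg: "- a \<in> G'" if "a \<in> G'" for a using G'(2)[OF 0 that] by simp
  have add: "a + b \<in> G'" if "a \<in> G'" "b \<in> G'" for a b using G'(2)[OF that(1) neg[OF that(2)]] by simp
  have nat: "of_nat k * a \<in> G'" if "a \<in> G'" for a k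
    by (induction k) (use 0 add that in \<open>auto simp: distrib_right\<close>)
  have int: "of_int z * a \<in> G'" if "a \<in> G'" for a z
    using nat[OF that, of "nat z"] neg[OF nat[OF that, of "nat (- z)"]] by (cases "z \<ge> 0") auto
  have sum: "(\<Sum>i\<in>I. f i) \<in> G'" if "\<And>i. f i \<in> G'" for f :: "'n => _" and I
    by (induction I rule: infinite_finite_induct) (use 0 add that in auto)
  have "m \<in> G'" for m
    by (subst vec_eq_sum_axis) (intro sum int G'(3))
  then have "\<psi> \<in> torus"
    unfolding torus_def using G'(4,5) G(1) \<phi>(1) by auto
  then show ?thesis using G'(4) by blast
qed

subsection \<open>Normal form of points of an affine toric variety\<close>

text \<open>Every point is the limit as \<open>s\<close> tends to 0 of the curve \<open>s \<mapsto> \<phi> \<cdot> \<lambda>\<^sub>u(s)\<close> for a point \<open>\<phi>\<close> of the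
  torus and a one-parameter subgroup \<open>\<lambda>\<^sub>u\<close> with \<open>u\<close> in the cone; \<open>u\<close> determines the orbit.\<close>

definition limit_pt :: "(real ^ 'n::finite) set => int ^ 'n => (int ^ 'n => 'k::field) => int ^ 'n => 'k"
  where "limit_pt K u \<phi> = (\<lambda>m. if m \<in> dual_semigroup K \<and> pairing m u = 0 then \<phi> m else 0)"

lemma limit_pt_in:
  assumes "lattice_vec u \<in> K" "\<phi> \<in> torus"
  shows "limit_pt K u \<phi> \<in> affine_toric_pts K"
  unfolding affine_toric_pts_def
proof (intro CollectI conjI ballI allI impI)
  show "limit_pt K u \<phi> 0 = 1" by (simp add: limit_pt_def torus_0[OF assms(2)])
  show "limit_pt K u \<phi> m = 0" if "m \<notin> dual_semigroup K" for m using that by (simp add: limit_pt_def)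
  fix m m' assume m: "m \<in> dual_semigroup K" "m' \<in> dual_semigroup K"
  have "0 \<le> pairing m u" "0 \<le> pairing m' u" using m assms(1) by (auto intro: dual_semigroup_pairing)
  then show "limit_pt K u \<phi> (m + m') = limit_pt K u \<phi> m * limit_pt K u \<phi> m'"
    using m by (auto simp: limit_pt_def dual_semigroup_add torus_add[OF assms(2)])
qed

lemma affine_toric_pts_0: "x \<in> affine_toric_pts K ==> x 0 = 1"
  and affine_toric_pts_add: "x \<in> affine_toric_pts K ==> m \<in> dual_semigroup K ==> m' \<in> dual_semigroup K ==>
    x (m + m') = x m * x m'"
  and affine_toric_pts_outside: "x \<in> affine_toric_pts K ==> m \<notin> dual_semigroup K ==> x m = 0"
  by (auto simp: affine_toric_pts_def)

lemma affine_toric_pts_of_nat: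
  assumes "x \<in> affine_toric_pts K" "m \<in> dual_semigroup K"
  shows "x (of_nat N * m) = x m ^ N"
  by (induction N)
    (use assms in \<open>simp_all add: affine_toric_pts_0 affine_toric_pts_add dual_semigroup_mult distrib_right\<close>)

lemma affine_toric_pts_sum_list:
  assumes "x \<in> affine_toric_pts K" "set ms \<subseteq> dual_semigroup K"
  shows "x (sum_list ms) = (\<Prod>m\<leftarrow>ms. x m)"
  using assms(2)
  by (induction ms) (use assms(1) in \<open>auto simp: affine_toric_pts_0 affine_toric_pts_add dual_semigroup_sum_list\<close>)

lemma affine_toric_pts_zero_cone: "affine_toric_pts {0} = torus"
  by (auto simp: affine_toric_pts_def torus_def)

text \<open>The elements of the semigroup at which the point does not vanish form a face, which is cut out by some
  \<open>u\<close>; on the group generated by the face the point is a character, which extends to the lattice.\<close>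

lemma limit_pt_form:
  fixes x :: "int ^ 'n::finite => 'k::alg_closed_field"
  assumes K: "rational_polyhedral_cone K" and x: "x \<in> affine_toric_pts K"
  shows "\<exists>u \<phi>. lattice_vec u \<in> K \<and> \<phi> \<in> torus \<and> x = limit_pt K u \<phi>"
proof -
  define S where "S = dual_semigroup K"
  define F where "F = {m \<in> S. x m \<noteq> 0}"
  have face: "a + b \<in> F \<longleftrightarrow> a \<in> F \<and> b \<in> F" if "a \<in> S" "b \<in> S" for a b
    using that affine_toric_pts_add[OF x] dual_semigroup_add by (auto simp: F_def S_def)
  have F0: "0 \<in> F" using affine_toric_pts_0[OF x] by (simp add: F_def S_def)
  have addF: "x (a + b) = x a * x b" if "a \<in> F" "b \<in> F" for a b
    using affine_toric_pts_add[OF x] that by (auto simp: F_def S_def)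
  obtain u where u: "lattice_vec u \<in> K" "F = {m \<in> S. pairing m u = 0}"
    using dual_semigroup_face[OF K, of F] face F0 unfolding S_def F_def by blast
  define G where "G = {a - b |a b. a \<in> F \<and> b \<in> F}"
  define \<phi> where "\<phi> g = (SOME v. \<exists>a b. a \<in> F \<and> b \<in> F \<and> g = a - b \<and> v = x a / x b)" for g
  have nz: "x a \<noteq> 0" if "a \<in> F" for a using that by (simp add: F_def)
  have FF: "a + b \<in> F" if "a \<in> F" "b \<in> F" for a b using face that by (auto simp: F_def)
  have \<phi>: "\<phi> (a - b) = x a / x b" if "a \<in> F" "b \<in> F" for a b
  proof -
    have "\<exists>a' b'. a' \<in> F \<and> b' \<in> F \<and> a - b = a' - b' \<and> \<phi> (a - b) = x a' / x b'"
      unfolding \<phi>_def by (rule someI_ex) (use that in blast)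
    then obtain a' b' where ab: "a' \<in> F" "b' \<in> F" "a - b = a' - b'" "\<phi> (a - b) = x a' / x b'" by blast
    have "a + b' = a' + b" using ab(3) by (simp add: algebra_simps)
    then have "x a * x b' = x a' * x b" using addF[OF that(1) ab(2)] addF[OF ab(1) that(2)] by simp
    then have "x a / x b = x a' / x b'" using nz that ab(1,2) by (simp add: frac_eq_eq)
    then show ?thesis using ab(4) by simp
  qed
  have "\<exists>\<psi>\<in>torus. \<forall>a\<in>G. \<psi> a = \<phi> a"
  proof (rule extend_character)
    show "0 \<in> G" using F0 unfolding G_def by force
    show "\<phi> 0 = 1" using \<phi>[OF F0 F0] affine_toric_pts_0[OF x] by simp
    fix g h assume "g \<in> G" "h \<in> G"
    then obtain a b a' b' where ab: "a \<in> F" "b \<in> F" "g = a - b" "a' \<in> F" "b' \<in> F" "h = a' - b'"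
      unfolding G_def by blast
    have e: "g - h = (a + b') - (b + a')" "g + h = (a + a') - (b + b')"
      unfolding ab(3,6) by (simp_all add: algebra_simps)
    show "g - h \<in> G"
      unfolding e(1) G_def using FF[OF ab(1,5)] FF[OF ab(2,4)] by blast
    have "\<phi> (g + h) = x (a + a') / x (b + b')"
      unfolding e(2) by (rule \<phi>[OF FF[OF ab(1,4)] FF[OF ab(2,5)]])
    then show "\<phi> (g + h) = \<phi> g * \<phi> h"
      using \<phi>[OF ab(1,2)] \<phi>[OF ab(4,5)] addF[OF ab(1,4)] addF[OF ab(2,5)] ab(3,6) by simp
  qed
  then obtain \<psi> where \<psi>: "\<psi> \<in> torus" "\<forall>a\<in>G. \<psi> a = \<phi> a" by blast
  have "\<psi> a = x a" if "a \<in> F" for a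
  proof -
    have "a - 0 \<in> G" using that F0 unfolding G_def by blast
    then show ?thesis using \<psi>(2) \<phi>[OF that F0] affine_toric_pts_0[OF x] by simp
  qed
  moreover have "m \<in> F \<longleftrightarrow> m \<in> dual_semigroup K \<and> pairing m u = 0" for m
    using u(2) by (auto simp: S_def)
  moreover have "m \<notin> F ==> x m = 0" for m
    using affine_toric_pts_outside[OF x] by (auto simp: F_def S_def)
  ultimately have "x = limit_pt K u \<psi>" by (auto simp: limit_pt_def fun_eq_iff)
  then show ?thesis using u(1) \<psi>(1) by blast
qed

subsection \<open>Gluing\<close>

locale toric_fan =
  fixes \<Sigma> :: "(real ^ 'n::finite) set set"
  assumes is_fan: "fan \<Sigma>"
begin

lemma finite_fan: "finite \<Sigma>" and fan_nonempty: "\<Sigma> \<noteq> {}"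
  using is_fan by (auto simp: fan_def)

lemma rpc: "K \<in> \<Sigma> ==> rational_polyhedral_cone K"
  using is_fan by (auto simp: fan_def)

lemma pointed: "K \<in> \<Sigma> ==> K \<inter> uminus ` K = {0}"
  using is_fan by (auto simp: fan_def)

lemma face_in_fan: "K \<in> \<Sigma> ==> \<tau> face_of K ==> \<tau> \<noteq> {} ==> \<tau> \<in> \<Sigma>"
  using is_fan by (auto simp: fan_def)

lemma inter_face: "K \<in> \<Sigma> ==> K' \<in> \<Sigma> ==> (K \<inter> K') face_of K'"
  using is_fan by (auto simp: fan_def)

lemma cone: "K \<in> \<Sigma> ==> convex_cone K"
  by (simp add: rpc rational_polyhedral_cone_convex_cone)

lemma zero_in: "K \<in> \<Sigma> ==> 0 \<in> K"
  by (simp add: cone convex_cone_contains_0)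

lemma inter_in_fan: "K \<in> \<Sigma> ==> K' \<in> \<Sigma> ==> K \<inter> K' \<in> \<Sigma>"
  using face_in_fan[OF _ inter_face] zero_in by blast

lemma zero_cone_in_fan: "{0} \<in> \<Sigma>"
proof -
  obtain K where K: "K \<in> \<Sigma>" using fan_nonempty by blast
  have "a = 0" if ab: "a \<in> K" "b \<in> K" "0 \<in> open_segment a b" for a b
  proof -
    obtain t where t: "0 < t" "t < 1" "0 = (1 - t) *\<^sub>R a + t *\<^sub>R b"
      using ab(3) by (auto simp: in_segment)
    have "(1 - t) *\<^sub>R a \<in> K" "t *\<^sub>R b \<in> K" using ab t cone[OF K] by (auto intro: convex_cone_scaleR)
    moreover have "(1 - t) *\<^sub>R a = - (t *\<^sub>R b)" using t(3) by (simp add: eq_neg_iff_add_eq_0)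
    ultimately have "(1 - t) *\<^sub>R a \<in> K \<inter> uminus ` K" by simp
    then show ?thesis using t pointed[OF K] by simp
  qed
  then have "{0} face_of K"
    unfolding face_of_def using zero_in[OF K] by (auto simp: open_segment_commute)
  then show ?thesis using face_in_fan[OF K] by blast
qed

lemma separating:
  assumes "K \<in> \<Sigma>" "K' \<in> \<Sigma>"
  obtains m where "m \<in> dual_semigroup K'" "- m \<in> dual_semigroup K"
    "\<And>p. p \<in> dual_semigroup (K \<inter> K') ==> \<exists>N. p + of_nat N * m \<in> dual_semigroup K'"
  using separating_lattice_vector[OF rpc[OF assms(1)] rpc[OF assms(2)] inter_face[OF assms]] by blast

lemma separating_pairing_0:
  assumes "m \<in> dual_semigroup K'" "- m \<in> dual_semigroup K" "lattice_vec u \<in> K" "lattice_vec u \<in> K'"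
  shows "pairing m u = 0"
  using dual_semigroup_pairing[OF assms(1,4)] dual_semigroup_pairing[OF assms(2,3)] by simp

text \<open>In terms of limits, points of two charts are identified iff they are the limits along the same
  one-parameter subgroup in both cones from the same point of the torus.\<close>

lemma gluing_rel_iff:
  fixes x x' :: "int ^ 'n => 'k::alg_closed_field"
  shows "((K, x), (K', x')) \<in> gluing_rel \<Sigma> \<longleftrightarrow> K \<in> \<Sigma> \<and> K' \<in> \<Sigma> \<and>
    (\<exists>u \<phi>. lattice_vec u \<in> K \<inter> K' \<and> \<phi> \<in> torus \<and> x = limit_pt K u \<phi> \<and> x' = limit_pt K' u \<phi>)"
proof -
  have res: "restrict_hom K (limit_pt \<tau> u \<phi>) = limit_pt K u \<phi>" if "\<tau> \<subseteq> K"
    for K \<tau> u and \<phi> :: "int ^ 'n => 'k"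
    using dual_semigroup_mono[OF that] by (auto simp: restrict_hom_def limit_pt_def fun_eq_iff)
  show ?thesis
  proof
    assume "((K, x), (K', x')) \<in> gluing_rel \<Sigma>"
    then obtain y where y: "K \<in> \<Sigma>" "K' \<in> \<Sigma>" "y \<in> affine_toric_pts (K \<inter> K')"
      "x = restrict_hom K y" "x' = restrict_hom K' y"
      by (auto simp: gluing_rel_def)
    obtain u \<phi> where "lattice_vec u \<in> K \<inter> K'" "\<phi> \<in> torus" "y = limit_pt (K \<inter> K') u \<phi>"
      using limit_pt_form[OF rpc[OF inter_in_fan[OF y(1,2)]] y(3)] by blast
    then show "K \<in> \<Sigma> \<and> K' \<in> \<Sigma> \<and>
      (\<exists>u \<phi>. lattice_vec u \<in> K \<inter> K' \<and> \<phi> \<in> torus \<and> x = limit_pt K u \<phi> \<and> x' = limit_pt K' u \<phi>)"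
      using y res[of "K \<inter> K'"] by auto
  next
    assume "K \<in> \<Sigma> \<and> K' \<in> \<Sigma> \<and>
      (\<exists>u \<phi>. lattice_vec u \<in> K \<inter> K' \<and> \<phi> \<in> torus \<and> x = limit_pt K u \<phi> \<and> x' = limit_pt K' u \<phi>)"
    then obtain u \<phi> where *: "K \<in> \<Sigma>" "K' \<in> \<Sigma>" "lattice_vec u \<in> K \<inter> K'" "\<phi> \<in> torus"
      "x = limit_pt K u \<phi>" "x' = limit_pt K' u \<phi>" by blast
    have "limit_pt (K \<inter> K') u \<phi> \<in> affine_toric_pts (K \<inter> K')" by (rule limit_pt_in[OF *(3,4)])
    then show "((K, x), (K', x')) \<in> gluing_rel \<Sigma>"
      unfolding gluing_rel_def using *(1,2,5,6) res[of "K \<inter> K'" K u \<phi>] res[of "K \<inter> K'" K' u \<phi>]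
      by (intro CollectI exI[of _ K] exI[of _ K'] exI[of _ "limit_pt (K \<inter> K') u \<phi>"]) auto
  qed
qed

text \<open>The functions of the chart of \<open>K'\<close> detect the faces of \<open>K'\<close> that contain \<open>u\<close>: a function
  vanishes at a limit along \<open>u\<close> iff it vanishes at a limit along \<open>u'\<close>, hence \<open>N u - u'\<close> lies in the
  cone for large \<open>N\<close>.\<close>

lemma same_orbit_dominated:
  assumes K: "rational_polyhedral_cone K" and u: "lattice_vec u \<in> K"
    and zero: "\<And>m. m \<in> dual_semigroup K ==> pairing m u = 0 ==> pairing m u' = 0"
  shows "\<exists>N. lattice_vec (of_nat N * u - u') \<in> K"
proof -
  obtain H where H: "finite H" "H \<subseteq> dual_semigroup K"
    "\<And>m. m \<in> dual_semigroup K ==> \<exists>ls. set ls \<subseteq> H \<and> sum_list ls = m"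
    using dual_semigroup_finitely_generated[OF K] by blast
  define N where "N = nat (\<Sum>h\<in>H. \<bar>pairing h u'\<bar>)"
  have h: "0 \<le> pairing h (of_nat N * u - u')" if "h \<in> H" for h
  proof (cases "pairing h u = 0")
    case True
    then show ?thesis using zero[of h] H(2) that by auto
  next
    case False
    then have "1 \<le> pairing h u" using dual_semigroup_pairing[OF _ u, of h] H(2) that by auto
    then have "int N \<le> int N * pairing h u" by (simp add: mult_le_cancel_left1)
    moreover have "pairing h u' \<le> (\<Sum>h\<in>H. \<bar>pairing h u'\<bar>)"
      by (rule order_trans[OF _ member_le_sum[of h]]) (use that H(1) in auto)
    moreover have "int N = (\<Sum>h\<in>H. \<bar>pairing h u'\<bar>)" by (simp add: N_def sum_nonneg)
    moreover have "pairing h (of_nat N * u - u') = int N * pairing h u - pairing h u'" by simp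
    ultimately show ?thesis by linarith
  qed
  have "0 \<le> pairing (sum_list ls) (of_nat N * u - u')" if "set ls \<subseteq> H" for ls
    using that
  proof (induction ls)
    case (Cons a ls)
    then have "0 \<le> pairing a (of_nat N * u - u')" "0 \<le> pairing (sum_list ls) (of_nat N * u - u')" using h by auto
    then show ?case by (simp only: sum_list.Cons pairing_add_left)
  qed simp
  then have "lattice_vec (of_nat N * u - u') \<in> K"
    using lattice_point_of_bidual[OF K] H(3) by metis
  then show ?thesis by blast
qed

lemma same_limit_pt:
  fixes \<phi> \<phi>' :: "int ^ 'n => 'k::field"
  assumes K: "K \<in> \<Sigma>" and K': "K' \<in> \<Sigma>" and u: "lattice_vec u \<in> K \<inter> K'" and u': "lattice_vec u' \<in> K'"
    and \<phi>: "\<phi> \<in> torus" "\<phi>' \<in> torus" and eq: "limit_pt K' u \<phi> = limit_pt K' u' \<phi>'"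
  shows "lattice_vec u' \<in> K" and "limit_pt K u \<phi> = limit_pt K u' \<phi>'"
proof -
  have zero: "pairing m u = 0 \<longleftrightarrow> pairing m u' = 0" and val: "pairing m u = 0 ==> \<phi> m = \<phi>' m"
    if "m \<in> dual_semigroup K'" for m
    using fun_cong[OF eq, of m] that \<phi> by (auto simp: limit_pt_def split: if_splits)
  have con: "conic (K \<inter> K')" using cone[OF inter_in_fan[OF K K']] by (simp add: convex_cone_def)
  have us: "lattice_vec u \<in> K'" using u by simp
  have key: "lattice_vec v' \<in> K \<inter> K' \<and> (\<exists>N. lattice_vec (of_nat N * v - v') \<in> K \<inter> K')"
    if v: "lattice_vec v \<in> K \<inter> K'" "lattice_vec v' \<in> K'"
     and z: "\<And>m. m \<in> dual_semigroup K' ==> pairing m v = 0 ==> pairing m v' = 0" for v v'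
  proof -
    obtain N where N: "lattice_vec (of_nat N * v - v') \<in> K'"
      using same_orbit_dominated[OF rpc[OF K'] _ z] v by blast
    have "lattice_vec (of_nat N * v) \<in> K \<inter> K'"
      using conicD[OF con v(1), of "real N"] by simp
    then have s: "lattice_vec v' + lattice_vec (of_nat N * v - v') \<in> K \<inter> K'"
      "lattice_vec (of_nat N * v - v') + lattice_vec v' \<in> K \<inter> K'"
      by (simp_all only: lattice_vec_simps(2)[symmetric]) (simp_all add: add.commute)
    show ?thesis
      using face_of_add[OF inter_face[OF K K'] con cone[OF K'] v(2) N s(1)]
        face_of_add[OF inter_face[OF K K'] con cone[OF K'] N v(2) s(2)] by blast
  qed
  obtain N where uN: "lattice_vec u' \<in> K \<inter> K'" "lattice_vec (of_nat N * u - u') \<in> K \<inter> K'"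
    using key[OF u u'] zero by blast
  then show u's: "lattice_vec u' \<in> K" by simp
  obtain N' where uN': "lattice_vec (of_nat N' * u' - u) \<in> K \<inter> K'"
    using key[OF uN(1) us] zero by blast
  obtain m0 where m0: "m0 \<in> dual_semigroup K'" "- m0 \<in> dual_semigroup K"
    "\<And>p. p \<in> dual_semigroup (K \<inter> K') ==> \<exists>N. p + of_nat N * m0 \<in> dual_semigroup K'"
    using separating[OF K K'] by blast
  have "(pairing m u = 0 \<longleftrightarrow> pairing m u' = 0) \<and> (pairing m u = 0 --> \<phi> m = \<phi>' m)"
    if m: "m \<in> dual_semigroup K" for m
  proof
    have "0 \<le> pairing m (of_nat N * u - u')" "0 \<le> pairing m (of_nat N' * u' - u)"
      "0 \<le> pairing m u" "0 \<le> pairing m u'"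
      using dual_semigroup_pairing[OF m] uN uN' u u's by blast+
    then show z: "pairing m u = 0 \<longleftrightarrow> pairing m u' = 0" by auto
    show "pairing m u = 0 --> \<phi> m = \<phi>' m"
    proof
      assume mu: "pairing m u = 0"
      have "m \<in> dual_semigroup (K \<inter> K')" using m dual_semigroup_mono[of "K \<inter> K'" K] by blast
      then obtain R where R: "m + of_nat R * m0 \<in> dual_semigroup K'" using m0(3) by blast
      have p0: "pairing m0 u = 0" using separating_pairing_0[OF m0(1,2)] u by blast
      have "\<phi> (m + of_nat R * m0) = \<phi>' (m + of_nat R * m0)" "\<phi> m0 = \<phi>' m0"
        using val[OF R] val[OF m0(1)] mu p0 by auto
      then show "\<phi> m = \<phi>' m" using \<phi> by (simp add: torus_add torus_of_nat)
    qed
  qed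
  then show "limit_pt K u \<phi> = limit_pt K u' \<phi>'" by (auto simp: limit_pt_def fun_eq_iff)
qed

definition chart :: "(real ^ 'n) set => (int ^ 'n => 'k::field) => ('n, 'k) toric_pt"
  where "chart K x = gluing_rel \<Sigma> `` {(K, x)}"

lemma chart_eq_iff:
  fixes x x' :: "int ^ 'n => 'k::alg_closed_field"
  assumes K: "K \<in> \<Sigma>" "K' \<in> \<Sigma>" and x: "x \<in> affine_toric_pts K" "x' \<in> affine_toric_pts K'"
  shows "chart K x = chart K' x' \<longleftrightarrow>
    (\<exists>u \<phi>. lattice_vec u \<in> K \<inter> K' \<and> \<phi> \<in> torus \<and> x = limit_pt K u \<phi> \<and> x' = limit_pt K' u \<phi>)"
proof
  assume eq: "chart K x = chart K' x'"
  obtain u \<phi> where "lattice_vec u \<in> K'" "\<phi> \<in> torus" "x' = limit_pt K' u \<phi>"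
    using limit_pt_form[OF rpc[OF K(2)] x(2)] by blast
  then have "((K', x'), (K', x')) \<in> gluing_rel \<Sigma>" using K unfolding gluing_rel_iff by auto
  then have "((K, x), (K', x')) \<in> gluing_rel \<Sigma>" using eq by (auto simp: chart_def)
  then show "\<exists>u \<phi>. lattice_vec u \<in> K \<inter> K' \<and> \<phi> \<in> torus \<and> x = limit_pt K u \<phi> \<and> x' = limit_pt K' u \<phi>"
    unfolding gluing_rel_iff by blast
next
  have sub: "chart K' x' \<subseteq> chart K x"
    if K: "K \<in> \<Sigma>" "K' \<in> \<Sigma>" and ex: "\<exists>u \<phi>. lattice_vec u \<in> K \<inter> K' \<and> \<phi> \<in> torus \<and> x = limit_pt K u \<phi> \<and> x' = limit_pt K' u \<phi>"
    for K K' and x x' :: "int ^ 'n => 'k"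
  proof
    fix z assume "z \<in> chart K' x'"
    then obtain K'' x'' where z: "z = (K'', x'')" "((K', x'), (K'', x'')) \<in> gluing_rel \<Sigma>"
      by (cases z) (auto simp: chart_def)
    obtain u \<phi> where 1: "lattice_vec u \<in> K \<inter> K'" "\<phi> \<in> torus" "x = limit_pt K u \<phi>" "x' = limit_pt K' u \<phi>"
      using ex by blast
    obtain u' \<phi>' where 2: "K'' \<in> \<Sigma>" "lattice_vec u' \<in> K' \<inter> K''" "\<phi>' \<in> torus" "x' = limit_pt K' u' \<phi>'" "x'' = limit_pt K'' u' \<phi>'"
      using z(2) unfolding gluing_rel_iff by blast
    have "lattice_vec u' \<in> K" "limit_pt K u \<phi> = limit_pt K u' \<phi>'"
      using same_limit_pt[OF K 1(1) _ 1(2) 2(3)] 1 2 by auto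
    then have "((K, x), (K'', x'')) \<in> gluing_rel \<Sigma>"
      unfolding gluing_rel_iff using K 1 2 by auto
    then show "z \<in> chart K x" using z(1) by (simp add: chart_def)
  qed
  assume ex: "\<exists>u \<phi>. lattice_vec u \<in> K \<inter> K' \<and> \<phi> \<in> torus \<and> x = limit_pt K u \<phi> \<and> x' = limit_pt K' u \<phi>"
  have ex': "\<exists>u \<phi>. lattice_vec u \<in> K' \<inter> K \<and> \<phi> \<in> torus \<and> x' = limit_pt K' u \<phi> \<and> x = limit_pt K u \<phi>"
    using ex by blast
  show "chart K x = chart K' x'"
    using sub[OF K ex] sub[OF K(2,1) ex'] by blast
qed

lemma chart_limit_pt:
  fixes \<phi> :: "int ^ 'n => 'k::alg_closed_field"
  assumes "K \<in> \<Sigma>" "K' \<in> \<Sigma>" "lattice_vec u \<in> K" "lattice_vec u \<in> K'" "\<phi> \<in> torus"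
  shows "chart K (limit_pt K u \<phi>) = chart K' (limit_pt K' u \<phi>)"
  using assms by (subst chart_eq_iff) (auto intro: limit_pt_in)

lemma chart_inj:
  fixes x x' :: "int ^ 'n => 'k::alg_closed_field"
  assumes "K \<in> \<Sigma>" "x \<in> affine_toric_pts K" "x' \<in> affine_toric_pts K" "chart K x = chart K x'"
  shows "x = x'"
  using chart_eq_iff[OF assms(1,1,2,3)] assms(4) by blast

end

subsection \<open>Functions on affine toric varieties\<close>

text \<open>Elements of the semigroup algebra multiply as functions only on the toric points. So the algebra
  is replaced by all functions that agree with one of its elements there; the maximal spectrum is
  the same.\<close>

definition toric_functions :: "(real ^ 'n::finite) set => ((int ^ 'n => 'k::field) => 'k) set"
  where "toric_functions K = {h. \<exists>f\<in>semigroup_algebra K. \<forall>x\<in>affine_toric_pts K. h x = f x}"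

text \<open>The maximal spectrum only depends on the values of the functions on the given point set.\<close>

lemma mspec_cong_on:
  "mspec V A = mspec V {h. \<exists>f\<in>A. \<forall>x\<in>V. h x = f x}" (is "_ = mspec V ?A'")
proof -
  let ?T = "topology_generated_by ((\<lambda>h. {x \<in> V. h x \<noteq> 0}) ` A)"
  have e: "(\<lambda>h. {x \<in> V. h x \<noteq> 0}) ` ?A' = (\<lambda>h. {x \<in> V. h x \<noteq> 0}) ` A"
  proof
    show "(\<lambda>h. {x \<in> V. h x \<noteq> 0}) ` ?A' \<subseteq> (\<lambda>h. {x \<in> V. h x \<noteq> 0}) ` A"
    proof
      fix D assume "D \<in> (\<lambda>h. {x \<in> V. h x \<noteq> 0}) ` ?A'"
      then obtain h f where "D = {x \<in> V. h x \<noteq> 0}" "f \<in> A" "\<forall>x\<in>V. h x = f x" by blast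
      then have "D = {x \<in> V. f x \<noteq> 0}" by auto
      then show "D \<in> (\<lambda>h. {x \<in> V. h x \<noteq> 0}) ` A" using \<open>f \<in> A\<close> by blast
    qed
    have "A \<subseteq> ?A'" by blast
    then show "(\<lambda>h. {x \<in> V. h x \<noteq> 0}) ` A \<subseteq> (\<lambda>h. {x \<in> V. h x \<noteq> 0}) ` ?A'" by blast
  qed
  have sub: "W \<subseteq> V" if "openin ?T W" for W
    using openin_subset[OF that] by auto
  have r: "(\<exists>g\<in>?A'. \<exists>h\<in>?A'. \<forall>y\<in>W \<inter> U. h y \<noteq> 0 \<and> f y = g y / h y) \<longleftrightarrow>
    (\<exists>g\<in>A. \<exists>h\<in>A. \<forall>y\<in>W \<inter> U. h y \<noteq> 0 \<and> f y = g y / h y)" if "W \<subseteq> V" for W U and f :: "'a => 'b"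
  proof
    assume "\<exists>g\<in>?A'. \<exists>h\<in>?A'. \<forall>y\<in>W \<inter> U. h y \<noteq> 0 \<and> f y = g y / h y"
    then obtain g h g' h' where *: "\<forall>y\<in>W \<inter> U. h y \<noteq> 0 \<and> f y = g y / h y" "g' \<in> A" "h' \<in> A"
      "\<forall>x\<in>V. g x = g' x" "\<forall>x\<in>V. h x = h' x" by blast
    then have "\<forall>y\<in>W \<inter> U. h' y \<noteq> 0 \<and> f y = g' y / h' y" using that by (metis IntD1 subsetD)
    then show "\<exists>g\<in>A. \<exists>h\<in>A. \<forall>y\<in>W \<inter> U. h y \<noteq> 0 \<and> f y = g y / h y" using * by blast
  next
    assume "\<exists>g\<in>A. \<exists>h\<in>A. \<forall>y\<in>W \<inter> U. h y \<noteq> 0 \<and> f y = g y / h y"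
    then show "\<exists>g\<in>?A'. \<exists>h\<in>?A'. \<forall>y\<in>W \<inter> U. h y \<noteq> 0 \<and> f y = g y / h y" by blast
  qed
  have "(\<lambda>U. {f. \<forall>x\<in>U. \<exists>W. openin ?T W \<and> x \<in> W \<and> (\<exists>g\<in>A. \<exists>h\<in>A. \<forall>y\<in>W \<inter> U. h y \<noteq> 0 \<and> f y = g y / h y)}) =
    (\<lambda>U. {f. \<forall>x\<in>U. \<exists>W. openin ?T W \<and> x \<in> W \<and> (\<exists>g\<in>?A'. \<exists>h\<in>?A'. \<forall>y\<in>W \<inter> U. h y \<noteq> 0 \<and> f y = g y / h y)})"
    by (intro ext Collect_cong ball_cong ex_cong1 conj_cong refl r[OF sub, symmetric])
  then show ?thesis
    unfolding mspec_def Let_def e by simp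
qed

lemma affine_toric_eq: "affine_toric K = mspec (affine_toric_pts K) (toric_functions K)"
  unfolding affine_toric_def toric_functions_def by (rule mspec_cong_on)

lemma semigroup_algebra_char: "m \<in> dual_semigroup K ==> (\<lambda>x. c * x m) \<in> semigroup_algebra K"
  unfolding semigroup_algebra_def
  by (rule CollectI, rule exI[of _ "{m}"], rule exI[of _ "\<lambda>_. c"]) auto

lemma semigroup_algebra_0: "(\<lambda>x. 0) \<in> semigroup_algebra K"
  unfolding semigroup_algebra_def by (rule CollectI, rule exI[of _ "{}"]) auto

lemma semigroup_algebra_add:
  assumes "f \<in> semigroup_algebra K" "g \<in> semigroup_algebra K"
  shows "(\<lambda>x. f x + g x) \<in> semigroup_algebra K"
proof -
  obtain F c where f: "finite F" "F \<subseteq> dual_semigroup K" "f = (\<lambda>x. \<Sum>m\<in>F. c m * x m)"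
    using assms(1) by (auto simp: semigroup_algebra_def)
  obtain G d where g: "finite G" "G \<subseteq> dual_semigroup K" "g = (\<lambda>x. \<Sum>m\<in>G. d m * x m)"
    using assms(2) by (auto simp: semigroup_algebra_def)
  define e where "e m = (if m \<in> F then c m else 0) + (if m \<in> G then d m else 0)" for m
  have 1: "(\<Sum>m\<in>F \<union> G. (if m \<in> F then c m else 0) * x m) = (\<Sum>m\<in>F. c m * x m)" for x
    by (rule sum.mono_neutral_cong_right) (use f(1) g(1) in auto)
  have 2: "(\<Sum>m\<in>F \<union> G. (if m \<in> G then d m else 0) * x m) = (\<Sum>m\<in>G. d m * x m)" for x
    by (rule sum.mono_neutral_cong_right) (use f(1) g(1) in auto)
  have "(\<lambda>x. f x + g x) = (\<lambda>x. \<Sum>m\<in>F \<union> G. e m * x m)"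
    unfolding f(3) g(3) e_def distrib_right sum.distrib 1 2 ..
  then show ?thesis
    unfolding semigroup_algebra_def using f(1,2) g(1,2)
    by (intro CollectI exI[of _ "F \<union> G"] exI[of _ e]) auto
qed

lemma toric_functions_sum:
  assumes "\<And>i. i \<in> I ==> f i \<in> toric_functions K"
  shows "(\<lambda>x. \<Sum>i\<in>I. f i x) \<in> toric_functions K"
  using assms
proof (induction I rule: infinite_finite_induct)
  case (insert i I)
  obtain g where "g \<in> semigroup_algebra K" "\<forall>x\<in>affine_toric_pts K. f i x = g x"
    using insert.prems[of i] by (auto simp: toric_functions_def)
  moreover have "(\<lambda>x. \<Sum>i\<in>I. f i x) \<in> toric_functions K"
    using insert by blast
  then obtain h where "h \<in> semigroup_algebra K" "\<forall>x\<in>affine_toric_pts K. (\<Sum>i\<in>I. f i x) = h x"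
    by (auto simp: toric_functions_def)
  ultimately show ?case
    using semigroup_algebra_add[of g K h] insert.hyps
    by (auto simp: toric_functions_def intro!: bexI[of _ "\<lambda>x. g x + h x"])
qed (auto simp: toric_functions_def intro: semigroup_algebra_0)

lemma toric_functions_char: "m \<in> dual_semigroup K ==> (\<lambda>x. c * x m) \<in> toric_functions K"
  unfolding toric_functions_def by (rule CollectI, rule bexI[OF _ semigroup_algebra_char]) auto

lemma toric_functions_cong: "f \<in> toric_functions K ==> (\<And>x. x \<in> affine_toric_pts K ==> g x = f x) ==> g \<in> toric_functions K"
  by (auto simp: toric_functions_def)

lemma toric_functionsE:
  assumes "f \<in> toric_functions K"
  obtains F c where "finite F" "F \<subseteq> dual_semigroup K" "\<And>x. x \<in> affine_toric_pts K ==> f x = (\<Sum>m\<in>F. c m * x m)"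
  using assms by (auto simp: toric_functions_def semigroup_algebra_def)

lemma toric_functions_algebra: "function_algebra (toric_functions K)"
  unfolding function_algebra_def
proof (intro conjI allI ballI)
  show "(\<lambda>x. c) \<in> toric_functions K" for c
    by (rule toric_functions_cong[OF toric_functions_char[of 0 K c]]) (auto simp: affine_toric_pts_0)
  fix f g :: "(int ^ 'a => 'b) => 'b" assume f: "f \<in> toric_functions K" and g: "g \<in> toric_functions K"
  show "(\<lambda>x. f x + g x) \<in> toric_functions K"
    using toric_functions_sum[of UNIV "\<lambda>b. if b then f else g" K] f g by (simp add: UNIV_bool add.commute)
  obtain F c where F: "finite F" "F \<subseteq> dual_semigroup K" "\<And>x. x \<in> affine_toric_pts K ==> f x = (\<Sum>m\<in>F. c m * x m)"
    using toric_functionsE[OF f] by blast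
  obtain G d where G: "finite G" "G \<subseteq> dual_semigroup K" "\<And>x. x \<in> affine_toric_pts K ==> g x = (\<Sum>m\<in>G. d m * x m)"
    using toric_functionsE[OF g] by blast
  have "(\<lambda>x. \<Sum>(a, b)\<in>F \<times> G. (c a * d b) * x (a + b)) \<in> toric_functions K"
    unfolding case_prod_beta'
    by (rule toric_functions_sum, rule toric_functions_char) (use F(2) G(2) in \<open>auto simp: subset_iff intro: dual_semigroup_add\<close>)
  then show "(\<lambda>x. f x * g x) \<in> toric_functions K"
  proof (rule toric_functions_cong)
    fix x :: "int ^ 'a => 'b" assume x: "x \<in> affine_toric_pts K"
    have "f x * g x = (\<Sum>a\<in>F. \<Sum>b\<in>G. (c a * x a) * (d b * x b))"
      unfolding F(3)[OF x] G(3)[OF x] by (rule sum_product)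
    also have "\<dots> = (\<Sum>a\<in>F. \<Sum>b\<in>G. (c a * d b) * x (a + b))"
      using F(2) G(2) affine_toric_pts_add[OF x] by (intro sum.cong refl) (auto simp: subset_iff mult_ac)
    finally show "f x * g x = (\<Sum>(a, b)\<in>F \<times> G. (c a * d b) * x (a + b))"
      by (simp add: sum.cartesian_product)
  qed
qed

lemma affine_toric_nice: "nice (affine_toric K)"
  unfolding affine_toric_eq by (rule mspec_nice[OF toric_functions_algebra])

lemma affine_toric_points [simp]: "pts (affine_toric K) = affine_toric_pts K"
  unfolding affine_toric_eq by (rule mspec_pts[OF toric_functions_algebra])

lemma affine_toric_openin:
  "zopen (affine_toric K) W \<longleftrightarrow> (\<forall>p\<in>W. \<exists>h\<in>toric_functions K.
    p \<in> affine_toric_pts K \<and> h p \<noteq> 0 \<and> (\<forall>q\<in>affine_toric_pts K. h q \<noteq> 0 --> q \<in> W))"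
  unfolding affine_toric_eq by (rule mspec_openin[OF toric_functions_algebra])

lemma affine_toric_reg:
  "zopen (affine_toric K) U ==> f \<in> reg (affine_toric K) U \<longleftrightarrow>
    (\<forall>p\<in>U. \<exists>g\<in>toric_functions K. \<exists>h\<in>toric_functions K. p \<in> affine_toric_pts K \<and> h p \<noteq> 0 \<and>
      (\<forall>q\<in>affine_toric_pts K. h q \<noteq> 0 --> q \<in> U \<and> f q = g q / h q))"
  unfolding affine_toric_eq by (rule mspec_reg[OF toric_functions_algebra])

lemma affine_toric_function_reg:
  "g \<in> toric_functions K ==> zopen (affine_toric K) U ==> g \<in> reg (affine_toric K) U"
  unfolding affine_toric_eq by (rule mspec_algebra_reg[OF toric_functions_algebra])

lemma affine_toric_char_reg:
  "m \<in> dual_semigroup K ==> zopen (affine_toric K) U ==> (\<lambda>x. x m) \<in> reg (affine_toric K) U"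
  using affine_toric_function_reg[OF toric_functions_char[of m K 1]] by simp

lemma morphism_into_affine_toric:
  fixes f :: "'a => int ^ 'n::finite => 'k::field"
  assumes X: "nice X" and im: "\<And>x. x \<in> pts X ==> f x \<in> affine_toric_pts K"
    and reg: "\<And>m. m \<in> dual_semigroup K ==> (\<lambda>x. f x m) \<in> reg X (pts X)"
  shows "morphism X (affine_toric K) f"
  unfolding affine_toric_eq
proof (rule morphism_into_mspec[OF X toric_functions_algebra im])
  fix h :: "(int ^ 'n => 'k) => 'k" assume "h \<in> toric_functions K"
  then obtain F c where F: "finite F" "F \<subseteq> dual_semigroup K" "\<And>x. x \<in> affine_toric_pts K ==> h x = (\<Sum>m\<in>F. c m * x m)"
    using toric_functionsE by blast
  have o: "zopen X (pts X)" by simp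
  have "(\<lambda>x. \<Sum>m\<in>F. c m * f x m) \<in> reg X (pts X)"
    by (rule reg_sum[OF X o], rule reg_mult[OF X o reg_const[OF X o] reg]) (use F(2) in auto)
  then show "(\<lambda>x. h (f x)) \<in> reg X (pts X)"
    by (rule reg_cong[OF X o]) (use F(3) im in auto)
qed

text \<open>By Gordan's lemma the semigroup algebra is a quotient of a polynomial ring; a point is determined
  by its values on the generators, and values satisfying all relations come from a point.\<close>

lemma polyfun_prod_list: "(\<And>i. i \<in> set ls ==> i < m) ==> (\<lambda>x. \<Prod>i\<leftarrow>ls. x i) \<in> polyfun m"
proof (induction ls)
  case (Cons a ls)
  then show ?case
    using polyfun.mult[OF polyfun.coord[of a m], of "\<lambda>x. \<Prod>i\<leftarrow>ls. x i"] by simp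
qed (auto intro: polyfun.const)

lemma is_affine_affine_toric:
  assumes K: "rational_polyhedral_cone K"
  shows "is_affine (affine_toric K :: (int ^ 'n::finite => 'k::field, 'k) fspace)"
proof -
  let ?U = "affine_toric_pts K :: (int ^ 'n => 'k) set"
  define S where "S = dual_semigroup K"
  obtain H where H: "finite H" "H \<subseteq> S" "\<And>m. m \<in> S ==> \<exists>ls. set ls \<subseteq> H \<and> sum_list ls = m"
    using dual_semigroup_finitely_generated[OF K] unfolding S_def by blast
  obtain hs where hs: "set hs = H" using finite_list[OF H(1)] by blast
  define r where "r = length hs"
  define h where "h = (!) hs"
  have hS: "h i \<in> S" if "i < r" for i using that hs H(2) by (auto simp: h_def r_def)
  have "\<exists>ls. set ls \<subseteq> {..<r} \<and> sum_list (map h ls) = m" if m: "m \<in> S" for m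
  proof -
    obtain ks where ks: "set ks \<subseteq> H" "sum_list ks = m" using H(3)[OF m] by blast
    have "\<exists>ls. set ls \<subseteq> {..<r} \<and> map h ls = ks" using ks(1)
    proof (induction ks)
      case (Cons k ks)
      then obtain ls where "set ls \<subseteq> {..<r}" "map h ls = ks" by auto
      moreover obtain i where "i < r" "h i = k" using Cons.prems hs by (auto simp: h_def r_def in_set_conv_nth)
      ultimately show ?case by (intro exI[of _ "i # ls"]) auto
    qed auto
    then show ?thesis using ks(2) by blast
  qed
  then obtain L where L: "\<And>m. m \<in> S ==> set (L m) \<subseteq> {..<r}" "\<And>m. m \<in> S ==> sum_list (map h (L m)) = m"
    by metis
  define f :: "(int ^ 'n => 'k) => nat => 'k" where "f x = (\<lambda>i. if i < r then x (h i) else 0)" for x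
  define g :: "(nat => 'k) => int ^ 'n => 'k" where "g a = (\<lambda>m. if m \<in> S then \<Prod>i\<leftarrow>L m. a i else 0)" for a
  define P where "P = {p \<in> polyfun r. \<forall>x\<in>?U. p (f x) = 0}"
  let ?A = "mspec (algebraic_set r P) (polyfun r) :: (nat => 'k, 'k) fspace"
  have prod: "(\<Prod>i\<leftarrow>ls. f x i) = x (sum_list (map h ls))" if x: "x \<in> ?U" and ls: "set ls \<subseteq> {..<r}" for x ls
  proof -
    have "(\<Prod>i\<leftarrow>ls. f x i) = (\<Prod>m\<leftarrow>map h ls. x m)"
      using ls by (induction ls) (auto simp: f_def)
    moreover have "set (map h ls) \<subseteq> dual_semigroup K" using ls hS by (auto simp: S_def)
    ultimately show ?thesis using affine_toric_pts_sum_list[OF x, of "map h ls"] by simp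
  qed
  have fA: "f x \<in> algebraic_set r P" if "x \<in> ?U" for x
    using that by (auto simp: algebraic_set_def affine_pts_def P_def f_def)
  have rel: "(\<Prod>i\<leftarrow>ls. a i) = (\<Prod>i\<leftarrow>ks. a i)"
    if a: "a \<in> algebraic_set r P" and ls: "set ls \<subseteq> {..<r}" "set ks \<subseteq> {..<r}" "sum_list (map h ls) = sum_list (map h ks)" for a ls ks
  proof -
    have "(\<lambda>x. (\<Prod>i\<leftarrow>ls. x i) + (-1) * (\<Prod>i\<leftarrow>ks. x i)) \<in> polyfun r"
      using ls by (intro polyfun.intros polyfun_prod_list) auto
    then have "(\<lambda>x. (\<Prod>i\<leftarrow>ls. x i) + (-1) * (\<Prod>i\<leftarrow>ks. x i)) \<in> P"
      using ls prod by (simp add: P_def)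
    moreover have "\<forall>p\<in>P. p a = 0" using a by (simp add: algebraic_set_def)
    ultimately have "(\<Prod>i\<leftarrow>ls. a i) + (-1) * (\<Prod>i\<leftarrow>ks. a i) = 0" by (rule bspec[rotated])
    then show ?thesis by simp
  qed
  have gU: "g a \<in> ?U" if a: "a \<in> algebraic_set r P" for a
    unfolding affine_toric_pts_def
  proof (intro CollectI conjI ballI allI impI)
    have "0 \<in> S" by (simp add: S_def)
    then show "g a 0 = 1" using rel[OF a L(1), of 0 "[]"] L(2)[of 0] by (simp add: g_def)
    show "g a m = 0" if "m \<notin> dual_semigroup K" for m using that by (simp add: g_def S_def)
    fix m m' assume "m \<in> dual_semigroup K" "m' \<in> dual_semigroup K"
    then have m: "m \<in> S" "m' \<in> S" "m + m' \<in> S" by (auto simp: S_def dual_semigroup_add)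
    then show "g a (m + m') = g a m * g a m'"
      using rel[OF a L(1)[OF m(3)], of "L m @ L m'"] L by (simp add: g_def)
  qed
  have nA: "nice ?A" by (rule mspec_nice[OF polyfun_algebra])
  have ptsA: "pts ?A = algebraic_set r P" by (rule mspec_pts[OF polyfun_algebra])
  have mf: "morphism (affine_toric K) ?A f"
  proof (rule morphism_into_mspec[OF affine_toric_nice polyfun_algebra])
    show "x \<in> pts (affine_toric K) ==> f x \<in> algebraic_set r P" for x using fA by simp
    have o: "zopen (affine_toric K :: (int ^ 'n => 'k, 'k) fspace) (pts (affine_toric K))"
      by (rule openin_topspace)
    fix p assume "p \<in> (polyfun r :: ((nat => 'k) => 'k) set)"
    then show "(\<lambda>x. p (f x)) \<in> reg (affine_toric K) (pts (affine_toric K))"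
    proof induction
      case (coord i)
      then show ?case using affine_toric_char_reg[OF _ o, of "h i"] hS[of i] by (simp add: f_def S_def)
    qed (rule reg_const[OF affine_toric_nice o] reg_add[OF affine_toric_nice o] reg_mult[OF affine_toric_nice o]; assumption)+
  qed
  have mg: "morphism ?A (affine_toric K) g"
  proof (rule morphism_into_affine_toric[OF nA])
    show "a \<in> pts ?A ==> g a \<in> affine_toric_pts K" for a using gU ptsA by simp
    fix m assume "m \<in> dual_semigroup K"
    then have m: "m \<in> S" by (simp add: S_def)
    have "(\<lambda>a. \<Prod>i\<leftarrow>L m. a i) \<in> polyfun r" using L(1)[OF m] by (intro polyfun_prod_list) auto
    from mspec_algebra_reg[OF polyfun_algebra this openin_topspace]
    show "(\<lambda>a. g a m) \<in> reg ?A (pts ?A)"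
      using m by (simp add: g_def)
  qed
  have "g (f x) = x" if x: "x \<in> ?U" for x
    using affine_toric_pts_outside[OF x] prod[OF x L(1)] L(2) by (auto simp: g_def S_def fun_eq_iff)
  moreover have "f (g a) = a" if a: "a \<in> algebraic_set r P" for a
  proof
    fix i
    show "f (g a) i = a i"
    proof (cases "i < r")
      case True
      then show ?thesis using rel[OF a L(1)[OF hS[OF True]], of "[i]"] L(2)[OF hS[OF True]] hS[OF True]
        by (simp add: f_def g_def)
    next
      case False
      then show ?thesis using a by (simp add: f_def algebraic_set_def affine_pts_def)
    qed
  qed
  ultimately have "isomorphic (affine_toric K) ?A"
    unfolding isomorphic_def using mf mg ptsA by (intro exI[of _ f] exI[of _ g]) simp
  moreover have "P \<subseteq> polyfun r" by (auto simp: P_def)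
  ultimately show ?thesis unfolding is_affine_def by (intro exI[of _ r] exI[of _ P] conjI)
qed

subsection \<open>Charts\<close>

context toric_fan
begin

abbreviation X :: "(('n, 'k::field) toric_pt, 'k) fspace"
  where "X \<equiv> toric_variety \<Sigma>"

lemma X_eq: "X = glue \<Sigma> affine_toric chart"
  unfolding toric_variety_def chart_def ..

lemma X_nice: "nice X"
  unfolding X_eq by (rule glue_nice) (rule affine_toric_nice)

definition chart_img :: "(real ^ 'n) set => ('n, 'k::field) toric_pt set"
  where "chart_img K = chart K ` affine_toric_pts K"

lemma X_pts: "pts X = (\<Union>K\<in>\<Sigma>. chart_img K)"
  unfolding X_eq glue_pts by (simp add: chart_img_def)

lemma chart_morphism: "K \<in> \<Sigma> ==> morphism (affine_toric K) X (chart K)"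
  unfolding X_eq by (rule morphism_glue_chart)

text \<open>A map is a morphism if it is locally given in one chart by regular values of all characters.\<close>

lemma morphism_into_X:
  assumes Z: "nice Z"
    and loc: "\<And>z. z \<in> pts Z ==> \<exists>N K g. zopen Z N \<and> z \<in> N \<and> K \<in> \<Sigma> \<and>
      (\<forall>w\<in>N. g w \<in> affine_toric_pts K \<and> f w = chart K (g w)) \<and>
      (\<forall>m\<in>dual_semigroup K. (\<lambda>w. g w m) \<in> reg Z N)"
  shows "morphism Z X f"
proof (rule morphism_local[OF Z])
  fix z assume "z \<in> pts Z"
  from loc[OF this] obtain N K g where N: "zopen Z N" "z \<in> N" "K \<in> \<Sigma>"
    "\<forall>w\<in>N. g w \<in> affine_toric_pts K \<and> f w = chart K (g w)" "\<forall>m\<in>dual_semigroup K. (\<lambda>w. g w m) \<in> reg Z N"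
    by (elim exE conjE) (rule that)
  have "morphism (induced Z N) (affine_toric K) g"
    by (rule morphism_into_affine_toric[OF induced_nice[OF Z N(1)]])
      (use N in \<open>auto simp: induced_pts[OF N(1)] induced_reg[OF nice_sheaf[OF Z] N(1)]\<close>)
  then have "morphism (induced Z N) X (chart K \<circ> g)"
    by (rule morphism_compose[OF _ chart_morphism[OF N(3)]])
  then have "morphism (induced Z N) X f"
    by (rule morphism_cong[OF induced_nice[OF Z N(1)]]) (use N(4) in \<open>simp add: induced_pts[OF N(1)]\<close>)
  then show "\<exists>N. zopen Z N \<and> z \<in> N \<and> morphism (induced Z N) X f" using N(1,2) by blast
qed

definition coords :: "(real ^ 'n) set => ('n, 'k::field) toric_pt => int ^ 'n => 'k"
  where "coords K p = (THE x. x \<in> affine_toric_pts K \<and> chart K x = p)"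

lemma coords_chart [simp]:
  fixes x :: "int ^ 'n => 'k::alg_closed_field"
  shows "K \<in> \<Sigma> ==> x \<in> affine_toric_pts K ==> coords K (chart K x) = x"
  unfolding coords_def by (rule the_equality) (auto dest: chart_inj)

lemma coords_in:
  fixes p :: "('n, 'k::alg_closed_field) toric_pt"
  assumes "K \<in> \<Sigma>" "p \<in> chart_img K"
  shows "coords K p \<in> affine_toric_pts K" "chart K (coords K p) = p"
  using assms by (auto simp: chart_img_def)

text \<open>With the separating character \<open>m\<close>, one chart meets the other in the principal open subset \<open>m \<noteq> 0\<close>, and
  the coordinates for one chart are quotients of those for the other.\<close>

lemma chart_overlap:
  assumes K: "K \<in> \<Sigma>" "K' \<in> \<Sigma>"
    and m: "m \<in> dual_semigroup K'" "- m \<in> dual_semigroup K"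
      "\<And>p. p \<in> dual_semigroup (K \<inter> K') ==> \<exists>N. p + of_nat N * m \<in> dual_semigroup K'"
  shows "{x' \<in> affine_toric_pts K'. (chart K' x' :: ('n, 'k::alg_closed_field) toric_pt) \<in> chart_img K} =
      {x' \<in> affine_toric_pts K'. x' m \<noteq> 0}" (is "?L = ?R")
    and "\<And>x' p N. x' \<in> affine_toric_pts K' ==> (chart K' x' :: ('n, 'k) toric_pt) \<in> chart_img K ==>
      p \<in> dual_semigroup K ==> p + of_nat N * m \<in> dual_semigroup K' ==>
      coords K (chart K' x') p = x' (p + of_nat N * m) / x' m ^ N"
proof -
  have form: "\<exists>u \<phi>. lattice_vec u \<in> K \<inter> K' \<and> \<phi> \<in> torus \<and> x' = limit_pt K' u \<phi> \<and>
     coords K (chart K' x') = limit_pt K u \<phi>"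
    if x': "x' \<in> affine_toric_pts K'" "chart K' x' \<in> chart_img K" for x' :: "int ^ 'n => 'k"
  proof -
    obtain x where x: "x \<in> affine_toric_pts K" "chart K x = chart K' x'"
      using x'(2) by (auto simp: chart_img_def)
    then obtain u \<phi> where "lattice_vec u \<in> K \<inter> K'" "\<phi> \<in> torus" "x = limit_pt K u \<phi>" "x' = limit_pt K' u \<phi>"
      using chart_eq_iff[OF K x(1) x'(1)] by blast
    then show ?thesis using coords_chart[OF K(1) x(1)] x(2) by auto
  qed
  show "?L = ?R"
  proof (intro equalityI subsetI)
    fix x' assume x': "x' \<in> ?L"
    then obtain u and \<phi> :: "int ^ 'n => 'k" where u: "lattice_vec u \<in> K \<inter> K'" "\<phi> \<in> torus" "x' = limit_pt K' u \<phi>"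
      using form by blast
    then have "pairing m u = 0" using separating_pairing_0[OF m(1,2)] by blast
    then show "x' \<in> ?R" using x' u m(1) by (simp add: limit_pt_def)
  next
    fix x' assume x': "x' \<in> ?R"
    then obtain u and \<phi> :: "int ^ 'n => 'k" where u: "lattice_vec u \<in> K'" "\<phi> \<in> torus" "x' = limit_pt K' u \<phi>"
      using limit_pt_form[OF rpc[OF K(2)]] by blast
    then have mu: "pairing m u = 0" using x' by (auto simp: limit_pt_def split: if_splits)
    have "lattice_vec u \<in> K"
    proof (rule lattice_point_of_bidual[OF rpc[OF K(1)]])
      fix p assume "p \<in> dual_semigroup K"
      then have "p \<in> dual_semigroup (K \<inter> K')" using dual_semigroup_mono[of "K \<inter> K'" K] by blast
      then obtain N where "p + of_nat N * m \<in> dual_semigroup K'" using m(3) by blast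
      from dual_semigroup_pairing[OF this u(1)] show "0 \<le> pairing p u" using mu by simp
    qed
    then have "chart K' x' \<in> chart_img K"
      using chart_limit_pt[OF K _ u(1,2)] limit_pt_in[OF _ u(2)] u(3) unfolding chart_img_def by blast
    then show "x' \<in> ?L" using x' by simp
  qed
  fix x' :: "int ^ 'n => 'k" and p N
  assume x': "x' \<in> affine_toric_pts K'" "chart K' x' \<in> chart_img K" and p: "p \<in> dual_semigroup K" "p + of_nat N * m \<in> dual_semigroup K'"
  obtain u \<phi> where u: "lattice_vec u \<in> K \<inter> K'" "\<phi> \<in> torus" "x' = limit_pt K' u \<phi>" "coords K (chart K' x') = limit_pt K u \<phi>"
    using form[OF x'] by blast
  have "pairing m u = 0" using separating_pairing_0[OF m(1,2)] u(1) by blast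
  moreover have "x' k = limit_pt K' u \<phi> k" for k using u(3) by simp
  ultimately show "coords K (chart K' x') p = x' (p + of_nat N * m) / x' m ^ N"
    using p m(1) u(2) by (simp add: u(4) limit_pt_def torus_add torus_of_nat)
qed

lemma chart_img_open: "K \<in> \<Sigma> ==> zopen X (chart_img K :: ('n, 'k::alg_closed_field) toric_pt set)"
  unfolding X_eq openin_glue
proof (intro conjI ballI)
  assume K: "K \<in> \<Sigma>"
  show "chart_img K \<subseteq> (\<Union>K\<in>\<Sigma>. chart K ` pts (affine_toric K))"
    using K by (auto simp: chart_img_def)
  fix K' assume K': "K' \<in> \<Sigma>"
  obtain m where m: "m \<in> dual_semigroup K'" "- m \<in> dual_semigroup K"
      "\<And>p. p \<in> dual_semigroup (K \<inter> K') ==> \<exists>N. p + of_nat N * m \<in> dual_semigroup K'"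
    using separating[OF K K'] by blast
  have "zopen (affine_toric K') {x' \<in> pts (affine_toric K'). (x' m :: 'k) \<noteq> 0}"
    by (rule reg_open[OF affine_toric_nice openin_topspace affine_toric_char_reg[OF m(1) openin_topspace]])
  then show "zopen (affine_toric K') {y \<in> pts (affine_toric K'). (chart K' y :: ('n, 'k) toric_pt) \<in> chart_img K}"
    using chart_overlap(1)[OF K K' m, where ?'k = 'k] by simp
qed

lemma coords_reg:
  assumes K: "K \<in> \<Sigma>" and p: "p \<in> dual_semigroup K"
  shows "(\<lambda>x. coords K x p) \<in> reg X (chart_img K :: ('n, 'k::alg_closed_field) toric_pt set)"
  unfolding X_eq glue_reg
proof (rule ballI)
  fix K' assume K': "K' \<in> \<Sigma>"
  obtain m where m: "m \<in> dual_semigroup K'" "- m \<in> dual_semigroup K"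
      "\<And>p. p \<in> dual_semigroup (K \<inter> K') ==> \<exists>N. p + of_nat N * m \<in> dual_semigroup K'"
    using separating[OF K K'] by blast
  let ?T = "affine_toric K' :: (int ^ 'n => 'k, 'k) fspace"
  let ?D = "{y \<in> pts ?T. (chart K' y :: ('n, 'k) toric_pt) \<in> chart_img K}"
  have D: "zopen ?T ?D"
    using chart_img_open[OF K, where ?'k = 'k] K' unfolding X_eq openin_glue by blast
  have "p \<in> dual_semigroup (K \<inter> K')" using p dual_semigroup_mono[of "K \<inter> K'" K] by blast
  then obtain N where N: "p + of_nat N * m \<in> dual_semigroup K'" using m(3) by blast
  have nz: "x m ^ N \<noteq> 0" if "x \<in> ?D" for x
    using that chart_overlap(1)[OF K K' m, where ?'k = 'k] by auto
  have "(\<lambda>x. x (p + of_nat N * m) / x m ^ N) \<in> reg ?T ?D"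
    by (rule reg_divide[OF affine_toric_nice D _ _ nz])
      (rule affine_toric_char_reg[OF N D] reg_power[OF affine_toric_nice D affine_toric_char_reg[OF m(1) D]])+
  then show "(\<lambda>x. coords K x p) \<circ> chart K' \<in> reg ?T ?D"
    by (rule reg_cong[OF affine_toric_nice D]) (use chart_overlap(2)[OF K K' m _ _ p N, where ?'k = 'k] in simp)
qed

lemma coords_morphism:
  assumes K: "K \<in> \<Sigma>"
  shows "morphism (induced X (chart_img K :: ('n, 'k::alg_closed_field) toric_pt set)) (affine_toric K) (coords K)"
  by (rule morphism_into_affine_toric[OF induced_nice[OF X_nice chart_img_open[OF K]]])
    (auto simp: induced_pts[OF chart_img_open[OF K]] coords_in[OF K]
      induced_reg[OF nice_sheaf[OF X_nice] chart_img_open[OF K]] coords_reg[OF K])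

lemma open_in_chart:
  fixes V :: "('n, 'k::alg_closed_field) toric_pt set"
  assumes K: "K \<in> \<Sigma>" and V: "V \<subseteq> chart_img K"
  shows "zopen X V \<longleftrightarrow> zopen (affine_toric K) {x \<in> affine_toric_pts K. chart K x \<in> V}"
proof
  assume "zopen X V"
  then show "zopen (affine_toric K) {x \<in> affine_toric_pts K. chart K x \<in> V}"
    using morphism_preimage_open[OF chart_morphism[OF K]] by simp
next
  assume o: "zopen (affine_toric K) {x \<in> affine_toric_pts K. chart K x \<in> V}"
  have "{p \<in> chart_img K. coords K p \<in> {x \<in> affine_toric_pts K. chart K x \<in> V}} = V"
    using V by (auto simp: coords_in[OF K] subset_iff)
  then have "zopen (induced X (chart_img K)) V"
    using morphism_preimage_open[OF coords_morphism[OF K] o] by (simp add: induced_pts[OF chart_img_open[OF K]])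
  then show "zopen X V" by (simp add: induced_openin[OF chart_img_open[OF K]])
qed

text \<open>The torus is the chart of the zero cone; it lies in every chart.\<close>

lemma chart_torus:
  fixes \<phi> :: "int ^ 'n => 'k::alg_closed_field"
  assumes "K \<in> \<Sigma>" "\<phi> \<in> torus"
  shows "chart K (limit_pt K 0 \<phi>) = chart {0} \<phi>"
proof -
  have "limit_pt {0} 0 \<phi> = \<phi>" by (auto simp: limit_pt_def)
  then show ?thesis using chart_limit_pt[of K "{0}" 0 \<phi>] assms zero_cone_in_fan zero_in by simp
qed

text \<open>By the gluing relation the choice of the cone does not matter.\<close>

definition limit :: "int ^ 'n => (int ^ 'n => 'k::field) => ('n, 'k) toric_pt"
  where "limit u \<phi> = (let K = (SOME K. K \<in> \<Sigma> \<and> lattice_vec u \<in> K) in chart K (limit_pt K u \<phi>))"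

lemma limit_eq:
  fixes \<phi> :: "int ^ 'n => 'k::alg_closed_field"
  assumes "K \<in> \<Sigma>" "lattice_vec u \<in> K" "\<phi> \<in> torus"
  shows "limit u \<phi> = chart K (limit_pt K u \<phi>)"
proof -
  define \<tau> where "\<tau> = (SOME K. K \<in> \<Sigma> \<and> lattice_vec u \<in> K)"
  have "\<tau> \<in> \<Sigma> \<and> lattice_vec u \<in> \<tau>" unfolding \<tau>_def by (rule someI) (use assms in blast)
  then show ?thesis
    unfolding limit_def Let_def \<tau>_def[symmetric] using assms by (intro chart_limit_pt) auto
qed

lemma X_pts_limit:
  fixes p :: "('n, 'k::alg_closed_field) toric_pt"
  assumes "K \<in> \<Sigma>" "p \<in> chart_img K"
  obtains u \<phi> where "lattice_vec u \<in> K" "\<phi> \<in> torus" "p = limit u \<phi>"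
proof -
  obtain x where x: "x \<in> affine_toric_pts K" "p = chart K x" using assms by (auto simp: chart_img_def)
  obtain u \<phi> where "lattice_vec u \<in> K" "\<phi> \<in> torus" "x = limit_pt K u \<phi>"
    using limit_pt_form[OF rpc[OF assms(1)] x(1)] by blast
  then show thesis using that x limit_eq[OF assms(1)] by metis
qed

lemma limit_0:
  fixes \<phi> :: "int ^ 'n => 'k::alg_closed_field"
  shows "\<phi> \<in> torus ==> limit 0 \<phi> = chart {0} \<phi>"
  using limit_eq[OF zero_cone_in_fan, of 0 \<phi>] chart_torus[OF zero_cone_in_fan] by simp

end

section \<open>Unions of toric charts\<close>

lemma affine_line_cofinite_ex:
  assumes "zopen (affine_line :: ('k::field_char_0, 'k) fspace) E" "a \<in> E" "finite B"
  shows "\<exists>s\<in>E. s \<notin> B"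
proof -
  have "finite (- E)" using assms(1,2) by (auto simp: affine_line_openin)
  then obtain s where "s \<notin> - E \<union> B"
    using ex_new_if_finite[OF infinite_UNIV_char_0, of "- E \<union> B"] assms(3) by blast
  then show ?thesis by blast
qed

lemma zero_powi_eq: "(0 :: 'k::field) powi k = (if k = 0 then 1 else 0)"
  by (simp add: power_int_def)

context toric_fan
begin

subsection \<open>Curves in the torus and their limits\<close>

definition torus_pt :: "(int ^ 'n => 'k::field) => ('n, 'k) toric_pt"
  where "torus_pt \<phi> = chart {0} \<phi>"

lemma chart_img_zero: "chart_img {0} = torus_pt ` torus"
  by (simp add: chart_img_def torus_pt_def affine_toric_pts_zero_cone)

lemma torus_pt_chart:
  fixes \<phi> :: "int ^ 'n => 'k::alg_closed_field"
  assumes "K \<in> \<Sigma>" "\<phi> \<in> torus"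
  shows "torus_pt \<phi> \<in> chart_img K" "m \<in> dual_semigroup K ==> coords K (torus_pt \<phi>) m = \<phi> m"
proof -
  have l: "limit_pt K 0 \<phi> \<in> affine_toric_pts K"
    using limit_pt_in[of 0 K \<phi>] assms zero_in by simp
  then show "torus_pt \<phi> \<in> chart_img K"
    using chart_torus[OF assms] by (auto simp: torus_pt_def chart_img_def)
  show "m \<in> dual_semigroup K ==> coords K (torus_pt \<phi>) m = \<phi> m"
    using coords_chart[OF assms(1) l] chart_torus[OF assms] by (simp add: torus_pt_def limit_pt_def)
qed

lemma torus_pt_in_X:
  fixes \<phi> :: "int ^ 'n => 'k::alg_closed_field"
  shows "\<phi> \<in> torus ==> torus_pt \<phi> \<in> pts X"
  using torus_pt_chart(1)[OF zero_cone_in_fan] zero_cone_in_fan by (auto simp: X_pts)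

lemma limit_chart:
  fixes \<phi> :: "int ^ 'n => 'k::alg_closed_field"
  assumes "K \<in> \<Sigma>" "lattice_vec u \<in> K" "\<phi> \<in> torus"
  shows "limit u \<phi> \<in> chart_img K" "coords K (limit u \<phi>) = limit_pt K u \<phi>"
  using limit_pt_in[OF assms(2,3)] coords_chart[OF assms(1)] limit_eq[OF assms] by (auto simp: chart_img_def)

lemma torus_pt_eq_limit:
  fixes \<phi> :: "int ^ 'n => 'k::alg_closed_field"
  shows "\<phi> \<in> torus ==> torus_pt \<phi> = limit 0 \<phi>"
  by (simp add: limit_0 torus_pt_def)

text \<open>Translates of the subtori generated by the one-parameter subgroups along \<open>w j\<close>. Two of their
  points are joined by letting all parameters move along a line.\<close>

definition subtorus :: "(int ^ 'n => 'k::field) => 'j set => ('j => int ^ 'n) => ('n, 'k) toric_pt set"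
  where "subtorus \<phi> J w = {torus_pt (\<lambda>m. \<phi> m * (\<Prod>j\<in>J. s j powi pairing m (w j))) |s. \<forall>j\<in>J. s j \<noteq> 0}"

lemma subtorus_char_in_torus:
  "\<phi> \<in> torus ==> \<forall>j\<in>J. s j \<noteq> 0 ==> (\<lambda>m. \<phi> m * (\<Prod>j\<in>J. s j powi pairing m (w j))) \<in> torus"
  by (intro torus_mult torus_prod one_parameter_torus) auto

lemma subtorus_irreducible:
  fixes \<phi> :: "int ^ 'n => 'k::{alg_closed_field, field_char_0}"
  assumes J: "finite J" and \<phi>: "\<phi> \<in> torus"
  shows "irreducible_in (zar X) (subtorus \<phi> J w)"
proof (rule irreducible_if_joined_by_curves)
  show "subtorus \<phi> J w \<noteq> {}"
    unfolding subtorus_def by (auto intro: exI[of _ "\<lambda>_. 1"])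
  show "subtorus \<phi> J w \<subseteq> pts X"
    unfolding subtorus_def using torus_pt_in_X[OF subtorus_char_in_torus[OF \<phi>]] by blast
  fix x y assume "x \<in> subtorus \<phi> J w" "y \<in> subtorus \<phi> J w"
  then obtain a b where a: "x = torus_pt (\<lambda>m. \<phi> m * (\<Prod>j\<in>J. a j powi pairing m (w j)))" "\<forall>j\<in>J. a j \<noteq> 0"
    and b: "y = torus_pt (\<lambda>m. \<phi> m * (\<Prod>j\<in>J. b j powi pairing m (w j)))" "\<forall>j\<in>J. b j \<noteq> 0"
    by (auto simp: subtorus_def)
  define l where "l j = [:a j, b j - a j:]" for j
  have l: "poly (l j) 0 = a j" "poly (l j) 1 = b j" for j by (simp_all add: l_def)
  define E where "E = {t. \<forall>j\<in>J. poly (l j) t \<noteq> 0}"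
  define g where "g t = (\<lambda>m. \<phi> m * (\<Prod>j\<in>J. poly (l j) t powi pairing m (w j)))" for t
  have "- E = (\<Union>j\<in>J. {t. poly (l j) t = 0})" by (auto simp: E_def)
  moreover have "l j \<noteq> 0" if "j \<in> J" for j using a(2) that by (auto simp: l_def)
  ultimately have E: "zopen (affine_line :: ('k, 'k) fspace) E"
    using J by (auto simp: affine_line_openin poly_roots_finite)
  have gt: "g t \<in> torus" if "t \<in> E" for t
    unfolding g_def using that by (intro subtorus_char_in_torus[OF \<phi>]) (simp add: E_def)
  have "morphism (induced affine_line E) X (\<lambda>t. torus_pt (g t))"
  proof (rule morphism_into_X[OF induced_nice[OF affine_line_nice E]])
    let ?Z = "induced affine_line E :: ('k, 'k) fspace"
    have op: "zopen ?Z E" using E by (simp add: induced_openin[OF E])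
    note nz = induced_nice[OF affine_line_nice E]
    have r: "reg ?Z E = reg affine_line E" by (rule induced_reg[OF nice_sheaf[OF affine_line_nice] E])
    have "(\<lambda>t. g t m) \<in> reg ?Z E" for m
      unfolding g_def r
      by (intro reg_mult[OF affine_line_nice E] reg_const[OF affine_line_nice E] reg_prod[OF affine_line_nice E]
          reg_power_int[OF affine_line_nice E] affine_line_poly_reg[OF E]) (auto simp: E_def)
    then show "\<exists>N K h. zopen ?Z N \<and> z \<in> N \<and> K \<in> \<Sigma> \<and>
      (\<forall>t\<in>N. h t \<in> affine_toric_pts K \<and> torus_pt (g t) = chart K (h t)) \<and>
      (\<forall>m\<in>dual_semigroup K. (\<lambda>t. h t m) \<in> reg ?Z N)" if "z \<in> pts ?Z" for z
      using that op gt zero_cone_in_fan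
      by (intro exI[of _ E] exI[of _ "{0}"] exI[of _ g])
        (auto simp: induced_pts[OF E] affine_toric_pts_zero_cone torus_pt_def)
  qed
  then have "continuous_map (zar (induced affine_line E)) (zar X) (\<lambda>t. torus_pt (g t))"
    by (rule morphism_continuous)
  moreover have "(\<lambda>t. torus_pt (g t)) ` E \<subseteq> subtorus \<phi> J w"
    by (auto simp: subtorus_def g_def E_def)
  moreover have "0 \<in> E" "1 \<in> E" using a b l by (auto simp: E_def)
  moreover have "torus_pt (g 0) = x" "torus_pt (g 1) = y" by (simp_all add: a b g_def l)
  ultimately show "\<exists>E g c d. zopen (affine_line :: ('k, 'k) fspace) E \<and>
      continuous_map (zar (induced affine_line E)) (zar X) g \<and> g ` E \<subseteq> subtorus \<phi> J w \<and> c \<in> E \<and> d \<in> E \<and> g c = x \<and> g d = y"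
    using E by (intro exI[of _ E] exI[of _ "\<lambda>t. torus_pt (g t)"] exI[of _ 0] exI[of _ 1] conjI)
qed

lemma limit_curve:
  fixes \<phi> :: "int ^ 'n => 'k::{alg_closed_field, field_char_0}"
  assumes K: "K \<in> \<Sigma>" and u: "lattice_vec u \<in> K" and \<phi>: "\<phi> \<in> torus"
  shows "morphism affine_line X (\<lambda>s. if s = 0 then limit u \<phi> else torus_pt (\<lambda>m. \<phi> m * s powi pairing m u))"
proof -
  define g where "g s = (\<lambda>m. if m \<in> dual_semigroup K then \<phi> m * s powi pairing m u else 0)" for s
  have g0: "g 0 = limit_pt K u \<phi>"
    by (auto simp: g_def limit_pt_def zero_powi_eq)
  have gs: "g s = limit_pt K 0 (\<lambda>m. \<phi> m * s powi pairing m u)" "(\<lambda>m. \<phi> m * s powi pairing m u) \<in> torus" if "s \<noteq> 0" for s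
    using that \<phi> by (auto simp: g_def limit_pt_def intro: torus_mult one_parameter_torus)
  have gin: "g s \<in> affine_toric_pts K" for s
    using g0 gs[of s] limit_pt_in[OF u \<phi>] limit_pt_in[of 0 K] zero_in[OF K] by (cases "s = 0") auto
  have eq: "(if s = 0 then limit u \<phi> else torus_pt (\<lambda>m. \<phi> m * s powi pairing m u)) = chart K (g s)" for s
    using limit_eq[OF K u \<phi>] g0 gs[of s] chart_torus[OF K] by (auto simp: torus_pt_def)
  show ?thesis
    unfolding eq
  proof (rule morphism_compose[OF _ chart_morphism[OF K], unfolded o_def])
    show "morphism affine_line (affine_toric K) g"
    proof (rule morphism_into_affine_toric[OF affine_line_nice gin])
      fix m assume m: "m \<in> dual_semigroup K"
      let ?A = "affine_line :: ('k, 'k) fspace"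
      have o: "zopen ?A (pts ?A)" by (rule openin_topspace)
      have "(\<lambda>s. \<phi> m * s powi pairing m u) \<in> reg ?A (pts ?A)"
        using dual_semigroup_pairing[OF m u]
        by (intro reg_mult[OF affine_line_nice o] reg_const[OF affine_line_nice o]
            reg_power_int[OF affine_line_nice o] affine_line_id_reg[OF o]) auto
      then show "(\<lambda>s. g s m) \<in> reg ?A (pts ?A)" using m by (simp add: g_def)
    qed
  qed
qed

text \<open>The curve through the limit is continuous at \<open>s = 0\<close>, and non-empty open subsets of the line are cofinite.\<close>

lemma open_meets_limit_curve:
  fixes \<phi> :: "int ^ 'n => 'k::{alg_closed_field, field_char_0}"
  assumes K: "K \<in> \<Sigma>" and u: "lattice_vec u \<in> K" and \<phi>: "\<phi> \<in> torus"
    and V: "zopen X V" "limit u \<phi> \<in> V"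
  shows "\<exists>s. s \<noteq> 0 \<and> torus_pt (\<lambda>m. \<phi> m * s powi pairing m u) \<in> V"
proof -
  let ?g = "\<lambda>s. if s = 0 then limit u \<phi> else torus_pt (\<lambda>m. \<phi> m * s powi pairing m u)"
  have o: "zopen (affine_line :: ('k, 'k) fspace) {s \<in> pts affine_line. ?g s \<in> V}"
    by (rule morphism_preimage_open[OF limit_curve[OF K u \<phi>] V(1)])
  have "0 \<in> {s \<in> pts affine_line. ?g s \<in> V}" using V(2) by simp
  from affine_line_cofinite_ex[OF o this, of "{0}"]
  obtain s where "?g s \<in> V" "s \<noteq> 0" by blast
  then show ?thesis by (intro exI[of _ s]) simp
qed

subsection \<open>Open unions of charts are varieties\<close>

lemma chart_isomorphic_subspace:
  fixes S :: "('n, 'k::alg_closed_field) toric_pt set"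
  assumes S: "zopen X S" and K: "K \<in> \<Sigma>" "chart_img K \<subseteq> S"
  shows "isomorphic (induced (induced X S) (chart_img K)) (affine_toric K)"
proof -
  let ?Y = "induced X S" and ?U = "chart_img K :: ('n, 'k) toric_pt set"
  have Y: "nice ?Y" by (rule induced_nice[OF X_nice S])
  have oX: "zopen X ?U" by (rule chart_img_open[OF K(1)])
  have o: "zopen ?Y ?U" using oX K(2) by (simp add: induced_openin[OF S])
  have r: "reg (induced ?Y ?U) ?U = reg X ?U"
    using induced_reg[OF nice_sheaf[OF Y] o] induced_reg[OF nice_sheaf[OF X_nice] oX] by simp
  have 1: "morphism (induced ?Y ?U) (affine_toric K) (coords K)"
    by (rule morphism_into_affine_toric[OF induced_nice[OF Y o]])
      (auto simp: induced_pts[OF o] r coords_in[OF K(1)] coords_reg[OF K(1)])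
  have "morphism (affine_toric K) ?Y (chart K)"
    by (rule morphism_into_induced[OF affine_toric_nice X_nice S chart_morphism[OF K(1)]])
      (use K(2) in \<open>simp add: chart_img_def\<close>)
  then have 2: "morphism (affine_toric K) (induced ?Y ?U) (chart K)"
    by (rule morphism_into_induced[OF affine_toric_nice Y o]) (simp add: chart_img_def)
  show ?thesis
    unfolding isomorphic_def using 1 2
    by (intro exI[of _ "coords K"] exI[of _ "chart K"])
      (auto simp: induced_pts[OF o] coords_in[OF K(1)] K(1))
qed

context
  fixes \<Delta> :: "(real ^ 'n) set set" and S :: "('n, 'k::{alg_closed_field, field_char_0}) toric_pt set"
  assumes \<Delta>: "\<Delta> \<subseteq> \<Sigma>" "\<Delta> \<noteq> {}" and S: "S = (\<Union>K\<in>\<Delta>. chart_img K)"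
begin

lemma union_open: "zopen X S"
  unfolding S using \<Delta> by (auto intro: chart_img_open)

lemma union_prevariety: "prevariety (induced X S)"
  unfolding prevariety_def
proof (intro conjI)
  have Y: "nice (induced X S)" by (rule induced_nice[OF X_nice union_open])
  then show "sheaf_of_functions (induced X S)" by (rule nice_sheaf)
  have "zopen (induced X S) (chart_img K) \<and> is_affine (induced (induced X S) (chart_img K))"
    if "K \<in> \<Delta>" for K
  proof
    have K: "K \<in> \<Sigma>" "chart_img K \<subseteq> S" using that \<Delta> S by auto
    show "zopen (induced X S) (chart_img K)"
      using chart_img_open[OF K(1)] K(2) by (simp add: induced_openin[OF union_open])
    have "is_affine (affine_toric K :: (int ^ 'n => 'k, 'k) fspace)"
      by (rule is_affine_affine_toric[OF rpc[OF K(1)]])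
    then show "is_affine (induced (induced X S) (chart_img K))"
      using isomorphic_trans[OF chart_isomorphic_subspace[OF union_open K]] unfolding is_affine_def by blast
  qed
  moreover have pS: "\<Union> (chart_img ` \<Delta>) = pts (induced X S)"
    by (simp only: S[symmetric] induced_pts[OF union_open])
  moreover have "finite (chart_img ` \<Delta> :: ('n, 'k) toric_pt set set)"
    using finite_fan \<Delta>(1) finite_subset by blast
  ultimately show "\<exists>\<U>. finite \<U> \<and> \<Union>\<U> = pts (induced X S) \<and>
      (\<forall>U\<in>\<U>. zopen (induced X S) U \<and> is_affine (induced (induced X S) U))"
    using pS by (intro exI[of _ "chart_img ` \<Delta>"] conjI) auto
qed

lemma union_torus: "\<phi> \<in> torus ==> torus_pt \<phi> \<in> S"
  unfolding S using \<Delta> torus_pt_chart(1) by (auto simp: subset_iff)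

lemma torus_pts_eq_subtorus:
  "torus_pt ` torus = (subtorus (\<lambda>_. 1) UNIV (\<lambda>i. axis i 1) :: ('n, 'k) toric_pt set)"
proof (intro equalityI subsetI)
  fix p :: "('n, 'k) toric_pt" assume "p \<in> torus_pt ` torus"
  then obtain \<phi> where \<phi>: "\<phi> \<in> torus" "p = torus_pt \<phi>" by blast
  have "(\<lambda>m. 1 * (\<Prod>i\<in>UNIV. \<phi> (axis i 1) powi pairing m (axis i 1))) = \<phi>"
    by (rule ext) (simp add: torus_eq_prod[OF \<phi>(1), symmetric])
  then show "p \<in> subtorus (\<lambda>_. 1) UNIV (\<lambda>i. axis i 1)"
    unfolding subtorus_def using \<phi> by (intro CollectI exI[of _ "\<lambda>i. \<phi> (axis i 1)"]) simp
next
  fix p :: "('n, 'k) toric_pt" assume "p \<in> subtorus (\<lambda>_. 1) UNIV (\<lambda>i. axis i 1)"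
  then obtain s where s: "\<forall>i\<in>UNIV. s i \<noteq> 0" "p = torus_pt (\<lambda>m. 1 * (\<Prod>i\<in>UNIV. s i powi pairing m (axis i 1)))"
    unfolding subtorus_def by blast
  have "(\<lambda>_. 1) \<in> torus" by (simp add: torus_def)
  from subtorus_char_in_torus[OF this s(1)] show "p \<in> torus_pt ` torus"
    unfolding s(2) by (rule imageI)
qed

text \<open>The torus is irreducible, and it is dense since every point is a limit of a curve in it.\<close>

lemma union_irreducible: "irreducible_in (zar (induced X S)) (pts (induced X S))"
  unfolding irreducible_in_def
proof (intro conjI allI impI)
  let ?Y = "induced X S"
  have one: "(\<lambda>_. 1) \<in> torus" by (simp add: torus_def)
  have p: "pts ?Y = S" by (rule induced_pts[OF union_open])
  show "pts ?Y \<noteq> {}" using union_torus[OF one] p by auto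
  show "pts ?Y \<subseteq> pts ?Y" by simp
  fix A B assume A: "closedin (zar ?Y) A" and B: "closedin (zar ?Y) B" and AB: "pts ?Y \<subseteq> A \<union> B"
  have cl: "closedin (zar X) (pts X - (S - A))" if A: "closedin (zar ?Y) A" for A
  proof -
    have "zopen ?Y (S - A)" using A p by (auto simp: closedin_def)
    then have "zopen X (S - A)" by (simp add: induced_openin[OF union_open])
    then show ?thesis by blast
  qed
  have T: "torus_pt ` torus \<subseteq> S" using union_torus by blast
  have SX: "S \<subseteq> pts X" using openin_subset[OF union_open] .
  have "irreducible_in (zar X) (torus_pt ` torus :: ('n, 'k) toric_pt set)"
    unfolding torus_pts_eq_subtorus by (rule subtorus_irreducible) (auto simp: one)
  moreover have "torus_pt ` torus \<subseteq> (pts X - (S - A)) \<union> (pts X - (S - B))"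
    using T SX AB p by blast
  ultimately have "torus_pt ` torus \<subseteq> pts X - (S - A) \<or> torus_pt ` torus \<subseteq> pts X - (S - B)"
    using cl[OF A] cl[OF B] unfolding irreducible_in_def by blast
  moreover have dense: "S \<subseteq> A'" if A': "closedin (zar ?Y) A'" "torus_pt ` torus \<subseteq> pts X - (S - A')" for A'
  proof
    fix p assume p: "p \<in> S"
    show "p \<in> A'"
    proof (rule ccontr)
      assume "p \<notin> A'"
      obtain K where K: "K \<in> \<Delta>" "p \<in> chart_img K" using p S by blast
      then have K': "K \<in> \<Sigma>" using \<Delta> by blast
      obtain u \<phi> where u: "lattice_vec u \<in> K" "\<phi> \<in> torus" "p = limit u \<phi>"
        using X_pts_limit[OF K' K(2)] by blast
      have V: "zopen X (S - A')"
        using cl[OF A'(1)] A'(1) induced_openin[OF union_open] induced_pts[OF union_open] by (auto simp: closedin_def)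
      obtain s where "s \<noteq> 0" "torus_pt (\<lambda>m. \<phi> m * s powi pairing m u) \<in> S - A'"
        using open_meets_limit_curve[OF K' u(1,2) V] p \<open>p \<notin> A'\<close> u(3) by blast
      moreover have "(\<lambda>m. \<phi> m * s powi pairing m u) \<in> torus"
        using u(2) \<open>s \<noteq> 0\<close> by (intro torus_mult one_parameter_torus)
      ultimately show False using A'(2) by blast
    qed
  qed
  ultimately show "pts ?Y \<subseteq> A \<or> pts ?Y \<subseteq> B" using A B p by blast
qed

text \<open>Two points in the charts of \<open>K\<close> and \<open>K'\<close> coincide iff their coordinates satisfy the relations
  \<open>x(m\<^sub>1) x'(n\<^sub>1) = x(m\<^sub>2) x'(n\<^sub>2)\<close> for \<open>m\<^sub>1 + n\<^sub>1 = m\<^sub>2 + n\<^sub>2\<close>, which are closed conditions.\<close>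

lemma coords_relation:
  fixes p :: "('n, 'k) toric_pt"
  assumes K: "K \<in> \<Sigma>" "K' \<in> \<Sigma>" and p: "p \<in> chart_img K" "p \<in> chart_img K'"
    and m: "m \<in> dual_semigroup K" "n \<in> dual_semigroup K'" "m' \<in> dual_semigroup K" "n' \<in> dual_semigroup K'" "m + n = m' + n'"
  shows "coords K p m * coords K' p n = coords K p m' * coords K' p n'"
proof -
  obtain x x' where x: "x \<in> affine_toric_pts K" "p = chart K x" "x' \<in> affine_toric_pts K'" "p = chart K' x'"
    using p by (auto simp: chart_img_def)
  obtain u \<phi> where u: "lattice_vec u \<in> K \<inter> K'" "\<phi> \<in> torus" "x = limit_pt K u \<phi>" "x' = limit_pt K' u \<phi>"
    using chart_eq_iff[OF K x(1,3)] x(2,4) by auto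
  have c: "coords K p = x" "coords K' p = x'"
    using x K coords_chart[OF K(1) x(1)] coords_chart[OF K(2) x(3)] by simp_all
  have *: "x a * x' b = (if pairing (a + b) u = 0 then \<phi> (a + b) else 0)"
    if "a \<in> dual_semigroup K" "b \<in> dual_semigroup K'" for a b
  proof -
    have "0 \<le> pairing a u" "0 \<le> pairing b u" using that u(1) dual_semigroup_pairing by blast+
    then show ?thesis using that u(2) by (auto simp: u(3,4) limit_pt_def torus_add)
  qed
  show ?thesis unfolding c *[OF m(1,2)] *[OF m(3,4)] m(5) ..
qed

text \<open>For the separating character \<open>m\<close> the relation \<open>x(-m) x'(m) = 1\<close> puts the second point into the first
  chart, where the remaining relations determine its coordinates.\<close>

lemma coords_relation_converse:
  fixes p q :: "('n, 'k) toric_pt"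
  assumes K: "K \<in> \<Sigma>" "K' \<in> \<Sigma>" and p: "p \<in> chart_img K" "q \<in> chart_img K'"
    and rel: "\<And>m n m' n'. m \<in> dual_semigroup K ==> n \<in> dual_semigroup K' ==> m' \<in> dual_semigroup K ==>
      n' \<in> dual_semigroup K' ==> m + n = m' + n' ==> coords K p m * coords K' q n = coords K p m' * coords K' q n'"
  shows "p = q"
proof -
  obtain m where m: "m \<in> dual_semigroup K'" "- m \<in> dual_semigroup K"
      "\<And>p. p \<in> dual_semigroup (K \<inter> K') ==> \<exists>N. p + of_nat N * m \<in> dual_semigroup K'"
    using separating[OF K] by blast
  define x where "x = coords K p" define x' where "x' = coords K' q"
  have x: "x \<in> affine_toric_pts K" "p = chart K x" and x': "x' \<in> affine_toric_pts K'" "q = chart K' x'"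
    using coords_in[OF K(1) p(1)] coords_in[OF K(2) p(2)] by (auto simp: x_def x'_def)
  have "x (- m) * x' m = x 0 * x' 0"
    unfolding x_def x'_def by (rule rel) (use m in auto)
  then have nz: "x' m \<noteq> 0" using x x' by (auto simp: affine_toric_pts_0)
  then have q: "chart K' x' \<in> chart_img K"
    using chart_overlap(1)[OF K m, where ?'k = 'k] x' by blast
  have "coords K q a = x a" for a
  proof (cases "a \<in> dual_semigroup K")
    case True
    then have "a \<in> dual_semigroup (K \<inter> K')" using dual_semigroup_mono[of "K \<inter> K'" K] by blast
    then obtain N where N: "a + of_nat N * m \<in> dual_semigroup K'" using m(3) by blast
    have "x a * x' (of_nat N * m) = x 0 * x' (a + of_nat N * m)"
      unfolding x_def x'_def by (rule rel) (use True N m in \<open>auto intro: dual_semigroup_mult\<close>)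
    then have e: "x' (a + of_nat N * m) = x a * x' m ^ N"
      using x x' m by (simp add: affine_toric_pts_0 affine_toric_pts_of_nat)
    have "coords K q a = x' (a + of_nat N * m) / x' m ^ N"
      using chart_overlap(2)[OF K m x'(1) q True N] x'(2) by simp
    then show ?thesis using nz unfolding e by simp
  next
    case False
    then show ?thesis
      using affine_toric_pts_outside[OF x(1)] coords_in(1)[OF K(1)] q x'(2) affine_toric_pts_outside by metis
  qed
  then have "coords K q = x" by blast
  then show "p = q" using coords_in(2)[OF K(1)] q x'(2) x(2) by metis
qed

lemma union_separated: "separated (induced X S)"
proof -
  let ?Y = "induced X S"
  have Y: "nice ?Y" by (rule induced_nice[OF X_nice union_open])
  have pY: "pts ?Y = S" by (rule induced_pts[OF union_open])
  have "zopen (fprod ?Y ?Y) (S \<times> S - (\<lambda>x. (x, x)) ` S)"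
    unfolding fprod_openin[OF Y Y]
  proof
    fix z assume z: "z \<in> S \<times> S - (\<lambda>x. (x, x)) ` S"
    then obtain p q where pq: "z = (p, q)" "p \<in> S" "q \<in> S" "p \<noteq> q" by auto
    obtain K K' where s: "K \<in> \<Delta>" "p \<in> chart_img K" "K' \<in> \<Delta>" "q \<in> chart_img K'" using pq S by blast
    have K: "K \<in> \<Sigma>" "K' \<in> \<Sigma>" using s \<Delta> by auto
    obtain m n m' n' where m: "m \<in> dual_semigroup K" "n \<in> dual_semigroup K'" "m' \<in> dual_semigroup K" "n' \<in> dual_semigroup K'"
      "m + n = m' + n'" "coords K p m * coords K' q n \<noteq> coords K p m' * coords K' q n'"
      using coords_relation_converse[OF K s(2,4)] pq(4) by blast
    let ?U = "chart_img K :: ('n, 'k) toric_pt set" and ?V = "chart_img K' :: ('n, 'k) toric_pt set"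
    have US: "?U \<subseteq> S" "?V \<subseteq> S" using s S by auto
    have oX: "zopen X ?U" "zopen X ?V" using K by (auto intro: chart_img_open)
    have o: "zopen ?Y ?U" "zopen ?Y ?V" using oX US by (auto simp: induced_openin[OF union_open])
    have r: "(\<lambda>x. coords K x a) \<in> reg ?Y ?U" if "a \<in> dual_semigroup K" for a
      using coords_reg[OF K(1) that] induced_reg[OF nice_sheaf[OF X_nice] oX(1)] by blast
    have r': "(\<lambda>x. coords K' x a) \<in> reg ?Y ?V" if "a \<in> dual_semigroup K'" for a
      using coords_reg[OF K(2) that] induced_reg[OF nice_sheaf[OF X_nice] oX(2)] by blast
    have rm: "(\<lambda>x. - coords K x m') \<in> reg ?Y ?U" by (rule reg_uminus[OF Y o(1) r[OF m(3)]])
    let ?h = "\<lambda>z. (case z of (x, y) => coords K x m * coords K' y n) + (case z of (x, y) => - coords K x m' * coords K' y n')"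
    have h: "?h \<in> tensor_fun ?Y ?Y ?U ?V"
      by (rule tensor_fun_add[OF tensor_fun_single[OF r[OF m(1)] r'[OF m(2)]] tensor_fun_single[OF rm r'[OF m(4)]]])
    have "y \<in> S \<times> S - (\<lambda>x. (x, x)) ` S" if "y \<in> ?U \<times> ?V" "?h y \<noteq> 0" for y
      using that US coords_relation[OF K _ _ m(1-5)] by auto
    then have "\<forall>y\<in>?U \<times> ?V. ?h y \<noteq> 0 --> y \<in> S \<times> S - (\<lambda>x. (x, x)) ` S" by (intro ballI impI)
    moreover have "z \<in> ?U \<times> ?V" "?h z \<noteq> 0" using pq(1) s m(6) by auto
    ultimately show "\<exists>U V. zopen ?Y U \<and> zopen ?Y V \<and> (\<exists>h\<in>tensor_fun ?Y ?Y U V. z \<in> U \<times> V \<and> h z \<noteq> 0 \<and>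
        (\<forall>q\<in>U \<times> V. h q \<noteq> 0 --> q \<in> S \<times> S - (\<lambda>x. (x, x)) ` S))"
      using o h by (intro exI[of _ ?U] exI[of _ ?V] conjI bexI[of _ ?h])
  qed
  then show ?thesis
    unfolding separated_def closedin_def fprod_pts[OF Y Y] pY by auto
qed

lemma union_variety: "variety (induced X S)"
  unfolding variety_def using union_prevariety union_irreducible union_separated by blast

end

subsection \<open>Complete fans\<close>

text \<open>The closure of the graph of the one-parameter subgroup along \<open>w\<close> has a point \<open>p\<close> over 0. A
  character \<open>m\<close> of the chart containing \<open>p\<close> with \<open>j = - \<langle>m, w\<rangle> > 0\<close> would give the relation
  \<open>\<chi>\<^sup>m \<cdot> t\<^sup>j = 1\<close> on the graph, which fails over \<open>t = 0\<close>.\<close>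

lemma complete_covers_lattice:
  assumes complete: "is_complete (X :: (('n, 'k::{alg_closed_field, field_char_0}) toric_pt, 'k) fspace)"
  shows "\<exists>K\<in>\<Sigma>. lattice_vec w \<in> K"
proof -
  let ?Z = "mspec (algebraic_set 1 {}) (polyfun 1) :: (nat => 'k, 'k) fspace"
  let ?X = "X :: (('n, 'k) toric_pt, 'k) fspace"
  define z where "z t = (\<lambda>i::nat. if i = 0 then t else 0)" for t :: 'k
  have Z: "nice ?Z" by (rule mspec_nice[OF polyfun_algebra])
  have pZ: "pts ?Z = algebraic_set 1 {}" by (rule mspec_pts[OF polyfun_algebra])
  have zZ: "z t \<in> pts ?Z" for t unfolding pZ by (simp add: z_def algebraic_set_def affine_pts_def)
  define ops where "ops t = (\<lambda>m. t powi pairing m w)" for t :: 'k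
  have lt: "ops t \<in> torus" if "t \<noteq> 0" for t unfolding ops_def by (rule one_parameter_torus[OF that])
  define \<Gamma> where "\<Gamma> = {(torus_pt (ops t), z t) |t. t \<noteq> 0}"
  define C where "C = zar (fprod ?X ?Z) closure_of \<Gamma>"
  have \<Gamma>: "\<Gamma> \<subseteq> pts (fprod ?X ?Z)"
    unfolding fprod_pts[OF X_nice Z] \<Gamma>_def using zZ torus_pt_in_X[OF lt] by blast
  have "prevariety ?Z" by (rule mspec_polyfun_prevariety) simp
  moreover have "closedin (zar (fprod ?X ?Z)) C" unfolding C_def by simp
  ultimately have clo: "closedin (zar ?Z) (snd ` C)"
    using complete unfolding is_complete_def by blast
  have "z 0 \<in> snd ` C"
  proof (rule ccontr)
    assume no: "z 0 \<notin> snd ` C"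
    have o: "zopen ?Z (pts ?Z - snd ` C)" using clo by blast
    have "z 0 \<in> pts ?Z - snd ` C" using no zZ by blast
    from bspec[OF o[unfolded mspec_openin[OF polyfun_algebra]] this]
    obtain h where h: "h \<in> polyfun 1" "h (z 0) \<noteq> 0" "\<forall>q\<in>algebraic_set 1 {}. h q \<noteq> 0 --> q \<in> pts ?Z - snd ` C"
      by blast
    have "\<exists>p. \<forall>t. h (z t) = poly p t" using h(1)
    proof induction
      case (const c)
      show ?case by (rule exI[of _ "[:c:]"]) simp
    next
      case (coord i)
      then show ?case by (intro exI[of _ "[:0, 1:]"]) (simp add: z_def)
    next
      case (add f g)
      then obtain p q where "\<forall>t. f (z t) = poly p t" "\<forall>t. g (z t) = poly q t" by blast
      then show ?case by (intro exI[of _ "p + q"]) simp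
    next
      case (mult f g)
      then obtain p q where "\<forall>t. f (z t) = poly p t" "\<forall>t. g (z t) = poly q t" by blast
      then show ?case by (intro exI[of _ "p * q"]) simp
    qed
    then obtain p where p: "\<And>t. h (z t) = poly p t" by blast
    then have "p \<noteq> 0" using h(2) by auto
    then obtain t where t: "t \<notin> insert 0 {t. poly p t = 0}"
      using ex_new_if_finite[OF infinite_UNIV_char_0, of "insert 0 {t. poly p t = 0}"] poly_roots_finite by auto
    then have "z t \<notin> snd ` C" using h(3) zZ[of t] p unfolding pZ by auto
    moreover have "(torus_pt (ops t), z t) \<in> \<Gamma>" using t by (auto simp: \<Gamma>_def)
    then have "(torus_pt (ops t), z t) \<in> C" using closure_of_subset[OF \<Gamma>] unfolding C_def by blast
    then have "z t \<in> snd ` C" by force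
    ultimately show False by blast
  qed
  then obtain p where p: "(p, z 0) \<in> C" by auto
  then have "(p, z 0) \<in> pts (fprod ?X ?Z)" unfolding C_def by (auto simp: in_closure_of)
  then have "p \<in> pts ?X" unfolding fprod_pts[OF X_nice Z] by blast
  then obtain K where K: "K \<in> \<Sigma>" "p \<in> chart_img K" unfolding X_pts by blast
  have "lattice_vec w \<in> K"
  proof (rule lattice_point_of_bidual[OF rpc[OF K(1)]], rule ccontr)
    fix m assume m: "m \<in> dual_semigroup K" "\<not> 0 \<le> pairing m w"
    define j where "j = nat (- pairing m w)"
    have j: "j > 0" "pairing m w = - int j" using m(2) by (auto simp: j_def)
    let ?U = "chart_img K :: ('n, 'k) toric_pt set"
    have o: "zopen ?X ?U" "zopen ?Z (pts ?Z)" using chart_img_open[OF K(1)] by simp_all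
    have P: "nice (fprod ?X ?Z)" by (rule fprod_nice[OF X_nice Z])
    have oP: "zopen (fprod ?X ?Z) (?U \<times> pts ?Z)" by (rule fprod_times_openin[OF X_nice Z o])
    have "(\<lambda>x. x 0) \<in> polyfun 1" by (rule polyfun.coord) simp
    then have "(\<lambda>x. x 0) \<in> reg ?Z (pts ?Z)" by (rule mspec_algebra_reg[OF polyfun_algebra _ o(2)])
    then have "(\<lambda>q. coords K (fst q) m * (snd q 0) ^ j - 1) \<in> reg (fprod ?X ?Z) (?U \<times> pts ?Z)" (is "?h \<in> _")
      by (intro reg_diff[OF P oP] reg_mult[OF P oP] reg_power[OF P oP] reg_const[OF P oP]
          fprod_fst_reg[OF X_nice Z o coords_reg[OF K(1) m(1)]] fprod_snd_reg[OF X_nice Z o])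
    then have oD: "zopen (fprod ?X ?Z) {q \<in> ?U \<times> pts ?Z. ?h q \<noteq> 0}" by (rule reg_open[OF P oP])
    have "z 0 0 = 0" by (simp add: z_def)
    then have "?h (p, z 0) \<noteq> 0" using j(1) by (simp add: zero_power)
    moreover have "(p, z 0) \<in> ?U \<times> pts ?Z" using K(2) zZ by blast
    ultimately have inD: "(p, z 0) \<in> {q \<in> ?U \<times> pts ?Z. ?h q \<noteq> 0}" by (intro CollectI conjI)
    have "\<forall>T. (p, z 0) \<in> T \<and> zopen (fprod ?X ?Z) T --> (\<exists>y. y \<in> \<Gamma> \<and> y \<in> T)"
      using p by (simp add: C_def in_closure_of)
    from this[rule_format, OF conjI[OF inD oD]]
    obtain y where y: "y \<in> \<Gamma>" "y \<in> {q \<in> ?U \<times> pts ?Z. ?h q \<noteq> 0}"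
      by (elim exE conjE) (rule that)
    then obtain t where t: "t \<noteq> 0" "y = (torus_pt (ops t), z t)" by (auto simp: \<Gamma>_def)
    have "?h y = t powi pairing m w * t ^ j - 1"
      using torus_pt_chart(2)[OF K(1) lt[OF t(1)] m(1)] by (simp add: t(2) z_def ops_def)
    also have "\<dots> = 0" using t(1) by (simp add: j(2) power_int_minus)
    finally show False using y(2) by blast
  qed
  then show ?thesis using K(1) by blast
qed

end

section \<open>Dimension\<close>

subsection \<open>Chains are local\<close>

lemma irreducible_in_subtopology:
  assumes "C \<subseteq> S"
  shows "irreducible_in (subtopology T S) C \<longleftrightarrow> irreducible_in T C"
proof
  assume i: "irreducible_in T C"
  show "irreducible_in (subtopology T S) C"
    unfolding irreducible_in_def
  proof (intro conjI allI impI)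
    show "C \<noteq> {}" "C \<subseteq> topspace (subtopology T S)" using i assms by (auto simp: irreducible_in_def)
    fix A B assume "closedin (subtopology T S) A" "closedin (subtopology T S) B" and AB: "C \<subseteq> A \<union> B"
    then obtain A' B' where A': "closedin T A'" "A = A' \<inter> S" and B': "closedin T B'" "B = B' \<inter> S"
      by (auto simp: closedin_subtopology)
    then have "C \<subseteq> A' \<or> C \<subseteq> B'" using i AB unfolding irreducible_in_def by blast
    then show "C \<subseteq> A \<or> C \<subseteq> B" using assms A' B' by blast
  qed
next
  assume i: "irreducible_in (subtopology T S) C"
  show "irreducible_in T C"
    unfolding irreducible_in_def
  proof (intro conjI allI impI)
    show "C \<noteq> {}" "C \<subseteq> topspace T" using i by (auto simp: irreducible_in_def)
    fix A B assume A: "closedin T A" and B: "closedin T B" and AB: "C \<subseteq> A \<union> B"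
    have "closedin (subtopology T S) (A \<inter> S)" "closedin (subtopology T S) (B \<inter> S)"
      using A B by (auto simp: closedin_subtopology)
    moreover have "C \<subseteq> A \<inter> S \<union> B \<inter> S" using AB assms by blast
    ultimately have "C \<subseteq> A \<inter> S \<or> C \<subseteq> B \<inter> S" using i unfolding irreducible_in_def by blast
    then show "C \<subseteq> A \<or> C \<subseteq> B" by blast
  qed
qed

lemma irreducible_in_closure:
  assumes i: "irreducible_in T C"
  shows "irreducible_in T (T closure_of C)"
  unfolding irreducible_in_def
proof (intro conjI allI impI)
  have C: "C \<noteq> {}" "C \<subseteq> topspace T" using i by (auto simp: irreducible_in_def)
  have sub: "C \<subseteq> T closure_of C" by (rule closure_of_subset[OF C(2)])
  then show "T closure_of C \<noteq> {}" using C(1) by blast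
  show "T closure_of C \<subseteq> topspace T" by (rule closure_of_subset_topspace)
  fix A B assume A: "closedin T A" and B: "closedin T B" and AB: "T closure_of C \<subseteq> A \<union> B"
  have "C \<subseteq> A \<union> B" using sub AB by (rule subset_trans)
  then have "C \<subseteq> A \<or> C \<subseteq> B" using i A B unfolding irreducible_in_def by blast
  then show "T closure_of C \<subseteq> A \<or> T closure_of C \<subseteq> B"
    using closure_of_minimal A B by metis
qed

lemma irreducible_in_Int_open:
  assumes i: "irreducible_in T C" and S: "openin T S" and ne: "C \<inter> S \<noteq> {}"
  shows "irreducible_in T (C \<inter> S)"
  unfolding irreducible_in_def
proof (intro conjI allI impI ne)
  show "C \<inter> S \<subseteq> topspace T" using S openin_subset by blast
  fix A B assume A: "closedin T A" and B: "closedin T B" and AB: "C \<inter> S \<subseteq> A \<union> B"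
  have cS: "closedin T (topspace T - S)" using S by blast
  have "C \<subseteq> (A \<union> B) \<union> (topspace T - S)" using AB i by (auto simp: irreducible_in_def)
  moreover have "closedin T (A \<union> B)" using A B by blast
  moreover have "\<not> C \<subseteq> topspace T - S" using ne by blast
  ultimately have "C \<subseteq> A \<union> B" using i cS unfolding irreducible_in_def by blast
  then have "C \<subseteq> A \<or> C \<subseteq> B" using i A B unfolding irreducible_in_def by blast
  then show "C \<inter> S \<subseteq> A \<or> C \<inter> S \<subseteq> B" by blast
qed

lemma irreducible_subset_if_Int_open:
  assumes i: "irreducible_in T C" and S: "openin T S" and ne: "C \<inter> S \<noteq> {}" and Z: "closedin T Z" "C \<inter> S \<subseteq> Z"
  shows "C \<subseteq> Z"
proof -
  have "C \<subseteq> Z \<union> (topspace T - S)" using Z(2) i by (auto simp: irreducible_in_def)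
  moreover have "closedin T (topspace T - S)" using S by blast
  ultimately show ?thesis using i Z(1) ne unfolding irreducible_in_def by blast
qed

text \<open>Intersection with the open subset and closure are inverse to each other on irreducible closed sets
  that contain a given point of the open subset.\<close>

lemma irreducible_chain_at_induced:
  assumes S: "zopen X S" and x: "x \<in> S"
  shows "irreducible_chain_at (induced X S) x d \<longleftrightarrow> irreducible_chain_at X x d"
proof
  let ?T = "zar X"
  have zi: "zar (induced X S) = subtopology ?T S" by (simp add: induced_def)
  { assume "irreducible_chain_at (induced X S) x d"
    then obtain Z where Z: "\<And>i. i \<le> d ==> closedin (subtopology ?T S) (Z i)"
      "\<And>i. i \<le> d ==> irreducible_in (subtopology ?T S) (Z i)" "\<And>i. i \<le> d ==> x \<in> Z i" "\<And>i. i < d ==> Z i \<subset> Z (Suc i)"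
      unfolding irreducible_chain_at_def zi by blast
    have ZS: "Z i \<subseteq> S" "Z i \<subseteq> topspace ?T" if "i \<le> d" for i
      using closedin_subset[OF Z(1)[OF that]] by auto
    have eq: "(?T closure_of Z i) \<inter> S = Z i" if il: "i \<le> d" for i
    proof
      obtain A where A: "closedin ?T A" "Z i = A \<inter> S" using Z(1)[OF il] by (auto simp: closedin_subtopology)
      then have "?T closure_of Z i \<subseteq> A" by (intro closure_of_minimal) auto
      then show "(?T closure_of Z i) \<inter> S \<subseteq> Z i" using A by blast
      show "Z i \<subseteq> (?T closure_of Z i) \<inter> S" using closure_of_subset[OF ZS(2)[OF il]] ZS(1)[OF il] by blast
    qed
    have "?T closure_of Z i \<subset> ?T closure_of Z (Suc i)" if "i < d" for i
    proof
      show "?T closure_of Z i \<subseteq> ?T closure_of Z (Suc i)" using Z(4)[OF that] by (intro closure_of_mono) blast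
      show "?T closure_of Z i \<noteq> ?T closure_of Z (Suc i)"
        using eq[of i] eq[of "Suc i"] Z(4)[OF that] that by auto
    qed
    moreover have "irreducible_in ?T (?T closure_of Z i)" if "i \<le> d" for i
      using Z(2)[OF that] irreducible_in_subtopology[OF ZS(1)[OF that]] irreducible_in_closure by blast
    moreover have "x \<in> ?T closure_of Z i" if "i \<le> d" for i
      using closure_of_subset[OF ZS(2)[OF that]] Z(3)[OF that] by blast
    ultimately show "irreducible_chain_at X x d"
      unfolding irreducible_chain_at_def by (intro exI[of _ "\<lambda>i. ?T closure_of Z i"]) simp }
  assume "irreducible_chain_at X x d"
  then obtain Z where Z: "\<And>i. i \<le> d ==> closedin ?T (Z i)"
      "\<And>i. i \<le> d ==> irreducible_in ?T (Z i)" "\<And>i. i \<le> d ==> x \<in> Z i" "\<And>i. i < d ==> Z i \<subset> Z (Suc i)"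
    unfolding irreducible_chain_at_def by blast
  have "Z i \<inter> S \<subset> Z (Suc i) \<inter> S" if i: "i < d" for i
  proof
    show "Z i \<inter> S \<subseteq> Z (Suc i) \<inter> S" using Z(4)[OF i] by blast
    show "Z i \<inter> S \<noteq> Z (Suc i) \<inter> S"
    proof
      assume "Z i \<inter> S = Z (Suc i) \<inter> S"
      then have "Z (Suc i) \<subseteq> Z i"
        using irreducible_subset_if_Int_open[OF Z(2)[of "Suc i"] S _ Z(1)[of i]] Z(3)[of "Suc i"] i x by auto
      then show False using Z(4)[OF i] by blast
    qed
  qed
  moreover have "irreducible_in (subtopology ?T S) (Z i \<inter> S)" if "i \<le> d" for i
    using irreducible_in_Int_open[OF Z(2)[OF that] S] Z(3)[OF that] x
    by (auto simp: irreducible_in_subtopology)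
  moreover have "closedin (subtopology ?T S) (Z i \<inter> S)" if "i \<le> d" for i
    using Z(1)[OF that] by (auto simp: closedin_subtopology)
  ultimately show "irreducible_chain_at (induced X S) x d"
    unfolding irreducible_chain_at_def zi using Z(3) x by (intro exI[of _ "\<lambda>i. Z i \<inter> S"]) auto
qed

lemma irreducible_chain_at_le:
  assumes "irreducible_chain_at X x d" "e \<le> d"
  shows "irreducible_chain_at X x e"
proof -
  obtain Z where Z: "\<forall>i\<le>d. closedin (zar X) (Z i) \<and> irreducible_in (zar X) (Z i) \<and> x \<in> Z i"
    "\<forall>i<d. Z i \<subset> Z (Suc i)"
    using assms(1) unfolding irreducible_chain_at_def by (elim exE conjE)
  then show ?thesis
    unfolding irreducible_chain_at_def using assms(2) by (intro exI[of _ Z]) auto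
qed

subsection \<open>Algebraic independence along a chain\<close>

text \<open>More unknowns than equations; Gaussian elimination of one unknown per equation.\<close>

lemma homogeneous_linear_system:
  fixes a :: "'e => 'm => 'k::field"
  assumes "finite M" "finite E" "card M < card E"
  shows "\<exists>c. (\<exists>e\<in>E. c e \<noteq> 0) \<and> (\<forall>m\<in>M. (\<Sum>e\<in>E. c e * a e m) = 0)"
  using assms
proof (induction M arbitrary: E a rule: finite_induct)
  case empty
  then obtain e where "e \<in> E" by fastforce
  then show ?case by (intro exI[of _ "\<lambda>_. 1"]) auto
next
  case (insert m M)
  show ?case
  proof (cases "\<forall>e\<in>E. a e m = 0")
    case True
    obtain c where "\<exists>e\<in>E. c e \<noteq> 0" "\<forall>m\<in>M. (\<Sum>e\<in>E. c e * a e m) = 0"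
      using insert.IH[of E a] insert.prems insert.hyps by auto
    then show ?thesis using True by (intro exI[of _ c]) auto
  next
    case False
    then obtain e0 where e0: "e0 \<in> E" "a e0 m \<noteq> 0" by blast
    define E' where "E' = E - {e0}"
    define r where "r e = a e m / a e0 m" for e
    have fE': "finite E'" using insert.prems by (simp add: E'_def)
    have "card M < card E'" using insert.prems insert.hyps e0 by (simp add: E'_def)
    then obtain c' where c': "\<exists>e\<in>E'. c' e \<noteq> 0"
      "\<forall>m'\<in>M. (\<Sum>e\<in>E'. c' e * (a e m' - r e * a e0 m')) = 0"
      using insert.IH[of E' "\<lambda>e m'. a e m' - r e * a e0 m'"] fE' by blast
    define c where "c e = (if e = e0 then - (\<Sum>e\<in>E'. c' e * r e) else c' e)" for e
    have sum: "(\<Sum>e\<in>E. c e * a e m') = (\<Sum>e\<in>E'. c' e * (a e m' - r e * a e0 m'))" for m'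
    proof -
      have "(\<Sum>e\<in>E. c e * a e m') = c e0 * a e0 m' + (\<Sum>e\<in>E'. c e * a e m')"
        unfolding E'_def using insert.prems e0 by (intro sum.remove) auto
      also have "(\<Sum>e\<in>E'. c e * a e m') = (\<Sum>e\<in>E'. c' e * a e m')"
        by (rule sum.cong) (auto simp: c_def E'_def)
      finally show ?thesis
        by (simp add: c_def algebra_simps sum_subtractf sum_distrib_left)
    qed
    have "(\<Sum>e\<in>E. c e * a e m) = 0" unfolding sum using e0 by (simp add: r_def)
    moreover have "(\<Sum>e\<in>E. c e * a e m') = 0" if "m' \<in> M" for m'
      unfolding sum using c'(2) that by blast
    moreover have "\<exists>e\<in>E. c e \<noteq> 0" using c'(1) by (auto simp: c_def E'_def)
    ultimately show ?thesis by (intro exI[of _ c]) auto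
  qed
qed

lemma function_algebra_const: "function_algebra R ==> (\<lambda>x. c) \<in> R"
  and function_algebra_add: "function_algebra R ==> f \<in> R ==> g \<in> R ==> (\<lambda>x. f x + g x) \<in> R"
  and function_algebra_mult: "function_algebra R ==> f \<in> R ==> g \<in> R ==> (\<lambda>x. f x * g x) \<in> R"
  by (auto simp: function_algebra_def)

lemma function_algebra_sum:
  assumes "function_algebra R" "\<And>i. i \<in> I ==> f i \<in> R"
  shows "(\<lambda>x. \<Sum>i\<in>I. f i x) \<in> R"
  using assms(2)
proof (induction I rule: infinite_finite_induct)
  case (insert i I)
  then have "f i \<in> R" "(\<lambda>x. \<Sum>i\<in>I. f i x) \<in> R" by auto
  then have "(\<lambda>x. f i x + (\<Sum>i\<in>I. f i x)) \<in> R" by (rule function_algebra_add[OF assms(1)])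
  then show ?case using insert.hyps by simp
qed (use assms(1) in \<open>auto simp: function_algebra_def\<close>)

lemma function_algebra_prod:
  assumes "function_algebra R" "\<And>i. i \<in> I ==> f i \<in> R"
  shows "(\<lambda>x. \<Prod>i\<in>I. f i x) \<in> R"
  using assms(2)
proof (induction I rule: infinite_finite_induct)
  case (insert i I)
  then have "f i \<in> R" "(\<lambda>x. \<Prod>i\<in>I. f i x) \<in> R" by auto
  then have "(\<lambda>x. f i x * (\<Prod>i\<in>I. f i x)) \<in> R" by (rule function_algebra_mult[OF assms(1)])
  then show ?case using insert.hyps by simp
qed (use assms(1) in \<open>auto simp: function_algebra_def\<close>)

lemma function_algebra_power:
  assumes "function_algebra R" "f \<in> R"
  shows "(\<lambda>x. f x ^ n) \<in> R"
  using function_algebra_prod[OF assms(1), of "{..<n}" "\<lambda>_. f"] assms(2) by simp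

lemma function_algebra_diff:
  "function_algebra R ==> f \<in> R ==> g \<in> R ==> (\<lambda>x. f x - g x) \<in> R"
  using function_algebra_add[of R f "\<lambda>x. - 1 * g x"] function_algebra_mult[of R "\<lambda>x. - 1" g]
    function_algebra_const[of R "- 1"] by simp

text \<open>If \<open>f i\<close> vanishes on \<open>A i\<close> but not on \<open>A (Suc i)\<close>, then the functions \<open>f i\<close> are algebraically
  independent: divide a relation by the largest possible power of the last function and restrict
  it to the last but one set.\<close>

lemma monomials_independent:
  fixes f :: "nat => 'a => 'k::field" and A :: "nat => 'a set"
  assumes R: "function_algebra R" and f: "\<And>i. i < d ==> f i \<in> R"
    and prime: "\<And>i g h. i \<le> d ==> g \<in> R ==> h \<in> R ==> (\<forall>x\<in>A i. g x * h x = 0) ==>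
      (\<forall>x\<in>A i. g x = 0) \<or> (\<forall>x\<in>A i. h x = 0)"
    and mono: "\<And>i. i < d ==> A i \<subseteq> A (Suc i)" and ne: "A 0 \<noteq> {}"
    and zero: "\<And>i x. i < d ==> x \<in> A i ==> f i x = 0"
    and nz: "\<And>i. i < d ==> \<exists>x\<in>A (Suc i). f i x \<noteq> 0"
    and E: "finite E" "\<And>e e'. e \<in> E ==> e' \<in> E ==> (\<forall>i<d. e i = e' i) ==> e = e'"
    and rel: "\<forall>x\<in>A d. (\<Sum>e\<in>E. c e * (\<Prod>i<d. f i x ^ e i)) = 0"
  shows "\<forall>e\<in>E. c e = 0"
  using f prime mono zero nz E rel
proof (induction d arbitrary: E)
  case 0
  show ?case
  proof
    fix e assume "e \<in> E"
    then have "E = {e}" using "0.prems"(7) by auto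
    then show "c e = 0" using "0.prems"(8) ne by auto
  qed
next
  case (Suc d)
  show ?case
  proof (rule ccontr)
    assume some: "\<not> (\<forall>e\<in>E. c e = 0)"
    define E' where "E' = {e \<in> E. c e \<noteq> 0}"
    have E': "finite E'" "E' \<noteq> {}" using some Suc.prems(6) by (auto simp: E'_def)
    define k where "k = Min ((\<lambda>e. e d) ` E')"
    have kle: "k \<le> e d" if "e \<in> E'" for e using that E' by (simp add: k_def)
    have "k \<in> (\<lambda>e. e d) ` E'" unfolding k_def using E' by (intro Min_in) auto
    then obtain e1 where e1: "e1 \<in> E'" "e1 d = k" by blast
    define G where "G x = (\<Sum>e\<in>E'. c e * ((\<Prod>i<d. f i x ^ e i) * f d x ^ (e d - k)))" for x
    have fd: "f d \<in> R" using Suc.prems(1) by simp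
    have "G \<in> R"
      unfolding G_def using Suc.prems(1)
      by (intro function_algebra_sum[OF R] function_algebra_mult[OF R] function_algebra_const[OF R]
          function_algebra_prod[OF R] function_algebra_power[OF R]) auto
    have "\<forall>x\<in>A (Suc d). f d x ^ k * G x = 0"
    proof
      fix x assume x: "x \<in> A (Suc d)"
      have "f d x ^ k * G x = (\<Sum>e\<in>E'. c e * (\<Prod>i<Suc d. f i x ^ e i))"
        unfolding G_def sum_distrib_left
        by (rule sum.cong) (auto simp: kle power_add[symmetric] mult_ac)
      also have "\<dots> = (\<Sum>e\<in>E. c e * (\<Prod>i<Suc d. f i x ^ e i))"
        by (rule sum.mono_neutral_left) (use Suc.prems(6) in \<open>auto simp: E'_def\<close>)
      finally show "f d x ^ k * G x = 0" using Suc.prems(8) x by simp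
    qed
    then have "(\<forall>x\<in>A (Suc d). f d x ^ k = 0) \<or> (\<forall>x\<in>A (Suc d). G x = 0)"
      by (intro Suc.prems(2)) (auto intro: \<open>G \<in> R\<close> function_algebra_power[OF R fd])
    moreover have "\<exists>x\<in>A (Suc d). f d x ^ k \<noteq> 0" using Suc.prems(5)[of d] by force
    ultimately have G0: "\<forall>x\<in>A (Suc d). G x = 0" by blast
    define E1 where "E1 = {e \<in> E'. e d = k}"
    have "(\<Sum>e\<in>E1. c e * (\<Prod>i<d. f i x ^ e i)) = 0" if x: "x \<in> A d" for x
    proof -
      have "(\<Sum>e\<in>E1. c e * (\<Prod>i<d. f i x ^ e i)) = (\<Sum>e\<in>E1. c e * ((\<Prod>i<d. f i x ^ e i) * f d x ^ (e d - k)))"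
        by (rule sum.cong) (auto simp: E1_def)
      also have "\<dots> = G x"
        unfolding G_def
      proof (rule sum.mono_neutral_left)
        show "\<forall>e\<in>E' - E1. c e * ((\<Prod>i<d. f i x ^ e i) * f d x ^ (e d - k)) = 0"
        proof
          fix e assume "e \<in> E' - E1"
          then have "e d - k > 0" using kle[of e] by (auto simp: E1_def)
          then show "c e * ((\<Prod>i<d. f i x ^ e i) * f d x ^ (e d - k)) = 0"
            using Suc.prems(4)[of d x] x by (simp add: zero_power)
        qed
      qed (use E' in \<open>auto simp: E1_def\<close>)
      also have "\<dots> = 0" using G0 Suc.prems(3)[of d] x by auto
      finally show ?thesis .
    qed
    then have "\<forall>e\<in>E1. c e = 0"
    proof (intro Suc.IH)
      show "\<And>e e'. e \<in> E1 ==> e' \<in> E1 ==> \<forall>i<d. e i = e' i ==> e = e'"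
        using Suc.prems(7) by (auto simp: E1_def E'_def less_Suc_eq)
      show "finite E1" using E' by (simp add: E1_def)
      fix i g h assume "i \<le> d" "g \<in> R" "h \<in> R" "\<forall>x\<in>A i. g x * h x = 0"
      then show "(\<forall>x\<in>A i. g x = 0) \<or> (\<forall>x\<in>A i. h x = 0)" by (intro Suc.prems(2)) auto
    qed (use Suc.prems in auto)
    then show False using e1 by (auto simp: E1_def E'_def)
  qed
qed

subsection \<open>Upper bound\<close>

definition exponent_box :: "nat => (int ^ 'n::finite) set"
  where "exponent_box L = {m. \<forall>i. \<bar>m $ i\<bar> \<le> int L}"

lemma box_eq_image: "(exponent_box L :: (int ^ 'n::finite) set) = vec_lambda ` (UNIV \<rightarrow>\<^sub>E {- int L..int L})"
proof (intro equalityI subsetI)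
  fix m :: "int ^ 'n" assume "m \<in> exponent_box L"
  then have "vec_nth m \<in> UNIV \<rightarrow>\<^sub>E {- int L..int L}" by (auto simp: exponent_box_def abs_le_iff) (smt (verit))
  then show "m \<in> vec_lambda ` (UNIV \<rightarrow>\<^sub>E {- int L..int L})" by (intro image_eqI[of _ _ "vec_nth m"]) auto
qed (auto simp: exponent_box_def abs_le_iff PiE_iff minus_le_iff)

lemma finite_box: "finite (exponent_box L :: (int ^ 'n::finite) set)" and card_box: "card (exponent_box L :: (int ^ 'n::finite) set) \<le> (2 * L + 1) ^ CARD('n)"
proof -
  have f: "finite ((UNIV :: 'n set) \<rightarrow>\<^sub>E {- int L..int L})" by (rule finite_PiE) auto
  then show "finite (exponent_box L :: (int ^ 'n) set)" unfolding box_eq_image by (rule finite_imageI)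
  have "card (exponent_box L :: (int ^ 'n) set) \<le> card ((UNIV :: 'n set) \<rightarrow>\<^sub>E {- int L..int L})"
    unfolding box_eq_image by (rule card_image_le[OF f])
  also have "\<dots> = (2 * L + 1) ^ CARD('n)" by (simp add: card_PiE nat_add_distrib nat_mult_distrib)
  finally show "card (exponent_box L :: (int ^ 'n) set) \<le> (2 * L + 1) ^ CARD('n)" .
qed

text \<open>An exhaustive filtration by finite-dimensional spaces; it is additive under multiplication, and the
  dimensions grow at most like the \<open>n\<close>-th power of the bound.\<close>

definition bounded_functions :: "(real ^ 'n::finite) set => nat => ((int ^ 'n => 'k::field) => 'k) set"
  where "bounded_functions K L =
    {f. \<exists>a. \<forall>x\<in>affine_toric_pts K. f x = (\<Sum>m\<in>dual_semigroup K \<inter> exponent_box L. a m * x m)}"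

lemma bounded_functionsI:
  "(\<And>x. x \<in> affine_toric_pts K ==> f x = (\<Sum>m\<in>dual_semigroup K \<inter> exponent_box L. a m * x m)) ==>
    f \<in> bounded_functions K L"
  unfolding bounded_functions_def by (intro CollectI exI[of _ a] ballI)

lemma toric_functions_bounded:
  assumes "f \<in> toric_functions K"
  shows "\<exists>L0. \<forall>L\<ge>L0. f \<in> bounded_functions K L"
proof -
  obtain F c where F: "finite F" "F \<subseteq> dual_semigroup K" "\<And>x. x \<in> affine_toric_pts K ==> f x = (\<Sum>m\<in>F. c m * x m)"
    using toric_functionsE[OF assms] by blast
  define L0 where "L0 = (\<Sum>m\<in>F. \<Sum>i\<in>UNIV. nat \<bar>m $ i\<bar>)"
  have "F \<subseteq> exponent_box L" if "L \<ge> L0" for L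
  proof
    fix m assume m: "m \<in> F"
    have "nat \<bar>m $ i\<bar> \<le> L" for i
    proof -
      have "nat \<bar>m $ i\<bar> \<le> (\<Sum>i\<in>UNIV. nat \<bar>m $ i\<bar>)" by (rule member_le_sum) auto
      also have "\<dots> \<le> L0" unfolding L0_def by (rule member_le_sum) (use m F in auto)
      finally show ?thesis using that by simp
    qed
    then show "m \<in> exponent_box L" by (auto simp: exponent_box_def nat_le_iff)
  qed
  then have sub: "F \<subseteq> dual_semigroup K \<inter> exponent_box L" if "L \<ge> L0" for L using F(2) that by blast
  show ?thesis
  proof (intro exI[of _ L0] allI impI)
    fix L assume L: "L \<ge> L0"
    have "f x = (\<Sum>m\<in>dual_semigroup K \<inter> exponent_box L. (if m \<in> F then c m else 0) * x m)" if "x \<in> affine_toric_pts K" for x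
      unfolding F(3)[OF that]
      by (rule sum.mono_neutral_cong_left) (use sub[OF L] finite_box in auto)
    then show "f \<in> bounded_functions K L" by (rule bounded_functionsI)
  qed
qed

lemma bounded_functions_mult:
  assumes "f \<in> bounded_functions K L" "g \<in> bounded_functions K L'"
  shows "(\<lambda>x. f x * g x) \<in> bounded_functions K (L + L')"
proof -
  let ?F = "dual_semigroup K \<inter> exponent_box L" and ?G = "dual_semigroup K \<inter> exponent_box L'"
  let ?H = "dual_semigroup K \<inter> exponent_box (L + L')"
  have fin: "finite ?F" "finite ?G" "finite ?H" using finite_box by auto
  obtain a b where a: "\<forall>x\<in>affine_toric_pts K. f x = (\<Sum>m\<in>?F. a m * x m)"
    and b: "\<forall>x\<in>affine_toric_pts K. g x = (\<Sum>m\<in>?G. b m * x m)"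
    using assms unfolding bounded_functions_def by blast
  define c where "c n = (\<Sum>p\<in>{p \<in> ?F \<times> ?G. fst p + snd p = n}. a (fst p) * b (snd p))" for n
  have "p + q \<in> exponent_box (L + L')" if "p \<in> exponent_box L" "q \<in> exponent_box L'" for p q :: "int ^ 'a"
    using that by (auto simp: exponent_box_def intro: order_trans[OF abs_triangle_ineq add_mono])
  then have im: "(\<lambda>p. fst p + snd p) ` (?F \<times> ?G) \<subseteq> ?H"
    by (auto intro: dual_semigroup_add)
  have "f x * g x = (\<Sum>n\<in>?H. c n * x n)" if x: "x \<in> affine_toric_pts K" for x
  proof -
    have "f x * g x = (\<Sum>p\<in>?F \<times> ?G. (a (fst p) * x (fst p)) * (b (snd p) * x (snd p)))"
      using a b x by (simp add: sum_product sum.cartesian_product case_prod_beta')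
    also have "\<dots> = (\<Sum>p\<in>?F \<times> ?G. a (fst p) * b (snd p) * x (fst p + snd p))"
      by (rule sum.cong) (auto simp: affine_toric_pts_add[OF x] mult_ac)
    also have "\<dots> = (\<Sum>n\<in>?H. \<Sum>p\<in>{p \<in> ?F \<times> ?G. fst p + snd p = n}. a (fst p) * b (snd p) * x (fst p + snd p))"
      using fin im by (intro sum.group[symmetric]) auto
    also have "\<dots> = (\<Sum>n\<in>?H. c n * x n)"
      unfolding c_def sum_distrib_right by (intro sum.cong refl) auto
    finally show ?thesis .
  qed
  then show ?thesis by (rule bounded_functionsI)
qed

lemma bounded_functions_one: "(\<lambda>x. 1) \<in> bounded_functions K L"
proof -
  have 0: "0 \<in> dual_semigroup K \<inter> exponent_box L" by (simp add: exponent_box_def)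
  have fin: "finite (dual_semigroup K \<inter> exponent_box L)" using finite_box by blast
  have "(1 :: 'b) = (\<Sum>m\<in>dual_semigroup K \<inter> exponent_box L. (if m = 0 then 1 else 0) * x m)"
    if "x \<in> affine_toric_pts K" for x :: "int ^ 'a => 'b"
    by (subst sum.remove[OF fin 0]) (simp add: affine_toric_pts_0[OF that] sum.neutral)
  then show ?thesis by (rule bounded_functionsI)
qed

lemma bounded_functions_power:
  assumes "f \<in> bounded_functions K L"
  shows "(\<lambda>x. f x ^ e) \<in> bounded_functions K (e * L)"
  by (induction e) (use bounded_functions_one bounded_functions_mult[OF assms] in auto)

lemma bounded_functions_mono:
  assumes "f \<in> bounded_functions K L" "L \<le> L'"
  shows "f \<in> bounded_functions K L'"
  using bounded_functions_mult[OF assms(1) bounded_functions_one, of "L' - L"] assms(2) by simp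

lemma bounded_functions_prod:
  fixes d :: nat
  assumes "\<And>i. i < d ==> f i \<in> bounded_functions K L"
  shows "(\<lambda>x. \<Prod>i<d. f i x) \<in> bounded_functions K (d * L)"
  using assms
proof (induction d)
  case (Suc d)
  then show ?case
    using bounded_functions_mult[of "\<lambda>x. \<Prod>i<d. f i x" K "d * L" "f d" L] by (simp add: add.commute)
qed (simp add: bounded_functions_one)

text \<open>There are \<open>N\<^sup>d\<close> monomials with exponents below \<open>N\<close> in \<open>d\<close> functions, and they lie in a space
  whose dimension grows like \<open>N\<^sup>n\<close>.\<close>

lemma few_independent_functions:
  fixes f :: "nat => (int ^ 'n::finite => 'k::field) => 'k"
  assumes f: "\<And>i. i < d ==> f i \<in> toric_functions K"
    and indep: "\<And>E c. finite E ==> (\<And>e e'. e \<in> E ==> e' \<in> E ==> (\<forall>i<d. e i = e' i) ==> e = e') ==>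
       (\<forall>x\<in>affine_toric_pts K. (\<Sum>e\<in>E. c e * (\<Prod>i<d. f i x ^ e i)) = 0) ==> \<forall>e\<in>E. c e = 0"
  shows "d \<le> CARD('n)"
proof (rule ccontr)
  assume d: "\<not> d \<le> CARD('n)"
  obtain B0 where B0: "\<And>i L. i < d ==> L \<ge> B0 i ==> f i \<in> bounded_functions K L"
    using toric_functions_bounded[OF f] by metis
  define B where "B = (\<Sum>i<d. B0 i)"
  have fB: "f i \<in> bounded_functions K B" if "i < d" for i
    by (rule B0[OF that]) (use that in \<open>auto simp: B_def intro: member_le_sum\<close>)
  \<comment> \<open>There are \<open>N ^ d\<close> monomials in a space of dimension at most \<open>(R N) ^ n\<close>, so \<open>N > R ^ n\<close> is large enough.\<close>
  define R where "R = 2 * (d * B) + 1"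
  define N where "N = R ^ CARD('n) + 1"
  define E where "E = ({..<d} \<rightarrow>\<^sub>E {..<N})"
  let ?M = "dual_semigroup K \<inter> exponent_box (d * (N * B)) :: (int ^ 'n) set"
  have fE: "finite E" unfolding E_def by (rule finite_PiE) auto
  have cE: "card E = N ^ d" by (simp add: E_def card_PiE)
  have fM: "finite ?M" using finite_box by auto
  have "card ?M \<le> card (exponent_box (d * (N * B)) :: (int ^ 'n) set)" by (rule card_mono) (auto simp: finite_box)
  also have "\<dots> \<le> (2 * (d * (N * B)) + 1) ^ CARD('n)" by (rule card_box)
  also have "\<dots> \<le> (R * N) ^ CARD('n)"
    by (rule power_mono) (auto simp: R_def N_def algebra_simps)
  also have "\<dots> = R ^ CARD('n) * N ^ CARD('n)" by (rule power_mult_distrib)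
  also have "\<dots> < N * N ^ CARD('n)" by (simp add: N_def)
  also have "\<dots> = N ^ Suc (CARD('n))" by simp
  also have "\<dots> \<le> N ^ d" by (rule power_increasing) (use d in \<open>auto simp: N_def\<close>)
  finally have lt: "card ?M < card E" by (simp only: cE)
  have "(\<lambda>x. \<Prod>i<d. f i x ^ e i) \<in> bounded_functions K (d * (N * B))" if "e \<in> E" for e
  proof (rule bounded_functions_prod[of d "\<lambda>i x. f i x ^ e i"])
    fix i assume i: "i < d"
    then have "e i < N" using that PiE_mem[of e "{..<d}" "\<lambda>_. {..<N}" i] by (simp add: E_def)
    then show "(\<lambda>x. f i x ^ e i) \<in> bounded_functions K (N * B)"
      by (intro bounded_functions_mono[OF bounded_functions_power[OF fB[OF i], of "e i"]]) simp
  qed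
  then obtain a where a: "\<And>e x. e \<in> E ==> x \<in> affine_toric_pts K ==> (\<Prod>i<d. f i x ^ e i) = (\<Sum>m\<in>?M. a e m * x m)"
    unfolding bounded_functions_def by (simp only: mem_Collect_eq) metis
  obtain c where c: "\<exists>e\<in>E. c e \<noteq> 0" "\<forall>m\<in>?M. (\<Sum>e\<in>E. c e * a e m) = 0"
    using homogeneous_linear_system[OF fM fE lt, of a] by blast
  have "(\<Sum>e\<in>E. c e * (\<Prod>i<d. f i x ^ e i)) = 0" if x: "x \<in> affine_toric_pts K" for x
  proof -
    have "(\<Sum>e\<in>E. c e * (\<Prod>i<d. f i x ^ e i)) = (\<Sum>e\<in>E. \<Sum>m\<in>?M. c e * a e m * x m)"
      by (rule sum.cong) (auto simp: a[OF _ x] sum_distrib_left mult_ac)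
    also have "\<dots> = (\<Sum>m\<in>?M. (\<Sum>e\<in>E. c e * a e m) * x m)"
      unfolding sum_distrib_right by (rule sum.swap)
    also have "\<dots> = 0" using c(2) by simp
    finally show ?thesis .
  qed
  moreover have "e = e'" if "e \<in> E" "e' \<in> E" "\<forall>i<d. e i = e' i" for e e'
    using that unfolding E_def by (intro PiE_ext[of e "{..<d}" _ e']) auto
  ultimately have "\<forall>e\<in>E. c e = 0" using indep[OF fE] by blast
  then show False using c(1) by blast
qed

lemma two_powi_eq_1: "(2 :: 'k::field_char_0) powi k = 1 ==> k = 0"
proof -
  assume "(2 :: 'k) powi k = 1"
  moreover have "(2 :: 'k) ^ j = 1 ==> j = 0" for j
  proof -
    assume "(2 :: 'k) ^ j = 1"
    then have "of_nat (2 ^ j) = (of_nat 1 :: 'k)" by simp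
    then have "(2 :: nat) ^ j = 1" by (simp only: of_nat_eq_iff)
    then show "j = 0" by simp
  qed
  moreover have "(2 :: 'k) ^ nat (- k) = 1" if "k < 0"
    using that \<open>(2 :: 'k) powi k = 1\<close> by (simp add: power_int_def power_one_over)
  ultimately show "k = 0"
    by (cases "k \<ge> 0") (fastforce simp: power_int_def)+
qed

context toric_fan
begin

text \<open>A chain of length \<open>d\<close> provides \<open>d\<close> functions that are algebraically independent.\<close>

lemma chain_length_le:
  fixes x :: "('n, 'k::{alg_closed_field, field_char_0}) toric_pt"
  assumes x: "x \<in> pts X" and chain: "irreducible_chain_at X x d"
  shows "d \<le> CARD('n)"
proof -
  obtain K where K: "K \<in> \<Sigma>" "x \<in> chart_img K" using x unfolding X_pts by blast
  let ?U = "chart_img K :: ('n, 'k) toric_pt set"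
  have U: "zopen X ?U" by (rule chart_img_open[OF K(1)])
  obtain Z where Z: "\<And>i. i \<le> d ==> closedin (zar X) (Z i)" "\<And>i. i \<le> d ==> irreducible_in (zar X) (Z i)"
    "\<And>i. i \<le> d ==> x \<in> Z i" "\<And>i. i < d ==> Z i \<subset> Z (Suc i)"
    using chain unfolding irreducible_chain_at_def by blast
  define A where "A i = {y \<in> affine_toric_pts K. chart K y \<in> Z i}" for i
  let ?R = "toric_functions K :: ((int ^ 'n => 'k) => 'k) set"
  have "\<exists>f\<in>?R. (\<forall>y\<in>A i. f y = 0) \<and> (\<exists>y\<in>A (Suc i). f y \<noteq> 0)" if i: "i < d" for i
  proof -
    have "\<not> Z (Suc i) \<inter> ?U \<subseteq> Z i"
    proof
      assume "Z (Suc i) \<inter> ?U \<subseteq> Z i"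
      then have "Z (Suc i) \<subseteq> Z i"
        using irreducible_subset_if_Int_open[OF Z(2)[of "Suc i"] U _ Z(1)[of i]] Z(3)[of "Suc i"] K(2) i by auto
      then show False using Z(4)[OF i] by blast
    qed
    then obtain p where p: "p \<in> Z (Suc i)" "p \<in> ?U" "p \<notin> Z i" by blast
    define y where "y = coords K p"
    have y: "y \<in> affine_toric_pts K" "chart K y = p" using coords_in[OF K(1) p(2)] by (auto simp: y_def)
    have "zopen X (pts X - Z i)" using Z(1)[of i] i by auto
    then have o: "zopen (affine_toric K) {y \<in> pts (affine_toric K). chart K y \<in> pts X - Z i}"
      by (rule morphism_preimage_open[OF chart_morphism[OF K(1)]])
    have "p \<in> pts X" using p(2) openin_subset[OF U] by blast
    then have "y \<in> {y \<in> pts (affine_toric K). chart K y \<in> pts X - Z i}" using y p(3) by simp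
    from bspec[OF o[unfolded affine_toric_openin] this]
    obtain h where "h \<in> ?R" "h y \<noteq> 0"
      "\<forall>q\<in>affine_toric_pts K. h q \<noteq> 0 --> q \<in> {y \<in> pts (affine_toric K). chart K y \<in> pts X - Z i}"
      by blast
    then show ?thesis using y p(1) by (intro bexI[of _ h]) (auto simp: A_def)
  qed
  then obtain f where f: "\<And>i. i < d ==> f i \<in> ?R" "\<And>i y. i < d ==> y \<in> A i ==> f i y = 0"
    "\<And>i. i < d ==> \<exists>y\<in>A (Suc i). f i y \<noteq> 0" by metis
  have clo: "closedin (zar X) (pts X - chart K ` {y \<in> affine_toric_pts K. g y \<noteq> 0})" if g: "g \<in> ?R" for g
  proof -
    have "{y \<in> affine_toric_pts K. chart K y \<in> chart K ` {y \<in> affine_toric_pts K. g y \<noteq> 0}} = {y \<in> affine_toric_pts K. g y \<noteq> 0}"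
      using chart_inj[OF K(1)] by auto
    moreover have "zopen (affine_toric K) {y \<in> affine_toric_pts K. g y \<noteq> 0}"
      using reg_open[OF affine_toric_nice openin_topspace affine_toric_function_reg[OF g openin_topspace]] by simp
    moreover have "chart K ` {y \<in> affine_toric_pts K. g y \<noteq> 0} \<subseteq> ?U" by (auto simp: chart_img_def)
    ultimately have "zopen X (chart K ` {y \<in> affine_toric_pts K. g y \<noteq> 0})"
      by (subst open_in_chart[OF K(1)]) simp_all
    then show ?thesis by blast
  qed
  have prime: "(\<forall>y\<in>A i. g y = 0) \<or> (\<forall>y\<in>A i. h y = 0)"
    if i: "i \<le> d" and g: "g \<in> ?R" "h \<in> ?R" and 0: "\<forall>y\<in>A i. g y * h y = 0" for i g h
  proof -
    let ?C = "\<lambda>g. pts X - chart K ` {y \<in> affine_toric_pts K. g y \<noteq> 0}"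
    have "Z i \<subseteq> ?C g \<union> ?C h"
    proof
      fix p assume p: "p \<in> Z i"
      then have "p \<in> pts X" using closedin_subset[OF Z(1)[OF i]] by blast
      moreover have "False" if y: "p = chart K y" "y \<in> affine_toric_pts K" "g y \<noteq> 0"
         "p = chart K y'" "y' \<in> affine_toric_pts K" "h y' \<noteq> 0" for y y'
      proof -
        have "y = y'" using chart_inj[OF K(1) y(2,5)] y(1,4) by simp
        moreover have "y \<in> A i" using y(1,2) p by (simp add: A_def)
        ultimately show False using 0 y(3,6) by auto
      qed
      ultimately show "p \<in> ?C g \<union> ?C h" by blast
    qed
    then have "Z i \<subseteq> ?C g \<or> Z i \<subseteq> ?C h"
      using Z(2)[OF i] clo[OF g(1)] clo[OF g(2)] unfolding irreducible_in_def by blast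
    then show ?thesis by (auto simp: A_def)
  qed
  have "coords K x \<in> A 0" using coords_in[OF K] Z(3)[of 0] by (simp add: A_def)
  then have ne: "A 0 \<noteq> {}" by blast
  have mono: "A i \<subseteq> A (Suc i)" if "i < d" for i using Z(4)[OF that] by (auto simp: A_def)
  show ?thesis
  proof (rule few_independent_functions[of d f])
    fix E c assume E: "finite E" "\<And>e e'. e \<in> E ==> e' \<in> E ==> (\<forall>i<d. e i = e' i) ==> e = e'"
      and rel: "\<forall>x\<in>affine_toric_pts K. (\<Sum>e\<in>E. c e * (\<Prod>i<d. f i x ^ e i)) = 0"
    have "\<forall>x\<in>A d. (\<Sum>e\<in>E. c e * (\<Prod>i<d. f i x ^ e i)) = 0" using rel by (auto simp: A_def)
    then show "\<forall>e\<in>E. c e = 0"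
      by (intro monomials_independent[OF toric_functions_algebra f(1) prime mono ne f(2,3) E])
  qed (use f(1) in blast)
qed

subsection \<open>Lower bound\<close>

text \<open>On the torus no character vanishes, so all characters of the chart are orthogonal to \<open>u\<close>, and the cone
  contains \<open>- u\<close>, too.\<close>

lemma limit_in_torus_imp_zero:
  fixes \<phi> :: "int ^ 'n => 'k::alg_closed_field"
  assumes K: "K \<in> \<Sigma>" "lattice_vec u \<in> K" and \<phi>: "\<phi> \<in> torus" and t: "limit u \<phi> \<in> chart_img {0}"
  shows "u = 0"
proof -
  obtain \<psi> :: "int ^ 'n => 'k" where \<psi>: "\<psi> \<in> torus" "limit u \<phi> = torus_pt \<psi>"
    using t unfolding chart_img_zero by blast
  then have "limit_pt K u \<phi> = limit_pt K 0 \<psi>"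
    using limit_chart(2)[OF K \<phi>] limit_chart(2)[OF K(1), of 0 \<psi>] torus_pt_eq_limit[OF \<psi>(1)] zero_in[OF K(1)] by simp
  then have "pairing m u = 0" if "m \<in> dual_semigroup K" for m
    using that \<psi>(1) by (auto simp: limit_pt_def fun_eq_iff split: if_splits)
  then have "lattice_vec (- u) \<in> K"
    by (intro lattice_point_of_bidual[OF rpc[OF K(1)]]) simp
  then have "lattice_vec u \<in> K \<inter> uminus ` K"
    using K(2) by (auto intro: image_eqI[of _ _ "lattice_vec (- u)"])
  then show "u = 0" using pointed[OF K(1)] by simp
qed

text \<open>A chain through a limit along \<open>u\<close> consists of the closures of the orbits of growing subtori,
  the first of which is generated by the one-parameter subgroup along \<open>u\<close>.\<close>

lemma chain_exists:
  fixes x :: "('n, 'k::{alg_closed_field, field_char_0}) toric_pt"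
  assumes x: "x \<in> pts X"
  shows "irreducible_chain_at X x (CARD('n))"
proof -
  let ?T = "zar (X :: (('n, 'k) toric_pt, 'k) fspace)"
  obtain K where K: "K \<in> \<Sigma>" "x \<in> chart_img K" using x unfolding X_pts by blast
  obtain u \<phi> where u: "lattice_vec u \<in> K" "\<phi> \<in> torus" "x = limit u \<phi>" using X_pts_limit[OF K] by blast
  define n where "n = CARD('n)"
  obtain i0 where i0: "u \<noteq> 0 ==> u $ i0 \<noteq> 0" by (cases "u = 0") (auto simp: vec_eq_iff)
  \<comment> \<open>At a point of the torus the first subgroup of the chain may be any one.\<close>
  define v where "v = (if u = 0 then axis i0 1 else u)"
  have v0: "v $ i0 \<noteq> 0" using i0 by (auto simp: v_def)
  define w where "w j = (if j = i0 then v else axis j 1)" for j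
  obtain g0 :: "nat => 'n" where g0: "bij_betw g0 {0..<n} UNIV"
    using ex_bij_betw_nat_finite[of "UNIV :: 'n set"] by (auto simp: n_def)
  have n0: "n > 0" by (simp add: n_def)
  define g where "g = Transposition.transpose (g0 0) i0 \<circ> g0"
  have gb: "bij_betw g {0..<n} UNIV"
    unfolding g_def by (rule bij_betw_trans[OF g0]) simp
  have gg: "g 0 = i0" by (simp add: g_def)
  have ginj: "g i = g j \<longleftrightarrow> i = j" if "i < n" "j < n" for i j
    using gb that by (auto simp: bij_betw_def inj_on_def)
  define J where "J k = g ` {..<k}" for k
  \<comment> \<open>A character that is trivial on the earlier subgroups and separates the next one.\<close>
  define m :: "'n => int ^ 'n" where "m j = (if j = i0 then axis i0 1 else of_int (v $ i0) * axis j 1 - of_int (v $ j) * axis i0 1)" for j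
  have ax: "axis i (1 :: int) $ j = (if i = j then 1 else 0)" for i j :: 'n by (simp add: axis_def)
  have mw: "pairing (m (g k)) (w (g k)) \<noteq> 0" if "k < n" for k
    using v0 by (auto simp: m_def w_def ax of_int_vec_index)
  have mw0: "pairing (m (g k)) (w (g l)) = 0" if kl: "l < k" "k < n" for k l
  proof -
    have "g k \<noteq> i0" "g k \<noteq> g l" using ginj[of k 0] ginj[of k l] kl gg by auto
    then show ?thesis
      by (auto simp: m_def w_def ax of_int_vec_index mult.commute[of "v $ g k"])
  qed
  define Z0 where "Z0 k = (if k = 0 then {x} else subtorus \<phi> (J k) w)" for k
  have Z0i: "irreducible_in ?T (Z0 k)" for k
  proof (cases "k = 0")
    case True
    then show ?thesis using x by (auto simp: Z0_def irreducible_in_def)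
  qed (simp add: Z0_def J_def subtorus_irreducible[OF _ u(2)])
  then have Z0X: "Z0 k \<subseteq> topspace ?T" for k by (auto simp: irreducible_in_def)
  define Z where "Z k = ?T closure_of (Z0 k)" for k
  have xZ: "x \<in> Z k" for k
  proof (cases "k = 0")
    case True
    then show ?thesis using closure_of_subset[OF Z0X[of k]] by (auto simp: Z_def Z0_def)
  next
    case False
    then have iJ: "i0 \<in> J k" using gg by (auto simp: J_def)
    have fJ: "finite (J k)" by (simp add: J_def)
    have prod: "(\<Prod>j\<in>J k. (if j = i0 then s else 1) powi pairing q (w j)) = s powi pairing q v" for s :: 'k and q
      by (subst prod.remove[OF fJ iJ]) (simp add: w_def)
    have "\<exists>y\<in>subtorus \<phi> (J k) w. y \<in> V" if V: "x \<in> V" "openin ?T V" for V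
    proof (cases "u = 0")
      case True
      have "torus_pt \<phi> \<in> subtorus \<phi> (J k) w"
        unfolding subtorus_def by (intro CollectI exI[of _ "\<lambda>_. 1"]) simp
      then show ?thesis using V u True by (auto simp: torus_pt_eq_limit[OF u(2)])
    next
      case False
      obtain s where s: "s \<noteq> 0" "torus_pt (\<lambda>m. \<phi> m * s powi pairing m u) \<in> V"
        using open_meets_limit_curve[OF K(1) u(1,2) V(2)] V(1) u(3) by blast
      have "torus_pt (\<lambda>m. \<phi> m * s powi pairing m u) \<in> subtorus \<phi> (J k) w"
        unfolding subtorus_def
        by (intro CollectI exI[of _ "\<lambda>j. if j = i0 then s else 1"]) (use False s in \<open>simp add: prod v_def\<close>)
      then show ?thesis using s(2) by blast
    qed
    then show ?thesis using False x by (auto simp: Z_def Z0_def in_closure_of)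
  qed
  have sub: "Z k \<subseteq> Z (Suc k)" for k
  proof (cases "k = 0")
    case True
    have "?T closure_of {x} \<subseteq> Z (Suc k)"
      using xZ[of "Suc k"] by (intro closure_of_minimal) (auto simp: Z_def)
    then show ?thesis using True by (simp add: Z_def Z0_def)
  next
    case False
    have "subtorus \<phi> (J k) w \<subseteq> subtorus \<phi> (J (Suc k)) w"
    proof
      fix y assume "y \<in> subtorus \<phi> (J k) w"
      then obtain s where s: "\<forall>j\<in>J k. s j \<noteq> 0" "y = torus_pt (\<lambda>m. \<phi> m * (\<Prod>j\<in>J k. s j powi pairing m (w j)))"
        unfolding subtorus_def by blast
      have "(\<Prod>j\<in>J (Suc k). (if j \<in> J k then s j else 1) powi pairing q (w j)) = (\<Prod>j\<in>J k. s j powi pairing q (w j))" for q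
        by (rule prod.mono_neutral_cong_right) (auto simp: J_def)
      then show "y \<in> subtorus \<phi> (J (Suc k)) w"
        unfolding subtorus_def s(2) using s(1)
        by (intro CollectI exI[of _ "\<lambda>j. if j \<in> J k then s j else 1"]) auto
    qed
    then show ?thesis using False by (auto simp: Z_def Z0_def intro!: closure_of_mono)
  qed
  have strict: "Z k \<noteq> Z (Suc k)" if k: "k < n" for k
  proof -
    define \<psi> where "\<psi> = (\<lambda>q. \<phi> q * 2 powi pairing q (w (g k)))"
    have \<psi>: "\<psi> \<in> torus" unfolding \<psi>_def using u(2) by (intro torus_mult one_parameter_torus) auto
    have kJ: "g k \<in> J (Suc k)" by (simp add: J_def)
    have fJ: "finite (J (Suc k))" by (simp add: J_def)
    have prod: "(\<Prod>j\<in>J (Suc k). (if j = g k then 2 else 1 :: 'k) powi pairing q (w j)) = 2 powi pairing q (w (g k))" for q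
      by (subst prod.remove[OF fJ kJ]) simp
    have "torus_pt \<psi> \<in> Z0 (Suc k)"
      unfolding Z0_def subtorus_def \<psi>_def
      by (simp, intro exI[of _ "\<lambda>j. if j = g k then 2 else 1"]) (simp add: prod)
    then have in1: "torus_pt \<psi> \<in> Z (Suc k)" using closure_of_subset[OF Z0X] by (auto simp: Z_def)
    let ?U = "chart_img {0} :: ('n, 'k) toric_pt set" and ?f = "\<lambda>p. coords {0} p (m (g k)) - \<phi> (m (g k))"
    have U: "openin ?T ?U" by (rule chart_img_open[OF zero_cone_in_fan])
    have "?f \<in> reg X ?U"
      by (intro reg_diff[OF X_nice U] reg_const[OF X_nice U] coords_reg[OF zero_cone_in_fan]) simp
    then have O: "openin ?T {p \<in> ?U. ?f p \<noteq> 0}" by (rule reg_open[OF X_nice U])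
    have "\<phi> (m (g k)) * 2 powi pairing (m (g k)) (w (g k)) \<noteq> \<phi> (m (g k))"
      using two_powi_eq_1[where ?'k = 'k] mw[OF k] u(2) by auto
    then have "torus_pt \<psi> \<in> {p \<in> ?U. ?f p \<noteq> 0}"
      using torus_pt_chart[OF zero_cone_in_fan \<psi>] by (simp add: \<psi>_def)
    moreover have "p \<notin> {p \<in> ?U. ?f p \<noteq> 0}" if p: "p \<in> Z0 k" for p
    proof (cases "k = 0")
      case True
      then have px: "p = x" using p by (simp add: Z0_def)
      show ?thesis
      proof (cases "u = 0")
        case True
        then have "p = torus_pt \<phi>" using px u by (simp add: torus_pt_eq_limit)
        then show ?thesis using torus_pt_chart[OF zero_cone_in_fan u(2)] by simp
      next
        case False
        then have "p \<notin> ?U" using limit_in_torus_imp_zero[OF K(1) u(1,2)] px u(3) by blast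
        then show ?thesis by blast
      qed
    next
      case False
      then obtain s where s: "\<forall>j\<in>J k. s j \<noteq> 0" "p = torus_pt (\<lambda>m. \<phi> m * (\<Prod>j\<in>J k. s j powi pairing m (w j)))"
        using p by (auto simp: Z0_def subtorus_def)
      have "(\<Prod>j\<in>J k. s j powi pairing (m (g k)) (w j)) = 1"
        by (rule prod.neutral) (use mw0 k in \<open>auto simp: J_def\<close>)
      then show ?thesis
        using torus_pt_chart(2)[OF zero_cone_in_fan subtorus_char_in_torus[OF u(2) s(1)], of "m (g k)"] by (simp add: s(2))
    qed
    ultimately have disj: "torus_pt \<psi> \<in> {p \<in> ?U. ?f p \<noteq> 0}" "\<And>p. p \<in> Z0 k ==> p \<notin> {p \<in> ?U. ?f p \<noteq> 0}"
      by blast+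
    have "torus_pt \<psi> \<notin> Z k"
    proof
      assume "torus_pt \<psi> \<in> Z k"
      then have "\<forall>T. torus_pt \<psi> \<in> T \<and> openin ?T T --> (\<exists>p. p \<in> Z0 k \<and> p \<in> T)"
        by (simp add: Z_def in_closure_of)
      from this[rule_format, OF conjI[OF disj(1) O]] show False using disj(2) by blast
    qed
    then show ?thesis using in1 by blast
  qed
  have "Z k \<subset> Z (Suc k)" if "k < n" for k using sub strict[OF that] by blast
  moreover have "closedin ?T (Z k)" "irreducible_in ?T (Z k)" for k
    unfolding Z_def using irreducible_in_closure[OF Z0i] by auto
  ultimately show ?thesis
    unfolding irreducible_chain_at_def n_def[symmetric] using xZ by (intro exI[of _ Z]) auto
qed

lemma krull_dim_at_iff:
  fixes x :: "('n, 'k::{alg_closed_field, field_char_0}) toric_pt"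
  assumes x: "x \<in> pts X"
  shows "krull_dim_at X x d \<longleftrightarrow> d = CARD('n)"
proof
  assume k: "krull_dim_at X x d"
  then have "d \<le> CARD('n)" using chain_length_le[OF x] by (auto simp: krull_dim_at_def)
  moreover have "\<not> Suc d \<le> CARD('n)"
    using k irreducible_chain_at_le[OF chain_exists[OF x]] by (auto simp: krull_dim_at_def)
  ultimately show "d = CARD('n)" by simp
next
  assume "d = CARD('n)"
  then show "krull_dim_at X x d"
    using chain_exists[OF x] chain_length_le[OF x, of "Suc d"] by (auto simp: krull_dim_at_def)
qed

lemma smooth_at_iff:
  fixes x :: "('n, 'k::{alg_closed_field, field_char_0}) toric_pt"
  assumes x: "x \<in> pts X"
  shows "smooth_at X x \<longleftrightarrow> max_ideal_generated_by X x (CARD('n))"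
  by (simp add: smooth_at_def krull_dim_at_iff[OF x])

end

section \<open>Smoothness\<close>

subsection \<open>Generators of the maximal ideal\<close>

lemma max_ideal_generated_byE:
  assumes "max_ideal_generated_by X x d"
  obtains U t where "zopen X U" "x \<in> U" "\<forall>i<d. t i \<in> reg X U \<and> t i x = 0"
    "\<forall>V g. zopen X V \<and> x \<in> V \<and> g \<in> reg X V \<and> g x = 0 -->
        (\<exists>W h. zopen X W \<and> x \<in> W \<and> W \<subseteq> U \<inter> V \<and> (\<forall>i<d. h i \<in> reg X W) \<and>
          (\<forall>y\<in>W. g y = (\<Sum>i<d. h i y * t i y)))"
  using assms unfolding max_ideal_generated_by_def by (elim exE conjE) (rule that)

lemma max_ideal_generated_byI:
  assumes "zopen X U" "x \<in> U" "\<forall>i<d. t i \<in> reg X U \<and> t i x = 0"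
    and "\<And>V g. zopen X V \<and> x \<in> V \<and> g \<in> reg X V \<and> g x = 0 ==>
        \<exists>W h. zopen X W \<and> x \<in> W \<and> W \<subseteq> U \<inter> V \<and> (\<forall>i<d. h i \<in> reg X W) \<and>
          (\<forall>y\<in>W. g y = (\<Sum>i<d. h i y * t i y))"
  shows "max_ideal_generated_by X x d"
  unfolding max_ideal_generated_by_def
  by (rule exI[of _ U], rule exI[of _ t], intro conjI, rule assms(1), rule assms(2), rule assms(3),
      intro allI impI, rule assms(4), assumption)

lemma max_ideal_generated_by_induced:
  assumes X: "nice X" and S: "zopen X S" and x: "x \<in> S"
  shows "max_ideal_generated_by (induced X S) x d \<longleftrightarrow> max_ideal_generated_by X x d"
proof
  let ?Y = "induced X S"
  have o: "zopen ?Y U \<longleftrightarrow> zopen X U \<and> U \<subseteq> S" for U by (rule induced_openin[OF S])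
  have r: "reg ?Y U = reg X U" if "zopen X U" for U by (rule induced_reg[OF nice_sheaf[OF X] that])
  { assume "max_ideal_generated_by ?Y x d"
    then obtain U t where U: "zopen ?Y U" "x \<in> U" "\<forall>i<d. t i \<in> reg ?Y U \<and> t i x = 0"
      and gen: "\<forall>V g. zopen ?Y V \<and> x \<in> V \<and> g \<in> reg ?Y V \<and> g x = 0 -->
        (\<exists>W h. zopen ?Y W \<and> x \<in> W \<and> W \<subseteq> U \<inter> V \<and> (\<forall>i<d. h i \<in> reg ?Y W) \<and> (\<forall>y\<in>W. g y = (\<Sum>i<d. h i y * t i y)))"
      by (rule max_ideal_generated_byE)
    have U': "zopen X U" using U(1) o by blast
    have "\<exists>W h. zopen X W \<and> x \<in> W \<and> W \<subseteq> U \<inter> V \<and> (\<forall>i<d. h i \<in> reg X W) \<and> (\<forall>y\<in>W. g y = (\<Sum>i<d. h i y * t i y))"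
      if V: "zopen X V \<and> x \<in> V \<and> g \<in> reg X V \<and> g x = 0" for V g
    proof -
      have VS: "zopen X (V \<inter> S)" using V S by blast
      have oV: "zopen ?Y (V \<inter> S)" using VS by (simp add: o)
      have "g \<in> reg X (V \<inter> S)" by (rule reg_restrict[OF X VS]) (use V in auto)
      then have g: "g \<in> reg ?Y (V \<inter> S)" using r[OF VS] by simp
      have xV: "x \<in> V \<inter> S" using V x by blast
      have gx: "g x = 0" using V by blast
      from gen[rule_format, OF conjI[OF oV conjI[OF xV conjI[OF g gx]]]] obtain W h where W: "zopen ?Y W" "x \<in> W" "W \<subseteq> U \<inter> (V \<inter> S)" "\<forall>i<d. h i \<in> reg ?Y W"
        "\<forall>y\<in>W. g y = (\<Sum>i<d. h i y * t i y)" by blast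
      have W': "zopen X W" using W(1) o by blast
      show ?thesis
        by (rule exI[of _ W], rule exI[of _ h]) (use W W' r[OF W'] in auto)
    qed
    then show "max_ideal_generated_by X x d"
      by (rule max_ideal_generated_byI[OF U' U(2) U(3)[unfolded r[OF U']]]) }
  assume "max_ideal_generated_by X x d"
  then obtain U t where U: "zopen X U" "x \<in> U" "\<forall>i<d. t i \<in> reg X U \<and> t i x = 0"
      and gen: "\<forall>V g. zopen X V \<and> x \<in> V \<and> g \<in> reg X V \<and> g x = 0 -->
        (\<exists>W h. zopen X W \<and> x \<in> W \<and> W \<subseteq> U \<inter> V \<and> (\<forall>i<d. h i \<in> reg X W) \<and> (\<forall>y\<in>W. g y = (\<Sum>i<d. h i y * t i y)))"
    by (rule max_ideal_generated_byE)
  have US: "zopen X (U \<inter> S)" using U S by blast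
  have t: "t i \<in> reg ?Y (U \<inter> S)" if "i < d" for i
    unfolding r[OF US] by (rule reg_restrict[OF X US U(1)]) (use U that in auto)
  have "\<exists>W h. zopen ?Y W \<and> x \<in> W \<and> W \<subseteq> (U \<inter> S) \<inter> V \<and> (\<forall>i<d. h i \<in> reg ?Y W) \<and> (\<forall>y\<in>W. g y = (\<Sum>i<d. h i y * t i y))"
    if V: "zopen ?Y V \<and> x \<in> V \<and> g \<in> reg ?Y V \<and> g x = 0" for V g
  proof -
    have V': "zopen X V" "V \<subseteq> S" using V o by blast+
    have g: "g \<in> reg X V" using V r[OF V'(1)] by simp
    have xV: "x \<in> V" and gx: "g x = 0" using V by blast+
    from gen[rule_format, OF conjI[OF V'(1) conjI[OF xV conjI[OF g gx]]]] obtain W h where W: "zopen X W" "x \<in> W" "W \<subseteq> U \<inter> V" "\<forall>i<d. h i \<in> reg X W"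
        "\<forall>y\<in>W. g y = (\<Sum>i<d. h i y * t i y)" by blast
    show ?thesis
      by (rule exI[of _ W], rule exI[of _ h]) (use W V' r[OF W(1)] in \<open>auto simp: o\<close>)
  qed
  moreover have "zopen ?Y (U \<inter> S)" using US by (simp add: o)
  moreover have "\<forall>i<d. t i \<in> reg ?Y (U \<inter> S) \<and> t i x = 0" using t U(3) by blast
  moreover have "x \<in> U \<inter> S" using U(2) x by blast
  ultimately show "max_ideal_generated_by ?Y x d"
    by (intro max_ideal_generated_byI[of ?Y "U \<inter> S" x d t])
qed

lemma smooth_at_induced:
  assumes "nice X" "zopen X S" "x \<in> S"
  shows "smooth_at (induced X S) x \<longleftrightarrow> smooth_at X x"
  unfolding smooth_at_def krull_dim_at_def
  using irreducible_chain_at_induced[OF assms(2,3)] max_ideal_generated_by_induced[OF assms] by blast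

lemma max_ideal_generated_by_iso:
  assumes f: "morphism A B f" and g: "morphism B A g"
    and gf: "\<And>y. y \<in> pts A ==> g (f y) = y" and a: "a \<in> pts A" and gen: "max_ideal_generated_by B (f a) d"
  shows "max_ideal_generated_by A a d"
proof -
  obtain U t where U: "zopen B U" "f a \<in> U" "\<forall>i<d. t i \<in> reg B U \<and> t i (f a) = 0"
      and gen: "\<forall>V h. zopen B V \<and> f a \<in> V \<and> h \<in> reg B V \<and> h (f a) = 0 -->
        (\<exists>W k. zopen B W \<and> f a \<in> W \<and> W \<subseteq> U \<inter> V \<and> (\<forall>i<d. k i \<in> reg B W) \<and> (\<forall>y\<in>W. h y = (\<Sum>i<d. k i y * t i y)))"
    using gen by (rule max_ideal_generated_byE)
  let ?p = "\<lambda>V. {y \<in> pts A. f y \<in> V}"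
  have "\<exists>W k. zopen A W \<and> a \<in> W \<and> W \<subseteq> ?p U \<inter> V \<and> (\<forall>i<d. k i \<in> reg A W) \<and> (\<forall>y\<in>W. h y = (\<Sum>i<d. k i y * (t i \<circ> f) y))"
    if V: "zopen A V \<and> a \<in> V \<and> h \<in> reg A V \<and> h a = 0" for V h
  proof -
    let ?V = "{b \<in> pts B. g b \<in> V}"
    have oV: "zopen B ?V" using morphism_preimage_open[OF g] V by blast
    have fa: "f a \<in> ?V" using V gf[OF a] morphism_pts[OF f a] by simp
    have hg: "h \<circ> g \<in> reg B ?V" using morphism_reg[OF g] V by blast
    have "(h \<circ> g) (f a) = 0" using V gf[OF a] by simp
    from gen[rule_format, OF conjI[OF oV conjI[OF fa conjI[OF hg this]]]] obtain W k where W: "zopen B W" "f a \<in> W" "W \<subseteq> U \<inter> ?V" "\<forall>i<d. k i \<in> reg B W"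
        "\<forall>y\<in>W. (h \<circ> g) y = (\<Sum>i<d. k i y * t i y)" by blast
    have "zopen A (?p W)" by (rule morphism_preimage_open[OF f W(1)])
    moreover have "\<forall>i<d. k i \<circ> f \<in> reg A (?p W)" using morphism_reg[OF f W(1)] W(4) by blast
    moreover have "\<forall>y\<in>?p W. h y = (\<Sum>i<d. (k i \<circ> f) y * (t i \<circ> f) y)"
    proof
      fix y assume "y \<in> ?p W"
      then have y: "y \<in> pts A" "f y \<in> W" by auto
      have "h y = (h \<circ> g) (f y)" using gf[OF y(1)] by simp
      then show "h y = (\<Sum>i<d. (k i \<circ> f) y * (t i \<circ> f) y)" using W(5) y(2) by simp
    qed
    moreover have "?p W \<subseteq> ?p U \<inter> V"
    proof
      fix y assume "y \<in> ?p W"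
      then have "y \<in> pts A" "f y \<in> U" "g (f y) \<in> V" using W(3) by auto
      then show "y \<in> ?p U \<inter> V" using gf[of y] by simp
    qed
    ultimately show ?thesis using W(2) a
      by (intro exI[of _ "?p W"] exI[of _ "\<lambda>i. k i \<circ> f"]) simp
  qed
  moreover have "zopen A (?p U)" by (rule morphism_preimage_open[OF f U(1)])
  moreover have "\<forall>i<d. (t i \<circ> f) \<in> reg A (?p U) \<and> (t i \<circ> f) a = 0" using morphism_reg[OF f U(1)] U(3) by simp
  moreover have "a \<in> ?p U" using a U(2) by simp
  ultimately show ?thesis
    by (intro max_ideal_generated_byI[of A "?p U" a d "\<lambda>i. t i \<circ> f"])
qed

definition in_ideal :: "('a, 'k::field) fspace => 'a => nat => (nat => 'a => 'k) => ('a => 'k) => bool"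
  where "in_ideal A y s t f \<longleftrightarrow> (\<exists>W h. zopen A W \<and> y \<in> W \<and> (\<forall>i<s. h i \<in> reg A W) \<and>
    (\<forall>z\<in>W. f z = (\<Sum>i<s. h i z * t i z)))"

context
  fixes A :: "('a, 'k::field) fspace" and y :: 'a
  assumes A: "nice A" and y: "y \<in> pts A"
begin

lemma in_ideal_zero: "in_ideal A y s t (\<lambda>z. 0)"
  unfolding in_ideal_def using y reg_const[OF A openin_topspace, of 0]
  by (intro exI[of _ "pts A"] exI[of _ "\<lambda>i z. 0"]) auto

lemma in_ideal_gen:
  assumes "i < s"
  shows "in_ideal A y s t (t i)"
proof -
  have "(\<Sum>j<s. (if j = i then 1 else 0) * t j z) = t i z" for z
    using assms by (subst sum.remove[of _ i]) (auto intro: sum.neutral)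
  then show ?thesis
    unfolding in_ideal_def using y reg_const[OF A openin_topspace]
    by (intro exI[of _ "pts A"] exI[of _ "\<lambda>j z. if j = i then 1 else 0"]) auto
qed

lemma in_ideal_add:
  assumes "in_ideal A y s t f" "in_ideal A y s t g"
  shows "in_ideal A y s t (\<lambda>z. f z + g z)"
proof -
  obtain W h where W: "zopen A W" "y \<in> W" "\<forall>i<s. h i \<in> reg A W" "\<forall>z\<in>W. f z = (\<Sum>i<s. h i z * t i z)"
    using assms(1) unfolding in_ideal_def by blast
  obtain V k where V: "zopen A V" "y \<in> V" "\<forall>i<s. k i \<in> reg A V" "\<forall>z\<in>V. g z = (\<Sum>i<s. k i z * t i z)"
    using assms(2) unfolding in_ideal_def by blast
  have o: "zopen A (W \<inter> V)" using W V by blast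
  have "\<forall>i<s. (\<lambda>z. h i z + k i z) \<in> reg A (W \<inter> V)"
    using reg_restrict[OF A o W(1)] reg_restrict[OF A o V(1)] W(3) V(3) by (auto intro: reg_add[OF A o])
  then show ?thesis
    unfolding in_ideal_def using o W V
    by (intro exI[of _ "W \<inter> V"] exI[of _ "\<lambda>i z. h i z + k i z"]) (auto simp: sum.distrib algebra_simps)
qed

lemma in_ideal_mult:
  assumes "in_ideal A y s t f" and V: "zopen A V" "y \<in> V" "g \<in> reg A V"
  shows "in_ideal A y s t (\<lambda>z. g z * f z)"
proof -
  obtain W h where W: "zopen A W" "y \<in> W" "\<forall>i<s. h i \<in> reg A W" "\<forall>z\<in>W. f z = (\<Sum>i<s. h i z * t i z)"
    using assms(1) unfolding in_ideal_def by blast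
  have o: "zopen A (W \<inter> V)" using W V by blast
  have "\<forall>i<s. (\<lambda>z. g z * h i z) \<in> reg A (W \<inter> V)"
    using reg_restrict[OF A o W(1)] reg_restrict[OF A o V(1)] W(3) V(3) by (auto intro: reg_mult[OF A o])
  then show ?thesis
    unfolding in_ideal_def using o W V
    by (intro exI[of _ "W \<inter> V"] exI[of _ "\<lambda>i z. g z * h i z"]) (auto simp: sum_distrib_left mult_ac)
qed

lemma in_ideal_cong:
  assumes "in_ideal A y s t f" "zopen A V" "y \<in> V" "\<And>z. z \<in> V ==> g z = f z"
  shows "in_ideal A y s t g"
proof -
  obtain W h where W: "zopen A W" "y \<in> W" "\<forall>i<s. h i \<in> reg A W" "\<forall>z\<in>W. f z = (\<Sum>i<s. h i z * t i z)"
    using assms(1) unfolding in_ideal_def by blast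
  have o: "zopen A (W \<inter> V)" using W assms by blast
  have "\<forall>i<s. h i \<in> reg A (W \<inter> V)" using reg_restrict[OF A o W(1)] W(3) by auto
  then show ?thesis
    unfolding in_ideal_def using o W assms(3,4)
    by (intro exI[of _ "W \<inter> V"] exI[of _ h]) auto
qed

lemma in_ideal_sum: "(\<And>i. i \<in> I ==> in_ideal A y s t (f i)) ==> in_ideal A y s t (\<lambda>z. \<Sum>i\<in>I. f i z)"
  by (induction I rule: infinite_finite_induct) (auto intro: in_ideal_zero in_ideal_add)

end

text \<open>The functions \<open>\<chi>\<^sup>m - y(m)\<close> span the ideal of functions that vanish at \<open>y\<close>, so it suffices to generate these.\<close>

lemma max_ideal_generated_by_affine_toric:
  fixes y :: "int ^ 'n::finite => 'k::field"
  assumes y: "y \<in> affine_toric_pts K"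
    and t: "\<And>i. i < s ==> t i \<in> toric_functions K \<and> t i y = 0" and s: "s \<le> n"
    and gen: "\<And>m. m \<in> dual_semigroup K ==> in_ideal (affine_toric K) y s t (\<lambda>z. z m - y m)"
  shows "max_ideal_generated_by (affine_toric K) y n"
proof -
  let ?A = "affine_toric K :: (int ^ 'n => 'k, 'k) fspace"
  define t' where "t' i = (if i < s then t i else (\<lambda>_. 0))" for i
  have pA: "y \<in> pts ?A" using y by simp
  have o: "zopen ?A (affine_toric_pts K)" using openin_topspace[of "zar ?A"] by simp
  have t'r: "t' i \<in> reg ?A (affine_toric_pts K) \<and> t' i y = 0" if "i < n" for i
    using t[of i] affine_toric_function_reg[OF _ o, of "t i"] reg_const[OF affine_toric_nice o]
    by (auto simp: t'_def)
  have "\<exists>W h. zopen ?A W \<and> y \<in> W \<and> W \<subseteq> affine_toric_pts K \<inter> V \<and> (\<forall>i<n. h i \<in> reg ?A W) \<and>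
      (\<forall>z\<in>W. g z = (\<Sum>i<n. h i z * t' i z))"
    if V: "zopen ?A V" "y \<in> V" "g \<in> reg ?A V" "g y = 0" for V g
  proof -
    from bspec[OF V(3)[unfolded affine_toric_reg[OF V(1)]] V(2)]
    obtain a b where ab: "a \<in> toric_functions K" "b \<in> toric_functions K" "b y \<noteq> 0"
      "\<forall>q\<in>affine_toric_pts K. b q \<noteq> 0 --> q \<in> V \<and> g q = a q / b q" by blast
    obtain F c where F: "finite F" "F \<subseteq> dual_semigroup K" "\<And>x. x \<in> affine_toric_pts K ==> a x = (\<Sum>m\<in>F. c m * x m)"
      using toric_functionsE[OF ab(1)] by blast
    let ?D = "{q \<in> affine_toric_pts K. b q \<noteq> 0}"
    have D: "zopen ?A ?D"
      using reg_open[OF affine_toric_nice o affine_toric_function_reg[OF ab(2) o]] by simp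
    have yD: "y \<in> ?D" using y ab(3) by simp
    have "a y = 0" using ab y V(4) by (metis divide_eq_0_iff)
    then have ay: "(\<Sum>m\<in>F. c m * y m) = 0" using F(3)[OF y] by simp
    have "in_ideal ?A y s t (\<lambda>z. \<Sum>m\<in>F. c m * (z m - y m))"
      by (rule in_ideal_sum[OF affine_toric_nice pA],
          rule in_ideal_mult[OF affine_toric_nice pA gen o y reg_const[OF affine_toric_nice o]])
        (use F(2) in auto)
    then have "in_ideal ?A y s t a"
      by (rule in_ideal_cong[OF affine_toric_nice pA _ o y])
        (use F(3) ay in \<open>simp add: algebra_simps sum_subtractf\<close>)
    then have "in_ideal ?A y s t (\<lambda>z. inverse (b z) * a z)"
      by (rule in_ideal_mult[OF affine_toric_nice pA _ D yD])
        (rule reg_inverse[OF affine_toric_nice D affine_toric_function_reg[OF ab(2) D]], simp)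
    then have "in_ideal ?A y s t g"
      by (rule in_ideal_cong[OF affine_toric_nice pA _ D yD]) (use ab(4) in \<open>simp add: divide_inverse mult.commute\<close>)
    then obtain W h where W: "zopen ?A W" "y \<in> W" "\<forall>i<s. h i \<in> reg ?A W" "\<forall>z\<in>W. g z = (\<Sum>i<s. h i z * t i z)"
      unfolding in_ideal_def by blast
    have WV: "zopen ?A (W \<inter> V)" using W V by blast
    define h' where "h' i = (if i < s then h i else (\<lambda>_. 0))" for i
    have "h' i \<in> reg ?A (W \<inter> V)" for i
      using reg_restrict[OF affine_toric_nice WV W(1)] W(3) reg_const[OF affine_toric_nice WV] by (auto simp: h'_def)
    moreover have "g z = (\<Sum>i<n. h' i z * t' i z)" if "z \<in> W \<inter> V" for z
    proof -
      have "g z = (\<Sum>i<s. h i z * t i z)" using W(4) that by blast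
      also have "\<dots> = (\<Sum>i<n. h' i z * t' i z)"
        by (rule sum.mono_neutral_cong_left) (use s in \<open>auto simp: h'_def t'_def\<close>)
      finally show ?thesis .
    qed
    ultimately show ?thesis
      using WV W(2) V(2) openin_subset[OF WV] by (intro exI[of _ "W \<inter> V"] exI[of _ h']) auto
  qed
  then have "\<exists>W h. zopen ?A W \<and> y \<in> W \<and> W \<subseteq> affine_toric_pts K \<inter> V \<and> (\<forall>i<n. h i \<in> reg ?A W) \<and>
      (\<forall>z\<in>W. g z = (\<Sum>i<n. h i z * t' i z))"
    if "zopen ?A V \<and> y \<in> V \<and> g \<in> reg ?A V \<and> g y = 0" for V g
    using that by blast
  moreover have "\<forall>i<n. t' i \<in> reg ?A (affine_toric_pts K) \<and> t' i y = 0" using t'r by blast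
  ultimately show ?thesis
    using o y by (intro max_ideal_generated_byI[of ?A "affine_toric_pts K" y n t'])
qed

subsection \<open>Derivations\<close>

text \<open>Dedekind's independence of characters, for the characters of the torus.\<close>

lemma characters_independent:
  fixes c :: "int ^ 'n::finite => 'k::field_char_0"
  assumes "finite F" "\<And>\<phi>. \<phi> \<in> torus ==> (\<Sum>m\<in>F. c m * \<phi> m) = 0"
  shows "\<forall>m\<in>F. c m = 0"
  using assms
proof (induction F arbitrary: c rule: finite_induct)
  case (insert m1 F)
  have "c m = 0" if m: "m \<in> F" for m
  proof -
    have "m \<noteq> m1" using m insert.hyps by auto
    then obtain i where i: "m $ i \<noteq> m1 $ i" by (auto simp: vec_eq_iff)
    define \<psi> where "\<psi> m = (2 :: 'k) powi (m $ i)" for m :: "int ^ 'n"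
    have \<psi>: "\<psi> \<in> torus" using one_parameter_torus[of "2 :: 'k" "axis i 1"] by (simp add: \<psi>_def[abs_def])
    have "(\<Sum>m\<in>F. (c m * (\<psi> m - \<psi> m1)) * \<phi> m) = 0" if \<phi>: "\<phi> \<in> torus" for \<phi>
    proof -
      have "(\<Sum>m\<in>insert m1 F. c m * \<phi> m) = 0" "(\<Sum>m\<in>insert m1 F. c m * (\<psi> m * \<phi> m)) = 0"
        using insert.prems[OF \<phi>] insert.prems[OF torus_mult[OF \<psi> \<phi>]] by auto
      then have "(\<Sum>m\<in>insert m1 F. c m * (\<psi> m * \<phi> m)) - \<psi> m1 * (\<Sum>m\<in>insert m1 F. c m * \<phi> m) = 0" by simp
      then have "(\<Sum>m\<in>insert m1 F. (c m * (\<psi> m - \<psi> m1)) * \<phi> m) = 0"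
        by (simp only: sum_distrib_left sum_subtractf[symmetric]) (simp add: algebra_simps)
      then show ?thesis using insert.hyps by simp
    qed
    then have "\<forall>m\<in>F. c m * (\<psi> m - \<psi> m1) = 0" by (rule insert.IH)
    moreover have "\<psi> m \<noteq> \<psi> m1"
    proof
      assume "\<psi> m = \<psi> m1"
      then have "(2 :: 'k) powi (m $ i - m1 $ i) = 1" by (simp add: \<psi>_def power_int_diff)
      then show False using two_powi_eq_1 i by fastforce
    qed
    ultimately show ?thesis using m by auto
  qed
  moreover have "c m1 = 0"
  proof -
    have one: "(\<lambda>_. 1) \<in> torus" by (simp add: torus_def)
    have "(\<Sum>m\<in>F. c m) = 0" using calculation by (intro sum.neutral) auto
    then show ?thesis using insert.prems[OF one] insert.hyps by simp
  qed
  ultimately show ?case by blast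
qed simp

text \<open>A map \<open>D\<close> on the semigroup extends linearly to functions, as monomials are independent.\<close>

definition linear_ext :: "(real ^ 'n::finite) set => (int ^ 'n => 'k::field) => ((int ^ 'n => 'k) => 'k) => 'k"
  where "linear_ext K D f = (SOME v. \<exists>F c. finite F \<and> F \<subseteq> dual_semigroup K \<and>
    (\<forall>x\<in>affine_toric_pts K. f x = (\<Sum>m\<in>F. c m * x m)) \<and> v = (\<Sum>m\<in>F. c m * D m))"

lemma linear_ext_eq:
  fixes f :: "(int ^ 'n::finite => 'k::field_char_0) => 'k"
  assumes K: "0 \<in> K" and F: "finite F" "F \<subseteq> dual_semigroup K" "\<And>x. x \<in> affine_toric_pts K ==> f x = (\<Sum>m\<in>F. c m * x m)"
  shows "linear_ext K D f = (\<Sum>m\<in>F. c m * D m)"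
proof -
  have "\<exists>F' c'. finite F' \<and> F' \<subseteq> dual_semigroup K \<and>
    (\<forall>x\<in>affine_toric_pts K. f x = (\<Sum>m\<in>F'. c' m * x m)) \<and> linear_ext K D f = (\<Sum>m\<in>F'. c' m * D m)"
    unfolding linear_ext_def by (rule someI_ex) (use F in blast)
  then obtain F' c' where F': "finite F'" "F' \<subseteq> dual_semigroup K" "\<forall>x\<in>affine_toric_pts K. f x = (\<Sum>m\<in>F'. c' m * x m)"
    "linear_ext K D f = (\<Sum>m\<in>F'. c' m * D m)" by blast
  define e where "e m = (if m \<in> F then c m else 0) - (if m \<in> F' then c' m else 0)" for m
  have sum: "(\<Sum>m\<in>F \<union> F'. e m * z m) = (\<Sum>m\<in>F. c m * z m) - (\<Sum>m\<in>F'. c' m * z m)" for z :: "int ^ 'n => 'k"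
  proof -
    have 1: "(\<Sum>m\<in>F \<union> F'. (if m \<in> F then c m else 0) * z m) = (\<Sum>m\<in>F. c m * z m)"
      by (rule sum.mono_neutral_cong_right) (use F F' in auto)
    have 2: "(\<Sum>m\<in>F \<union> F'. (if m \<in> F' then c' m else 0) * z m) = (\<Sum>m\<in>F'. c' m * z m)"
      by (rule sum.mono_neutral_cong_right) (use F F' in auto)
    show ?thesis unfolding e_def left_diff_distrib sum_subtractf 1 2 ..
  qed
  have "\<forall>m\<in>F \<union> F'. e m = 0"
  proof (rule characters_independent)
    fix \<phi> :: "int ^ 'n => 'k" assume \<phi>: "\<phi> \<in> torus"
    have "limit_pt K 0 \<phi> \<in> affine_toric_pts K" by (rule limit_pt_in) (use K \<phi> in auto)
    then have "(\<Sum>m\<in>F \<union> F'. e m * limit_pt K 0 \<phi> m) = 0"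
      unfolding sum using F(3) F'(3) by (metis diff_self)
    moreover have "(\<Sum>m\<in>F \<union> F'. e m * limit_pt K 0 \<phi> m) = (\<Sum>m\<in>F \<union> F'. e m * \<phi> m)"
      by (rule sum.cong) (use F(2) F'(2) in \<open>auto simp: limit_pt_def subset_iff\<close>)
    ultimately show "(\<Sum>m\<in>F \<union> F'. e m * \<phi> m) = 0" by simp
  qed (use F F' in auto)
  then have "(\<Sum>m\<in>F \<union> F'. e m * D m) = 0" by (intro sum.neutral) auto
  then show ?thesis using sum[of D] F'(4) by simp
qed

context
  fixes K :: "(real ^ 'n::finite) set" and y D :: "int ^ 'n => 'k::field_char_0"
  assumes K: "0 \<in> K" and y: "y \<in> affine_toric_pts K"
    and D: "\<And>a b. a \<in> dual_semigroup K ==> b \<in> dual_semigroup K ==> D (a + b) = y a * D b + y b * D a"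
begin

lemma linear_ext_char: "m \<in> dual_semigroup K ==> linear_ext K D (\<lambda>x. x m) = D m"
  using linear_ext_eq[OF K, of "{m}" "\<lambda>x. x m" "\<lambda>_. 1" D] by simp

lemma linear_ext_const: "linear_ext K D (\<lambda>x. c) = 0"
proof -
  have "D 0 = D 0 + D 0" using D[of 0 0] affine_toric_pts_0[OF y] by simp
  then have "D 0 = 0" by simp
  then show ?thesis using linear_ext_eq[OF K, of "{0}" "\<lambda>x. c" "\<lambda>_. c" D] by (simp add: affine_toric_pts_0)
qed

lemma linear_ext_cong:
  assumes "f \<in> toric_functions K" "\<And>x. x \<in> affine_toric_pts K ==> g x = f x"
  shows "linear_ext K D g = linear_ext K D f"
proof -
  obtain F c where F: "finite F" "F \<subseteq> dual_semigroup K" "\<And>x. x \<in> affine_toric_pts K ==> f x = (\<Sum>m\<in>F. c m * x m)"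
    using toric_functionsE[OF assms(1)] by blast
  show ?thesis
    using linear_ext_eq[OF K F] linear_ext_eq[OF K F(1,2), of g c] F(3) assms(2) by simp
qed

lemma linear_ext_add:
  assumes f: "f \<in> toric_functions K" and g: "g \<in> toric_functions K"
  shows "linear_ext K D (\<lambda>x. f x + g x) = linear_ext K D f + linear_ext K D g"
proof -
  obtain F c where F: "finite F" "F \<subseteq> dual_semigroup K" "\<And>x. x \<in> affine_toric_pts K ==> f x = (\<Sum>m\<in>F. c m * x m)"
    using toric_functionsE[OF f] by blast
  obtain G d where G: "finite G" "G \<subseteq> dual_semigroup K" "\<And>x. x \<in> affine_toric_pts K ==> g x = (\<Sum>m\<in>G. d m * x m)"
    using toric_functionsE[OF g] by blast
  define e where "e m = (if m \<in> F then c m else 0) + (if m \<in> G then d m else 0)" for m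
  have sum: "(\<Sum>m\<in>F \<union> G. e m * z m) = (\<Sum>m\<in>F. c m * z m) + (\<Sum>m\<in>G. d m * z m)" for z :: "int ^ 'n => 'k"
  proof -
    have 1: "(\<Sum>m\<in>F \<union> G. (if m \<in> F then c m else 0) * z m) = (\<Sum>m\<in>F. c m * z m)"
      by (rule sum.mono_neutral_cong_right) (use F G in auto)
    have 2: "(\<Sum>m\<in>F \<union> G. (if m \<in> G then d m else 0) * z m) = (\<Sum>m\<in>G. d m * z m)"
      by (rule sum.mono_neutral_cong_right) (use F G in auto)
    show ?thesis unfolding e_def distrib_right sum.distrib 1 2 ..
  qed
  have "linear_ext K D (\<lambda>x. f x + g x) = (\<Sum>m\<in>F \<union> G. e m * D m)"
    by (rule linear_ext_eq[OF K]) (use F G sum in auto)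
  then show ?thesis using sum[of D] linear_ext_eq[OF K F] linear_ext_eq[OF K G] by simp
qed

text \<open>If \<open>D\<close> obeys the Leibniz rule on characters, its linear extension is a derivation at \<open>y\<close>.\<close>

lemma linear_ext_mult:
  assumes f: "f \<in> toric_functions K" and g: "g \<in> toric_functions K"
  shows "linear_ext K D (\<lambda>x. f x * g x) = f y * linear_ext K D g + g y * linear_ext K D f"
proof -
  obtain F c where F: "finite F" "F \<subseteq> dual_semigroup K" "\<And>x. x \<in> affine_toric_pts K ==> f x = (\<Sum>m\<in>F. c m * x m)"
    using toric_functionsE[OF f] by blast
  obtain G d where G: "finite G" "G \<subseteq> dual_semigroup K" "\<And>x. x \<in> affine_toric_pts K ==> g x = (\<Sum>m\<in>G. d m * x m)"
    using toric_functionsE[OF g] by blast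
  let ?s = "\<lambda>p :: (int ^ 'n) \<times> (int ^ 'n). fst p + snd p"
  let ?H = "?s ` (F \<times> G)"
  define e where "e n = (\<Sum>p\<in>{p \<in> F \<times> G. ?s p = n}. c (fst p) * d (snd p))" for n
  have fin: "finite (F \<times> G)" using F G by simp
  have sum: "(\<Sum>n\<in>?H. e n * z n) = (\<Sum>p\<in>F \<times> G. c (fst p) * d (snd p) * z (?s p))" for z :: "int ^ 'n => 'k"
  proof -
    have "(\<Sum>p\<in>F \<times> G. c (fst p) * d (snd p) * z (?s p)) =
      (\<Sum>n\<in>?H. \<Sum>p\<in>{p \<in> F \<times> G. ?s p = n}. c (fst p) * d (snd p) * z (?s p))"
      using fin by (intro sum.group[symmetric]) auto
    also have "\<dots> = (\<Sum>n\<in>?H. e n * z n)"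
      unfolding e_def sum_distrib_right by (intro sum.cong refl) auto
    finally show ?thesis by simp
  qed
  have prod: "(\<Sum>p\<in>F \<times> G. u (fst p) * v (snd p)) = (\<Sum>a\<in>F. u a) * (\<Sum>b\<in>G. v b)" for u v :: "int ^ 'n => 'k"
    by (simp add: sum_product sum.cartesian_product case_prod_beta')
  have "linear_ext K D (\<lambda>x. f x * g x) = (\<Sum>n\<in>?H. e n * D n)"
  proof (rule linear_ext_eq[OF K])
    show "finite ?H" using fin by blast
    show "?H \<subseteq> dual_semigroup K" using F(2) G(2) by (auto simp: subset_iff intro: dual_semigroup_add)
    fix x :: "int ^ 'n => 'k" assume x: "x \<in> affine_toric_pts K"
    have "f x * g x = (\<Sum>p\<in>F \<times> G. (c (fst p) * x (fst p)) * (d (snd p) * x (snd p)))"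
      unfolding prod[of "\<lambda>a. c a * x a" "\<lambda>b. d b * x b"] F(3)[OF x] G(3)[OF x] ..
    also have "\<dots> = (\<Sum>p\<in>F \<times> G. c (fst p) * d (snd p) * x (?s p))"
      by (rule sum.cong) (use F(2) G(2) in \<open>auto simp: affine_toric_pts_add[OF x] subset_iff\<close>)
    finally show "f x * g x = (\<Sum>n\<in>?H. e n * x n)" unfolding sum .
  qed
  also have "\<dots> = (\<Sum>p\<in>F \<times> G. c (fst p) * d (snd p) * D (?s p))" by (rule sum)
  also have "\<dots> = (\<Sum>p\<in>F \<times> G. (c (fst p) * y (fst p)) * (d (snd p) * D (snd p)) + (c (fst p) * D (fst p)) * (d (snd p) * y (snd p)))"
    by (rule sum.cong) (use F(2) G(2) in \<open>auto simp: D subset_iff algebra_simps\<close>)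
  also have "\<dots> = (\<Sum>a\<in>F. c a * y a) * (\<Sum>b\<in>G. d b * D b) + (\<Sum>a\<in>F. c a * D a) * (\<Sum>b\<in>G. d b * y b)"
    unfolding sum.distrib prod[of "\<lambda>a. c a * y a" "\<lambda>b. d b * D b"] prod[of "\<lambda>a. c a * D a" "\<lambda>b. d b * y b"] ..
  also have "\<dots> = f y * linear_ext K D g + g y * linear_ext K D f"
    using F(3)[OF y] G(3)[OF y] linear_ext_eq[OF K F] linear_ext_eq[OF K G] by simp
  finally show ?thesis .
qed

lemma linear_ext_sum:
  assumes "\<And>i. i \<in> I ==> f i \<in> toric_functions K"
  shows "linear_ext K D (\<lambda>x. \<Sum>i\<in>I. f i x) = (\<Sum>i\<in>I. linear_ext K D (f i))"
  using assms
  by (induction I rule: infinite_finite_induct)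
    (auto simp: linear_ext_const linear_ext_add toric_functions_sum)

end

text \<open>Finitely many regular functions near \<open>y\<close> have a common denominator.\<close>

lemma common_denominator:
  fixes f :: "nat => (int ^ 'n::finite => 'k::field) => 'k"
  assumes W: "zopen (affine_toric K) W" "y \<in> W" "\<forall>i<d. f i \<in> reg (affine_toric K) W"
  shows "\<exists>p q. q \<in> toric_functions K \<and> q y \<noteq> 0 \<and> (\<forall>i<d. p i \<in> toric_functions K) \<and>
    (\<forall>x\<in>affine_toric_pts K. q x \<noteq> 0 --> x \<in> W \<and> (\<forall>i<d. f i x = p i x / q x))"
  using W(3)
proof (induction d)
  case 0
  from bspec[OF W(1)[unfolded affine_toric_openin] W(2)] show ?case by auto
next
  case (Suc d)
  obtain p q where pq: "q \<in> toric_functions K" "q y \<noteq> 0" "\<forall>i<d. p i \<in> toric_functions K"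
    "\<forall>x\<in>affine_toric_pts K. q x \<noteq> 0 --> x \<in> W \<and> (\<forall>i<d. f i x = p i x / q x)"
  proof -
    have "\<forall>i<d. f i \<in> reg (affine_toric K) W" using Suc.prems by simp
    from Suc.IH[OF this] show thesis by (elim exE conjE) (rule that)
  qed
  have "f d \<in> reg (affine_toric K) W" using Suc.prems by simp
  from bspec[OF this[unfolded affine_toric_reg[OF W(1)]] W(2)]
  obtain a b where ab: "a \<in> toric_functions K" "b \<in> toric_functions K" "b y \<noteq> 0"
    "\<forall>x\<in>affine_toric_pts K. b x \<noteq> 0 --> x \<in> W \<and> f d x = a x / b x" by auto
  note mult = function_algebra_mult[OF toric_functions_algebra]
  show ?case
  proof (intro exI conjI allI impI ballI)
    show "(\<lambda>x. q x * b x) \<in> toric_functions K" by (rule mult[OF pq(1) ab(2)])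
    show "q y * b y \<noteq> 0" using pq ab by simp
    show "(if i < d then (\<lambda>x. p i x * b x) else (\<lambda>x. a x * q x)) \<in> toric_functions K" if "i < Suc d" for i
      using mult[OF _ ab(2), of "p i"] mult[OF ab(1) pq(1)] pq(3) by simp
    fix x assume x: "x \<in> affine_toric_pts K" "q x * b x \<noteq> 0"
    then show "x \<in> W" using ab(4) by simp
    fix i assume "i < Suc d"
    then show "f i x = (if i < d then (\<lambda>x. p i x * b x) else (\<lambda>x. a x * q x)) x / (q x * b x)"
      using x pq(4) ab(4) by (cases "i < d") (auto simp: less_Suc_eq field_simps)
  qed
qed

text \<open>The tangent space at a point whose maximal ideal has \<open>d\<close> generators has dimension at most \<open>d\<close>:
  a derivation is determined by its values on the generators.\<close>

lemma derivations_bound: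
  fixes y :: "int ^ 'n::finite => 'k::field_char_0" and Ds :: "'i => int ^ 'n => 'k"
  assumes K: "0 \<in> K" and y: "y \<in> affine_toric_pts K"
    and gen: "max_ideal_generated_by (affine_toric K) y d"
    and I: "finite I"
    and D: "\<And>i a b. i \<in> I ==> a \<in> dual_semigroup K ==> b \<in> dual_semigroup K ==>
      Ds i (a + b) = y a * Ds i b + y b * Ds i a"
    and m: "\<And>i. i \<in> I ==> m i \<in> dual_semigroup K"
    and diag: "\<And>i. i \<in> I ==> Ds i (m i) \<noteq> 0" and off: "\<And>i j. i \<in> I ==> j \<in> I ==> i \<noteq> j ==> Ds i (m j) = 0"
  shows "card I \<le> d"
proof (rule ccontr)
  assume "\<not> card I \<le> d"
  let ?A = "affine_toric K :: (int ^ 'n => 'k, 'k) fspace"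
  note alg = toric_functions_algebra[of K]
  obtain U t where U: "zopen ?A U" "y \<in> U" "\<forall>i<d. t i \<in> reg ?A U \<and> t i y = 0"
    and gen': "\<forall>V g. zopen ?A V \<and> y \<in> V \<and> g \<in> reg ?A V \<and> g y = 0 -->
        (\<exists>W h. zopen ?A W \<and> y \<in> W \<and> W \<subseteq> U \<inter> V \<and> (\<forall>i<d. h i \<in> reg ?A W) \<and> (\<forall>x\<in>W. g x = (\<Sum>i<d. h i x * t i x)))"
    using gen by (rule max_ideal_generated_byE)
  have tr: "\<forall>i<d. t i \<in> reg ?A U" using U(3) by blast
  have t0: "t i y = 0" if "i < d" for i using U(3) that by blast
  obtain a b where ab: "b \<in> toric_functions K" "b y \<noteq> 0" "\<forall>i<d. a i \<in> toric_functions K"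
    "\<forall>x\<in>affine_toric_pts K. b x \<noteq> 0 --> x \<in> U \<and> (\<forall>i<d. t i x = a i x / b x)"
    using common_denominator[OF U(1,2) tr] by (elim exE conjE) (rule that)
  have ay: "a i y = 0" if "i < d" for i using ab(2,4) y t0[OF that] that by auto
  obtain \<alpha> where \<alpha>: "\<exists>i\<in>I. \<alpha> i \<noteq> 0" "\<forall>l\<in>{..<d}. (\<Sum>i\<in>I. \<alpha> i * linear_ext K (Ds i) (a l)) = 0"
    using homogeneous_linear_system[of "{..<d}" I "\<lambda>i l. linear_ext K (Ds i) (a l)"] I \<open>\<not> card I \<le> d\<close> by auto
  define E where "E n = (\<Sum>i\<in>I. \<alpha> i * Ds i n)" for n
  have E: "E (p + q) = y p * E q + y q * E p" if "p \<in> dual_semigroup K" "q \<in> dual_semigroup K" for p q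
  proof -
    have "E (p + q) = (\<Sum>i\<in>I. \<alpha> i * (y p * Ds i q + y q * Ds i p))"
      unfolding E_def by (rule sum.cong) (auto simp: D that)
    then show ?thesis by (simp add: E_def sum_distrib_left algebra_simps sum.distrib)
  qed
  have Ea: "linear_ext K E (a l) = 0" if l: "l < d" for l
  proof -
    have "a l \<in> toric_functions K" using ab(3) l by blast
    then obtain F c where F: "finite F" "F \<subseteq> dual_semigroup K" "\<And>x. x \<in> affine_toric_pts K ==> a l x = (\<Sum>m\<in>F. c m * x m)"
      using toric_functionsE by blast
    have "linear_ext K E (a l) = (\<Sum>n\<in>F. c n * E n)" by (rule linear_ext_eq[OF K F])
    also have "\<dots> = (\<Sum>n\<in>F. \<Sum>i\<in>I. \<alpha> i * (c n * Ds i n))"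
      by (simp add: E_def sum_distrib_left mult_ac)
    also have "\<dots> = (\<Sum>i\<in>I. \<alpha> i * (\<Sum>n\<in>F. c n * Ds i n))"
      by (subst sum.swap) (simp add: sum_distrib_left)
    also have "\<dots> = (\<Sum>i\<in>I. \<alpha> i * linear_ext K (Ds i) (a l))" using linear_ext_eq[OF K F] by simp
    finally show ?thesis using \<alpha>(2) l by simp
  qed
  note ext_simps = linear_ext_char[OF K y E] linear_ext_const[OF K y E] linear_ext_add[OF K y E]
  have "E n = 0" if n: "n \<in> dual_semigroup K" for n
  proof -
    define g where "g x = x n - y n" for x :: "int ^ 'n => 'k"
    have chn: "(\<lambda>x. x n) \<in> toric_functions K" using toric_functions_char[OF n, of 1] by simp
    have cst: "(\<lambda>x. c) \<in> toric_functions K" for c by (rule function_algebra_const[OF alg])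
    have gT: "g \<in> toric_functions K"
      unfolding g_def[abs_def] by (rule function_algebra_diff[OF alg chn cst])
    have gE: "linear_ext K E g = E n"
      using linear_ext_add[OF K y E chn cst[of "- y n"]] linear_ext_char[OF K y E n] linear_ext_const[OF K y E, of "- y n"]
      by (simp add: g_def[abs_def])
    have o: "zopen ?A (pts ?A)" by (rule openin_topspace)
    have gy: "g y = 0" by (simp add: g_def)
    have yA: "y \<in> pts ?A" using y by simp
    obtain W h where W: "zopen ?A W" "y \<in> W" "W \<subseteq> U \<inter> pts ?A" "\<forall>i<d. h i \<in> reg ?A W"
      "\<forall>x\<in>W. g x = (\<Sum>i<d. h i x * t i x)"
      using gen'[rule_format, OF conjI[OF o conjI[OF yA conjI[OF affine_toric_function_reg[OF gT o] gy]]]] by (elim exE conjE) (rule that)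
    obtain p q where pq: "q \<in> toric_functions K" "q y \<noteq> 0" "\<forall>i<d. p i \<in> toric_functions K"
      "\<forall>x\<in>affine_toric_pts K. q x \<noteq> 0 --> x \<in> W \<and> (\<forall>i<d. h i x = p i x / q x)"
      using common_denominator[OF W(1,2,4)] by (elim exE conjE) (rule that)
    define f where "f x = b x * q x" for x
    define S where "S x = (\<Sum>i<d. p i x * a i x)" for x
    define R where "R x = g x * f x + - 1 * S x" for x
    note mult = function_algebra_mult[OF alg]
    have fT: "f \<in> toric_functions K" unfolding f_def[abs_def] by (rule mult[OF ab(1) pq(1)])
    have paT: "(\<lambda>x. p i x * a i x) \<in> toric_functions K" if "i < d" for i
      using mult ab(3) pq(3) that by blast
    have ST: "S \<in> toric_functions K" unfolding S_def[abs_def] by (rule toric_functions_sum) (use paT in auto)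
    have gfT: "(\<lambda>x. g x * f x) \<in> toric_functions K" by (rule mult[OF gT fT])
    have mST: "(\<lambda>x. - 1 * S x) \<in> toric_functions K" by (rule mult[OF cst ST])
    have RT: "R \<in> toric_functions K"
      unfolding R_def[abs_def] by (rule function_algebra_add[OF alg gfT mST])
    have fR: "f x * R x = 0" if x: "x \<in> affine_toric_pts K" for x
    proof (cases "f x = 0")
      case False
      then have nz: "b x \<noteq> 0" "q x \<noteq> 0" by (auto simp: f_def)
      have xW: "x \<in> W" using pq(4) x nz(2) by blast
      have "g x = (\<Sum>i<d. h i x * t i x)" using W(5) xW by blast
      also have "\<dots> = (\<Sum>i<d. (p i x * a i x) / f x)"
        by (rule sum.cong) (use pq(4) ab(4) x nz in \<open>auto simp: f_def\<close>)
      also have "\<dots> = S x / f x" by (simp add: S_def sum_divide_distrib)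
      finally show ?thesis using False by (simp add: R_def)
    qed simp
    have fy: "f y \<noteq> 0" using ab(2) pq(2) by (simp add: f_def)
    then have Ry: "R y = 0" using fR[OF y] by simp
    have "linear_ext K E (\<lambda>x. f x * R x) = 0"
      using linear_ext_cong[OF K y E cst[of 0], of "\<lambda>x. f x * R x"] fR linear_ext_const[OF K y E, of 0] by simp
    then have "f y * linear_ext K E R = 0"
      using linear_ext_mult[OF K y E fT RT] Ry by simp
    then have R0: "linear_ext K E R = 0" using fy by simp
    have "linear_ext K E S = (\<Sum>i<d. linear_ext K E (\<lambda>x. p i x * a i x))"
      unfolding S_def[abs_def] by (rule linear_ext_sum[OF K y E]) (use paT in auto)
    also have "\<dots> = 0"
      by (rule sum.neutral) (use linear_ext_mult[OF K y E] pq(3) ab(3) Ea ay in auto)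
    finally have S0: "linear_ext K E S = 0" .
    have "linear_ext K E R = linear_ext K E (\<lambda>x. g x * f x) + linear_ext K E (\<lambda>x. - 1 * S x)"
      unfolding R_def[abs_def] by (rule linear_ext_add[OF K y E gfT mST])
    also have "linear_ext K E (\<lambda>x. - 1 * S x) = 0"
      using linear_ext_mult[OF K y E cst[of "- 1"] ST] linear_ext_const[OF K y E, of "- 1"] S0 by simp
    also have "linear_ext K E (\<lambda>x. g x * f x) = f y * E n"
      using linear_ext_mult[OF K y E gT fT] gE by (simp add: g_def)
    finally show "E n = 0" using R0 fy by simp
  qed
  moreover obtain i where i: "i \<in> I" "\<alpha> i \<noteq> 0" using \<alpha>(1) by blast
  moreover have "E (m i) = \<alpha> i * Ds i (m i)"
    unfolding E_def by (subst sum.remove[OF I i(1)]) (use off i(1) in \<open>auto intro!: sum.neutral\<close>)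
  ultimately show False using m[of i] diag[of i] by auto
qed

subsection \<open>Smooth charts\<close>

definition units :: "(real ^ 'n::finite) set => (int ^ 'n) set"
  where "units K = {m \<in> dual_semigroup K. - m \<in> dual_semigroup K}"

lemma units_dual: "b \<in> units K ==> b \<in> dual_semigroup K"
  and units_minus: "b \<in> units K ==> - b \<in> units K"
  and units_add: "a \<in> units K ==> b \<in> units K ==> a + b \<in> units K"
  and units_0: "0 \<in> units K"
  using dual_semigroup_add[of "- a" K "- b"] by (auto simp: units_def dual_semigroup_add)

lemma units_diff: "a \<in> units K ==> b \<in> units K ==> a - b \<in> units K"
  using units_add[OF _ units_minus, of a K b] by simp

lemma units_of_add:
  assumes "a \<in> dual_semigroup K" "b \<in> dual_semigroup K" "a + b \<in> units K"
  shows "a \<in> units K"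
proof -
  have "- (a + b) + b \<in> dual_semigroup K"
    using assms by (intro dual_semigroup_add) (auto simp: units_def)
  then show ?thesis using assms(1) by (simp add: units_def)
qed

text \<open>A maximal linearly independent set of units generates the units up to finite index: they lie in its
  real span, which is the cone generated by its elements and their negatives, and lattice points of
  such a cone are rational combinations.\<close>

lemma units_basis:
  fixes K :: "(real ^ 'n::finite) set"
  obtains B where "finite B" "B \<subseteq> units K" "independent (lattice_vec ` B)"
    "\<And>b. b \<in> units K ==> \<exists>Q>0. \<exists>ls. set ls \<subseteq> B \<union> uminus ` B \<and> sum_list ls = of_nat Q * b"
proof -
  obtain B' where B': "B' \<subseteq> lattice_vec ` units K" "independent B'" "lattice_vec ` units K \<subseteq> span B'"
    using maximal_independent_subset[of "lattice_vec ` units K"] by blast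
  define B where "B = {b \<in> units K. lattice_vec b \<in> B'}"
  have imB: "lattice_vec ` B = B'" using B'(1) by (auto simp: B_def)
  have fB: "finite B"
    using finite_imageD[OF _ inj_on_subset[OF lattice_vec_inj, of B]] imB independent_imp_finite[OF B'(2)] by simp
  have unit_span: "\<exists>Q>0. \<exists>ls. set ls \<subseteq> B \<union> uminus ` B \<and> sum_list ls = of_nat Q * b" if b: "b \<in> units K" for b
  proof (rule lattice_point_of_hull)
    let ?E = "lattice_vec ` (B \<union> uminus ` B)"
    show "finite (B \<union> uminus ` B)" using fB by simp
    have E: "?E = B' \<union> uminus ` B'" using imB by (auto simp: image_Un image_image)
    have "lattice_vec b \<in> span B'" using B'(3) b by blast
    moreover have "span B' \<subseteq> convex_cone hull ?E"
    proof (rule span_minimal)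
      show "B' \<subseteq> convex_cone hull ?E" unfolding E by (auto intro: hull_inc)
      have neg: "- z \<in> convex_cone hull ?E" if "z \<in> convex_cone hull ?E" for z
      proof -
        have "convex_cone hull ?E \<subseteq> uminus ` (convex_cone hull ?E)"
        proof (rule hull_minimal)
          show "?E \<subseteq> uminus ` (convex_cone hull ?E)"
          proof
            fix e assume "e \<in> ?E"
            then have "- e \<in> ?E" unfolding E by auto
            then have "- e \<in> convex_cone hull ?E" by (rule hull_inc)
            then show "e \<in> uminus ` (convex_cone hull ?E)" by (intro image_eqI[of _ _ "- e"]) auto
          qed
          show "convex_cone (uminus ` (convex_cone hull ?E))"
            by (intro convex_cone_linear_image conjI convex_cone_convex_cone_hull) (simp add: linear_iff)
        qed
        then show ?thesis using that by force
      qed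
      show "subspace (convex_cone hull ?E)"
        unfolding subspace_def
      proof (intro conjI ballI allI)
        show "0 \<in> convex_cone hull ?E" by (rule convex_cone_hull_contains_0)
        show "x + z \<in> convex_cone hull ?E" if "x \<in> convex_cone hull ?E" "z \<in> convex_cone hull ?E" for x z
          using that by (rule convex_cone_hull_add)
        fix c :: real and z assume z: "z \<in> convex_cone hull ?E"
        show "c *\<^sub>R z \<in> convex_cone hull ?E"
          using convex_cone_hull_mul[OF z, of c] convex_cone_hull_mul[OF neg[OF z], of "- c"] by (cases "c \<ge> 0") auto
      qed
    qed
    ultimately show "lattice_vec b \<in> convex_cone hull ?E" by blast
  qed
  have "B \<subseteq> units K" by (auto simp: B_def)
  then show thesis by (rule that[OF fB _ _ unit_span]) (use imB B'(2) in simp_all)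
qed

text \<open>The dual semigroup is generated by its units and \<open>Hs\<close>, and the units, up to finite index, by \<open>B\<close>.
  With no more than \<open>n\<close> generators altogether, as many as the rank of the lattice, \<open>Hs\<close> is a basis modulo
  units; this is the combinatorial form of smoothness of the chart.\<close>

definition few_generators :: "(real ^ 'n::finite) set => (int ^ 'n) set => (int ^ 'n) set => bool"
  where "few_generators K Hs B \<longleftrightarrow> finite Hs \<and> finite B \<and> Hs \<subseteq> dual_semigroup K \<and> B \<subseteq> units K \<and>
    card Hs + card B \<le> CARD('n) \<and>
    (\<forall>m\<in>dual_semigroup K. \<exists>ls b. set ls \<subseteq> Hs \<and> b \<in> units K \<and> m = sum_list ls + b) \<and>
    (\<forall>b\<in>units K. \<exists>Q>0. \<exists>ls. set ls \<subseteq> B \<union> uminus ` B \<and> sum_list ls = of_nat Q * b)"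

text \<open>The differences \<open>\<chi>\<^sup>m - y(m)\<close> for the generators generate the maximal ideal at \<open>y\<close>. To pass from
  a multiple \<open>Q b\<close> of a unit to \<open>b\<close>, divide \<open>(\<chi>\<^sup>b)\<^sup>Q - y(b)\<^sup>Q\<close> by \<open>\<chi>\<^sup>b - y(b)\<close>; the quotient takes the value
  \<open>Q y(b)\<^bsup>Q-1\<^esup> \<noteq> 0\<close> at \<open>y\<close>.\<close>

lemma few_generators_max_ideal:
  fixes y :: "int ^ 'n::finite => 'k::field_char_0"
  assumes few: "few_generators K Hs B" and y: "y \<in> affine_toric_pts K"
  shows "max_ideal_generated_by (affine_toric K) y (CARD('n))"
proof -
  let ?A = "affine_toric K :: (int ^ 'n => 'k, 'k) fspace"
  let ?S = "dual_semigroup K"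
  have fin: "finite Hs" "finite B" and HsS: "Hs \<subseteq> ?S" and BU: "B \<subseteq> units K" and card: "card Hs + card B \<le> CARD('n)"
    and span: "\<And>m. m \<in> ?S ==> \<exists>ls b. set ls \<subseteq> Hs \<and> b \<in> units K \<and> m = sum_list ls + b"
    and unit_span: "\<And>b. b \<in> units K ==> \<exists>Q>0. \<exists>ls. set ls \<subseteq> B \<union> uminus ` B \<and> sum_list ls = of_nat Q * b"
    using few unfolding few_generators_def by simp_all
  obtain gs where gs: "set gs = Hs \<union> B" "distinct gs" using finite_distinct_list[of "Hs \<union> B"] fin by auto
  have len: "length gs \<le> CARD('n)"
    using card card_Un_le[of Hs B] distinct_card[OF gs(2)] gs(1) by simp
  have gsS: "gs ! i \<in> ?S" if "i < length gs" for i
  proof -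
    have "gs ! i \<in> Hs \<union> B" using that gs(1) nth_mem by blast
    then show ?thesis using HsS BU units_dual by blast
  qed
  define t where "t i x = x (gs ! i) - y (gs ! i)" for i and x :: "int ^ 'n => 'k"
  have yA: "y \<in> pts ?A" using y by simp
  note A = affine_toric_nice[of K, where ?'b = 'k]
  define I where "I m \<longleftrightarrow> in_ideal ?A y (length gs) t (\<lambda>z. z m - y m)" for m
  have o: "zopen ?A (affine_toric_pts K)" using openin_topspace[of "zar ?A"] by simp
  have chr: "(\<lambda>x. x m) \<in> reg ?A (affine_toric_pts K)" if "m \<in> ?S" for m
    by (rule affine_toric_char_reg[OF that o])
  have I_gen: "I g" if g: "g \<in> Hs \<union> B" for g
  proof -
    obtain i where i: "i < length gs" "gs ! i = g" using g in_set_conv_nth[of g gs] unfolding gs(1) by blast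
    have "t i = (\<lambda>z. z g - y g)" by (rule ext) (simp add: t_def i(2))
    then show ?thesis using in_ideal_gen[OF A yA i(1), of t] by (simp only: I_def)
  qed
  have I_0: "I 0"
    unfolding I_def
  proof (rule in_ideal_cong[OF A yA in_ideal_zero[OF A yA] o y])
    show "z 0 - y 0 = 0" if "z \<in> affine_toric_pts K" for z :: "int ^ 'n => 'k"
      using affine_toric_pts_0[OF that] affine_toric_pts_0[OF y] by simp
  qed
  have I_add: "I (a + b)" if "a \<in> ?S" "b \<in> ?S" "I a" "I b" for a b
  proof -
    have "in_ideal ?A y (length gs) t (\<lambda>z. z a * (z b - y b) + y b * (z a - y a))"
      using that(3,4) unfolding I_def
      by (intro in_ideal_add[OF A yA] in_ideal_mult[OF A yA _ o y chr[OF that(1)]]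
          in_ideal_mult[OF A yA _ o y reg_const[OF A o]])
    then show ?thesis
      unfolding I_def
      by (rule in_ideal_cong[OF A yA _ o y])
        (simp add: affine_toric_pts_add[OF _ that(1,2)] y algebra_simps)
  qed
  have I_sum: "I (sum_list ls)" if "set ls \<subseteq> ?S" "\<forall>l\<in>set ls. I l" for ls
    using that
  proof (induction ls)
    case (Cons a ls)
    then show ?case using I_add[of a "sum_list ls"] dual_semigroup_sum_list[of ls K] by simp
  qed (simp add: I_0)
  have inv: "z (- b) * z b = 1" if "b \<in> units K" "z \<in> affine_toric_pts K" for b and z :: "int ^ 'n => 'k"
    using affine_toric_pts_add[OF that(2), of "- b" b] affine_toric_pts_0[OF that(2)] that(1)
    by (simp add: units_def)
  have I_neg: "I (- b)" if b: "b \<in> units K" "I b" for b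
  proof -
    have mb: "- b \<in> ?S" using b(1) by (simp add: units_def)
    have "in_ideal ?A y (length gs) t (\<lambda>z. (- y (- b)) * (z (- b) * (z b - y b)))"
      using b(2) unfolding I_def
      by (intro in_ideal_mult[OF A yA _ o y chr[OF mb]] in_ideal_mult[OF A yA _ o y reg_const[OF A o]])
    then show ?thesis
      unfolding I_def
    proof (rule in_ideal_cong[OF A yA _ o y])
      fix z :: "int ^ 'n => 'k" assume z: "z \<in> affine_toric_pts K"
      have "(- y (- b)) * (z (- b) * (z b - y b)) = z (- b) * (y (- b) * y b) - y (- b) * (z (- b) * z b)"
        by (simp add: algebra_simps)
      then show "z (- b) - y (- b) = (- y (- b)) * (z (- b) * (z b - y b))"
        using inv[OF b(1) z] inv[OF b(1) y] by simp
    qed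
  qed
  have I_root: "I b" if b: "b \<in> units K" and Q: "Q > 0" "I (of_nat Q * b)" for b Q
  proof -
    have bS: "b \<in> ?S" using b by (rule units_dual)
    have yb: "y b \<noteq> 0" using inv[OF b y] by auto
    define q where "q z = (\<Sum>i<Q. y b ^ (Q - Suc i) * z b ^ i)" for z :: "int ^ 'n => 'k"
    have qr: "q \<in> reg ?A (affine_toric_pts K)"
      unfolding q_def[abs_def]
      by (intro reg_sum[OF A o] reg_mult[OF A o] reg_const[OF A o] reg_power[OF A o] chr[OF bS])
    have "q y = (\<Sum>i<Q. y b ^ (Q - 1))"
      unfolding q_def by (rule sum.cong) (auto simp: power_add[symmetric])
    then have qy: "q y \<noteq> 0" using Q(1) yb by simp
    let ?D = "{z \<in> affine_toric_pts K. q z \<noteq> 0}"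
    have D: "zopen ?A ?D" by (rule reg_open[OF A o qr])
    have yD: "y \<in> ?D" using y qy by simp
    have "(\<lambda>z. inverse (q z)) \<in> reg ?A ?D" by (rule reg_inverse'[OF A o qr])
    then have "in_ideal ?A y (length gs) t (\<lambda>z. inverse (q z) * (z (of_nat Q * b) - y (of_nat Q * b)))"
      using Q(2) unfolding I_def by (intro in_ideal_mult[OF A yA _ D yD])
    then show ?thesis
      unfolding I_def
    proof (rule in_ideal_cong[OF A yA _ D yD])
      fix z :: "int ^ 'n => 'k" assume z: "z \<in> ?D"
      have "z (of_nat Q * b) - y (of_nat Q * b) = z b ^ Q - y b ^ Q"
        using affine_toric_pts_of_nat[OF y bS, of Q] affine_toric_pts_of_nat[of z K b Q] z bS by simp
      also have "\<dots> = (z b - y b) * q z"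
        unfolding q_def by (rule power_diff_sumr2)
      finally show "z b - y b = inverse (q z) * (z (of_nat Q * b) - y (of_nat Q * b))"
        using z by simp
    qed
  qed
  have I_unit: "I b" if b: "b \<in> units K" for b
  proof -
    obtain Q ls where Q: "Q > 0" "set ls \<subseteq> B \<union> uminus ` B" "sum_list ls = of_nat Q * b"
      using unit_span[OF b] by blast
    have "I l \<and> l \<in> ?S" if "l \<in> set ls" for l
    proof -
      have "l \<in> B \<or> - l \<in> B" using that Q(2) by auto
      then show ?thesis
        using I_gen[of l] I_neg[of "- l"] I_gen[of "- l"] BU units_dual[of l K] units_minus[of "- l" K] by auto
    qed
    then have "I (sum_list ls)" by (intro I_sum) auto
    then show ?thesis using I_root[OF b Q(1)] Q(3) by simp
  qed
  have I_all: "I m" if m: "m \<in> ?S" for m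
  proof -
    obtain ls b where ls: "set ls \<subseteq> Hs" "b \<in> units K" "m = sum_list ls + b" using span[OF m] by blast
    have "I (sum_list ls)" using ls(1) HsS I_gen by (intro I_sum) auto
    then show ?thesis
      unfolding ls(3) using I_add I_unit[OF ls(2)] units_dual[OF ls(2)] dual_semigroup_sum_list[of ls K] ls(1) HsS by blast
  qed
  show ?thesis
  proof (rule max_ideal_generated_by_affine_toric[OF y _ len])
    show "t i \<in> toric_functions K \<and> t i y = 0" if "i < length gs" for i
    proof
      have "(\<lambda>x. x (gs ! i)) \<in> toric_functions K" using toric_functions_char[OF gsS[OF that], of 1] by simp
      then show "t i \<in> toric_functions K"
        unfolding t_def[abs_def]
        by (rule function_algebra_diff[OF toric_functions_algebra _ function_algebra_const[OF toric_functions_algebra]])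
    qed (simp add: t_def)
  qed (use I_all in \<open>simp add: I_def\<close>)
qed

context toric_fan
begin

lemma max_ideal_generated_by_chart:
  fixes x :: "('n, 'k::{alg_closed_field, field_char_0}) toric_pt"
  assumes K: "K \<in> \<Sigma>" "x \<in> chart_img K"
  shows "max_ideal_generated_by X x d \<longleftrightarrow> max_ideal_generated_by (affine_toric K) (coords K x) d"
proof -
  let ?U = "chart_img K :: ('n, 'k) toric_pt set"
  have U: "zopen X ?U" by (rule chart_img_open[OF K(1)])
  have p: "pts (induced X ?U) = ?U" by (rule induced_pts[OF U])
  have c: "morphism (affine_toric K) (induced X ?U) (chart K)"
    by (rule morphism_into_induced[OF affine_toric_nice X_nice U chart_morphism[OF K(1)]])
      (simp add: chart_img_def)
  note c' = coords_morphism[OF K(1), where ?'k = 'k]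
  have x: "coords K x \<in> affine_toric_pts K" "chart K (coords K x) = x" using coords_in[OF K] by auto
  have "max_ideal_generated_by (induced X ?U) x d \<longleftrightarrow> max_ideal_generated_by (affine_toric K) (coords K x) d"
  proof
    assume "max_ideal_generated_by (induced X ?U) x d"
    then show "max_ideal_generated_by (affine_toric K) (coords K x) d"
      by (intro max_ideal_generated_by_iso[OF c c']) (use x K(1) in simp_all)
  next
    assume "max_ideal_generated_by (affine_toric K) (coords K x) d"
    then show "max_ideal_generated_by (induced X ?U) x d"
      by (intro max_ideal_generated_by_iso[OF c' c]) (use p K coords_in(2)[OF K(1), where ?'k = 'k] in simp_all)
  qed
  then show ?thesis using max_ideal_generated_by_induced[OF X_nice U K(2)] by simp
qed

lemma few_generators_smooth:
  assumes K: "K \<in> \<Sigma>" and few: "few_generators K Hs B" and x: "x \<in> (chart_img K :: ('n, 'k::{alg_closed_field, field_char_0}) toric_pt set)"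
  shows "x \<in> pts X \<and> smooth_at X x"
proof -
  have X: "x \<in> pts X" using x K by (auto simp: X_pts)
  have "max_ideal_generated_by X x (CARD('n))"
    unfolding max_ideal_generated_by_chart[OF K x]
    by (rule few_generators_max_ideal[OF few coords_in(1)[OF K x]])
  then show ?thesis using X smooth_at_iff[OF X] by simp
qed

text \<open>Every lattice point of the support lies in the relative interior of one cone: the smallest
  cone that contains it.\<close>

lemma smallest_cone:
  assumes "K0 \<in> \<Sigma>" "lattice_vec v \<in> K0"
  obtains K where "K \<in> \<Sigma>" "lattice_vec v \<in> K" "\<And>m. m \<in> dual_semigroup K ==> pairing m v = 0 \<longleftrightarrow> m \<in> units K"
proof -
  define F where "F = {K \<in> \<Sigma>. lattice_vec v \<in> K}"
  define K where "K = \<Inter>F"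
  have F: "finite F" "F \<noteq> {}" "F \<subseteq> \<Sigma>" using finite_fan assms by (auto simp: F_def)
  have "\<Inter>G \<in> \<Sigma>" if "finite G" "G \<noteq> {}" "G \<subseteq> \<Sigma>" for G
    using that by (induction G rule: finite_ne_induct) (auto intro: inter_in_fan)
  then have K: "K \<in> \<Sigma>" using F by (simp add: K_def)
  have v: "lattice_vec v \<in> K" by (auto simp: K_def F_def)
  have "pairing m v = 0 \<longleftrightarrow> m \<in> units K" if m: "m \<in> dual_semigroup K" for m
  proof
    assume mv: "pairing m v = 0"
    let ?\<tau> = "K \<inter> {w. lattice_vec m \<bullet> w = 0}"
    have "?\<tau> face_of K"
      by (rule face_of_Int_supporting_hyperplane_ge)
        (use cone[OF K] m in \<open>auto simp: convex_cone_def dual_semigroup_def\<close>)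
    moreover have v\<tau>: "lattice_vec v \<in> ?\<tau>" using v mv by (simp add: inner_lattice_vec)
    ultimately have "?\<tau> \<in> F" using face_in_fan[OF K] unfolding F_def by blast
    then have "K \<subseteq> ?\<tau>" by (auto simp: K_def)
    then have "- m \<in> dual_semigroup K" by (auto simp: dual_semigroup_def)
    then show "m \<in> units K" using m by (simp add: units_def)
  next
    assume "m \<in> units K"
    then show "pairing m v = 0"
      using dual_semigroup_pairing[OF m v] dual_semigroup_pairing[of "- m" K v] v by (simp add: units_def)
  qed
  then show thesis using that K v by blast
qed

text \<open>At a point of the orbit of the cone, the irreducible elements of the semigroup modulo units and
  the linearly independent units give linearly independent tangent vectors.\<close>

lemma smooth_orbit_few_generators:
  fixes \<phi> :: "int ^ 'n => 'k::{alg_closed_field, field_char_0}"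
  assumes K: "K \<in> \<Sigma>" and v: "lattice_vec v \<in> K" and \<phi>: "\<phi> \<in> torus"
    and unit: "\<And>m. m \<in> dual_semigroup K ==> pairing m v = 0 \<longleftrightarrow> m \<in> units K"
    and smooth: "smooth_at X (limit v \<phi>)"
  shows "\<exists>Hs B. few_generators K Hs B"
proof -
  let ?S = "dual_semigroup K"
  define y where "y = limit_pt K v \<phi>"
  have y: "y \<in> affine_toric_pts K" unfolding y_def by (rule limit_pt_in[OF v \<phi>])
  have xU: "limit v \<phi> \<in> chart_img K" "coords K (limit v \<phi>) = y"
    using limit_chart[OF K v \<phi>] by (auto simp: y_def)
  then have xX: "limit v \<phi> \<in> pts X" using K by (auto simp: X_pts)
  have gen: "max_ideal_generated_by (affine_toric K) y (CARD('n))"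
    using smooth unfolding smooth_at_iff[OF xX] max_ideal_generated_by_chart[OF K xU(1)] xU(2) .
  have y_val: "y m = (if m \<in> units K then \<phi> m else 0)" for m
    using unit[of m] units_dual[of m K] by (auto simp: y_def limit_pt_def)
  have units_iff: "a + b \<in> units K \<longleftrightarrow> a \<in> units K \<and> b \<in> units K" if "a \<in> ?S" "b \<in> ?S" for a b
    using units_of_add[OF that] units_of_add[OF that(2,1)] units_add by (auto simp: add.commute)
  obtain B where B: "finite B" "B \<subseteq> units K" "independent (lattice_vec ` B)"
    and unit_span: "\<And>b. b \<in> units K ==> \<exists>Q>0. \<exists>ls. set ls \<subseteq> B \<union> uminus ` B \<and> sum_list ls = of_nat Q * b"
    by (rule units_basis[of K]) (rule that)
  define B' where "B' = lattice_vec ` B"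
  have fB: "finite B" and imB: "lattice_vec ` B = B'" and B': "independent B'"
    using B by (simp_all add: B'_def)
  have dualB: "\<exists>w. pairing b w \<noteq> 0 \<and> (\<forall>b'\<in>B - {b}. pairing b' w = 0)" if b: "b \<in> B" for b
  proof -
    let ?E = "lattice_vec ` (B - {b}) \<union> uminus ` lattice_vec ` (B - {b})"
    have "convex_cone hull ?E \<subseteq> span (B' - {lattice_vec b})"
    proof (rule hull_minimal)
      show "convex_cone (span (B' - {lattice_vec b}))" by (rule convex_cone_span)
      have "lattice_vec ` (B - {b}) \<subseteq> B' - {lattice_vec b}"
        using imB inj_eq[OF lattice_vec_inj] by auto
      then show "?E \<subseteq> span (B' - {lattice_vec b})" by (auto intro: span_base span_neg)
    qed
    moreover have "- lattice_vec b \<notin> span (B' - {lattice_vec b})"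
    proof
      assume "- lattice_vec b \<in> span (B' - {lattice_vec b})"
      then have "lattice_vec b \<in> span (B' - {lattice_vec b})" using span_neg by fastforce
      moreover have "lattice_vec b \<in> B'" using b imB by blast
      ultimately show False using B' unfolding dependent_def by blast
    qed
    ultimately have "- lattice_vec b \<notin> convex_cone hull ?E" by blast
    moreover have "finite ?E" using fB by simp
    ultimately obtain w where w: "\<forall>e\<in>?E. 0 \<le> w \<bullet> e" "w \<bullet> (- lattice_vec b) < 0"
      using closed_convex_cone_separation by blast
    have w0: "lattice_vec b' \<bullet> w = 0" if "b' \<in> B - {b}" for b'
    proof -
      have "lattice_vec b' \<in> ?E" "- lattice_vec b' \<in> ?E" using that by auto
      then have "0 \<le> w \<bullet> lattice_vec b'" "0 \<le> w \<bullet> (- lattice_vec b')" using w(1) by blast+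
      then show ?thesis by (simp add: inner_commute)
    qed
    obtain p where p: "\<forall>g\<in>B. sgn (real_of_int (pairing g p)) = sgn (lattice_vec g \<bullet> w)"
      using lattice_point_same_signs[OF fB] by blast
    have "pairing b' p = 0" if "b' \<in> B - {b}" for b'
    proof -
      have "sgn (real_of_int (pairing b' p)) = 0" using p w0[OF that] that by simp
      then show ?thesis by (simp add: sgn_zero_iff)
    qed
    moreover have "pairing b p \<noteq> 0"
    proof
      assume "pairing b p = 0"
      then have "sgn (lattice_vec b \<bullet> w) = 0" using p b by (metis of_int_0 sgn_0)
      then show False using w(2) by (simp add: sgn_zero_iff inner_commute)
    qed
    ultimately show ?thesis by blast
  qed
  then obtain w where w: "\<And>b. b \<in> B ==> pairing b (w b) \<noteq> 0"
    "\<And>b b'. b \<in> B ==> b' \<in> B ==> b' \<noteq> b ==> pairing b' (w b) = 0"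
    by (metis Diff_iff singletonD)
  define irr where "irr = {h \<in> ?S. h \<notin> units K \<and> (\<forall>a b. a \<in> ?S --> b \<in> ?S --> h = a + b --> a \<in> units K \<or> b \<in> units K)}"
  define P where "P Hs \<longleftrightarrow> finite Hs \<and> Hs \<subseteq> irr \<and> (\<forall>h\<in>Hs. \<forall>h'\<in>Hs. h \<noteq> h' --> h - h' \<notin> units K)" for Hs
  have bound: "card Hs + card B \<le> CARD('n)" if P: "P Hs" for Hs
  proof -
    \<comment> \<open>Derivations at \<open>y\<close>: for an irreducible \<open>h\<close>, the coefficient along \<open>h\<close> modulo units; for a unit \<open>b\<close>,
      the logarithmic derivative in the direction \<open>w b\<close>, which is orthogonal to the other units.\<close>
    define Ds :: "int ^ 'n + int ^ 'n => int ^ 'n => 'k" where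
      "Ds i m = (case i of Inl h => (if m - h \<in> units K then \<phi> (m - h) else 0)
                         | Inr b => (if m \<in> units K then of_int (pairing m (w b)) * \<phi> m else 0))" for i m
    define mm :: "int ^ 'n + int ^ 'n => int ^ 'n" where "mm i = (case i of Inl h => h | Inr b => b)" for i
    have Hs: "finite Hs" "Hs \<subseteq> irr" "\<And>h h'. h \<in> Hs ==> h' \<in> Hs ==> h \<noteq> h' ==> h - h' \<notin> units K"
      using P by (auto simp: P_def)
    have hS: "h \<in> ?S" "h \<notin> units K" if "h \<in> Hs" for h using Hs(2) that by (auto simp: irr_def)
    have BU: "b \<in> units K" if "b \<in> B" for b using that B(2) by blast
    have bh: "b - h \<notin> units K" if "h \<in> Hs" "b \<in> units K" for b h
      using units_diff[OF that(2), of "b - h"] hS(2)[OF that(1)] by auto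
    have half: "Ds (Inl h) (p + q) = y p * Ds (Inl h) q + y q * Ds (Inl h) p"
      if h: "h \<in> Hs" and pq: "p \<in> ?S" "q \<in> ?S" and p: "p \<in> units K" for h p q
    proof (cases "q \<in> units K")
      case True
      then have "p + q - h \<notin> units K" "q - h \<notin> units K" "p - h \<notin> units K"
        using bh[OF h] units_add[OF p True] p by auto
      then show ?thesis by (simp add: Ds_def)
    next
      case False
      have "p + q - h \<in> units K \<longleftrightarrow> q - h \<in> units K"
        using units_diff[of "p + q - h" K p] units_add[of "q - h" K p] p by (auto simp: algebra_simps)
      moreover have "\<phi> (p + q - h) = \<phi> p * \<phi> (q - h)"
        using torus_add[OF \<phi>, of p "q - h"] by (simp add: algebra_simps)
      ultimately show ?thesis using False p y_val by (simp add: Ds_def)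
    qed
    show ?thesis
    proof -
      have "card (Inl ` Hs \<union> Inr ` B :: (int ^ 'n + int ^ 'n) set) \<le> CARD('n)"
      proof (rule derivations_bound[OF zero_in[OF K] y gen, of _ Ds mm])
        show "finite (Inl ` Hs \<union> Inr ` B)" using Hs(1) fB by simp
        fix i assume i: "i \<in> Inl ` Hs \<union> Inr ` B"
        show "mm i \<in> ?S" using i hS BU units_dual[OF BU] by (auto simp: mm_def)
        show "Ds i (mm i) \<noteq> 0"
          using i BU w(1) torus_nonzero[OF \<phi>] units_0[of K] by (auto simp: Ds_def mm_def)
        fix p q assume pq: "p \<in> ?S" "q \<in> ?S"
        show "Ds i (p + q) = y p * Ds i q + y q * Ds i p"
        proof (cases i)
          case (Inr b)
          show ?thesis
            using units_iff[OF pq] by (auto simp: Inr Ds_def y_val torus_add[OF \<phi>] algebra_simps)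
        next
          case (Inl h)
          then have h: "h \<in> Hs" using i by auto
          consider "p \<in> units K" | "q \<in> units K" | "p \<notin> units K" "q \<notin> units K" by blast
          then show ?thesis
          proof cases
            case 1
            then show ?thesis using half[OF h pq] by (simp add: Inl)
          next
            case 2
            then show ?thesis using half[OF h pq(2,1)] by (simp add: Inl add.commute)
          next
            case 3
            have "p + q - h \<notin> units K"
            proof
              assume c: "p + q - h \<in> units K"
              have "q - (p + q - h) \<in> ?S"
                using dual_semigroup_add[OF pq(2) units_dual[OF units_minus[OF c]]] by simp
              moreover have "h = p + (q - (p + q - h))" by simp
              ultimately have "p \<in> units K \<or> q - (p + q - h) \<in> units K"
                using h Hs(2) pq(1) unfolding irr_def by blast
              then have "q - (p + q - h) + (p + q - h) \<in> units K" using 3 c units_add by blast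
              then show False using 3 by simp
            qed
            then show ?thesis using 3 by (simp add: Inl Ds_def y_val)
          qed
        qed
      next
        fix i j assume ij: "i \<in> Inl ` Hs \<union> Inr ` B" "j \<in> Inl ` Hs \<union> Inr ` B" "i \<noteq> j"
        show "Ds i (mm j) = 0"
        proof (cases i; cases j)
          fix h h' assume h: "i = Inl h" "j = Inl h'"
          then have "h' - h \<notin> units K" using ij Hs(3)[of h' h] by auto
          then show ?thesis using h by (simp add: Ds_def mm_def)
        next
          fix h b assume h: "i = Inl h" "j = Inr b"
          then have "b - h \<notin> units K" using ij bh[of h b] BU by auto
          then show ?thesis using h by (simp add: Ds_def mm_def)
        next
          fix b h assume h: "i = Inr b" "j = Inl h"
          then have "h \<notin> units K" using ij hS(2)[of h] by auto
          then show ?thesis using h by (simp add: Ds_def mm_def)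
        next
          fix b b' assume h: "i = Inr b" "j = Inr b'"
          then have "pairing b' (w b) = 0" using ij w(2)[of b b'] by auto
          then show ?thesis using h by (simp add: Ds_def mm_def)
        qed
      qed
      then show ?thesis
        by (subst (asm) card_Un_disjoint) (use Hs(1) fB in \<open>auto simp: card_image\<close>)
    qed
  qed
  have P0: "P {}" by (simp add: P_def)
  have "\<exists>Hs. P Hs \<and> (\<forall>Hs'. P Hs' --> card Hs' \<le> card Hs)"
  proof (rule ex_has_greatest_nat[of P "{}" card "Suc CARD('n)", OF P0])
    show "\<forall>Hs. P Hs --> card Hs < Suc CARD('n)" using bound by force
  qed
  then obtain Hs where Hs: "P Hs" "\<And>Hs'. P Hs' ==> card Hs' \<le> card Hs" by blast
  \<comment> \<open>By maximality of \<open>Hs\<close>.\<close>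
  have near: "\<exists>h'\<in>Hs. h - h' \<in> units K" if h: "h \<in> irr" for h
  proof (rule ccontr)
    assume no: "\<not> (\<exists>h'\<in>Hs. h - h' \<in> units K)"
    have nn: "h' - h \<notin> units K" if "h' \<in> Hs" for h' using units_minus[of "h' - h" K] no that by auto
    have "h \<notin> Hs" using no units_0[of K] by force
    have "P (insert h Hs)" using Hs(1) h no nn by (auto simp: P_def)
    then have "card (insert h Hs) \<le> card Hs" by (rule Hs(2))
    then show False using \<open>h \<notin> Hs\<close> Hs(1) by (simp add: P_def)
  qed
  have span: "\<exists>ls b. set ls \<subseteq> Hs \<and> b \<in> units K \<and> m = sum_list ls + b" if "m \<in> ?S" for m
    using that
  proof (induction "nat (pairing m v)" arbitrary: m rule: less_induct)
    case less
    show ?case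
    proof (cases "m \<in> units K")
      case True
      then show ?thesis by (intro exI[of _ "[]"] exI[of _ m]) simp
    next
      case mU: False
      show ?thesis
      proof (cases "m \<in> irr")
        case True
        then obtain h where "h \<in> Hs" "m - h \<in> units K" using near by blast
        then show ?thesis by (intro exI[of _ "[h]"] exI[of _ "m - h"]) simp
      next
        case False
        then obtain a b where ab: "a \<in> ?S" "b \<in> ?S" "m = a + b" "a \<notin> units K" "b \<notin> units K"
          using less.prems mU by (auto simp: irr_def)
        have "pairing a v > 0" "pairing b v > 0"
          using ab unit dual_semigroup_pairing[OF _ v] by (auto simp: order_less_le)
        then have "nat (pairing a v) < nat (pairing m v)" "nat (pairing b v) < nat (pairing m v)"
          using ab(3) by simp_all
        then obtain la ba lb bb where l: "set la \<subseteq> Hs" "ba \<in> units K" "a = sum_list la + ba"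
          "set lb \<subseteq> Hs" "bb \<in> units K" "b = sum_list lb + bb"
          using less.hyps[of a] less.hyps[of b] ab(1,2) by blast
        then show ?thesis
          using ab(3) units_add by (intro exI[of _ "la @ lb"] exI[of _ "ba + bb"]) auto
      qed
    qed
  qed
  have "few_generators K Hs B"
    unfolding few_generators_def
    using Hs(1) fB bound[OF Hs(1)] span unit_span B(2) by (auto simp: P_def irr_def)
  then show ?thesis by blast
qed

text \<open>Up to units, the semigroup consists of the multiples of any \<open>h\<close> with the smallest positive value on \<open>u\<close>.\<close>

lemma ray_few_generators:
  fixes u :: "int ^ 'n"
  assumes u: "u \<noteq> 0"
  shows "\<exists>Hs B. few_generators (convex_cone hull {lattice_vec u}) Hs B"
proof -
  let ?K = "convex_cone hull {lattice_vec u}"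
  have S: "dual_semigroup ?K = {m. 0 \<le> pairing m u}"
    using dual_semigroup_hull[of "{u}"] by simp
  have U: "units ?K = {m. pairing m u = 0}" by (auto simp: units_def S)
  obtain i0 where i0: "u $ i0 \<noteq> 0" using u by (auto simp: vec_eq_iff)
  obtain B where B: "finite B" "B \<subseteq> units ?K" "independent (lattice_vec ` B)"
    and unit_span: "\<And>b. b \<in> units ?K ==> \<exists>Q>0. \<exists>ls. set ls \<subseteq> B \<union> uminus ` B \<and> sum_list ls = of_nat Q * b"
    by (rule units_basis[of ?K]) (rule that)
  define Z where "Z = range (\<lambda>m. pairing m u)"
  have "0 \<in> Z" unfolding Z_def by (rule image_eqI[of _ _ 0]) auto
  moreover have "p - q \<in> Z" if pq: "p \<in> Z" "q \<in> Z" for p q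
  proof -
    obtain a c where "p = pairing a u" "q = pairing c u" using pq unfolding Z_def by blast
    then have "p - q = pairing (a - c) u" by (simp add: pairing_diff_left)
    then show ?thesis unfolding Z_def by blast
  qed
  ultimately obtain q where q: "q \<ge> 0" "Z = range (\<lambda>k. q * k)" using int_subgroup_generator[of Z] by blast
  have "pairing (axis i0 1) u \<in> Z" unfolding Z_def by blast
  then have "u $ i0 \<in> Z" by simp
  then have q0: "q > 0" using q i0 by (cases "q = 0") auto
  have "q * 1 \<in> Z" unfolding q(2) by blast
  then obtain h where h: "pairing h u = q" unfolding Z_def by auto
  have span: "\<exists>ls c. set ls \<subseteq> {h} \<and> c \<in> units ?K \<and> m = sum_list ls + c" if m: "m \<in> dual_semigroup ?K" for m
  proof -
    have "pairing m u \<in> Z" unfolding Z_def by blast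
    then obtain k where k: "pairing m u = q * k" unfolding q(2) by blast
    have "k \<ge> 0" using m k q0 by (simp add: S zero_le_mult_iff)
    then have "m - of_nat (nat k) * h \<in> units ?K" using k h by (simp add: U)
    then show ?thesis
      by (intro exI[of _ "replicate (nat k) h"] exI[of _ "m - of_nat (nat k) * h"])
        (auto simp: sum_list_replicate_of_nat)
  qed
  have "card B = card (lattice_vec ` B)" by (rule card_image[symmetric, OF inj_on_subset[OF lattice_vec_inj]]) simp
  also have "\<dots> \<le> dim {x. lattice_vec u \<bullet> x = 0}"
  proof (rule independent_card_le_dim[OF _ B(3)])
    show "lattice_vec ` B \<subseteq> {x. lattice_vec u \<bullet> x = 0}"
      using B(2) by (auto simp: U inner_lattice_vec pairing_commute)
  qed
  also have "\<dots> = CARD('n) - 1"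
    using u by (subst dim_hyperplane) (simp_all add: lattice_vec_def vec_eq_iff)
  finally have "card B \<le> CARD('n) - 1" .
  then have "card B + 1 \<le> CARD('n)" using zero_less_card_finite[where 'a = 'n] by linarith
  then have "card {h} + card B \<le> CARD('n)" by simp
  then have "few_generators ?K {h} B"
    unfolding few_generators_def using span unit_span B(1,2) h q0 by (auto simp: S)
  then show ?thesis by blast
qed

definition smooth_pts :: "('n, 'k::{alg_closed_field, field_char_0}) toric_pt set"
  where "smooth_pts = {x \<in> pts X. smooth_at X x}"

text \<open>The cone whose orbit contains the point has few generators, as the point is smooth; hence the whole
  chart is smooth.\<close>

lemma smooth_pts_cone:
  fixes x :: "('n, 'k::{alg_closed_field, field_char_0}) toric_pt"
  assumes x: "x \<in> smooth_pts"
  obtains K v \<phi> where "K \<in> \<Sigma>" "chart_img K \<subseteq> (smooth_pts :: ('n, 'k) toric_pt set)"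
    "lattice_vec v \<in> K" "\<phi> \<in> torus" "x = limit v \<phi>"
proof -
  have X: "x \<in> pts X" "smooth_at X x" using x by (auto simp: smooth_pts_def)
  obtain K0 where K0: "K0 \<in> \<Sigma>" "x \<in> chart_img K0" using X(1) unfolding X_pts by blast
  obtain v \<phi> where v: "lattice_vec v \<in> K0" "\<phi> \<in> torus" "x = limit v \<phi>" using X_pts_limit[OF K0] by blast
  obtain K where K: "K \<in> \<Sigma>" "lattice_vec v \<in> K" "\<And>m. m \<in> dual_semigroup K ==> pairing m v = 0 \<longleftrightarrow> m \<in> units K"
    using smallest_cone[OF K0(1) v(1)] by blast
  have "smooth_at X (limit v \<phi>)" using X(2) v(3) by simp
  then obtain Hs B where "few_generators K Hs B"
    using smooth_orbit_few_generators[OF K(1,2) v(2) K(3)] by blast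
  then have "chart_img K \<subseteq> (smooth_pts :: ('n, 'k) toric_pt set)"
    using few_generators_smooth[OF K(1)] by (auto simp: smooth_pts_def)
  then show thesis using that K(1,2) v(2,3) by blast
qed

text \<open>Toric varieties are normal, hence smooth in codimension one. For this reason every ray is available for
  the construction of curves in the smooth locus.\<close>

lemma ray_smooth:
  assumes "convex_cone hull {lattice_vec u} \<in> \<Sigma>" "u \<noteq> 0"
  shows "chart_img (convex_cone hull {lattice_vec u}) \<subseteq> (smooth_pts :: ('n, 'k::{alg_closed_field, field_char_0}) toric_pt set)"
  using few_generators_smooth[OF assms(1)] ray_few_generators[OF assms(2)] by (auto simp: smooth_pts_def)

end

section \<open>Rational curves in toric varieties\<close>

subsection \<open>Pencils of linear forms\<close>

text \<open>A list of \<open>q\<close> linear forms \<open>a\<^sub>i t + b\<^sub>i\<close> on the projective line, no two of which have a common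
  zero, is a point of an affine variety: \<open>a\<^sub>i\<close> and \<open>b\<^sub>i\<close> are the coordinates \<open>2 i\<close> and \<open>2 i + 1\<close>,
  and the last coordinate is the inverse of the product of all minors.\<close>

definition minors :: "nat => (nat => 'k::field) => 'k"
  where "minors q x = (\<Prod>j<q. \<Prod>i<j. x (2 * i) * x (Suc (2 * j)) - x (2 * j) * x (Suc (2 * i)))"

definition linear_forms :: "nat => (nat => 'k::field, 'k) fspace"
  where "linear_forms q = mspec (algebraic_set (Suc (2 * q)) {\<lambda>x. x (2 * q) * minors q x - 1}) (polyfun (Suc (2 * q)))"

definition linear_form :: "(nat => 'k::field) => nat => 'k option => 'k"
  where "linear_form x i p = (case p of None => x (2 * i) | Some t => x (2 * i) * t + x (Suc (2 * i)))"

lemma minors_polyfun: "minors q \<in> polyfun (Suc (2 * q))"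
proof -
  have "(\<lambda>x. x (2 * i) * x (Suc (2 * j)) - x (2 * j) * x (Suc (2 * i))) \<in> polyfun (Suc (2 * q))" if "i < j" "j < q" for i j
    using that by (intro function_algebra_diff[OF polyfun_algebra] polyfun.mult polyfun.coord) auto
  then show ?thesis
    unfolding minors_def[abs_def] by (intro function_algebra_prod[OF polyfun_algebra]) auto
qed

lemma linear_forms_prevariety: "prevariety (linear_forms q)"
proof -
  have "(\<lambda>x. x (2 * q) * minors q x - 1) \<in> polyfun (Suc (2 * q))"
    by (intro function_algebra_diff[OF polyfun_algebra] polyfun.mult polyfun.coord polyfun.const minors_polyfun) simp
  then show ?thesis unfolding linear_forms_def by (intro mspec_polyfun_prevariety) simp
qed

lemma linear_forms_nice: "nice (linear_forms q)"
  unfolding linear_forms_def by (rule mspec_nice[OF polyfun_algebra])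

lemma linear_forms_pts: "pts (linear_forms q) = {x \<in> affine_pts (Suc (2 * q)). x (2 * q) * minors q x = 1}"
  unfolding linear_forms_def mspec_pts[OF polyfun_algebra] algebraic_set_def by simp

lemma linear_forms_coord_reg:
  "i \<le> 2 * q ==> (\<lambda>x. x i) \<in> reg (linear_forms q) (pts (linear_forms q))"
  unfolding linear_forms_def
  by (rule mspec_algebra_reg[OF polyfun_algebra polyfun.coord]) auto

lemma linear_forms_minor:
  assumes x: "x \<in> pts (linear_forms q)" and ij: "i < q" "j < q" "i \<noteq> j"
  shows "x (2 * i) * x (Suc (2 * j)) \<noteq> x (2 * j) * x (Suc (2 * i))"
proof -
  have nz: "minors q x \<noteq> 0" using x by (auto simp: linear_forms_pts)
  have *: "x (2 * i) * x (Suc (2 * j)) \<noteq> x (2 * j) * x (Suc (2 * i))" if "i < j" "j < q" for i j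
    using nz that by (auto simp: minors_def)
  show ?thesis using *[of i j] *[of j i] ij by (cases "i < j") auto
qed

text \<open>A common zero of two linear forms makes their minor vanish.\<close>

lemma linear_form_common_zero:
  assumes x: "x \<in> pts (linear_forms q)" and ij: "i < q" "j < q"
    and z: "linear_form x i p = 0" "linear_form x j p = 0"
  shows "i = j"
proof (rule ccontr)
  assume "i \<noteq> j"
  then have n: "x (2 * i) * x (Suc (2 * j)) \<noteq> x (2 * j) * x (Suc (2 * i))" by (rule linear_forms_minor[OF x ij])
  show False
  proof (cases p)
    case None
    then show ?thesis using n z by (simp add: linear_form_def)
  next
    case (Some t)
    then have "x (Suc (2 * i)) = - (x (2 * i) * t)" "x (Suc (2 * j)) = - (x (2 * j) * t)"
      using z by (simp_all add: linear_form_def add_eq_0_iff)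
    then show ?thesis using n by simp
  qed
qed

lemma linear_forms_exists:
  fixes a b :: "nat => 'k::field"
  assumes n: "\<And>i j. i < j ==> j < q ==> a i * b j \<noteq> a j * b i"
  shows "\<exists>x\<in>pts (linear_forms q). \<forall>i<q. linear_form x i None = a i \<and> linear_form x i (Some 0) = b i"
proof -
  define x where "x = (\<lambda>k. if k < 2 * q then (if even k then a (k div 2) else b (k div 2))
    else if k = 2 * q then inverse (\<Prod>j<q. \<Prod>i<j. a i * b j - a j * b i) else 0)"
  have ab: "x (2 * i) = a i" "x (Suc (2 * i)) = b i" if "i < q" for i using that by (auto simp: x_def)
  have "minors q x = (\<Prod>j<q. \<Prod>i<j. a i * b j - a j * b i)"
    unfolding minors_def by (intro prod.cong) (simp_all add: ab)
  moreover have "(\<Prod>j<q. \<Prod>i<j. a i * b j - a j * b i) \<noteq> 0" using n by auto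
  ultimately have "x \<in> pts (linear_forms q)"
    by (auto simp: linear_forms_pts affine_pts_def x_def)
  then show ?thesis by (intro bexI[of _ x]) (simp_all add: linear_form_def ab)
qed

lemma linear_form_zero:
  assumes x: "x \<in> pts (linear_forms q)" and i: "i < q" "q \<ge> 2"
  obtains p where "linear_form x i p = 0"
proof (cases "x (2 * i) = 0")
  case True
  then show thesis by (intro that[of None]) (simp add: linear_form_def)
next
  case False
  then show thesis by (intro that[of "Some (- x (Suc (2 * i)) / x (2 * i))"]) (simp add: linear_form_def)
qed

lemma linear_forms_nonzero:
  fixes x :: "nat => 'k::field_char_0"
  assumes x: "x \<in> pts (linear_forms q)" and q: "q \<ge> 2"
  obtains p where "\<And>i. i < q ==> linear_form x i p \<noteq> 0"
proof -
  obtain t where t: "t \<notin> (\<lambda>i. - x (Suc (2 * i)) / x (2 * i)) ` {..<q}"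
    using ex_new_if_finite[OF infinite_UNIV_char_0, of "(\<lambda>i. - x (Suc (2 * i)) / x (2 * i)) ` {..<q}"] by auto
  have "linear_form x i (Some t) \<noteq> 0" if i: "i < q" for i
  proof
    assume z: "linear_form x i (Some t) = 0"
    define j where "j = (if i = 0 then 1 else 0 :: nat)"
    have j: "j < q" "i \<noteq> j" using q by (auto simp: j_def)
    have "x (2 * i) \<noteq> 0"
    proof
      assume "x (2 * i) = 0"
      then show False using z linear_forms_minor[OF x i j] by (simp add: linear_form_def)
    qed
    then have "t = - x (Suc (2 * i)) / x (2 * i)"
      using z by (simp add: linear_form_def field_simps add_eq_0_iff)
    then show False using t i by blast
  qed
  then show thesis by (rule that)
qed

lemma prod_power_int:
  fixes t :: "'k::field"
  assumes "t \<noteq> 0"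
  shows "(\<Prod>i\<in>I. t powi f i) = t powi (\<Sum>i\<in>I. f i)"
  by (induction I rule: infinite_finite_induct) (use assms in \<open>auto simp: power_int_add\<close>)

subsection \<open>Curves with prescribed linear factors\<close>

context toric_fan
begin

lemma limit_cong:
  assumes "\<And>m. pairing m u = 0 ==> \<phi> m = \<phi>' m"
  shows "limit u \<phi> = limit u \<phi>'"
proof -
  have "limit_pt K u \<phi> = limit_pt K u \<phi>'" for K using assms by (auto simp: limit_pt_def)
  then show ?thesis by (simp add: limit_def Let_def)
qed

text \<open>The point at which the character \<open>m\<close> takes the value \<open>\<Prod>i. l\<^sub>i\<^bsup>\<langle>m, v\<^sub>i\<rangle>\<^esup>\<close>. When some \<open>l\<^sub>i\<close> vanish
  this is to be read as a limit.\<close>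

definition factor_pt :: "nat => (nat => int ^ 'n) => (nat => 'k::field) => ('n, 'k) toric_pt"
  where "factor_pt q v l = limit (\<Sum>i\<in>{i. i < q \<and> l i = 0}. v i)
    (\<lambda>m. \<Prod>i\<in>{i. i < q \<and> l i \<noteq> 0}. l i powi pairing m (v i))"

lemma nonzero_factors_torus: "(\<lambda>m. \<Prod>i\<in>{i. i < (q :: nat) \<and> l i \<noteq> 0}. l i powi pairing m (v i)) \<in> torus"
  by (intro torus_prod one_parameter_torus) auto

lemma factor_pt_chart:
  fixes l :: "nat => 'k::alg_closed_field"
  assumes K: "K \<in> \<Sigma>" and i: "i < q" "lattice_vec (v i) \<in> K" and l: "\<And>j. j < q ==> j \<noteq> i ==> l j \<noteq> 0"
  defines "g \<equiv> (\<lambda>m. if m \<in> dual_semigroup K then \<Prod>j<q. l j powi pairing m (v j) else 0)"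
  shows "g \<in> affine_toric_pts K" "factor_pt q v l = chart K g"
proof -
  let ?\<phi> = "\<lambda>m. \<Prod>j\<in>{j. j < q \<and> l j \<noteq> 0}. l j powi pairing m (v j)"
  let ?w = "\<Sum>j\<in>{j. j < q \<and> l j = 0}. v j"
  have w: "lattice_vec ?w \<in> K \<and> limit_pt K ?w ?\<phi> = g"
  proof (cases "l i = 0")
    case True
    have s: "{j. j < q \<and> l j = 0} = {i}" "{j. j < q \<and> l j \<noteq> 0} = {..<q} - {i}"
      using True i l by auto
    have "limit_pt K (v i) ?\<phi> m = g m" for m
      using i(1) True
      by (simp add: s limit_pt_def g_def prod.remove[of "{..<q}" i] zero_powi_eq)
    then show ?thesis using i(2) by (simp add: s fun_eq_iff)
  next
    case False
    then have s: "{j. j < q \<and> l j = 0} = {}" "{j. j < q \<and> l j \<noteq> 0} = {..<q}"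
      using l by auto
    have "lattice_vec 0 \<in> K" using zero_in[OF K] by simp
    then show ?thesis by (auto simp: s limit_pt_def g_def)
  qed
  show "g \<in> affine_toric_pts K"
    using limit_pt_in[OF conjunct1[OF w] nonzero_factors_torus[where q = q and l = l and v = v]] w by simp
  show "factor_pt q v l = chart K g"
    unfolding factor_pt_def using limit_eq[OF K conjunct1[OF w] nonzero_factors_torus[where q = q and l = l and v = v]] w by simp
qed

lemma factor_pt_scale:
  fixes l :: "nat => 'k::field"
  assumes t: "t \<noteq> 0" and v: "(\<Sum>i<q. v i) = 0"
  shows "factor_pt q v (\<lambda>i. t * l i) = factor_pt q v l"
proof -
  let ?N = "{i. i < q \<and> l i \<noteq> 0}" and ?Z = "{i. i < q \<and> l i = 0}"
  have "(\<Prod>i\<in>?N. (t * l i) powi pairing m (v i)) = (\<Prod>i\<in>?N. l i powi pairing m (v i))"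
    if m: "pairing m (\<Sum>i\<in>?Z. v i) = 0" for m
  proof -
    have "(\<Sum>i<q. v i) = (\<Sum>i\<in>?N. v i) + (\<Sum>i\<in>?Z. v i)"
      by (subst sum.union_disjoint[symmetric]) (auto intro!: sum.cong)
    then have "pairing m (\<Sum>i\<in>?N. v i) + pairing m (\<Sum>i\<in>?Z. v i) = 0"
      unfolding v pairing_add_right[symmetric] by (metis pairing_0(2))
    then have "(\<Prod>i\<in>?N. t powi pairing m (v i)) = 1"
      using m by (simp add: prod_power_int[OF t] pairing_sum_right)
    then show ?thesis by (simp add: power_int_mult_distrib prod.distrib)
  qed
  then show ?thesis using t by (auto simp: factor_pt_def intro!: limit_cong)
qed

lemma factor_pt_torus:
  fixes l :: "nat => 'k::alg_closed_field"
  assumes "\<And>i. i < q ==> l i \<noteq> 0"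
  shows "factor_pt q v l = torus_pt (\<lambda>m. \<Prod>i<q. l i powi pairing m (v i))"
proof -
  have s: "{i. i < q \<and> l i = 0} = {}" "{i. i < q \<and> l i \<noteq> 0} = {..<q}" using assms by auto
  have "(\<lambda>m. \<Prod>i<q. l i powi pairing m (v i)) \<in> torus" using nonzero_factors_torus[where q = q and l = l and v = v] by (simp add: s)
  then show ?thesis by (simp add: factor_pt_def s torus_pt_eq_limit)
qed

text \<open>A family of points with varying factors is a morphism as long as no two factors vanish
  simultaneously: then the monomials that are regular on the chart of \<open>v\<^sub>i\<close> involve \<open>l\<^sub>i\<close> with
  non-negative exponents only.\<close>

lemma morphism_factor_pt:
  fixes f :: "'a => ('n, 'k::{alg_closed_field, field_char_0}) toric_pt"
  assumes Z: "nice Z" and q: "q > 0"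
    and K: "\<And>i. i < q ==> K i \<in> \<Sigma> \<and> lattice_vec (v i) \<in> K i"
    and loc: "\<And>z. z \<in> pts Z ==> \<exists>W l. zopen Z W \<and> z \<in> W \<and> (\<forall>i<q. l i \<in> reg Z W) \<and>
      (\<forall>w\<in>W. f w = factor_pt q v (\<lambda>i. l i w)) \<and> (\<forall>i<q. \<forall>j<q. l i z = 0 --> l j z = 0 --> i = j)"
  shows "morphism Z X f" and "\<And>z. z \<in> pts Z ==> \<exists>i<q. f z \<in> chart_img (K i)"
proof -
  have key: "\<exists>N i g. zopen Z N \<and> z \<in> N \<and> i < q \<and>
      (\<forall>w\<in>N. g w \<in> affine_toric_pts (K i) \<and> f w = chart (K i) (g w)) \<and>
      (\<forall>m\<in>dual_semigroup (K i). (\<lambda>w. g w m) \<in> reg Z N)" if z: "z \<in> pts Z" for z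
  proof -
    obtain W l where W: "zopen Z W" "z \<in> W" "\<forall>i<q. l i \<in> reg Z W"
      "\<forall>w\<in>W. f w = factor_pt q v (\<lambda>i. l i w)" "\<forall>i<q. \<forall>j<q. l i z = 0 --> l j z = 0 --> i = j"
      using loc[OF z] by (elim exE conjE) (rule that)
    \<comment> \<open>The only factor, if any, that may vanish near \<open>z\<close> determines the chart.\<close>
    have "\<exists>i<q. \<forall>j<q. j \<noteq> i --> l j z \<noteq> 0"
    proof (cases "\<exists>i<q. l i z = 0")
      case True
      then show ?thesis using W(5) by blast
    next
      case False
      then show ?thesis using q by blast
    qed
    then obtain i where i: "i < q" "\<forall>j<q. j \<noteq> i --> l j z \<noteq> 0" by blast
    define h where "h w = (\<Prod>j\<in>{..<q} - {i}. l j w)" for w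
    have h: "h \<in> reg Z W"
      unfolding h_def[abs_def] by (rule reg_prod[OF Z W(1)]) (use W(3) in simp)
    define N where "N = {w \<in> W. h w \<noteq> 0}"
    have N: "zopen Z N" unfolding N_def by (rule reg_open[OF Z W(1) h])
    have hz: "h z \<noteq> 0" using i(2) unfolding h_def by (subst prod_zero_iff) auto
    have lN: "l j w \<noteq> 0" if "w \<in> N" "j < q" "j \<noteq> i" for w j
      using that unfolding N_def h_def by (subst (asm) prod_zero_iff) auto
    have Ki: "K i \<in> \<Sigma>" "lattice_vec (v i) \<in> K i" using K[OF i(1)] by auto
    define g where "g w = (\<lambda>m. if m \<in> dual_semigroup (K i) then \<Prod>j<q. l j w powi pairing m (v j) else 0)" for w
    have g: "g w \<in> affine_toric_pts (K i) \<and> f w = chart (K i) (g w)" if w: "w \<in> N" for w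
    proof -
      have "f w = factor_pt q v (\<lambda>i. l i w)" using w W(4) unfolding N_def by blast
      then show ?thesis
        unfolding g_def using factor_pt_chart[of "K i" i q v "\<lambda>j. l j w", OF Ki(1) i(1) Ki(2)] lN[OF w] by simp
    qed
    have r: "(\<lambda>w. g w m) \<in> reg Z N" if m: "m \<in> dual_semigroup (K i)" for m
    proof -
      have lr: "l j \<in> reg Z N" if "j < q" for j
        by (rule reg_restrict[OF Z N W(1)]) (use W(3) that N_def in auto)
      have "(\<lambda>w. l j w powi pairing m (v j)) \<in> reg Z N" if j: "j < q" for j
      proof (rule reg_power_int[OF Z N lr[OF j]])
        show "0 \<le> pairing m (v j) \<or> (\<forall>x\<in>N. l j x \<noteq> 0)"
        proof (cases "j = i")
          case True
          then show ?thesis using dual_semigroup_pairing[OF m Ki(2)] by simp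
        next
          case False
          then show ?thesis using lN j by blast
        qed
      qed
      then have "(\<lambda>w. \<Prod>j<q. l j w powi pairing m (v j)) \<in> reg Z N" by (intro reg_prod[OF Z N]) simp
      then show ?thesis using m unfolding g_def by simp
    qed
    have zN: "z \<in> N" using W(2) hz by (simp add: N_def)
    show ?thesis
      by (rule exI[of _ N], rule exI[of _ i], rule exI[of _ g]) (intro conjI ballI N zN i(1) g r; assumption)
  qed
  show "morphism Z X f"
  proof (rule morphism_into_X[OF Z])
    fix z assume "z \<in> pts Z"
    from key[OF this] obtain N i g where "zopen Z N" "z \<in> N" and i: "i < q"
      and "\<forall>w\<in>N. g w \<in> affine_toric_pts (K i) \<and> f w = chart (K i) (g w)"
      and "\<forall>m\<in>dual_semigroup (K i). (\<lambda>w. g w m) \<in> reg Z N"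
      by (elim exE conjE) (rule that)
    then show "\<exists>N K g. zopen Z N \<and> z \<in> N \<and> K \<in> \<Sigma> \<and>
      (\<forall>w\<in>N. g w \<in> affine_toric_pts K \<and> f w = chart K (g w)) \<and>
      (\<forall>m\<in>dual_semigroup K. (\<lambda>w. g w m) \<in> reg Z N)"
      using K[OF i] by - (rule exI[of _ N], rule exI[of _ "K i"], rule exI[of _ g], intro conjI, auto)
  qed
  fix z assume "z \<in> pts Z"
  from key[OF this] obtain N i g where "z \<in> N" and i: "i < q"
    and "\<forall>w\<in>N. g w \<in> affine_toric_pts (K i) \<and> f w = chart (K i) (g w)"
    by (elim exE conjE) (rule that)
  then show "\<exists>i<q. f z \<in> chart_img (K i)" unfolding chart_img_def by blast
qed

definition curve_family :: "nat => (nat => int ^ 'n) => (nat => 'k::field) \<times> 'k option => ('n, 'k) toric_pt"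
  where "curve_family q v z = factor_pt q v (\<lambda>i. linear_form (fst z) i (snd z))"

text \<open>The curve \<open>m \<mapsto> \<Prod>i. l\<^sub>i\<^bsup>\<langle>m, v\<^sub>i\<rangle>\<^esup>\<close> is well defined at infinity because the \<open>v\<^sub>i\<close> add up to zero:
  multiplying all \<open>l\<^sub>i\<close> by \<open>1/t\<close> does not change it.\<close>

lemma family_of_curves:
  fixes S :: "('n, 'k::{alg_closed_field, field_char_0}) toric_pt set"
  assumes q: "q \<ge> 2" and v: "\<And>i. i < q ==> v i \<noteq> 0" "(\<Sum>i<q. v i) = 0"
    and K: "\<And>i. i < q ==> K i \<in> \<Sigma> \<and> lattice_vec (v i) \<in> K i \<and> chart_img (K i) \<subseteq> S"
    and S: "zopen X S"
  shows "family_of_rational_curves (linear_forms q) (induced X S) (curve_family q v)"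
proof -
  let ?T = "linear_forms q :: (nat => 'k, 'k) fspace" and ?P = "P1 :: ('k option, 'k) fspace"
  let ?Z = "fprod ?T ?P"
  have T: "nice ?T" by (rule linear_forms_nice)
  have P: "nice ?P" by (rule P1_nice)
  have Z: "nice ?Z" by (rule fprod_nice[OF T P])
  have pZ: "pts ?Z = pts ?T \<times> UNIV" by (simp add: fprod_pts[OF T P])
  have oT: "zopen ?T (pts ?T)" by simp
  have q0: "q > 0" using q by simp
  have loc: "\<exists>W l. zopen ?Z W \<and> z \<in> W \<and> (\<forall>i<q. l i \<in> reg ?Z W) \<and>
      (\<forall>w\<in>W. curve_family q v w = factor_pt q v (\<lambda>i. l i w)) \<and>
      (\<forall>i<q. \<forall>j<q. l i z = 0 --> l j z = 0 --> i = j)" if z: "z \<in> pts ?Z" for z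
  proof -
    obtain x p where xp: "z = (x, p)" "x \<in> pts ?T" using z unfolding pZ by auto
    show ?thesis
    proof (cases p)
      case (Some t)
      let ?U = "range Some :: 'k option set"
      let ?W = "pts ?T \<times> ?U"
      note U = P1_finite_chart(1)[where ?'k = 'k]
      have W: "zopen ?Z ?W" by (rule fprod_times_openin[OF T P oT U])
      define l where "l i = (\<lambda>w :: (nat => 'k) \<times> 'k option. fst w (2 * i) * (case snd w of None => 0 | Some t => t) + fst w (Suc (2 * i)))" for i
      have lr: "l i \<in> reg ?Z ?W" if i: "i < q" for i
        unfolding l_def
        by (intro reg_add[OF Z W] reg_mult[OF Z W] fprod_fst_reg[OF T P oT U, of "\<lambda>x. x (2 * i)"]
            fprod_fst_reg[OF T P oT U, of "\<lambda>x. x (Suc (2 * i))"] linear_forms_coord_reg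
            fprod_snd_reg[OF T P oT U] P1_finite_chart(2))
          (use i in auto)
      have le: "linear_form (fst w) i (snd w) = l i w" if "w \<in> ?W" for w i
        using that by (auto simp: l_def linear_form_def)
      have zW: "z \<in> ?W" using xp Some by simp
      have "\<forall>i<q. \<forall>j<q. l i z = 0 --> l j z = 0 --> i = j"
        using linear_form_common_zero[OF xp(2), of _ _ p] le[OF zW] xp(1) by simp
      moreover have "curve_family q v w = factor_pt q v (\<lambda>i. l i w)" if "w \<in> ?W" for w
        using le[OF that] by (simp add: curve_family_def)
      ultimately show ?thesis
        using W zW lr by - (rule exI[of _ ?W], rule exI[of _ l], intro conjI, auto)
    next
      case None
      let ?U = "- {Some 0} :: 'k option set"
      let ?W = "pts ?T \<times> ?U"
      note U = P1_infinite_chart(1)[where ?'k = 'k]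
      have W: "zopen ?Z ?W" by (rule fprod_times_openin[OF T P oT U])
      define l where "l i = (\<lambda>w :: (nat => 'k) \<times> 'k option. fst w (2 * i) + fst w (Suc (2 * i)) * (case snd w of None => 0 | Some t => inverse t))" for i
      have lr: "l i \<in> reg ?Z ?W" if i: "i < q" for i
        unfolding l_def
        by (intro reg_add[OF Z W] reg_mult[OF Z W] fprod_fst_reg[OF T P oT U, of "\<lambda>x. x (2 * i)"]
            fprod_fst_reg[OF T P oT U, of "\<lambda>x. x (Suc (2 * i))"] linear_forms_coord_reg
            fprod_snd_reg[OF T P oT U] P1_infinite_chart(2))
          (use i in auto)
      have zW: "z \<in> ?W" using xp None by simp
      have "l i z = linear_form x i p" for i using xp(1) None by (simp add: l_def linear_form_def)
      then have "\<forall>i<q. \<forall>j<q. l i z = 0 --> l j z = 0 --> i = j"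
        using linear_form_common_zero[OF xp(2), of _ _ p] by simp
      moreover have "curve_family q v w = factor_pt q v (\<lambda>i. l i w)" if w: "w \<in> ?W" for w
      proof (cases "snd w")
        case None
        then show ?thesis by (simp add: curve_family_def l_def linear_form_def)
      next
        case (Some s)
        then have s: "s \<noteq> 0" using w by auto
        have "linear_form (fst w) i (snd w) = s * l i w" for i
          using Some s by (simp add: l_def linear_form_def field_simps)
        then show ?thesis using factor_pt_scale[OF s v(2), of "\<lambda>i. l i w"] by (simp add: curve_family_def)
      qed
      ultimately show ?thesis
        using W zW lr by - (rule exI[of _ ?W], rule exI[of _ l], intro conjI, auto)
    qed
  qed
  have K': "K i \<in> \<Sigma> \<and> lattice_vec (v i) \<in> K i" if "i < q" for i using K[OF that] by blast
  have mor: "morphism ?Z X (curve_family q v)"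
    by (rule morphism_factor_pt(1)[of ?Z q K v, OF Z q0 K' loc])
  have in_chart: "\<exists>i<q. curve_family q v z \<in> chart_img (K i)" if "z \<in> pts ?Z" for z
    by (rule morphism_factor_pt(2)[of ?Z q K v, OF Z q0 K' loc that])
  have im: "curve_family q v ` pts ?Z \<subseteq> S"
  proof
    fix y assume "y \<in> curve_family q v ` pts ?Z"
    then obtain z where z: "z \<in> pts ?Z" "y = curve_family q v z" by blast
    then obtain i where "i < q" "y \<in> chart_img (K i)" using in_chart[OF z(1)] by blast
    then show "y \<in> S" using K by blast
  qed
  have F: "morphism ?Z (induced X S) (curve_family q v)"
    by (rule morphism_into_induced[OF Z X_nice S mor im])
  have "rational_curve (induced X S) (\<lambda>p. curve_family q v (x, p))" if x: "x \<in> pts ?T" for x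
    unfolding rational_curve_def
  proof
    show "morphism P1 (induced X S) (\<lambda>p. curve_family q v (x, p))"
      using morphism_compose[OF morphism_slice[OF T P x] F] by (simp add: o_def)
    obtain p where p: "linear_form x 0 p = 0" using linear_form_zero[OF x q0 q] by blast
    obtain p' where p': "\<And>i. i < q ==> linear_form x i p' \<noteq> 0" using linear_forms_nonzero[OF x q] by blast
    have "{i. i < q \<and> linear_form x i p = 0} = {0}" using linear_form_common_zero[OF x _ q0 _ p] p q0 by auto
    then have c: "curve_family q v (x, p) = limit (v 0) (\<lambda>m. \<Prod>i\<in>{i. i < q \<and> linear_form x i p \<noteq> 0}. linear_form x i p powi pairing m (v i))"
      by (simp add: curve_family_def factor_pt_def)
    have "curve_family q v (x, p) \<notin> chart_img {0}"
      unfolding c using limit_in_torus_imp_zero[of "K 0" "v 0", OF _ _ nonzero_factors_torus[where q = q and l = "\<lambda>i. linear_form x i p" and v = v]] K'[OF q0] v(1)[OF q0] by blast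
    moreover have "curve_family q v (x, p') \<in> chart_img {0}"
      using nonzero_factors_torus[where q = q and l = "\<lambda>i. linear_form x i p'" and v = v] p'
      unfolding chart_img_zero curve_family_def
      by (subst factor_pt_torus) (auto cong: conj_cong simp: lessThan_def)
    ultimately show "\<exists>p p'. curve_family q v (x, p) \<noteq> curve_family q v (x, p')" by metis
  qed
  then show ?thesis
    unfolding family_of_rational_curves_def using F linear_forms_prevariety by blast
qed

end

subsection \<open>Prescribing the values of a curve\<close>

definition positively_spans :: "(int ^ 'n::finite) set => bool"
  where "positively_spans R \<longleftrightarrow> (\<forall>w. \<exists>d>0. \<exists>ls. set ls \<subseteq> R \<and> sum_list ls = of_nat d * w)"

lemma positively_spansD:
  assumes "positively_spans R"
  obtains d ls where "d > 0" "set ls \<subseteq> R" "sum_list ls = of_nat d * w"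
  using assms unfolding positively_spans_def by blast

text \<open>Since the field has all roots, it suffices that the one-parameter groups span up to finite
  index.\<close>

lemma torus_generated:
  fixes \<phi> :: "int ^ 'n::finite => 'k::alg_closed_field"
  assumes R: "finite R" "positively_spans R" and \<phi>: "\<phi> \<in> torus"
  obtains s where "\<And>u. s u \<noteq> 0" "\<And>m. \<phi> m = (\<Prod>u\<in>R. s u powi pairing m u)"
proof -
  define H where "H = {\<lambda>m :: int ^ 'n. \<Prod>u\<in>R. s u powi pairing m u :: 'k |s. \<forall>u. s u \<noteq> 0}"
  have one: "(\<lambda>m. 1) \<in> H" unfolding H_def by (auto intro!: exI[of _ "\<lambda>_. 1"])
  have mult: "(\<lambda>m. f m * g m) \<in> H" if fg: "f \<in> H" "g \<in> H" for f g
  proof -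
    obtain s where s: "f = (\<lambda>m. \<Prod>u\<in>R. s u powi pairing m u)" "\<forall>u. s u \<noteq> 0" using fg(1) unfolding H_def by blast
    obtain t where t: "g = (\<lambda>m. \<Prod>u\<in>R. t u powi pairing m u)" "\<forall>u. t u \<noteq> 0" using fg(2) unfolding H_def by blast
    have "(\<lambda>m. f m * g m) = (\<lambda>m. \<Prod>u\<in>R. (s u * t u) powi pairing m u)"
      by (simp add: s(1) t(1) power_int_mult_distrib prod.distrib)
    then show ?thesis
      unfolding H_def using s(2) t(2) by (intro CollectI exI[of _ "\<lambda>u. s u * t u"] conjI) simp_all
  qed
  have gen: "(\<lambda>m. r powi pairing m w) \<in> H" if r: "r \<noteq> 0" and w: "w \<in> R" for r w
  proof -
    have "(\<lambda>m. r powi pairing m w) = (\<lambda>m. \<Prod>u\<in>R. (if u = w then r else 1) powi pairing m u)"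
    proof
      fix m
      have "(\<Prod>u\<in>R. (if u = w then r else 1) powi pairing m u) = (\<Prod>u\<in>R. if u = w then r powi pairing m w else 1)"
        by (rule prod.cong) auto
      then show "r powi pairing m w = (\<Prod>u\<in>R. (if u = w then r else 1) powi pairing m u)" using R(1) w by simp
    qed
    moreover have "\<forall>u. (if u = w then r else 1) \<noteq> 0" using r by simp
    ultimately show ?thesis unfolding H_def by (auto intro!: exI[of _ "\<lambda>u. if u = w then r else 1"])
  qed
  have list: "(\<lambda>m. r powi pairing m (sum_list ls)) \<in> H" if r: "r \<noteq> 0" and ls: "set ls \<subseteq> R" for r ls
    using ls
  proof (induction ls)
    case Nil
    then show ?case using one by simp
  next
    case (Cons u ls)
    then show ?case using mult[OF gen[OF r, of u] Cons.IH] r by (simp add: power_int_add)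
  qed
  have axis: "(\<lambda>m. \<phi> (axis i 1) powi (m $ i)) \<in> H" for i
  proof -
    obtain d ls where d: "d > 0" "set ls \<subseteq> R" "sum_list ls = of_nat d * axis i 1"
      using positively_spansD[OF R(2)] by blast
    obtain r where r: "r ^ d = \<phi> (axis i 1)" using nth_root_exists[OF d(1)] by blast
    have "r \<noteq> 0" using r d(1) \<phi> by (auto simp: power_0_left)
    then have "(\<lambda>m. r powi pairing m (of_nat d * axis i 1)) \<in> H" using list[OF _ d(2)] d(3) by simp
    moreover have "r powi pairing m (of_nat d * axis i 1) = \<phi> (axis i 1) powi (m $ i)" for m
      by (simp add: power_int_mult flip: r)
    ultimately show ?thesis by simp
  qed
  have "(\<lambda>m. \<Prod>i\<in>I. \<phi> (axis i 1) powi (m $ i)) \<in> H" if "finite I" for I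
    using that by (induction I rule: finite_induct) (auto intro: one mult axis)
  then have "(\<lambda>m. \<Prod>i\<in>UNIV. \<phi> (axis i 1) powi (m $ i)) \<in> H" by simp
  then have "\<phi> \<in> H" using torus_eq_prod[OF \<phi>] by (metis (no_types, lifting) ext)
  then obtain s where "\<phi> = (\<lambda>m. \<Prod>u\<in>R. s u powi pairing m u)" "\<forall>u. s u \<noteq> 0" unfolding H_def by blast
  then show thesis by (intro that[of s]) auto
qed

text \<open>The character \<open>\<xi>\<close> is a product of one-parameter groups in the directions \<open>vs\<close> with distinct
  parameters that avoid \<open>B\<close>.\<close>

definition realized :: "(int ^ 'n::finite) list => (int ^ 'n => 'k::field) => 'k set => bool"
  where "realized vs \<xi> B \<longleftrightarrow> (\<exists>cs. length cs = length vs \<and> distinct cs \<and> set cs \<inter> insert 0 B = {} \<and>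
    \<xi> = (\<lambda>m. \<Prod>i<length vs. cs ! i powi pairing m (vs ! i)))"

lemma realized_Nil: "realized [] (\<lambda>m. 1) B"
  by (simp add: realized_def)

lemma realized_Cons:
  assumes c: "c \<noteq> 0" "c \<notin> B" and vs: "realized vs \<xi> (insert c B)"
  shows "realized (v # vs) (\<lambda>m. c powi pairing m v * \<xi> m) B"
proof -
  obtain cs where cs: "length cs = length vs" "distinct cs" "set cs \<inter> insert 0 (insert c B) = {}"
    "\<xi> = (\<lambda>m. \<Prod>i<length vs. cs ! i powi pairing m (vs ! i))"
    using vs unfolding realized_def by blast
  have "length (c # cs) = length (v # vs) \<and> distinct (c # cs) \<and> set (c # cs) \<inter> insert 0 B = {} \<and>
      (\<lambda>m. c powi pairing m v * \<xi> m) = (\<lambda>m. \<Prod>i<length (v # vs). (c # cs) ! i powi pairing m ((v # vs) ! i))"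
    unfolding cs(4) using c cs(1-3) by (auto simp: prod.lessThan_Suc_shift simp del: prod.lessThan_Suc)
  then show ?thesis unfolding realized_def by blast
qed

definition twice :: "nat => (int ^ 'n::finite) list => (int ^ 'n) list"
  where "twice d us = concat (map (\<lambda>u. [of_nat d * u, of_nat d * u]) us)"

lemma sum_list_twice: "sum_list (twice d us) = of_nat d * (2 * sum_list us)"
  by (induction us) (simp_all add: twice_def algebra_simps)

text \<open>Each direction occurs twice, so that the product of two parameters is prescribed and the first
  one is free to avoid any finite set of values.\<close>

lemma realized_twice:
  fixes s :: "int ^ 'n::finite => 'k::{alg_closed_field, field_char_0}"
  assumes d: "d > 0" and s: "\<And>u. s u \<noteq> 0"
  shows "distinct us ==> finite B ==> realized (twice d us) (\<lambda>m. \<Prod>u\<in>set us. s u powi pairing m u) B"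
proof (induction us arbitrary: B)
  case Nil
  then show ?case by (simp add: twice_def realized_Nil)
next
  case (Cons u us)
  obtain r where r: "r ^ d = s u" using nth_root_exists[OF d] by blast
  have r0: "r \<noteq> 0" using r s[of u] d by (auto simp: power_0_left)
  obtain c1 where c1: "c1 ^ 2 = r" using nth_root_exists[of 2 r] by auto
  \<comment> \<open>The second parameter \<open>r / c\<close> differs from \<open>c\<close> iff \<open>c\<close> is not a square root of \<open>r\<close>.\<close>
  let ?bad = "{0, c1, - c1} \<union> B \<union> (\<lambda>b. r / b) ` B"
  obtain c where c: "c \<notin> ?bad" using ex_new_if_finite[OF infinite_UNIV_char_0, of ?bad] Cons.prems by auto
  have c0: "c \<noteq> 0" "c \<notin> B" using c by auto
  define c' where "c' = r / c"
  have cc: "c * c' = r" using c0 by (simp add: c'_def)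
  have c': "c' \<noteq> 0" "c' \<notin> insert c B"
  proof -
    show "c' \<noteq> 0" using r0 c0 by (simp add: c'_def)
    have "c' \<noteq> c"
    proof
      assume "c' = c"
      then have "c ^ 2 = c1 ^ 2" using cc c1 by (simp add: power2_eq_square)
      then show False using c by (auto simp: power2_eq_iff)
    qed
    moreover have "c' \<notin> B"
    proof
      assume "c' \<in> B"
      moreover have "c = r / c'" using r0 c0 by (simp add: c'_def)
      ultimately show False using c by blast
    qed
    ultimately show "c' \<notin> insert c B" by blast
  qed
  have "realized (twice d us) (\<lambda>m. \<Prod>u\<in>set us. s u powi pairing m u) (insert c' (insert c B))"
    using Cons by simp
  from realized_Cons[OF c0 realized_Cons[OF c' this, of "of_nat d * u"], of "of_nat d * u"]
  have r1: "realized (twice d (u # us)) (\<lambda>m. c powi pairing m (of_nat d * u) * (c' powi pairing m (of_nat d * u) *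
      (\<Prod>u\<in>set us. s u powi pairing m u))) B"
    by (simp add: twice_def)
  have "c powi pairing m (of_nat d * u) * (c' powi pairing m (of_nat d * u) * x) = s u powi pairing m u * x" for m x
  proof -
    have "c powi pairing m (of_nat d * u) * c' powi pairing m (of_nat d * u) = (c * c') powi (int d * pairing m u)"
      by (simp add: power_int_mult_distrib)
    also have "\<dots> = s u powi pairing m u" by (simp add: cc power_int_mult r)
    finally show ?thesis by (simp add: mult.assoc[symmetric])
  qed
  then have "(\<lambda>m. c powi pairing m (of_nat d * u) * (c' powi pairing m (of_nat d * u) *
      (\<Prod>u\<in>set us. s u powi pairing m u))) = (\<lambda>m. \<Prod>u\<in>set (u # us). s u powi pairing m u)"
    using Cons.prems by (intro ext) (simp only: list.set prod.insert List.finite_set distinct.simps simp_thms)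
  then show ?case using r1 by (simp only:)
qed

text \<open>The parameters in the directions \<open>ls\<close> are arbitrary; their contribution is a character, by which one has
  to correct the value prescribed for the other directions.\<close>

lemma realized_append:
  fixes B :: "'k::field_char_0 set"
  assumes "finite B"
  shows "\<exists>\<xi>0\<in>torus. \<exists>B'. finite B' \<and>
    (\<forall>(vs :: (int ^ 'n::finite) list) \<xi>. realized vs \<xi> B' --> realized (ls @ vs) (\<lambda>m. \<xi>0 m * \<xi> m) B)"
  using assms
proof (induction ls arbitrary: B)
  case Nil
  then show ?case by (intro bexI[of _ "\<lambda>_. 1"] exI[of _ B]) (auto simp: torus_def)
next
  case (Cons l ls)
  obtain c where c: "c \<notin> insert 0 B" using ex_new_if_finite[OF infinite_UNIV_char_0, of "insert 0 B"] Cons.prems by auto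
  have "finite (insert c B)" using Cons.prems by simp
  from Cons.IH[OF this] obtain \<xi>0 B' where \<xi>0: "\<xi>0 \<in> torus" "finite B'"
    and IH: "\<And>(vs :: (int ^ 'n) list) \<xi>. realized vs \<xi> B' ==> realized (ls @ vs) (\<lambda>m. \<xi>0 m * \<xi> m) (insert c B)"
    by (elim bexE exE conjE) (rule that, auto)
  have t: "(\<lambda>m. c powi pairing m l * \<xi>0 m) \<in> torus"
    by (rule torus_mult[OF one_parameter_torus \<xi>0(1)]) (use c in simp)
  have r: "realized ((l # ls) @ vs) (\<lambda>m. c powi pairing m l * \<xi>0 m * \<xi> m) B" if "realized vs \<xi> B'" for vs \<xi>
    using realized_Cons[OF _ _ IH[OF that], of l] c by (simp add: mult.assoc)
  show ?case by (rule bexI[OF _ t], rule exI[of _ B']) (intro conjI allI impI \<xi>0(2) r; assumption)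
qed

lemma realized_all:
  fixes \<xi> :: "int ^ 'n::finite => 'k::{alg_closed_field, field_char_0}"
  assumes us: "distinct us" "positively_spans (set us)" and d: "d > 0" and \<xi>: "\<xi> \<in> torus"
  shows "realized (ls @ twice d us) \<xi> {}"
proof -
  obtain \<xi>0 :: "int ^ 'n => 'k" and B' where \<xi>0: "\<xi>0 \<in> torus" "finite B'"
    and r: "\<And>(vs :: (int ^ 'n) list) \<xi>. realized vs \<xi> B' ==> realized (ls @ vs) (\<lambda>m. \<xi>0 m * \<xi> m) {}"
    using realized_append[of "{} :: 'k set" ls, OF finite.emptyI] by (elim bexE exE conjE) (rule that, auto)
  have t: "(\<lambda>m. inverse (\<xi>0 m) * \<xi> m) \<in> torus" by (rule torus_mult[OF torus_inverse[OF \<xi>0(1)] \<xi>])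
  obtain s where s: "\<And>u. s u \<noteq> 0" "\<And>m. inverse (\<xi>0 m) * \<xi> m = (\<Prod>u\<in>set us. s u powi pairing m u)"
    by (rule torus_generated[OF List.finite_set us(2) t]) (rule that)
  have "realized (ls @ twice d us) (\<lambda>m. \<xi>0 m * (\<Prod>u\<in>set us. s u powi pairing m u)) {}"
    by (rule r[OF realized_twice[OF d s(1) us(1) \<xi>0(2)]])
  moreover have "\<xi>0 m * (\<Prod>u\<in>set us. s u powi pairing m u) = \<xi> m" for m
    unfolding s(2)[symmetric] using torus_nonzero[OF \<xi>0(1), of m] by simp
  ultimately show ?thesis by simp
qed

lemma realizedE:
  assumes "realized vs \<xi> {}"
  obtains c where "\<And>i. i < length vs ==> c i \<noteq> 0" "\<And>i j. i < length vs ==> j < length vs ==> c i = c j ==> i = j"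
    "\<And>m. \<xi> m = (\<Prod>i<length vs. c i powi pairing m (vs ! i))"
proof -
  obtain cs where cs: "length cs = length vs" "distinct cs" "0 \<notin> set cs"
    "\<xi> = (\<lambda>m. \<Prod>i<length vs. cs ! i powi pairing m (vs ! i))"
    using assms unfolding realized_def by auto
  show thesis
  proof (rule that[of "(!) cs"])
    show "cs ! i \<noteq> 0" if "i < length vs" for i using cs(1,3) that by (metis nth_mem)
    show "i = j" if "i < length vs" "j < length vs" "cs ! i = cs ! j" for i j
      using cs(1,2) that by (simp add: nth_eq_iff_index_eq)
  qed (simp add: cs(4))
qed

context toric_fan
begin

text \<open>By completeness every lattice vector lies in a cone, which is generated by its rays.\<close>

lemma complete_rays:
  assumes "is_complete (X :: (('n, 'k::{alg_closed_field, field_char_0}) toric_pt, 'k) fspace)"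
  obtains us where "distinct us" "positively_spans (set us)"
    "\<And>u. u \<in> set us ==> u \<noteq> 0 \<and> convex_cone hull {lattice_vec u} \<in> \<Sigma>"
proof -
  have "\<forall>K\<in>\<Sigma>. \<exists>G. finite G \<and> K = convex_cone hull (lattice_vec ` G) \<and>
      (\<forall>g\<in>G. g \<noteq> 0 \<and> (convex_cone hull {lattice_vec g}) face_of K)"
    using pointed_cone_rays rpc pointed by blast
  from bchoice[OF this] obtain G where G0: "\<forall>K\<in>\<Sigma>. finite (G K) \<and> K = convex_cone hull (lattice_vec ` G K) \<and>
      (\<forall>g\<in>G K. g \<noteq> 0 \<and> (convex_cone hull {lattice_vec g}) face_of K)"
    by (elim exE) (rule that)
  have G1: "finite (G K)" if "K \<in> \<Sigma>" for K
    using bspec[OF G0 that] by (elim conjE)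
  have G2: "K = convex_cone hull (lattice_vec ` G K)" if "K \<in> \<Sigma>" for K
    using bspec[OF G0 that] by (elim conjE)
  have G3: "g \<noteq> 0 \<and> (convex_cone hull {lattice_vec g}) face_of K" if "K \<in> \<Sigma>" "g \<in> G K" for g K
    using bspec[OF conjunct2[OF conjunct2[OF bspec[OF G0 that(1)]]] that(2)] .
  define R where "R = (\<Union>K\<in>\<Sigma>. G K)"
  have fR: "finite R" using G1 finite_fan by (simp add: R_def)
  obtain us where us: "set us = R" "distinct us" using finite_distinct_list[OF fR] by blast
  have "\<exists>d>0. \<exists>ls. set ls \<subseteq> R \<and> sum_list ls = of_nat d * w" for w
  proof -
    obtain K where K: "K \<in> \<Sigma>" "lattice_vec w \<in> K" using complete_covers_lattice[OF assms] by blast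
    then have "lattice_vec w \<in> convex_cone hull (lattice_vec ` G K)" using K(2) by (subst (asm) G2[OF K(1)])
    from lattice_point_of_hull[OF G1[OF K(1)] this]
    obtain d ls where "d > 0" "set ls \<subseteq> G K" "sum_list ls = of_nat d * w" by blast
    then show ?thesis using K(1) unfolding R_def by blast
  qed
  then have "positively_spans R" by (simp add: positively_spans_def)
  moreover have "u \<noteq> 0 \<and> convex_cone hull {lattice_vec u} \<in> \<Sigma>" if u: "u \<in> R" for u
  proof -
    obtain K where K: "K \<in> \<Sigma>" "u \<in> G K" using u by (auto simp: R_def)
    have "convex_cone hull {lattice_vec u} \<noteq> {}" using convex_cone_hull_contains_0 by blast
    then show ?thesis using G3[OF K] face_in_fan[OF K(1)] by blast
  qed
  ultimately show thesis using that us by blast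
qed

lemma family_of_curves_list:
  fixes S :: "('n, 'k::{alg_closed_field, field_char_0}) toric_pt set"
  assumes vs: "length vs \<ge> 2" "sum_list vs = 0"
    and K: "\<And>v. v \<in> set vs ==> v \<noteq> 0 \<and> (\<exists>K\<in>\<Sigma>. lattice_vec v \<in> K \<and> chart_img K \<subseteq> S)"
    and S: "zopen X S"
  shows "family_of_rational_curves (linear_forms (length vs)) (induced X S) (curve_family (length vs) ((!) vs))"
proof -
  define K' where "K' i = (SOME K. K \<in> \<Sigma> \<and> lattice_vec (vs ! i) \<in> K \<and> chart_img K \<subseteq> S)" for i
  have "K' i \<in> \<Sigma> \<and> lattice_vec (vs ! i) \<in> K' i \<and> chart_img (K' i) \<subseteq> S" if "i < length vs" for i
    unfolding K'_def by (rule someI_ex) (use K[OF nth_mem[OF that]] in blast)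
  moreover have "(\<Sum>i<length vs. vs ! i) = 0" using vs(2) by (simp add: sum_list_sum_nth atLeast0LessThan)
  ultimately show ?thesis
    using family_of_curves[of "length vs" "(!) vs" K' S] vs(1) K nth_mem S by blast
qed

lemma factor_pt_cong:
  assumes "\<And>i. i < q ==> l i = l' i"
  shows "factor_pt q v l = factor_pt q v l'"
proof -
  have s: "{i. i < q \<and> l i = 0} = {i. i < q \<and> l' i = 0}" "{i. i < q \<and> l i \<noteq> 0} = {i. i < q \<and> l' i \<noteq> 0}"
    using assms by auto
  have "(\<Prod>i\<in>{i. i < q \<and> l' i \<noteq> 0}. l i powi pairing m (v i)) = (\<Prod>i\<in>{i. i < q \<and> l' i \<noteq> 0}. l' i powi pairing m (v i))" for m
    using assms by (intro prod.cong) auto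
  then show ?thesis by (simp add: factor_pt_def s)
qed

lemma curve_family_values:
  fixes a b :: "nat => 'k::field"
  assumes "\<And>i j. i < j ==> j < q ==> a i * b j \<noteq> a j * b i"
  obtains x where "x \<in> pts (linear_forms q)" "curve_family q v (x, Some 0) = factor_pt q v b"
    "curve_family q v (x, None) = factor_pt q v a"
proof -
  obtain x where x: "x \<in> pts (linear_forms q)"
    "\<And>i. i < q ==> linear_form x i None = a i" "\<And>i. i < q ==> linear_form x i (Some 0) = b i"
    using linear_forms_exists[of q a b] assms by blast
  show thesis
    using that[OF x(1)] factor_pt_cong[of q "\<lambda>i. linear_form x i (Some 0)" b v]
      factor_pt_cong[of q "\<lambda>i. linear_form x i None" a v] x(2,3)
    by (simp add: curve_family_def)
qed

context
  fixes us :: "(int ^ 'n) list" and S :: "('n, 'k::{alg_closed_field, field_char_0}) toric_pt set"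
  assumes us: "distinct us" "positively_spans (set us)"
    and ray: "\<And>u. u \<in> set us ==> u \<noteq> 0 \<and> convex_cone hull {lattice_vec u} \<in> \<Sigma> \<and>
      chart_img (convex_cone hull {lattice_vec u}) \<subseteq> S"
    and S: "zopen X S"
begin

text \<open>A relation with positive coefficients in which every ray occurs at least twice.\<close>

lemma relation_of_rays:
  obtains d ls where "d > 0" "of_nat d * w + sum_list (ls @ twice d us) = 0" "length (ls @ twice d us) \<ge> 2"
    "\<And>v. v \<in> set (ls @ twice d us) ==> v \<noteq> 0 \<and> (\<exists>K\<in>\<Sigma>. lattice_vec v \<in> K \<and> chart_img K \<subseteq> S)"
proof -
  obtain d ls where d: "d > 0" "set ls \<subseteq> set us" "sum_list ls = of_nat d * (- (w + 2 * sum_list us))"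
    using positively_spansD[OF us(2)] by blast
  obtain d' ls' where "d' > 0" "set ls' \<subseteq> set us" "sum_list ls' = of_nat d' * axis (SOME i. True) 1"
    using positively_spansD[OF us(2)] by blast
  moreover have "us \<noteq> []"
  proof
    assume "us = []"
    then have "of_nat d' * axis (SOME i :: 'n. True) (1 :: int) = 0" using calculation by simp
    then have "pairing (axis (SOME i. True) 1) (of_nat d' * axis (SOME i :: 'n. True) (1 :: int)) = 0" by simp
    then show False using \<open>d' > 0\<close> by simp
  qed
  then have "length (ls @ twice d us) \<ge> 2" by (cases us) (auto simp: twice_def)
  moreover have "of_nat d * w + sum_list (ls @ twice d us) = 0"
    by (simp add: d(3) sum_list_twice algebra_simps)
  moreover have "v \<noteq> 0 \<and> (\<exists>K\<in>\<Sigma>. lattice_vec v \<in> K \<and> chart_img K \<subseteq> S)" if v: "v \<in> set (ls @ twice d us)" for v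
  proof -
    have "\<exists>u\<in>set us. \<exists>k>0. v = of_nat k * u"
    proof (cases "v \<in> set ls")
      case True
      then show ?thesis using d(2) by (intro bexI[of _ v] exI[of _ 1]) auto
    next
      case False
      then show ?thesis using v d(1) by (auto simp: twice_def)
    qed
    then obtain u k where u: "u \<in> set us" "k > 0" "v = of_nat k * u" by blast
    let ?K = "convex_cone hull {lattice_vec u}"
    have "lattice_vec v = real k *\<^sub>R lattice_vec u"
      unfolding u(3) by (simp add: lattice_vec_simps)
    then have "lattice_vec v \<in> ?K"
      using convex_cone_hull_mul[of "lattice_vec u" "{lattice_vec u}" "real k"] hull_inc[of "lattice_vec u" "{lattice_vec u}"] by simp
    moreover have "v \<noteq> 0"
    proof
      assume v0: "v = 0"
      obtain i where "u $ i \<noteq> 0" using ray[OF u(1)] by (auto simp: vec_eq_iff)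
      moreover have "pairing (axis i 1) v = int k * u $ i" unfolding u(3) by simp
      ultimately show False using v0 u(2) by simp
    qed
    ultimately show ?thesis using ray[OF u(1)] by blast
  qed
  ultimately show thesis using that d(1) by blast
qed

text \<open>Two points of the torus: take the quotients \<open>\<beta>\<^sub>i = b\<^sub>i / a\<^sub>i\<close> of the values of the linear forms at the
  two points distinct, so that the forms have no common zeros.\<close>

lemma torus_pts_joined:
  obtains q v where "family_of_rational_curves (linear_forms q) (induced X S) (curve_family q v)"
    "\<And>\<phi> \<psi>. \<phi> \<in> torus ==> \<psi> \<in> torus ==> \<exists>x\<in>pts (linear_forms q).
      curve_family q v (x, Some 0) = (torus_pt \<phi> :: ('n, 'k) toric_pt) \<and> curve_family q v (x, None) = torus_pt \<psi>"
proof -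
  obtain d ls where d: "d > 0" "of_nat d * 0 + sum_list (ls @ twice d us) = 0" "length (ls @ twice d us) \<ge> 2"
    "\<And>v. v \<in> set (ls @ twice d us) ==> v \<noteq> 0 \<and> (\<exists>K\<in>\<Sigma>. lattice_vec v \<in> K \<and> chart_img K \<subseteq> S)"
    using relation_of_rays[of 0] by blast
  define vs where "vs = ls @ twice d us"
  let ?q = "length vs"
  have fam: "family_of_rational_curves (linear_forms ?q) (induced X S) (curve_family ?q ((!) vs))"
    by (rule family_of_curves_list[OF _ _ _ S]) (use d in \<open>simp_all add: vs_def\<close>)
  have "\<exists>x\<in>pts (linear_forms ?q). curve_family ?q ((!) vs) (x, Some 0) = torus_pt \<phi> \<and> curve_family ?q ((!) vs) (x, None) = torus_pt \<psi>"
    if \<phi>: "\<phi> \<in> torus" and \<psi>: "\<psi> \<in> torus" for \<phi> \<psi> :: "int ^ 'n => 'k"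
  proof -
    have "realized vs (\<lambda>m. inverse (\<psi> m) * \<phi> m) {}"
      unfolding vs_def by (rule realized_all[OF us d(1) torus_mult[OF torus_inverse[OF \<psi>] \<phi>]])
    then obtain \<beta> where \<beta>: "\<And>i. i < ?q ==> \<beta> i \<noteq> 0" "\<And>i j. i < ?q ==> j < ?q ==> \<beta> i = \<beta> j ==> i = j"
      "\<And>m. inverse (\<psi> m) * \<phi> m = (\<Prod>i<?q. \<beta> i powi pairing m (vs ! i))"
      by (rule realizedE) (rule that)
    have "realized vs \<psi> {}" unfolding vs_def by (rule realized_all[OF us d(1) \<psi>])
    then obtain a where a: "\<And>i. i < ?q ==> a i \<noteq> 0" "\<And>i j. i < ?q ==> j < ?q ==> a i = a j ==> i = j"
      "\<And>m. \<psi> m = (\<Prod>i<?q. a i powi pairing m (vs ! i))"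
      by (rule realizedE) (rule that)
    \<comment> \<open>The minors are then \<open>a\<^sub>i a\<^sub>j (\<beta>\<^sub>j - \<beta>\<^sub>i)\<close>.\<close>
    define b where "b i = \<beta> i * a i" for i
    have b: "(\<Prod>i<?q. b i powi pairing m (vs ! i)) = \<phi> m" for m
      unfolding b_def power_int_mult_distrib prod.distrib \<beta>(3)[symmetric] a(3)[symmetric]
      using torus_nonzero[OF \<psi>, of m] by simp
    have "a i * b j \<noteq> a j * b i" if "i < j" "j < ?q" for i j
      using \<beta>(2)[of i j] a(1)[of i] a(1)[of j] that by (auto simp: b_def)
    then obtain x where x: "x \<in> pts (linear_forms ?q)" "curve_family ?q ((!) vs) (x, Some 0) = factor_pt ?q ((!) vs) b"
      "curve_family ?q ((!) vs) (x, None) = factor_pt ?q ((!) vs) a"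
      by (rule curve_family_values)
    have "factor_pt ?q ((!) vs) b = torus_pt \<phi>"
      using factor_pt_torus[of ?q b "(!) vs"] a(1) \<beta>(1) by (simp add: b_def[symmetric] b) (simp add: b_def)
    moreover have "factor_pt ?q ((!) vs) a = torus_pt \<psi>"
      using factor_pt_torus[of ?q a "(!) vs"] a(1) by (simp add: a(3)[symmetric])
    ultimately show ?thesis using x by auto
  qed
  then show thesis by (rule that[OF fam])
qed

text \<open>For a boundary point \<open>lim\<^bsub>s \<rightarrow> 0\<^esub> \<phi> \<cdot> s\<^sup>v\<close> one more factor is needed, which vanishes there.\<close>

lemma limit_joined:
  fixes \<phi> \<psi> :: "int ^ 'n => 'k"
  assumes K: "K \<in> \<Sigma>" "chart_img K \<subseteq> S" "lattice_vec v \<in> K" and v0: "v \<noteq> 0" and \<phi>: "\<phi> \<in> torus" and \<psi>: "\<psi> \<in> torus"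
  shows "\<exists>f. rational_curve (induced X S) f \<and> limit v \<phi> \<in> range f \<and> torus_pt \<psi> \<in> range f"
proof -
  obtain d ls where d: "d > 0" "of_nat d * v + sum_list (ls @ twice d us) = 0" "length (ls @ twice d us) \<ge> 2"
    "\<And>v. v \<in> set (ls @ twice d us) ==> v \<noteq> 0 \<and> (\<exists>K\<in>\<Sigma>. lattice_vec v \<in> K \<and> chart_img K \<subseteq> S)"
    using relation_of_rays[of v] by blast
  define ws where "ws = ls @ twice d us"
  let ?v = "of_nat d * v" and ?q = "length ws"
  let ?vs = "?v # ws"
  have dv: "lattice_vec ?v \<in> K" "?v \<noteq> 0"
  proof -
    have "lattice_vec ?v = real d *\<^sub>R lattice_vec v" by (simp add: lattice_vec_simps)
    then show "lattice_vec ?v \<in> K" using cone[OF K(1)] K(3) by (simp add: convex_cone_def conic_def)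
    obtain i where "v $ i \<noteq> 0" using v0 by (auto simp: vec_eq_iff)
    moreover have "pairing (axis i 1) ?v = int d * v $ i" by simp
    ultimately show "?v \<noteq> 0" using d(1) by (metis mult_eq_0_iff of_nat_eq_0_iff pairing_0(2) less_irrefl)
  qed
  have fam: "family_of_rational_curves (linear_forms (Suc ?q)) (induced X S) (curve_family (Suc ?q) ((!) ?vs))"
  proof -
    have "u \<noteq> 0 \<and> (\<exists>K\<in>\<Sigma>. lattice_vec u \<in> K \<and> chart_img K \<subseteq> S)" if "u \<in> set ?vs" for u
      using that d(4)[of u] dv K unfolding ws_def by auto
    then have "family_of_rational_curves (linear_forms (length ?vs)) (induced X S) (curve_family (length ?vs) ((!) ?vs))"
      by (intro family_of_curves_list[OF _ _ _ S]) (use d in \<open>simp_all add: ws_def\<close>)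
    then show ?thesis by simp
  qed
  have "realized ws (\<lambda>m. inverse (\<psi> m) * \<phi> m) {}"
    unfolding ws_def by (rule realized_all[OF us d(1) torus_mult[OF torus_inverse[OF \<psi>] \<phi>]])
  then obtain \<beta> where \<beta>: "\<And>i. i < ?q ==> \<beta> i \<noteq> 0" "\<And>i j. i < ?q ==> j < ?q ==> \<beta> i = \<beta> j ==> i = j"
    "\<And>m. inverse (\<psi> m) * \<phi> m = (\<Prod>i<?q. \<beta> i powi pairing m (ws ! i))"
    by (rule realizedE) (rule that)
  have "realized ws \<psi> {}" unfolding ws_def by (rule realized_all[OF us d(1) \<psi>])
  then obtain a where a: "\<And>i. i < ?q ==> a i \<noteq> 0" "\<And>i j. i < ?q ==> j < ?q ==> a i = a j ==> i = j"
    "\<And>m. \<psi> m = (\<Prod>i<?q. a i powi pairing m (ws ! i))"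
    by (rule realizedE) (rule that)
  \<comment> \<open>The additional linear form is the coordinate \<open>t\<close> itself.\<close>
  define A where "A i = (case i of 0 => 1 | Suc j => a j)" for i
  define B where "B i = (case i of 0 => 0 | Suc j => \<beta> j * a j)" for i
  have "A i * B j \<noteq> A j * B i" if ij: "i < j" "j < Suc ?q" for i j
  proof -
    obtain j' where j': "j = Suc j'" using ij by (cases j) auto
    show ?thesis
    proof (cases i)
      case 0
      then show ?thesis using j' ij a(1)[of j'] \<beta>(1)[of j'] by (simp add: A_def B_def)
    next
      case (Suc i')
      then show ?thesis using \<beta>(2)[of i' j'] a(1)[of i'] a(1)[of j'] j' ij by (auto simp: A_def B_def)
    qed
  qed
  then obtain x where x: "x \<in> pts (linear_forms (Suc ?q))"
    "curve_family (Suc ?q) ((!) ?vs) (x, Some 0) = factor_pt (Suc ?q) ((!) ?vs) B"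
    "curve_family (Suc ?q) ((!) ?vs) (x, None) = factor_pt (Suc ?q) ((!) ?vs) A"
    by (rule curve_family_values)
  have "factor_pt (Suc ?q) ((!) ?vs) A = torus_pt \<psi>"
  proof -
    have "A i \<noteq> 0" if "i < Suc ?q" for i using that a(1) by (cases i) (auto simp: A_def)
    then have "factor_pt (Suc ?q) ((!) ?vs) A = torus_pt (\<lambda>m. \<Prod>i<Suc ?q. A i powi pairing m (?vs ! i))"
      by (rule factor_pt_torus)
    also have "(\<lambda>m. \<Prod>i<Suc ?q. A i powi pairing m (?vs ! i)) = \<psi>"
      by (rule ext) (simp add: a(3) A_def prod.lessThan_Suc_shift del: prod.lessThan_Suc)
    finally show ?thesis .
  qed
  moreover have "factor_pt (Suc ?q) ((!) ?vs) B = limit v \<phi>"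
  proof -
    have B0: "B 0 = 0" and BS: "\<And>i. i < ?q ==> B (Suc i) \<noteq> 0" using a(1) \<beta>(1) by (simp_all add: B_def)
    have "i < Suc ?q \<and> B i = 0 \<longleftrightarrow> i = 0" for i using B0 BS by (cases i) auto
    moreover have "i < Suc ?q \<and> B i \<noteq> 0 \<longleftrightarrow> i \<in> Suc ` {..<?q}" for i using B0 BS by (cases i) auto
    ultimately have s: "{i. i < Suc ?q \<and> B i = 0} = {0}" "{i. i < Suc ?q \<and> B i \<noteq> 0} = Suc ` {..<?q}"
      by (simp_all only: Collect_mem_eq singleton_conv)
    have "(\<Prod>i\<in>Suc ` {..<?q}. B i powi pairing m (?vs ! i)) = \<phi> m" for m
    proof -
      have "(\<Prod>i\<in>Suc ` {..<?q}. B i powi pairing m (?vs ! i)) = (\<Prod>i<?q. (\<beta> i * a i) powi pairing m (ws ! i))"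
        by (subst prod.reindex) (simp_all add: B_def)
      also have "\<dots> = \<phi> m"
        unfolding power_int_mult_distrib prod.distrib \<beta>(3)[symmetric] a(3)[symmetric]
        using torus_nonzero[OF \<psi>, of m] by simp
      finally show ?thesis .
    qed
    then have "factor_pt (Suc ?q) ((!) ?vs) B = limit ?v \<phi>"
      by (simp add: factor_pt_def s)
    also have "\<dots> = limit v \<phi>"
    proof -
      have "limit_pt K ?v \<phi> = limit_pt K v \<phi>" using d(1) by (simp add: limit_pt_def fun_eq_iff)
      then show ?thesis using limit_eq[OF K(1) dv(1) \<phi>] limit_eq[OF K(1,3) \<phi>] by simp
    qed
    finally show ?thesis .
  qed
  moreover have "rational_curve (induced X S) (\<lambda>p. curve_family (Suc ?q) ((!) ?vs) (x, p))"
    using fam x(1) unfolding family_of_rational_curves_def by blast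
  ultimately show ?thesis
    using x(2,3) by (intro exI[of _ "\<lambda>p. curve_family (Suc ?q) ((!) ?vs) (x, p)"]) (metis rangeI)
qed

end

subsection \<open>The smooth locus\<close>

lemma smooth_locus_strongly_rationally_connected:
  assumes "is_complete (X :: (('n, 'k::{alg_closed_field, field_char_0}) toric_pt, 'k) fspace)"
  shows "strongly_rationally_connected (smooth_locus (X :: (('n, 'k) toric_pt, 'k) fspace))"
proof -
  let ?S = "smooth_pts :: ('n, 'k) toric_pt set"
  let ?Y = "induced X ?S"
  obtain us where us: "distinct us" "positively_spans (set us)"
    "\<And>u. u \<in> set us ==> u \<noteq> 0 \<and> convex_cone hull {lattice_vec u} \<in> \<Sigma>"
    using complete_rays[OF assms] by blast
  define \<Delta> where "\<Delta> = {K \<in> \<Sigma>. chart_img K \<subseteq> ?S}"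
  have S_eq: "?S = (\<Union>K\<in>\<Delta>. chart_img K)"
  proof
    show "?S \<subseteq> (\<Union>K\<in>\<Delta>. chart_img K)"
    proof
      fix x assume "x \<in> ?S"
      then obtain K v \<phi> where K: "K \<in> \<Sigma>" "chart_img K \<subseteq> ?S" "lattice_vec v \<in> K" "\<phi> \<in> torus" "x = limit v \<phi>"
        by (rule smooth_pts_cone)
      then show "x \<in> (\<Union>K\<in>\<Delta>. chart_img K)" using limit_chart(1)[of K v \<phi>] unfolding \<Delta>_def by blast
    qed
  qed (auto simp: \<Delta>_def)
  have ray: "u \<noteq> 0 \<and> convex_cone hull {lattice_vec u} \<in> \<Sigma> \<and> chart_img (convex_cone hull {lattice_vec u}) \<subseteq> ?S"
    if "u \<in> set us" for u
    using us(3)[OF that] ray_smooth[of u] by blast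
  have "us \<noteq> []"
  proof
    assume e: "us = []"
    obtain d ls where d: "d > 0" "set ls \<subseteq> set us" "sum_list ls = of_nat d * axis (SOME i. True) 1"
      using positively_spansD[OF us(2)] by blast
    have "pairing (axis (SOME i. True) 1) (of_nat d * axis (SOME i :: 'n. True) (1 :: int)) = 0"
      using d e by (simp flip: d(3))
    then show False using d(1) by simp
  qed
  then have \<Delta>: "\<Delta> \<subseteq> \<Sigma>" "\<Delta> \<noteq> {}" using ray[of "hd us"] by (auto simp: \<Delta>_def)
  note S = union_open[OF \<Delta> S_eq]
  have pY: "pts ?Y = ?S" by (rule induced_pts[OF S])
  have "variety ?Y" by (rule union_variety[OF \<Delta> S_eq])
  moreover have "smooth ?Y"
    unfolding smooth_def pY using smooth_at_induced[OF X_nice S] by (auto simp: smooth_pts_def)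
  moreover
  have torus_S: "chart_img {0} \<subseteq> ?S"
    unfolding chart_img_zero using union_torus[OF \<Delta> S_eq] by blast
  have t0: "zopen ?Y (chart_img {0} :: ('n, 'k) toric_pt set)"
    using chart_img_open[OF zero_cone_in_fan] torus_S by (simp add: induced_openin[OF S])
  have ne: "chart_img {0} \<noteq> ({} :: ('n, 'k) toric_pt set)"
    unfolding chart_img_zero by (auto simp: torus_def intro!: exI[of _ "\<lambda>_. 1"])
  obtain q v where fam: "family_of_rational_curves (linear_forms q) ?Y (curve_family q v)"
    and join: "\<And>\<phi> \<psi>. \<phi> \<in> torus ==> \<psi> \<in> torus ==> \<exists>x\<in>pts (linear_forms q).
      curve_family q v (x, Some 0) = (torus_pt \<phi> :: ('n, 'k) toric_pt) \<and> curve_family q v (x, None) = torus_pt \<psi>"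
    by (rule torus_pts_joined[OF us(1,2) ray S]) (assumption, rule that)
  have "rationally_connected ?Y"
    unfolding rationally_connected_def
  proof (rule exI[of _ "linear_forms q"], rule exI[of _ "curve_family q v"], intro conjI fam,
      rule exI[of _ "chart_img {0} \<times> chart_img {0}"], intro conjI)
    show "zopen (fprod ?Y ?Y) (chart_img {0} \<times> chart_img {0})"
      by (rule fprod_times_openin[OF induced_nice[OF X_nice S] induced_nice[OF X_nice S] t0 t0])
    show "chart_img {0} \<times> chart_img {0} \<noteq> ({} :: (('n, 'k) toric_pt \<times> ('n, 'k) toric_pt) set)" using ne by blast
    show "\<forall>(y, z)\<in>chart_img {0} \<times> chart_img {0}. \<exists>x\<in>pts (linear_forms q). \<exists>p p'.
        curve_family q v (x, p) = (y :: ('n, 'k) toric_pt) \<and> curve_family q v (x, p') = z"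
      unfolding chart_img_zero using join by fast
  qed
  moreover have "\<exists>U. zopen ?Y U \<and> U \<noteq> {} \<and>
      (\<forall>z\<in>U. \<exists>f. rational_curve ?Y f \<and> y \<in> range f \<and> z \<in> range f)" if y: "y \<in> pts ?Y" for y
  proof (rule exI[of _ "chart_img {0}"], intro conjI t0 ne ballI)
    fix z :: "('n, 'k) toric_pt" assume "z \<in> chart_img {0}"
    then obtain \<psi> :: "int ^ 'n => 'k" where \<psi>: "\<psi> \<in> torus" "z = torus_pt \<psi>" unfolding chart_img_zero by blast
    obtain K w \<phi> where K: "K \<in> \<Sigma>" "chart_img K \<subseteq> ?S" "lattice_vec w \<in> K" "\<phi> \<in> torus" "y = limit w \<phi>"
      using y unfolding pY by (rule smooth_pts_cone)
    show "\<exists>f. rational_curve ?Y f \<and> y \<in> range f \<and> z \<in> range f"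
    proof (cases "w = 0")
      case True
      obtain x where x: "x \<in> pts (linear_forms q)" "curve_family q v (x, Some 0) = torus_pt \<phi>" "curve_family q v (x, None) = z"
        using join[OF K(4) \<psi>(1)] \<psi>(2) by blast
      have "y = torus_pt \<phi>" using True K(5) torus_pt_eq_limit[OF K(4)] by simp
      moreover have "rational_curve ?Y (\<lambda>p. curve_family q v (x, p))"
        using fam x(1) unfolding family_of_rational_curves_def by blast
      ultimately show ?thesis
        using x(2,3) by (intro exI[of _ "\<lambda>p. curve_family q v (x, p)"]) (metis rangeI)
    next
      case False
      show ?thesis
        unfolding K(5) \<psi>(2) by (rule limit_joined[OF us(1,2) ray S K(1-3) False K(4) \<psi>(1)])
    qed
  qed
  ultimately have "strongly_rationally_connected ?Y"
    unfolding strongly_rationally_connected_def by blast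
  then show ?thesis by (simp add: smooth_locus_def smooth_pts_def)
qed

end

theorem corollary1:
  fixes \<Sigma> :: "(real ^ 'n::finite) set set"
    and X :: "(('n, 'k::{alg_closed_field, field_char_0}) toric_pt, 'k) fspace"
  assumes "uncountable (UNIV :: 'k set)"
    and "fan \<Sigma>"
    and "X = toric_variety \<Sigma>"
    and "is_complete X"
  shows "strongly_rationally_connected (smooth_locus X)"
proof -
  interpret toric_fan \<Sigma> by unfold_locales (rule assms(2))
  show ?thesis using smooth_locus_strongly_rationally_connected assms(3,4) by blast
qed

end
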